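(* Let $M\hookrightarrow\mathbb{P}^5$ be a nondegenerate Legendrian surface with structure coefficients $a_i,b_j,c_k$ and Maurer-Cartan form $\phi$ of its $5$-adapted frames. A $\Psi$-deformation of $M$ is determined by three parameters (functions) $\{u_0,v_1,w_1\}$: with respect to a suitable $5$-adapted frame its Maurer-Cartan form is $\pi=\phi+\delta\phi$, where $$\delta\omega_{01}=-u_0\omega^1,\ \ \delta\omega_{02}=-u_0\omega^2,\ \ \delta\eta_{11}=-2u_0\omega^2,\ \ \delta\eta_{12}=u_0(\omega^1+\omega^2),\ \ \delta\eta_{22}=-2u_0\omega^1,$$ $$\delta\eta_{10}=-v_1(\omega^1+\omega^2),\quad \delta\eta_{20}=v_1(\omega^1+\omega^2),\quad \delta\eta_{00}=w_1\omega^1+w_2\omega^2,\quad w_2=w_1+\tfrac65(-a_2+a_3)u_0,$$ and all other independent components of $\delta\phi$ vanish. These parameters satisfy the closed structure equation $$du_0+\tfrac43u_0\omega_{00}=v_1(-\omega^1+\omega^2),$$ $$dv_1+2v_1\omega_{00}=\Big(\tfrac32u_0^2+(\tfrac35a_3-a_4-a_1-\tfrac85a_2)u_0+\tfrac12w_1\Big)\omega^1+\Big(-\tfrac32u_0^2+(a_3+a_4+a_1)u_0-\tfrac12w_1\Big)\omega^2,$$ $$dw_1+\tfrac83w_1\omega_{00}=w_{11}\omega^1+w_{12}\omega^2,$$ where $$w_{11}=-2u_0v_1+\big(-\tfrac{12}{5}a_3+\tfrac{22}{5}a_2+a_4+a_1\big)v_1+\big(24b_1-4b_2+15b_3+a_{41}+a_{12}-3a_{21}\big)u_0,$$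 $$w_{12}=2u_0v_1+\big(-\tfrac{28}{5}a_3+\tfrac{18}{5}a_2-a_4-a_1\big)v_1+\big(36b_1-6b_2+26b_3+a_{41}+a_{12}-6a_{21}\big)u_0.$$ The exterior derivative identity $d(dw_1)=0$ gives an integrability condition of the form $$\big(-60b_1+8b_2-42b_3-a_{41}-a_{12}+10a_{21}\big)v_1+\tfrac{12}{5}(a_2-a_3)w_1\equiv0 \mod u_0 .$$ The structure equation and the integrability condition imply: (a) A nondegenerate Legendrian surface admits at most a three parameter family of $\Psi$-deformations. (b) If the asymptotic web of $M$ is not flat, $M$ admits at most a two parameter family of $\Psi$-deformations. (c) Assume the asymptotic web of $M$ is flat. If the structure coefficients of $M$ do not satisfy the relation $a_{41}+a_{12}+4b_2-4b_1=0$, then $M$ admits at most a one parameter family of $\Psi$-deformations. (d) Assume the asymptotic web of $M$ is flat and $a_{41}+a_{12}+4b_2-4b_1=0$. If the structure coefficients do not satisfy the additional relation $c_1=c_2$, then $M$ does not admit nontrivial $\Psi$-deformations. (e) $M$ admits a maximum three parameter family of $\Psi$-deformations if and only if $M$ has flat asymptotic web and its structure coefficients satisfy $$a_2=a_3,\qquad b_1-b_2=\tfrac14(a_{41}+a_{12}),\qquad c_1=c_2 .$$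
   Context: Everything is holomorphic and local. $V=\mathbb{C}^6$ with standard symplectic form $\varpi$; $\mathbb{P}^5=\mathbb{P}(V)$ carries the contact hyperplane field $\mathcal{H}_{x}=[(\hat{x}\lrcorner\varpi)^{\perp}]$ ($\hat x$ any lift of $x$). An immersed Legendrian surface is an immersion $x:M\hookrightarrow\mathbb{P}^5$ of a (connected) complex surface tangent to $\mathcal{H}$. Symplectic frames $(e_0,e_1,e_2,f_0,f_1,f_2)$ of $V$ (with $\sum e_i\wedge f_i$ dual to $\varpi$) satisfy $d(e,f)=(e,f)\phi$, $\phi=\begin{pmatrix}\omega&\eta\\ \theta&-\omega^t\end{pmatrix}$, $\theta,\eta$ symmetric $3\times 3$ with indices $0,1,2$, $d\phi+\phi\wedge\phi=0$. Along $x$ one uses frames with $[e_0]=x$ and $[e_0\wedge e_1\wedge e_2]$ the tangent plane; then $\theta_{i0}=0$, $\omega^i:=\omega_{i0}$ ($i=1,2$) is a coframe, $\theta_{ij}=t_{ijk}\omega^k$ with $t$ fully symmetric, and the cubic $\Phi=t_{ijk}\omega^i\omega^j\omega^k$ is well defined up to scale. $x$ is nondegenerate if $\Phi$ is everywhere a product of three pairwise non-proportional linear forms. A nondegenerate $x$ has a canonical bundle of $5$-adapted frames with one-dimensional fibers (unique up to a finite group), characterized by $\theta_{11}=\omega^2$, $\theta_{12}=\omega^1+\omega^2$, $\theta_{22}=\omega^1$, $\omega_{ij}=\frac{\delta_{ij}}3\omega_{00}$ ($i,j=1,2$), $\omega_{01}=(a_2+a_4)\omega^1+\frac35(a_3-a_2)\omega^2$,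 $\omega_{02}=\frac35(a_2-a_3)\omega^1+(a_1+a_3)\omega^2$, $\eta_{11}=a_1\omega^2$, $\eta_{12}=a_2\omega^1+a_3\omega^2$, $\eta_{22}=a_4\omega^1$, $\eta_{10}=b_1\omega^1+b_2\omega^2$, $\eta_{20}=b_3\omega^1-b_1\omega^2$, $\eta_{00}=c_1\omega^1+c_2\omega^2$. The functions $a_i,b_j,c_k$ are the structure coefficients, with covariant derivatives $da_i=-\frac43a_i\omega_{00}+a_{ik}\omega^k$, $db_i=-2b_i\omega_{00}+b_{ik}\omega^k$, $dc_i=-\frac83c_i\omega_{00}+c_{ik}\omega^k$. The cubic differential $\Psi=(a_1+2a_2)(\omega^1)^2\omega^2+(2a_3+a_4)\omega^1(\omega^2)^2$ is well defined up to scale. The asymptotic web is the $3$-web of the foliations $\omega^1=0$, $\omega^2=0$, $\omega^1+\omega^2=0$; its curvature $K$ is given by $\frac23d\omega_{00}=K\omega^1\wedge\omega^2$, $K=-\frac45(a_2-a_3)$, so it is flat iff $a_2=a_3$. Deformations. A Legendrian immersion $x':M\hookrightarrow\mathbb{P}^5$ is a second order deformation of $x$ if there is a map $g:M\to\mathrm{Sp}_3\mathbb{C}$ such that for each $p$ the $2$-adapted frame bundles (symplectic frames with $[e_0]$ the point of the immersed surface, $[e_0\wedge e_1\wedge e_2]$ its tangent plane, and $\theta_{11}=\omega^2,\theta_{12}=\omega^1+\omega^2,\theta_{22}=\omega^1$) of $x'$ and of $g(p)\circ x$ are isomorphic at $p$; equivalently the cubic $\Phi'$ of $x'$ is a nonzero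 multiple of $\Phi$ at each point. Then the $5$-adapted frames of $x'$ can be identified with those of $x$ so that $\omega^1,\omega^2,\omega_{00}$ coincide, and the Maurer-Cartan form $\pi$ of $x'$ becomes another $\mathfrak{sp}_3\mathbb{C}$-valued form on the frame bundle of $x$; $\delta\phi:=\pi-\phi=\begin{pmatrix}\delta\omega&\delta\eta\\ \delta\theta&-\delta\omega^t\end{pmatrix}$. $x'$ is a $\Psi$-deformation if moreover, under this identification, $\Psi'=\Psi$. A deformation is trivial if $g$ can be taken constant ($x'$ congruent to $x$). Deformations are counted modulo the action of $\mathrm{Sp}_3\mathbb{C}$; "at most a $k$ parameter family" means the set of solutions $(u_0,v_1,w_1)$ of the closed total differential system expressing $du_0,dv_1,dw_1$ through $u_0,v_1,w_1$, the structure coefficients and their covariant derivatives, equivalently of germs of $\Psi$-deformations up to congruence, is at most $k$-dimensional, and a "maximum three parameter family" means this set is $3$-dimensional. "$\equiv 0\mod u_0$" means equality up to $u_0$ times an expression in $u_0$ and the structure coefficients and their covariant derivatives. "Do not satisfy a relation" means the corresponding expression does not vanish identically. *)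

theory Defs
  imports "HOL-Analysis.Analysis"
begin

text \<open>
  Everything is local, so the surface is a connected open subset of \<open>complex ^ 2\<close>, which also serves
  as its tangent space.  Index types are numeral types, so that indices can be written as in the
  usual notation; note that \<open>2 = (0 :: 2)\<close>, \<open>3 = (0 :: 3)\<close> and \<open>4 = (0 :: 4)\<close>.
  The indices of \<open>V\<close> and of frames run over \<open>3 + 3\<close> with \<open>0, 1, 2 :: 3\<close> in each block:
  \<open>Inl\<close> for the \<open>e\<close>-part and \<open>Inr\<close> for the \<open>f\<close>-part.
\<close>

type_synonym pt = "complex ^ 2"
type_synonym V = "complex ^ (3 + 3)"
type_synonym mat6 = "complex ^ (3 + 3) ^ (3 + 3)"
type_synonym fn = "pt \<Rightarrow> complex"
type_synonym form = "pt \<Rightarrow> pt \<Rightarrow> complex"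

abbreviation D :: "(pt \<Rightarrow> 'b::real_normed_vector) \<Rightarrow> pt \<Rightarrow> pt \<Rightarrow> 'b" where
  "D f p \<equiv> frechet_derivative f (at p)"

definition holo_on :: "pt set \<Rightarrow> fn \<Rightarrow> bool" where
  "holo_on S f \<longleftrightarrow>
     (\<forall>p\<in>S. \<exists>L. (f has_derivative L) (at p) \<and> (\<forall>z \<xi>. L (z *s \<xi>) = z * L \<xi>))"

definition jointly_holo_on ::
  "(complex ^ 'k::finite) set \<Rightarrow> pt set \<Rightarrow> (complex ^ 'k \<Rightarrow> fn) \<Rightarrow> bool" where
  "jointly_holo_on T S h \<longleftrightarrow>
     (\<forall>t\<in>T. \<forall>p\<in>S. \<exists>L. ((\<lambda>(s, q). h s q) has_derivative L) (at (t, p)) \<and>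
        (\<forall>z \<tau> \<xi>. L (z *s \<tau>, z *s \<xi>) = z * L (\<tau>, \<xi>)))"

definition subdomain :: "pt set \<Rightarrow> pt set \<Rightarrow> bool" where
  "subdomain N U \<longleftrightarrow> open N \<and> connected N \<and> N \<noteq> {} \<and> N \<subseteq> U"


section \<open>Legendrian surfaces\<close>

definition sympl :: "V \<Rightarrow> V \<Rightarrow> complex" where
  "sympl v w = (\<Sum>i\<in>UNIV. v $ Inl i * w $ Inr i - v $ Inr i * w $ Inl i)"

definition Sp3 :: "mat6 set" where
  "Sp3 = {A. \<forall>v w. sympl (A *v v) (A *v w) = sympl v w}"

text \<open>A point of the projective space is the line in \<open>V\<close> that it represents.\<close>

definition pline :: "V \<Rightarrow> V set" where
  "pline v = vec.span {v}"

text \<open>The tangent space of the projective space at \<open>pline v\<close> is \<open>Hom (pline v) (V / pline v)\<close>, so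
  the implication below is injectivity of the differential of \<open>x\<close>.\<close>

definition legendrian_immersion :: "pt set \<Rightarrow> (pt \<Rightarrow> V set) \<Rightarrow> bool" where
  "legendrian_immersion U x \<longleftrightarrow>
     (\<forall>p\<in>U. \<exists>N X. open N \<and> p \<in> N \<and> N \<subseteq> U \<and> (\<forall>I. holo_on N (\<lambda>q. X q $ I)) \<and>
        (\<forall>q\<in>N. X q \<noteq> 0 \<and> x q = pline (X q) \<and>
           (\<forall>\<xi>. D X q \<xi> \<in> pline (X q) \<longrightarrow> \<xi> = 0) \<and>
           (\<forall>\<xi>. sympl (X q) (D X q \<xi>) = 0)))"

definition congruent_on :: "pt set \<Rightarrow> (pt \<Rightarrow> V set) \<Rightarrow> (pt \<Rightarrow> V set) \<Rightarrow> bool" where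
  "congruent_on N x x' \<longleftrightarrow> (\<exists>g\<in>Sp3. \<forall>p\<in>N. x' p = (*v) g ` x p)"


section \<open>Frames and the Maurer--Cartan form\<close>

text \<open>A frame \<open>(e\<^sub>0, e\<^sub>1, e\<^sub>2, f\<^sub>0, f\<^sub>1, f\<^sub>2)\<close> is the matrix with these columns.\<close>

definition e_vec :: "(pt \<Rightarrow> mat6) \<Rightarrow> 3 \<Rightarrow> pt \<Rightarrow> V" where
  "e_vec F i p = column (Inl i) (F p)"

definition symplectic_frame :: "pt set \<Rightarrow> (pt \<Rightarrow> mat6) \<Rightarrow> bool" where
  "symplectic_frame N F \<longleftrightarrow>
     (\<forall>I J. holo_on N (\<lambda>p. F p $ I $ J)) \<and> (\<forall>p\<in>N. F p \<in> Sp3)"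

definition mc :: "(pt \<Rightarrow> mat6) \<Rightarrow> pt \<Rightarrow> pt \<Rightarrow> mat6" where
  "mc F p \<xi> = matrix_inv (F p) ** D F p \<xi>"

definition om :: "(pt \<Rightarrow> mat6) \<Rightarrow> 3 \<Rightarrow> 3 \<Rightarrow> form" where
  "om F i j p \<xi> = mc F p \<xi> $ Inl i $ Inl j"

definition eta :: "(pt \<Rightarrow> mat6) \<Rightarrow> 3 \<Rightarrow> 3 \<Rightarrow> form" where
  "eta F i j p \<xi> = mc F p \<xi> $ Inl i $ Inr j"

definition theta :: "(pt \<Rightarrow> mat6) \<Rightarrow> 3 \<Rightarrow> 3 \<Rightarrow> form" where
  "theta F i j p \<xi> = mc F p \<xi> $ Inr i $ Inl j"

abbreviation om1 :: "(pt \<Rightarrow> mat6) \<Rightarrow> form" where "om1 F \<equiv> om F 1 0"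
abbreviation om2 :: "(pt \<Rightarrow> mat6) \<Rightarrow> form" where "om2 F \<equiv> om F 2 0"
abbreviation om00 :: "(pt \<Rightarrow> mat6) \<Rightarrow> form" where "om00 F \<equiv> om F 0 0"

definition adapted1 :: "pt set \<Rightarrow> (pt \<Rightarrow> V set) \<Rightarrow> (pt \<Rightarrow> mat6) \<Rightarrow> bool" where
  "adapted1 N x F \<longleftrightarrow> symplectic_frame N F \<and>
     (\<forall>p\<in>N. x p = pline (e_vec F 0 p) \<and>
        vec.span {e_vec F 0 p, e_vec F 1 p, e_vec F 2 p} =
        vec.span (insert (e_vec F 0 p) (range (D (e_vec F 0) p))))"

definition cubic :: "(pt \<Rightarrow> mat6) \<Rightarrow> form" where
  "cubic F p \<xi> = (\<Sum>i\<in>{1, 2}. \<Sum>j\<in>{1, 2}. theta F i j p \<xi> * om F i 0 p \<xi> * om F j 0 p \<xi>)"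

text \<open>The three linear forms are given by their coefficient vectors \<open>l i\<close>.\<close>

definition nondegenerate :: "pt set \<Rightarrow> (pt \<Rightarrow> V set) \<Rightarrow> bool" where
  "nondegenerate U x \<longleftrightarrow>
     (\<forall>p\<in>U. \<exists>N F (l :: 3 \<Rightarrow> pt). open N \<and> p \<in> N \<and> N \<subseteq> U \<and> adapted1 N x F \<and>
        (\<forall>i j. i \<noteq> j \<longrightarrow> l i \<notin> vec.span {l j}) \<and>
        (\<forall>\<xi>. cubic F p \<xi> = (\<Prod>i\<in>UNIV. \<Sum>k\<in>UNIV. l i $ k * \<xi> $ k)))"

definition adapted2 :: "pt set \<Rightarrow> (pt \<Rightarrow> V set) \<Rightarrow> (pt \<Rightarrow> mat6) \<Rightarrow> bool" where
  "adapted2 N x F \<longleftrightarrow> adapted1 N x F \<and>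
     (\<forall>p\<in>N. \<forall>\<xi>. theta F 1 1 p \<xi> = om2 F p \<xi> \<and>
        theta F 1 2 p \<xi> = om1 F p \<xi> + om2 F p \<xi> \<and>
        theta F 2 2 p \<xi> = om1 F p \<xi>)"

definition adapted5 ::
  "pt set \<Rightarrow> (pt \<Rightarrow> V set) \<Rightarrow> (pt \<Rightarrow> mat6) \<Rightarrow> (4 \<Rightarrow> fn) \<Rightarrow> (3 \<Rightarrow> fn) \<Rightarrow> (2 \<Rightarrow> fn) \<Rightarrow> bool" where
  "adapted5 N x F a b c \<longleftrightarrow> adapted2 N x F \<and>
     (\<forall>p\<in>N. \<forall>\<xi>. let w1 = om1 F p \<xi>; w2 = om2 F p \<xi> in
        (\<forall>i\<in>{1, 2}. \<forall>j\<in>{1, 2}. om F i j p \<xi> = (if i = j then 1 / 3 * om00 F p \<xi> else 0)) \<and>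
        om F 0 1 p \<xi> = (a 2 p + a 4 p) * w1 + 3 / 5 * (a 3 p - a 2 p) * w2 \<and>
        om F 0 2 p \<xi> = 3 / 5 * (a 2 p - a 3 p) * w1 + (a 1 p + a 3 p) * w2 \<and>
        eta F 1 1 p \<xi> = a 1 p * w2 \<and>
        eta F 1 2 p \<xi> = a 2 p * w1 + a 3 p * w2 \<and>
        eta F 2 2 p \<xi> = a 4 p * w1 \<and>
        eta F 1 0 p \<xi> = b 1 p * w1 + b 2 p * w2 \<and>
        eta F 2 0 p \<xi> = b 3 p * w1 - b 1 p * w2 \<and>
        eta F 0 0 p \<xi> = c 1 p * w1 + c 2 p * w2)"

text \<open>Moving frames are used through sections: the frame field \<open>F\<close> is a section of the bundle of 5-adapted frames, to which all structure
  coefficients and forms refer.\<close>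

definition legendrian_surface ::
  "pt set \<Rightarrow> (pt \<Rightarrow> V set) \<Rightarrow> (pt \<Rightarrow> mat6) \<Rightarrow> (4 \<Rightarrow> fn) \<Rightarrow> (3 \<Rightarrow> fn) \<Rightarrow> (2 \<Rightarrow> fn) \<Rightarrow> bool" where
  "legendrian_surface U x F a b c \<longleftrightarrow>
     open U \<and> connected U \<and> U \<noteq> {} \<and>
     legendrian_immersion U x \<and> nondegenerate U x \<and> adapted5 U x F a b c"


section \<open>Covariant derivatives and the asymptotic web\<close>

text \<open>Covariant derivatives \<open>h\<^sub>1, h\<^sub>2\<close> of a function \<open>h\<close> of weight \<open>r\<close>:
  \<open>dh = - r h \<omega>\<^sub>0\<^sub>0 + h\<^sub>1 \<omega>\<^sup>1 + h\<^sub>2 \<omega>\<^sup>2\<close>.\<close>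

definition cov :: "(pt \<Rightarrow> mat6) \<Rightarrow> complex \<Rightarrow> fn \<Rightarrow> 2 \<Rightarrow> fn" where
  "cov F r h k p =
     (THE q :: pt. \<forall>\<xi>. D h p \<xi> = - r * h p * om00 F p \<xi> + q $ 1 * om1 F p \<xi> + q $ 2 * om2 F p \<xi>) $ k"

text \<open>Since \<open>d\<omega>\<^sup>i = 2/3 \<omega>\<^sub>0\<^sub>0 \<and> \<omega>\<^sup>i\<close>, a covariant derivative raises the weight by \<open>2/3\<close>.\<close>

fun cov_jet :: "(pt \<Rightarrow> mat6) \<Rightarrow> complex \<Rightarrow> fn \<Rightarrow> 2 list \<Rightarrow> fn" where
  "cov_jet F r h [] = h"
| "cov_jet F r h (k # ks) = cov_jet F (r + 2 / 3) (cov F r h k) ks"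

definition acov :: "(pt \<Rightarrow> mat6) \<Rightarrow> (4 \<Rightarrow> fn) \<Rightarrow> 4 \<Rightarrow> 2 \<Rightarrow> fn" where
  "acov F a i k = cov F (4 / 3) (a i) k"

text \<open>Expressions in \<open>u\<^sub>0\<close>, the structure coefficients and their covariant derivatives; the list
  gives the directions of differentiation, first one first.\<close>

datatype jexpr =
    Num rat
  | U0
  | JA 4 "2 list"
  | JB 3 "2 list"
  | JC 2 "2 list"
  | Plus jexpr jexpr
  | Times jexpr jexpr

primrec jval ::
  "(pt \<Rightarrow> mat6) \<Rightarrow> (4 \<Rightarrow> fn) \<Rightarrow> (3 \<Rightarrow> fn) \<Rightarrow> (2 \<Rightarrow> fn) \<Rightarrow> fn \<Rightarrow> jexpr \<Rightarrow> fn" where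
  "jval F a b c u (Num r) p = of_rat r"
| "jval F a b c u U0 p = u p"
| "jval F a b c u (JA i ks) p = cov_jet F (4 / 3) (a i) ks p"
| "jval F a b c u (JB i ks) p = cov_jet F 2 (b i) ks p"
| "jval F a b c u (JC i ks) p = cov_jet F (8 / 3) (c i) ks p"
| "jval F a b c u (Plus s t) p = jval F a b c u s p + jval F a b c u t p"
| "jval F a b c u (Times s t) p = jval F a b c u s p * jval F a b c u t p"

definition ext_d :: "form \<Rightarrow> pt \<Rightarrow> pt \<Rightarrow> pt \<Rightarrow> complex" where
  "ext_d \<alpha> p \<xi> \<zeta> = D (\<lambda>q. \<alpha> q \<zeta>) p \<xi> - D (\<lambda>q. \<alpha> q \<xi>) p \<zeta>"

definition web_curvature :: "pt set \<Rightarrow> (pt \<Rightarrow> mat6) \<Rightarrow> fn \<Rightarrow> bool" where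
  "web_curvature U F K \<longleftrightarrow>
     (\<forall>p\<in>U. \<forall>\<xi> \<zeta>. 2 / 3 * ext_d (om00 F) p \<xi> \<zeta> =
        K p * (om1 F p \<xi> * om2 F p \<zeta> - om1 F p \<zeta> * om2 F p \<xi>))"

definition web_flat :: "pt set \<Rightarrow> (pt \<Rightarrow> mat6) \<Rightarrow> bool" where
  "web_flat U F \<longleftrightarrow> (\<exists>K. web_curvature U F K \<and> (\<forall>p\<in>U. K p = 0))"


section \<open>Deformations\<close>

text \<open>The 2-adapted frames over a point form an orbit of a fixed structure group, which acts in the
  same way on the coframes of both bundles.  Hence the bundles of \<open>x'\<close> and \<open>g p \<circ> x\<close> are
  isomorphic at \<open>p\<close> iff they have one frame at \<open>p\<close> in common that induces the same coframe
  \<open>\<omega>\<^sup>1, \<omega>\<^sup>2\<close> there; the frames of \<open>g p \<circ> x\<close> are the products \<open>g p ** F p\<close>.\<close>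

definition second_order_deformation ::
  "pt set \<Rightarrow> (pt \<Rightarrow> V set) \<Rightarrow> (pt \<Rightarrow> V set) \<Rightarrow> bool" where
  "second_order_deformation N x x' \<longleftrightarrow> legendrian_immersion N x' \<and>
     (\<exists>g. \<forall>p\<in>N. g p \<in> Sp3 \<and>
        (\<exists>N' F F'. open N' \<and> p \<in> N' \<and> N' \<subseteq> N \<and> adapted2 N' x F \<and> adapted2 N' x' F' \<and>
           F' p = g p ** F p \<and>
           (\<forall>\<xi>. om1 F' p \<xi> = om1 F p \<xi> \<and> om2 F' p \<xi> = om2 F p \<xi>)))"

definition Psi :: "(pt \<Rightarrow> mat6) \<Rightarrow> (4 \<Rightarrow> fn) \<Rightarrow> form" where
  "Psi F a p \<xi> = (a 1 p + 2 * a 2 p) * (om1 F p \<xi>)\<^sup>2 * om2 F p \<xi> +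
     (2 * a 3 p + a 4 p) * om1 F p \<xi> * (om2 F p \<xi>)\<^sup>2"

text \<open>The 5-adapted frame \<open>F'\<close> is the one identified with \<open>F\<close>; the condition on \<open>\<omega>\<^sup>1, \<omega>\<^sup>2, \<omega>\<^sub>0\<^sub>0\<close>
  determines it up to sign, and \<open>F'\<close> and \<open>- F'\<close> have the same Maurer--Cartan form.\<close>

definition psi_deformation ::
  "pt set \<Rightarrow> (pt \<Rightarrow> V set) \<Rightarrow> (pt \<Rightarrow> mat6) \<Rightarrow> (4 \<Rightarrow> fn) \<Rightarrow> (pt \<Rightarrow> V set) \<Rightarrow> bool" where
  "psi_deformation N x F a x' \<longleftrightarrow> second_order_deformation N x x' \<and>
     (\<exists>F' a' b' c'. adapted5 N x' F' a' b' c' \<and>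
        (\<forall>p\<in>N. \<forall>\<xi>. om1 F' p \<xi> = om1 F p \<xi> \<and> om2 F' p \<xi> = om2 F p \<xi> \<and>
           om00 F' p \<xi> = om00 F p \<xi> \<and> Psi F' a' p \<xi> = Psi F a p \<xi>))"

definition delta_om :: "(pt \<Rightarrow> mat6) \<Rightarrow> fn \<Rightarrow> 3 \<Rightarrow> 3 \<Rightarrow> form" where
  "delta_om F u i j p \<xi> =
     (if i = 0 \<and> j = 1 then - u p * om1 F p \<xi>
      else if i = 0 \<and> j = 2 then - u p * om2 F p \<xi>
      else 0)"

definition delta_eta ::
  "(pt \<Rightarrow> mat6) \<Rightarrow> (4 \<Rightarrow> fn) \<Rightarrow> fn \<Rightarrow> fn \<Rightarrow> fn \<Rightarrow> 3 \<Rightarrow> 3 \<Rightarrow> form" where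
  "delta_eta F a u v w i j p \<xi> =
     (let w2 = w p + 6 / 5 * (- a 2 p + a 3 p) * u p in
      if i = 1 \<and> j = 1 then - 2 * u p * om2 F p \<xi>
      else if i = 1 \<and> j = 2 \<or> i = 2 \<and> j = 1 then u p * (om1 F p \<xi> + om2 F p \<xi>)
      else if i = 2 \<and> j = 2 then - 2 * u p * om1 F p \<xi>
      else if i = 1 \<and> j = 0 \<or> i = 0 \<and> j = 1 then - v p * (om1 F p \<xi> + om2 F p \<xi>)
      else if i = 2 \<and> j = 0 \<or> i = 0 \<and> j = 2 then v p * (om1 F p \<xi> + om2 F p \<xi>)
      else w p * om1 F p \<xi> + w2 * om2 F p \<xi>)"

definition delta_mc ::
  "(pt \<Rightarrow> mat6) \<Rightarrow> (4 \<Rightarrow> fn) \<Rightarrow> fn \<Rightarrow> fn \<Rightarrow> fn \<Rightarrow> pt \<Rightarrow> pt \<Rightarrow> mat6" where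
  "delta_mc F a u v w p \<xi> = (\<chi> I J.
     (case I of
        Inl i \<Rightarrow> (case J of Inl j \<Rightarrow> delta_om F u i j p \<xi> | Inr j \<Rightarrow> delta_eta F a u v w i j p \<xi>)
      | Inr i \<Rightarrow> (case J of Inl j \<Rightarrow> 0 | Inr j \<Rightarrow> - delta_om F u j i p \<xi>)))"

text \<open>\<open>x'\<close> is a \<open>\<Psi>\<close>-deformation with parameters \<open>u = u\<^sub>0\<close>, \<open>v = v\<^sub>1\<close>, \<open>w = w\<^sub>1\<close>.\<close>

definition psi_parameters ::
  "pt set \<Rightarrow> (pt \<Rightarrow> V set) \<Rightarrow> (pt \<Rightarrow> mat6) \<Rightarrow> (4 \<Rightarrow> fn) \<Rightarrow> (pt \<Rightarrow> V set) \<Rightarrow> fn \<Rightarrow> fn \<Rightarrow> fn \<Rightarrow> bool" where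
  "psi_parameters N x F a x' u v w \<longleftrightarrow> psi_deformation N x F a x' \<and>
     holo_on N u \<and> holo_on N v \<and> holo_on N w \<and>
     (\<exists>F' a' b' c'. adapted5 N x' F' a' b' c' \<and>
        (\<forall>p\<in>N. \<forall>\<xi>. mc F' p \<xi> = mc F p \<xi> + delta_mc F a u v w p \<xi>))"

definition structure_equation ::
  "pt set \<Rightarrow> (pt \<Rightarrow> mat6) \<Rightarrow> (4 \<Rightarrow> fn) \<Rightarrow> (3 \<Rightarrow> fn) \<Rightarrow> fn \<Rightarrow> fn \<Rightarrow> fn \<Rightarrow> bool" where
  "structure_equation N F a b u v w \<longleftrightarrow>
     holo_on N u \<and> holo_on N v \<and> holo_on N w \<and>
     (\<forall>p\<in>N. \<forall>\<xi>.
        let a1 = a 1 p; a2 = a 2 p; a3 = a 3 p; a4 = a 4 p;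
            b1 = b 1 p; b2 = b 2 p; b3 = b 3 p;
            a41 = acov F a 4 1 p; a12 = acov F a 1 2 p; a21 = acov F a 2 1 p;
            u0 = u p; v1 = v p; w1 = w p;
            w11 = - 2 * u0 * v1 + (- 12 / 5 * a3 + 22 / 5 * a2 + a4 + a1) * v1 +
                  (24 * b1 - 4 * b2 + 15 * b3 + a41 + a12 - 3 * a21) * u0;
            w12 = 2 * u0 * v1 + (- 28 / 5 * a3 + 18 / 5 * a2 - a4 - a1) * v1 +
                  (36 * b1 - 6 * b2 + 26 * b3 + a41 + a12 - 6 * a21) * u0
        in D u p \<xi> + 4 / 3 * u0 * om00 F p \<xi> = v1 * (- om1 F p \<xi> + om2 F p \<xi>) \<and>
           D v p \<xi> + 2 * v1 * om00 F p \<xi> =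
             (3 / 2 * u0\<^sup>2 + (3 / 5 * a3 - a4 - a1 - 8 / 5 * a2) * u0 + 1 / 2 * w1) * om1 F p \<xi> +
             (- 3 / 2 * u0\<^sup>2 + (a3 + a4 + a1) * u0 - 1 / 2 * w1) * om2 F p \<xi> \<and>
           D w p \<xi> + 8 / 3 * w1 * om00 F p \<xi> = w11 * om1 F p \<xi> + w12 * om2 F p \<xi>)"

text \<open>\<open>M\<close> admits, near \<open>p\<close>, a family of \<open>\<Psi>\<close>-deformations that depends effectively on \<open>CARD('k)\<close>
  parameters: a nonempty open set \<open>T\<close> of pairwise non-congruent \<open>\<Psi>\<close>-deformations on a common
  neighbourhood of \<open>p\<close>, with \<open>(u\<^sub>0, v\<^sub>1, w\<^sub>1)\<close> depending holomorphically on \<open>t \<in> T\<close> and the point.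
  The set of germs of \<open>\<Psi>\<close>-deformations at \<open>p\<close> up to congruence is at most \<open>k\<close>-dimensional if
  there is no such family with more than \<open>k\<close> parameters.\<close>

definition admits_psi_family ::
  "'k::finite itself \<Rightarrow> pt set \<Rightarrow> (pt \<Rightarrow> V set) \<Rightarrow> (pt \<Rightarrow> mat6) \<Rightarrow> (4 \<Rightarrow> fn) \<Rightarrow> pt \<Rightarrow> bool" where
  "admits_psi_family _ U x F a p \<longleftrightarrow>
     (\<exists>N (T :: (complex ^ 'k) set) X u v w. subdomain N U \<and> p \<in> N \<and> open T \<and> T \<noteq> {} \<and>
        jointly_holo_on T N u \<and> jointly_holo_on T N v \<and> jointly_holo_on T N w \<and>
        (\<forall>t\<in>T. psi_parameters N x F a (X t) (u t) (v t) (w t)) \<and>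
        (\<forall>s\<in>T. \<forall>t\<in>T. s \<noteq> t \<longrightarrow> \<not> congruent_on N (X s) (X t)))"

end

theory Submission
  imports Defs "HOL-Complex_Analysis.Complex_Analysis"
begin

unbundle no fps_syntax
no_notation fps_nth (infixl "$" 75)

text \<open>
  Frames with the same Maurer--Cartan form differ by a constant symplectic matrix, and the 5-adapted
  frame of a surface with given \<open>\<omega>\<^sup>1, \<omega>\<^sup>2, \<omega>\<^sub>0\<^sub>0\<close> is unique up to sign.  Hence \<open>\<Psi>\<close>-deformations up to congruence
  are the solutions of the Maurer--Cartan equation among the forms with the given first columns, that is
  (after solving the linear relations between structure coefficients that the equation imposes) the
  solutions \<open>(u\<^sub>0, v\<^sub>1, w\<^sub>1)\<close> of a total differential system.  A solution is determined by its value at a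
  single point, so by invariance of domain a family of non-congruent deformations has at most as many
  parameters as there are free values at a suitably chosen point; the integrability condition removes
  some of them.  In the case where the integrability condition is vacuous, a holomorphic Frobenius
  theorem, proved by Picard iteration along rays, is applied twice: to the total differential system
  with initial values as parameters, and to the rows of the frame equation \<open>dG = G \<pi>\<close>.
\<close>

section \<open>Holomorphic functions of several variables\<close>

text \<open>The algebra stays manageable because it is done with weighted covariant derivatives: a
  function of weight \<open>r\<close> has derivatives of weight \<open>r + 2/3\<close>, the terms in
  \<open>om00\<close> cancel throughout, and d(dh) = 0 turns into the commutation rule
  \<open>cov_commute\<close>. For a deformation, the Maurer-Cartan equation fixes both derivatives
  of u, but only one combination of the derivatives of v and one of those of w. The missing ones
  come from d(du) = 0 and d(dv) = 0, so that d(dw) = 0 is the first identity that can obstruct. A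
  family lives on some neighbourhood N of the given point, and the coefficient by which the
  integrability condition has to be divided may vanish at that point. By the identity theorem it
  does not vanish on all of N, so the point at which parameters are compared is chosen after N. For
  existence, the Frobenius condition concerns all values of the unknowns at a point, whereas the
  identities above are computed along functions. The gap is closed by functions that satisfy the
  system to first order at a single point.\<close>

abbreviation FD :: "('a::real_normed_vector \<Rightarrow> 'b::real_normed_vector) \<Rightarrow> 'a \<Rightarrow> 'a \<Rightarrow> 'b" where
  "FD f p \<equiv> frechet_derivative f (at p)"

lemma FD_eqI: "(f has_derivative L) (at p) \<Longrightarrow> FD f p = L"
  by (metis frechet_derivative_at)

text \<open>Taylor's formula with a Cauchy bound on discs of radius \<open>R / 4\<close> about
  points of the half disc. The constant depends only on \<open>B\<close> and \<open>R\<close>, which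
  later makes difference quotients converge uniformly in the base point.\<close>

lemma holomorphic_second_order_bound:
  assumes "g holomorphic_on ball 0 R" "\<And>z. z \<in> ball 0 R \<Longrightarrow> cmod (g z) \<le> B" "0 < R" "cmod h < R/2"
  shows "cmod (g h - g 0 - deriv g 0 * h) \<le> 32 * B / R\<^sup>2 * (cmod h)\<^sup>2"
proof -
  have der: "((deriv ^^ i) g has_field_derivative (deriv ^^ Suc i) g z) (at z within ball 0 (R/2))"
    if "z \<in> ball 0 (R/2)" for z i
  proof -
    have "(deriv ^^ i) g holomorphic_on ball 0 R"
      using assms(1) holomorphic_higher_deriv by blast
    then have "((deriv ^^ i) g has_field_derivative deriv ((deriv ^^ i) g) z) (at z)"
      by (rule holomorphic_derivI) (use that \<open>0 < R\<close> in auto)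
    then show ?thesis by (simp add: has_field_derivative_at_within)
  qed
  have bd: "cmod ((deriv ^^ 2) g z) \<le> 32 * B / R\<^sup>2" if z: "z \<in> ball 0 (R/2)" for z
  proof -
    have sub: "cball z (R/4) \<subseteq> ball 0 R"
    proof
      fix y assume "y \<in> cball z (R/4)"
      then have "dist 0 y \<le> dist 0 z + R/4"
        using dist_triangle[of 0 y z] by auto
      then show "y \<in> ball 0 R" using z \<open>0 < R\<close> by auto
    qed
    have "cmod ((deriv ^^ 2) g z) \<le> fact 2 * B / (R/4)^2"
    proof (rule Cauchy_inequality)
      show "g holomorphic_on ball z (R/4)"
        using assms(1) sub ball_subset_cball holomorphic_on_subset by blast
      show "continuous_on (cball z (R/4)) g"
        using assms(1) sub continuous_on_subset holomorphic_on_imp_continuous_on by blast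
      show "0 < R/4" using \<open>0 < R\<close> by simp
      show "cmod (g x) \<le> B" if "cmod (z - x) = R/4" for x
        by (rule assms(2)) (use sub that in \<open>auto simp: dist_norm\<close>)
    qed
    then show ?thesis by (simp add: power2_eq_square field_simps)
  qed
  have "cmod ((deriv ^^ 0) g h - (\<Sum>i\<le>1. (deriv ^^ i) g 0 * (h-0) ^ i / (fact i)))
      \<le> 32 * B / R\<^sup>2 * cmod(h - 0)^(Suc 1) / fact 1"
    by (rule complex_Taylor[where S="ball 0 (R/2)"])
      (use der bd assms in \<open>auto simp: numeral_2_eq_2\<close>)
  then show ?thesis by (simp add: power2_eq_square algebra_simps)
qed

text \<open>An abstract complex scalar action lets one calculus serve both
  \<open>complex ^ 'n\<close> and products of two such spaces, on which joint holomorphy in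
  parameter and point is formulated.\<close>

locale complex_structure =
  fixes sm :: "complex \<Rightarrow> 'a::euclidean_space \<Rightarrow> 'a"  (infixr "\<cdot>" 75)
  assumes sm_assoc: "(z * w) \<cdot> x = z \<cdot> (w \<cdot> x)"
    and sm_add_left: "(z + w) \<cdot> x = z \<cdot> x + w \<cdot> x"
    and sm_norm: "norm (z \<cdot> x) = cmod z * norm x"
    and sm_real: "complex_of_real r \<cdot> x = r *\<^sub>R x"
begin

definition cdiff :: "'a set \<Rightarrow> ('a \<Rightarrow> complex) \<Rightarrow> bool" where
  "cdiff S f \<longleftrightarrow> (\<forall>p\<in>S. \<exists>L. (f has_derivative L) (at p) \<and> (\<forall>z \<xi>. L (z \<cdot> \<xi>) = z * L \<xi>))"

lemma sm_zero[simp]: "0 \<cdot> x = 0"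
  using sm_norm[of 0 x] by simp

lemma sm_one[simp]: "1 \<cdot> x = x"
  using sm_real[of 1 x] by simp

lemma sm_bounded_linear: "bounded_linear (\<lambda>z. z \<cdot> x)"
proof (rule bounded_linear_intro)
  show "(r *\<^sub>R z) \<cdot> x = r *\<^sub>R (z \<cdot> x)" for r z
    by (metis scaleR_conv_of_real sm_assoc sm_real)
qed (auto simp: sm_add_left sm_norm mult.commute)

end

context complex_structure
begin

lemma cdiffD:
  assumes "cdiff S f" "p \<in> S"
  shows "(f has_derivative FD f p) (at p)" "FD f p (z \<cdot> \<xi>) = z * FD f p \<xi>"
  using assms FD_eqI unfolding cdiff_def by metis+

lemma cdiffI:
  "(\<And>p. p \<in> S \<Longrightarrow> (f has_derivative L p) (at p)) \<Longrightarrow> (\<And>p z \<xi>. p \<in> S \<Longrightarrow> L p (z \<cdot> \<xi>) = z * L p \<xi>) \<Longrightarrow> cdiff S f"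
  unfolding cdiff_def by metis

lemma cdiff_subset: "cdiff S f \<Longrightarrow> T \<subseteq> S \<Longrightarrow> cdiff T f"
  unfolding cdiff_def by blast

lemma cdiff_isCont: "cdiff S f \<Longrightarrow> p \<in> S \<Longrightarrow> isCont f p"
  using cdiffD(1) has_derivative_continuous by blast

lemma cdiff_continuous_on: "cdiff S f \<Longrightarrow> continuous_on S f"
  by (simp add: cdiff_isCont continuous_at_imp_continuous_on)

lemma cdiff_cong:
  assumes "cdiff S f" "open S" "\<And>p. p \<in> S \<Longrightarrow> f p = g p"
  shows "cdiff S g"
proof (rule cdiffI)
  show "(g has_derivative FD f p) (at p)" if "p \<in> S" for p
    using has_derivative_transform_within_open[OF cdiffD(1)[OF assms(1) that] assms(2) that] assms(3) by blast
qed (use assms cdiffD in auto)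

lemma cdiff_const: "cdiff S (\<lambda>_. c)"
  by (rule cdiffI[where L="\<lambda>_ _. 0"]) auto

lemma cdiff_add: "cdiff S f \<Longrightarrow> cdiff S g \<Longrightarrow> cdiff S (\<lambda>x. f x + g x)"
  by (rule cdiffI[where L="\<lambda>p h. FD f p h + FD g p h"])
    (auto intro!: has_derivative_add cdiffD simp: cdiffD(2) algebra_simps)

lemma cdiff_uminus: "cdiff S f \<Longrightarrow> cdiff S (\<lambda>x. - f x)"
  by (rule cdiffI[where L="\<lambda>p h. - FD f p h"])
    (auto intro!: has_derivative_minus cdiffD simp: cdiffD(2))

lemma cdiff_diff: "cdiff S f \<Longrightarrow> cdiff S g \<Longrightarrow> cdiff S (\<lambda>x. f x - g x)"
  using cdiff_add[OF _ cdiff_uminus, of S f g] by simp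

lemma cdiff_mult: "cdiff S f \<Longrightarrow> cdiff S g \<Longrightarrow> cdiff S (\<lambda>x. f x * g x)"
  by (rule cdiffI[where L="\<lambda>p h. f p * FD g p h + FD f p h * g p"])
    (auto intro!: has_derivative_eq_rhs[OF has_derivative_mult] cdiffD(1) simp: cdiffD(2) algebra_simps)

lemma cdiff_power: "cdiff S f \<Longrightarrow> cdiff S (\<lambda>x. f x ^ n)"
  by (induction n) (auto intro: cdiff_const cdiff_mult)

lemma cdiff_inverse: "cdiff S f \<Longrightarrow> (\<And>p. p \<in> S \<Longrightarrow> f p \<noteq> 0) \<Longrightarrow> cdiff S (\<lambda>x. inverse (f x))"
  by (rule cdiffI[where L="\<lambda>p h. - (inverse (f p) * FD f p h * inverse (f p))"])
    (auto intro!: Deriv.has_derivative_inverse cdiffD simp: cdiffD(2))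

lemma cdiff_divide: "cdiff S f \<Longrightarrow> cdiff S g \<Longrightarrow> (\<And>p. p \<in> S \<Longrightarrow> g p \<noteq> 0) \<Longrightarrow> cdiff S (\<lambda>x. f x / g x)"
  using cdiff_mult[OF _ cdiff_inverse, of S f g] by (simp add: divide_inverse)

lemma cdiff_sum: "(\<And>i. i \<in> I \<Longrightarrow> cdiff S (f i)) \<Longrightarrow> cdiff S (\<lambda>x. \<Sum>i\<in>I. f i x)"
  by (induction I rule: infinite_finite_induct) (auto intro: cdiff_const cdiff_add)

lemma cdiff_line:
  assumes "cdiff S f" "x + z \<cdot> \<xi> \<in> S"
  shows "((\<lambda>z. f (x + z \<cdot> \<xi>)) has_field_derivative FD f (x + z \<cdot> \<xi>) \<xi>) (at z)"
proof -
  have *: "((\<lambda>z. x + z \<cdot> \<xi>) has_derivative (\<lambda>h. h \<cdot> \<xi>)) (at z)"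
    by (auto intro!: derivative_eq_intros bounded_linear_imp_has_derivative[OF sm_bounded_linear])
  have "((\<lambda>z. f (x + z \<cdot> \<xi>)) has_derivative (\<lambda>h. FD f (x + z \<cdot> \<xi>) (h \<cdot> \<xi>))) (at z)"
    using has_derivative_compose[OF * cdiffD(1)[OF assms]] .
  then show ?thesis
    unfolding has_field_derivative_def
    by (rule has_derivative_eq_rhs) (simp add: cdiffD(2)[OF assms] mult.commute fun_eq_iff)
qed

lemma line_in_ball: "cmod z * norm \<xi> < r \<Longrightarrow> x + z \<cdot> \<xi> \<in> ball x r"
  by (simp add: dist_norm sm_norm)

lemma cdiff_line_holomorphic:
  assumes "cdiff S f" "\<And>z. z \<in> A \<Longrightarrow> x + z \<cdot> \<xi> \<in> S"
  shows "(\<lambda>z. f (x + z \<cdot> \<xi>)) holomorphic_on A"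
  unfolding holomorphic_on_def field_differentiable_def
  using cdiff_line[OF assms(1)] assms(2) DERIV_subset by blast

text \<open>The one-variable Cauchy inequality on the complex line through \<open>x\<close> in
  direction \<open>\<xi>\<close>. The factor 2 comes from halving the radius, so that the closed
  disc stays in the open ball.\<close>

lemma Cauchy_estimate:
  assumes f: "cdiff (ball x r) f" and B: "\<And>y. y \<in> ball x r \<Longrightarrow> cmod (f y) \<le> B" and "0 < r"
  shows "cmod (FD f x \<xi>) \<le> 2 * B / r * norm \<xi>"
proof (cases "\<xi> = 0")
  case True
  have "FD f x (0 \<cdot> \<xi>) = 0"
    by (subst cdiffD(2)[OF f]) (use \<open>0 < r\<close> in auto)
  then show ?thesis using True by simp
next
  case False
  define \<rho> where "\<rho> = r / (2 * norm \<xi>)"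
  have \<rho>: "0 < \<rho>" using False \<open>0 < r\<close> by (simp add: \<rho>_def)
  have inb: "x + z \<cdot> \<xi> \<in> ball x r" if "z \<in> cball 0 \<rho>" for z
  proof (rule line_in_ball)
    have "cmod z * norm \<xi> \<le> \<rho> * norm \<xi>" using that by (simp add: mult_right_mono)
    also have "\<dots> < r" using False \<open>0 < r\<close> by (simp add: \<rho>_def)
    finally show "cmod z * norm \<xi> < r" .
  qed
  let ?g = "\<lambda>z. f (x + z \<cdot> \<xi>)"
  have hol: "?g holomorphic_on cball 0 \<rho>"
    by (rule cdiff_line_holomorphic[OF f inb])
  have "cmod ((deriv ^^ 1) ?g 0) \<le> fact 1 * B / \<rho> ^ 1"
  proof (rule Cauchy_inequality)
    show "?g holomorphic_on ball 0 \<rho>"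
      using hol ball_subset_cball holomorphic_on_subset by blast
    show "continuous_on (cball 0 \<rho>) ?g"
      using hol holomorphic_on_imp_continuous_on by blast
  qed (use \<rho> B inb in auto)
  moreover have "deriv ?g 0 = FD f x \<xi>"
    using DERIV_imp_deriv[OF cdiff_line[OF f, of x 0 \<xi>]] \<open>0 < r\<close> by simp
  ultimately show ?thesis
    using False \<open>0 < r\<close> by (simp add: \<rho>_def field_simps)
qed

lemma ball_half_subset: "y \<in> ball x (r/2) \<Longrightarrow> ball y (r/2) \<subseteq> ball x (r::real)"
  for x y :: "'x::metric_space"
proof
  fix z assume "y \<in> ball x (r/2)" "z \<in> ball y (r/2)"
  then show "z \<in> ball x r"
    using dist_triangle[of x z y] by auto
qed

text \<open>Weierstrass: the Cauchy estimate for differences \<open>f m - f n\<close> shows that the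
  derivatives are uniformly Cauchy on the half ball, and complex linearity passes to the
  limit.\<close>

lemma cdiff_uniform_limit_ball:
  assumes f: "\<And>n. cdiff (ball x r) (f n)" and "0 < r" and lim: "uniform_limit (ball x r) f l sequentially"
  shows "cdiff (ball x (r/2)) l"
    and "y \<in> ball x (r/2) \<Longrightarrow> (\<lambda>n. FD (f n) y \<xi>) \<longlonglongrightarrow> FD l y \<xi>"
proof -
  have est: "cmod (FD (f m) y h - FD (f n) y h) \<le> 4 * e / r * norm h"
    if "\<And>z. z \<in> ball x r \<Longrightarrow> cmod (f m z - f n z) \<le> e" "y \<in> ball x (r/2)" for m n y h e
  proof -
    have y: "y \<in> ball x r" using that(2) \<open>0 < r\<close> by auto
    have sub: "ball y (r/2) \<subseteq> ball x r" by (rule ball_half_subset[OF that(2)])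
    have "FD (\<lambda>z. f m z - f n z) y = (\<lambda>h. FD (f m) y h - FD (f n) y h)"
      by (intro FD_eqI has_derivative_diff cdiffD(1)[OF f y])
    moreover have "cmod (FD (\<lambda>z. f m z - f n z) y h) \<le> 2 * e / (r/2) * norm h"
      by (rule Cauchy_estimate)
        (use sub that \<open>0 < r\<close> in \<open>auto intro!: cdiff_diff cdiff_subset[OF f sub]\<close>)
    ultimately show ?thesis by simp
  qed
  have uc: "\<exists>N. \<forall>m\<ge>N. \<forall>n\<ge>N. \<forall>z\<in>ball x r. cmod (f m z - f n z) \<le> e" if "e > 0" for e
    using lim that uniformly_convergent_Cauchy[of "ball x r" f]
    unfolding uniformly_convergent_on_def uniformly_Cauchy_on_def dist_norm
    by (meson less_imp_le)
  have cau: "Cauchy (\<lambda>n. FD (f n) y h)" if y: "y \<in> ball x (r/2)" for y h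
  proof (rule metric_CauchyI)
    fix e :: real assume e: "e > 0"
    define d where "d = e * r / (8 * (norm h + 1))"
    have d: "d > 0" using e \<open>0 < r\<close> by (simp add: d_def add_nonneg_pos)
    obtain N where N: "\<And>m n z. m\<ge>N \<Longrightarrow> n\<ge>N \<Longrightarrow> z\<in>ball x r \<Longrightarrow> cmod (f m z - f n z) \<le> d"
      using uc[OF d] by blast
    have "dist (FD (f m) y h) (FD (f n) y h) < e" if "m \<ge> N" "n \<ge> N" for m n
    proof -
      have "dist (FD (f m) y h) (FD (f n) y h) \<le> 4 * d / r * norm h"
        unfolding dist_norm by (rule est[OF _ y]) (use N that in auto)
      also have "\<dots> = e/2 * (norm h / (norm h + 1))"
        using \<open>0 < r\<close> by (simp add: d_def field_simps add_nonneg_eq_0_iff)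
      also have "\<dots> \<le> e/2 * 1"
        using e by (intro mult_left_mono) (auto simp: divide_le_eq_1 add_nonneg_pos)
      also have "\<dots> < e" using e by simp
      finally show ?thesis .
    qed
    then show "\<exists>M. \<forall>m\<ge>M. \<forall>n\<ge>M. dist (FD (f m) y h) (FD (f n) y h) < e" by blast
  qed
  define G where "G = (\<lambda>y h. lim (\<lambda>n. FD (f n) y h))"
  have G: "(\<lambda>n. FD (f n) y h) \<longlonglongrightarrow> G y h" if "y \<in> ball x (r/2)" for y h
    using Cauchy_convergent[OF cau[OF that]] convergent_LIMSEQ_iff unfolding G_def by blast
  have lp: "(\<lambda>n. f n y) \<longlonglongrightarrow> l y" if "y \<in> ball x r" for y
    using tendsto_uniform_limitI[OF lim that] .
  have "\<exists>g. \<forall>y\<in>ball x (r/2). (\<lambda>n. f n y) \<longlonglongrightarrow> g y \<and> (g has_derivative G y) (at y within ball x (r/2))"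
  proof (rule has_derivative_sequence)
    show "((f n) has_derivative FD (f n) y) (at y within ball x (r/2))" if "y \<in> ball x (r/2)" for n y
      by (rule has_derivative_at_withinI, rule cdiffD(1)[OF f]) (use that \<open>0 < r\<close> in auto)
    show "\<forall>\<^sub>F n in sequentially. \<forall>y\<in>ball x (r/2). \<forall>h. cmod (FD (f n) y h - G y h) \<le> e * norm h"
      if e: "e > 0" for e
    proof -
      define d where "d = e * r / 4"
      have d: "d > 0" using e \<open>0 < r\<close> by (simp add: d_def)
      obtain N where N: "\<And>m n z. m\<ge>N \<Longrightarrow> n\<ge>N \<Longrightarrow> z\<in>ball x r \<Longrightarrow> cmod (f m z - f n z) \<le> d"
        using uc[OF d] by blast
      have "cmod (FD (f n) y h - G y h) \<le> e * norm h" if n: "n \<ge> N" and y: "y\<in>ball x (r/2)" for n y h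
      proof (rule Lim_norm_ubound)
        show "(\<lambda>m. FD (f n) y h - FD (f m) y h) \<longlonglongrightarrow> FD (f n) y h - G y h"
          by (intro tendsto_intros G y)
        have "cmod (FD (f n) y h - FD (f m) y h) \<le> e * norm h" if "m \<ge> N" for m
          using est[of n m d y h] N n that y \<open>0 < r\<close> by (simp add: d_def)
        then show "\<forall>\<^sub>F m in sequentially. cmod (FD (f n) y h - FD (f m) y h) \<le> e * norm h"
          unfolding eventually_sequentially by blast
      qed simp
      then show ?thesis unfolding eventually_sequentially by blast
    qed
    show "x \<in> ball x (r/2)" using \<open>0 < r\<close> by simp
    show "(\<lambda>n. f n x) \<longlonglongrightarrow> l x" by (rule lp) (use \<open>0 < r\<close> in simp)
  qed simp
  then obtain g where g: "\<And>y. y\<in>ball x (r/2) \<Longrightarrow> (\<lambda>n. f n y) \<longlonglongrightarrow> g y"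
    "\<And>y. y\<in>ball x (r/2) \<Longrightarrow> (g has_derivative G y) (at y within ball x (r/2))" by blast
  have der: "(l has_derivative G y) (at y)" if y: "y\<in>ball x (r/2)" for y
  proof (rule has_derivative_transform_within_open[OF _ open_ball y])
    show "(g has_derivative G y) (at y)" using g(2)[OF y] y at_within_open[OF y] by simp
    show "g z = l z" if "z \<in> ball x (r/2)" for z
      using LIMSEQ_unique[OF g(1)[OF that] lp] that \<open>0 < r\<close> by auto
  qed
  show "cdiff (ball x (r/2)) l"
  proof (rule cdiffI[OF der])
    fix y z \<xi> assume y: "y \<in> ball x (r/2)"
    have "(\<lambda>n. FD (f n) y (z \<cdot> \<xi>)) \<longlonglongrightarrow> z * G y \<xi>"
    proof -
      have "FD (f n) y (z \<cdot> \<xi>) = z * FD (f n) y \<xi>" for n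
        by (rule cdiffD(2)[OF f]) (use y \<open>0 < r\<close> in auto)
      then show ?thesis using tendsto_mult_left[OF G[OF y]] by simp
    qed
    then show "G y (z \<cdot> \<xi>) = z * G y \<xi>"
      using LIMSEQ_unique G[OF y] by blast
  qed
  show "(\<lambda>n. FD (f n) y \<xi>) \<longlonglongrightarrow> FD l y \<xi>" if "y \<in> ball x (r/2)"
    using G[OF that] FD_eqI[OF der[OF that]] by simp
qed

lemma cdiff_uniform_limit:
  assumes "\<And>x. x \<in> S \<Longrightarrow> \<exists>r>0. (\<forall>n. cdiff (ball x r) (f n)) \<and> uniform_limit (ball x r) f l sequentially"
  shows "cdiff S l" and "x \<in> S \<Longrightarrow> (\<lambda>n. FD (f n) x \<xi>) \<longlonglongrightarrow> FD l x \<xi>"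
proof -
  have *: "\<exists>r>0. cdiff (ball x r) l \<and> (\<forall>\<xi>. (\<lambda>n. FD (f n) x \<xi>) \<longlonglongrightarrow> FD l x \<xi>)" if x: "x \<in> S" for x
  proof -
    obtain r where r: "r > 0" "\<And>n. cdiff (ball x r) (f n)" "uniform_limit (ball x r) f l sequentially"
      using assms[OF x] by blast
    show ?thesis
      by (rule exI[of _ "r/2"])
        (use cdiff_uniform_limit_ball[OF r(2,1,3)] r(1) in auto)
  qed
  show "cdiff S l"
    unfolding cdiff_def
  proof
    fix p assume "p \<in> S"
    then obtain r where "r > 0" "cdiff (ball p r) l" using * by blast
    then show "\<exists>L. (l has_derivative L) (at p) \<and> (\<forall>z \<xi>. L (z \<cdot> \<xi>) = z * L \<xi>)"
      unfolding cdiff_def by simp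
  qed
  show "x \<in> S \<Longrightarrow> (\<lambda>n. FD (f n) x \<xi>) \<longlonglongrightarrow> FD l x \<xi>" using * by blast
qed

end

text \<open>Serves to exhibit an integral with a parameter as a locally uniform limit of finite
  sums, with an error that depends only on the modulus of continuity. The induction is over the
  number of subintervals, each of which contributes \<open>e / m\<close>.\<close>

lemma Riemann_sum_bound:
  fixes g :: "real \<Rightarrow> complex"
  assumes g: "continuous_on {0..1} g" and "0 < m"
    and e: "\<And>s t. s \<in> {0..1} \<Longrightarrow> t \<in> {0..1} \<Longrightarrow> \<bar>s - t\<bar> \<le> 1 / real m \<Longrightarrow> cmod (g s - g t) \<le> e"
  shows "cmod (integral {0..1} g - (\<Sum>k<m. g (real k / real m) / of_nat m)) \<le> e"
proof -
  have "j \<le> m \<Longrightarrow> cmod (integral {0..real j / m} g - (\<Sum>k<j. g (real k / real m) / of_nat m)) \<le> e * (real j / m)" for j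
  proof (induction j)
    case (Suc j)
    let ?a = "real j / m" and ?b = "real (Suc j) / m"
    have ab: "0 \<le> ?a" "?a \<le> ?b" "?b \<le> 1" "?b - ?a = 1 / m"
      using Suc.prems \<open>0 < m\<close> by (auto simp: divide_simps)
    have int: "g integrable_on {u..v}" if "0 \<le> u" "v \<le> 1" for u v
      by (rule integrable_continuous_real) (use that in \<open>auto intro: continuous_on_subset[OF g]\<close>)
    have "integral {0..?b} g = integral {0..?a} g + integral {?a..?b} g"
      using Henstock_Kurzweil_Integration.integral_combine[OF ab(1,2) int] ab by simp
    moreover have "integral {?a..?b} (\<lambda>s. g s - g ?a) = integral {?a..?b} g - g ?a / of_nat m"
    proof -
      have "integral {?a..?b} (\<lambda>s. g s - g ?a) = integral {?a..?b} g - integral {?a..?b} (\<lambda>s. g ?a)"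
        by (rule Henstock_Kurzweil_Integration.integral_diff) (use ab int in auto)
      also have "integral {?a..?b} (\<lambda>s. g ?a) = g ?a / of_nat m"
        using ab by (simp add: scaleR_conv_of_real)
      finally show ?thesis .
    qed
    moreover have "cmod (integral {?a..?b} (\<lambda>s. g s - g ?a)) \<le> e * (?b - ?a)"
    proof (rule integral_bound)
      show "continuous_on {?a..?b} (\<lambda>s. g s - g ?a)"
        by (intro continuous_intros continuous_on_subset[OF g]) (use ab in auto)
      show "cmod (g s - g ?a) \<le> e" if "s \<in> {?a..?b}" for s
        by (rule e) (use that ab order_trans[OF ab(1), of s] in auto)
    qed (rule ab)
    ultimately have "integral {0..?b} g - (\<Sum>k<Suc j. g (real k / real m) / of_nat m)
        = (integral {0..?a} g - (\<Sum>k<j. g (real k / real m) / of_nat m)) + integral {?a..?b} (\<lambda>s. g s - g ?a)"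
      by simp
    also have "cmod \<dots> \<le> e * ?a + e * (?b - ?a)"
      using Suc \<open>cmod (integral {?a..?b} (\<lambda>s. g s - g ?a)) \<le> e * (?b - ?a)\<close>
      by (intro norm_triangle_mono) auto
    finally show ?case by (simp add: algebra_simps)
  qed simp
  from this[of m] show ?thesis using \<open>0 < m\<close> by simp
qed

section \<open>Higher derivatives, integrals with parameters and the identity theorem\<close>

context complex_structure
begin

lemma cdiff_shift:
  assumes "cdiff S f" "\<And>q. q \<in> T \<Longrightarrow> q + c \<in> S"
  shows "cdiff T (\<lambda>q. f (q + c))" "q \<in> T \<Longrightarrow> FD (\<lambda>q. f (q + c)) q = FD f (q + c)"
proof -
  have *: "((\<lambda>q. f (q + c)) has_derivative FD f (q + c)) (at q)" if "q \<in> T" for q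
  proof -
    have "((\<lambda>q. q + c) has_derivative (\<lambda>h. h)) (at q)" by (auto intro!: derivative_eq_intros)
    from has_derivative_compose[OF this cdiffD(1)[OF assms(1) assms(2)[OF that]]] show ?thesis .
  qed
  show "cdiff T (\<lambda>q. f (q + c))"
    by (rule cdiffI[OF *]) (use assms cdiffD(2) in auto)
  show "q \<in> T \<Longrightarrow> FD (\<lambda>q. f (q + c)) q = FD f (q + c)"
    by (rule FD_eqI[OF *])
qed

lemma cdiff_local:
  assumes "\<And>x. x \<in> S \<Longrightarrow> \<exists>r>0. cdiff (ball x r) f"
  shows "cdiff S f"
  unfolding cdiff_def
proof
  fix p assume "p \<in> S"
  then obtain r where "r > 0" "cdiff (ball p r) f" using assms by blast
  then show "\<exists>L. (f has_derivative L) (at p) \<and> (\<forall>z \<xi>. L (z \<cdot> \<xi>) = z * L \<xi>)"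
    unfolding cdiff_def by simp
qed

lemma cdiff_locally_bounded:
  assumes "cdiff S f" "open S" "x \<in> S"
  obtains r B where "0 < r" "ball x r \<subseteq> S" "\<And>y. y \<in> ball x r \<Longrightarrow> cmod (f y) \<le> B"
proof -
  obtain r1 where r1: "0 < r1" "ball x r1 \<subseteq> S" using assms openE by blast
  obtain r2 where r2: "0 < r2" "\<And>y. dist y x < r2 \<Longrightarrow> dist (f y) (f x) < 1"
    using cdiff_isCont[OF assms(1,3), unfolded continuous_at_eps_delta, rule_format, of 1] by auto
  show ?thesis
  proof (rule that[of "min r1 r2" "cmod (f x) + 1"])
    show "ball x (min r1 r2) \<subseteq> S" using r1 by auto
    show "cmod (f y) \<le> cmod (f x) + 1" if "y \<in> ball x (min r1 r2)" for y
      using r2(2)[of y] that norm_triangle_ineq2[of "f y" "f x"] by (auto simp: dist_norm dist_commute norm_minus_commute)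
  qed (use r1 r2 in auto)
qed

text \<open>The uniform second order bound on complex lines through nearby points shows that the
  difference quotients in a fixed direction converge uniformly near \<open>x\<close>. As they are
  holomorphic, the theorem on uniform limits then applies to the derivative.\<close>

lemma difference_quotients:
  assumes f: "cdiff S f" and "open S" and "x \<in> S"
  obtains r t where "0 < r" "(\<And>n. 0 < t n)" "t \<longlonglongrightarrow> (0::real)" "\<And>n q. q \<in> ball x r \<Longrightarrow> q \<in> S \<and> q + of_real (t n) \<cdot> \<xi> \<in> S"
    "uniform_limit (ball x r) (\<lambda>n q. (f (q + of_real (t n) \<cdot> \<xi>) - f q) / of_real (t n)) (\<lambda>q. FD f q \<xi>) sequentially"
proof -
  obtain r B where r: "0 < r" "ball x r \<subseteq> S" and B: "\<And>y. y \<in> ball x r \<Longrightarrow> cmod (f y) \<le> B"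
    by (rule cdiff_locally_bounded[OF assms]) blast
  \<comment> \<open>Complex displacements \<open>z\<close> with modulus below \<open>R\<close> move
    the half ball into the full one; the \<open>+ 1\<close> takes care of
    \<open>\<xi> = 0\<close>.\<close>
  define R where "R = r / 2 / (norm \<xi> + 1)"
  have R: "0 < R" using r by (simp add: R_def add_nonneg_pos)
  have inb: "q + z \<cdot> \<xi> \<in> ball x r" if "q \<in> ball x (r/2)" "z \<in> ball 0 R" for q z
  proof -
    have "cmod z * norm \<xi> \<le> R * (norm \<xi> + 1)" using that R by (intro mult_mono) auto
    also have "\<dots> = r/2" 
    proof -
      have "r / 2 / c * c = r / 2" if "0 < c" for c :: real using that by simp
      from this[of "norm \<xi> + 1"] show ?thesis unfolding R_def by (simp only: add_nonneg_pos norm_ge_zero zero_less_one)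
    qed
    finally have "norm (z \<cdot> \<xi>) \<le> r/2" by (simp add: sm_norm)
    then show ?thesis
      using that(1) norm_triangle_ineq4[of "x - q" "z \<cdot> \<xi>"] by (simp add: dist_norm diff_diff_eq)
  qed
  define t where "t = (\<lambda>n. R / 4 * inverse (real (Suc n)))"
  have t: "0 < t n" "t n < R/2" for n
  proof -
    show "0 < t n" using R by (simp add: t_def)
    have "t n \<le> R/4 * 1" unfolding t_def using R by (intro mult_left_mono) (auto simp: inverse_le_1_iff)
    then show "t n < R/2" using R by simp
  qed
  have tlim: "t \<longlonglongrightarrow> 0"
    unfolding t_def using tendsto_mult[OF tendsto_const[of "R/4"] LIMSEQ_inverse_real_of_nat] by (simp only: mult_zero_right)
  have est: "cmod ((f (q + of_real (t n) \<cdot> \<xi>) - f q) / of_real (t n) - FD f q \<xi>) \<le> 32 * B / R\<^sup>2 * t n"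
    if q: "q \<in> ball x (r/2)" for q n
  proof -
    let ?g = "\<lambda>z. f (q + z \<cdot> \<xi>)"
    have "?g holomorphic_on ball 0 R"
      by (rule cdiff_line_holomorphic[OF f]) (use inb[OF q] r in auto)
    then have "cmod (?g (t n) - ?g 0 - deriv ?g 0 * t n) \<le> 32 * B / R\<^sup>2 * (cmod (t n))\<^sup>2"
      by (rule holomorphic_second_order_bound) (use inb[OF q] B R t[of n] in auto)
    moreover have "deriv ?g 0 = FD f q \<xi>"
    proof -
      have "q \<in> S" using q r by auto
      then show ?thesis
        using DERIV_imp_deriv[OF cdiff_line[OF f, of q 0 \<xi>]] by simp
    qed
    ultimately have *: "cmod (f (q + of_real (t n) \<cdot> \<xi>) - f q - FD f q \<xi> * t n) \<le> 32 * B / R\<^sup>2 * (t n)\<^sup>2"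
      using t(1)[of n] by simp
    have "(f (q + of_real (t n) \<cdot> \<xi>) - f q) / of_real (t n) - FD f q \<xi> = (f (q + of_real (t n) \<cdot> \<xi>) - f q - FD f q \<xi> * t n) / of_real (t n)"
      using t(1)[of n] by (simp add: field_simps)
    also have "cmod \<dots> = cmod (f (q + of_real (t n) \<cdot> \<xi>) - f q - FD f q \<xi> * t n) / t n"
      using t(1)[of n] by (simp add: norm_divide)
    also have "\<dots> \<le> 32 * B / R\<^sup>2 * (t n)\<^sup>2 / t n"
      using * t(1)[of n] by (intro divide_right_mono) auto
    also have "\<dots> = 32 * B / R\<^sup>2 * t n" using t(1)[of n] by (simp add: power2_eq_square)
    finally show ?thesis .
  qed
  show ?thesis
  proof (rule that[of "r/2" t])
    show "q \<in> S \<and> q + of_real (t n) \<cdot> \<xi> \<in> S" if "q \<in> ball x (r/2)" for n q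
      using inb[OF that, of "of_real (t n)"] inb[OF that, of 0] t[of n] r R by auto
    show "uniform_limit (ball x (r/2)) (\<lambda>n q. (f (q + of_real (t n) \<cdot> \<xi>) - f q) / of_real (t n)) (\<lambda>q. FD f q \<xi>) sequentially"
    proof (rule uniform_limitI)
      fix e :: real assume "e > 0"
      have "(\<lambda>n. 32 * B / R\<^sup>2 * t n) \<longlonglongrightarrow> 32 * B / R\<^sup>2 * 0"
        by (intro tendsto_intros tlim)
      then have "\<forall>\<^sub>F n in sequentially. 32 * B / R\<^sup>2 * t n < e"
        using \<open>e > 0\<close> by (simp add: order_tendstoD)
      then show "\<forall>\<^sub>F n in sequentially. \<forall>q\<in>ball x (r/2). dist ((f (q + of_real (t n) \<cdot> \<xi>) - f q) / of_real (t n)) (FD f q \<xi>) < e"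
      proof eventually_elim
        case (elim n)
        then show ?case using est[of _ n] unfolding dist_norm by (meson le_less_trans)
      qed
    qed
  qed (use t tlim r in auto)
qed

lemma cdiff_quotient:
  assumes f: "cdiff S f" and q: "q \<in> T" and T: "\<And>q. q \<in> T \<Longrightarrow> q \<in> S \<and> q + c \<in> S"
  shows "cdiff T (\<lambda>q. (f (q + c) - f q) / a)"
    "FD (\<lambda>q. (f (q + c) - f q) / a) q \<zeta> = (FD f (q + c) \<zeta> - FD f q \<zeta>) / a"
proof -
  have s: "cdiff T (\<lambda>q. f (q + c))" "FD (\<lambda>q. f (q + c)) q = FD f (q + c)"
    using cdiff_shift(1)[OF f, of T c] cdiff_shift(2)[OF f, of T c, OF _ q] T by auto
  have f': "cdiff T f" using cdiff_subset[OF f] T by blast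
  show "cdiff T (\<lambda>q. (f (q + c) - f q) / a)"
    using cdiff_mult[OF cdiff_diff[OF s(1) f'] cdiff_const[of _ "1/a"]] by simp
  have "((\<lambda>q. (f (q + c) - f q) / a) has_derivative (\<lambda>\<zeta>. (FD f (q + c) \<zeta> - FD f q \<zeta>) / a)) (at q)"
    using cdiffD(1)[OF s(1) q] cdiffD(1)[OF f' q] s(2)
    by (auto intro!: derivative_eq_intros simp: divide_inverse algebra_simps)
  from FD_eqI[OF this] show "FD (\<lambda>q. (f (q + c) - f q) / a) q \<zeta> = (FD f (q + c) \<zeta> - FD f q \<zeta>) / a" by simp
qed

lemma cdiff_FD:
  assumes f: "cdiff S f" and "open S"
  shows "cdiff S (\<lambda>p. FD f p \<xi>)"
proof -
  have "\<exists>r>0. cdiff (ball x r) (\<lambda>p. FD f p \<xi>)" if x: "x \<in> S" for x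
  proof -
    obtain r t where rt: "0 < r" "\<And>n q. q \<in> ball x r \<Longrightarrow> q \<in> S \<and> q + of_real (t n :: real) \<cdot> \<xi> \<in> S"
      "uniform_limit (ball x r) (\<lambda>n q. (f (q + of_real (t n) \<cdot> \<xi>) - f q) / of_real (t n)) (\<lambda>q. FD f q \<xi>) sequentially"
      by (rule difference_quotients[OF assms x, of \<xi>]) blast
    have "cdiff (ball x (r/2)) (\<lambda>q. FD f q \<xi>)"
      by (rule cdiff_uniform_limit_ball[OF _ rt(1,3)], rule cdiff_quotient[OF f, of x])
        (use rt in auto)
    then show ?thesis using rt(1) half_gt_zero by blast
  qed
  then show ?thesis by (rule cdiff_local)
qed

text \<open>The difference quotient in direction \<open>\<xi>\<close> may be differentiated in
  direction \<open>\<zeta>\<close> before the limit, since holomorphic limits commute with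
  derivatives. This gives the difference quotient of the \<open>\<zeta>\<close>-derivative, whose
  limit is the mixed derivative in the other order.\<close>

lemma FD_symmetric:
  assumes f: "cdiff S f" and "open S" "x \<in> S"
  shows "FD (\<lambda>p. FD f p \<xi>) x \<zeta> = FD (\<lambda>p. FD f p \<zeta>) x \<xi>"
proof -
  obtain r t where rt: "0 < r" "\<And>n. 0 < t n" "t \<longlonglongrightarrow> 0" "\<And>n q. q \<in> ball x r \<Longrightarrow> q \<in> S \<and> q + of_real (t n :: real) \<cdot> \<xi> \<in> S"
    "uniform_limit (ball x r) (\<lambda>n q. (f (q + of_real (t n) \<cdot> \<xi>) - f q) / of_real (t n)) (\<lambda>q. FD f q \<xi>) sequentially"
    by (rule difference_quotients[OF assms, of \<xi>]) blast
  have x: "x \<in> ball x r" using rt by simp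
  have "(\<lambda>n. FD (\<lambda>q. (f (q + of_real (t n) \<cdot> \<xi>) - f q) / of_real (t n)) x \<zeta>) \<longlonglongrightarrow> FD (\<lambda>q. FD f q \<xi>) x \<zeta>"
    by (rule cdiff_uniform_limit_ball(2)[OF _ rt(1,5)], rule cdiff_quotient[OF f x])
      (use rt in auto)
  moreover have "FD (\<lambda>q. (f (q + of_real (t n) \<cdot> \<xi>) - f q) / of_real (t n)) x \<zeta>
      = (FD f (x + of_real (t n) \<cdot> \<xi>) \<zeta> - FD f x \<zeta>) / of_real (t n)" for n
    by (rule cdiff_quotient[OF f x rt(4)])
  ultimately have 1: "(\<lambda>n. (FD f (x + of_real (t n) \<cdot> \<xi>) \<zeta> - FD f x \<zeta>) / of_real (t n)) \<longlonglongrightarrow> FD (\<lambda>q. FD f q \<xi>) x \<zeta>"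
    by simp
  have "((\<lambda>z. FD f (x + z \<cdot> \<xi>) \<zeta>) has_field_derivative FD (\<lambda>q. FD f q \<zeta>) x \<xi>) (at 0)"
    using cdiff_line[OF cdiff_FD[OF f \<open>open S\<close>, of \<zeta>], of x 0 \<xi>] \<open>x \<in> S\<close> by simp
  then have "((\<lambda>h. (FD f (x + h \<cdot> \<xi>) \<zeta> - FD f x \<zeta>) / h) \<longlongrightarrow> FD (\<lambda>q. FD f q \<zeta>) x \<xi>) (at 0)"
    by (simp add: DERIV_def)
  moreover have "filterlim (\<lambda>n. complex_of_real (t n)) (at 0) sequentially"
    unfolding filterlim_at using rt(2) tendsto_of_real[OF rt(3), where 'a=complex]
    by (simp add: less_imp_neq[symmetric])
  ultimately have "(\<lambda>n. (FD f (x + of_real (t n) \<cdot> \<xi>) \<zeta> - FD f x \<zeta>) / of_real (t n)) \<longlonglongrightarrow> FD (\<lambda>q. FD f q \<zeta>) x \<xi>"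
    by (rule filterlim_compose)
  then show ?thesis using LIMSEQ_unique[OF 1] by blast
qed

text \<open>Riemann sums are holomorphic in the parameter, and uniform continuity on a compact ball
  times the unit interval makes them converge uniformly there.\<close>

lemma cdiff_integral:
  assumes cont: "continuous_on (S \<times> {0..1}) (\<lambda>(x, s). g x s)"
    and hol: "\<And>s. s \<in> {0..1} \<Longrightarrow> cdiff S (\<lambda>x. g x s)" and "open S"
  shows "cdiff S (\<lambda>x. integral {0..1::real} (g x))"
proof (rule cdiff_uniform_limit(1)[where f="\<lambda>n x. \<Sum>k<Suc n. g x (real k / real (Suc n)) / of_nat (Suc n)"])
  fix x assume "x \<in> S"
  then obtain r where r: "0 < r" "cball x r \<subseteq> S" using \<open>open S\<close> open_contains_cball by blast
  have uc: "uniformly_continuous_on (cball x r \<times> {0..1}) (\<lambda>(x, s). g x s)"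
    by (rule compact_uniformly_continuous)
      (use r in \<open>auto intro!: compact_Times continuous_on_subset[OF cont]\<close>)
  show "\<exists>r>0. (\<forall>n. cdiff (ball x r) (\<lambda>x. \<Sum>k<Suc n. g x (real k / real (Suc n)) / of_nat (Suc n))) \<and>
      uniform_limit (ball x r) (\<lambda>n x. \<Sum>k<Suc n. g x (real k / real (Suc n)) / of_nat (Suc n)) (\<lambda>x. integral {0..1} (g x)) sequentially"
  proof (intro exI[of _ r] conjI allI)
    have "cdiff (ball x r) (\<lambda>x. g x s / of_nat (Suc n))" if "s \<in> {0..1}" for n s
      using cdiff_mult[OF cdiff_subset[OF hol[OF that]] cdiff_const[of _ "1 / of_nat (Suc n)"], of "ball x r"] r
        subset_trans[OF ball_subset_cball, of x r S] by (simp del: of_nat_Suc)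
    then show "cdiff (ball x r) (\<lambda>x. \<Sum>k<Suc n. g x (real k / real (Suc n)) / of_nat (Suc n))" for n
      by (intro cdiff_sum) (auto simp: divide_simps)
    show "uniform_limit (ball x r) (\<lambda>n x. \<Sum>k<Suc n. g x (real k / real (Suc n)) / of_nat (Suc n)) (\<lambda>x. integral {0..1} (g x)) sequentially"
    proof (rule uniform_limitI)
      fix e :: real assume e: "e > 0"
      obtain d where d: "d > 0" "\<And>p q. p \<in> cball x r \<times> {0..1} \<Longrightarrow> q \<in> cball x r \<times> {0..1} \<Longrightarrow> dist q p < d
          \<Longrightarrow> dist (case q of (x, s) \<Rightarrow> g x s) (case p of (x, s) \<Rightarrow> g x s) < e/2"
        using uc[unfolded uniformly_continuous_on_def, rule_format, OF half_gt_zero[OF e]]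
        by blast
      obtain N where N: "inverse (real (Suc N)) < d" using reals_Archimedean d(1) by blast
      have "dist (\<Sum>k<Suc n. g y (real k / real (Suc n)) / of_nat (Suc n)) (integral {0..1} (g y)) < e"
        if n: "n \<ge> N" and y: "y \<in> ball x r" for n y
      proof -
        have "1 / real (Suc n) \<le> inverse (real (Suc N))" using n by (simp add: divide_simps)
        then have nd: "1 / real (Suc n) < d" using N by linarith
        have "cmod (integral {0..1} (g y) - (\<Sum>k<Suc n. g y (real k / real (Suc n)) / of_nat (Suc n))) \<le> e/2"
        proof (rule Riemann_sum_bound)
          have "continuous_on {0..1} (\<lambda>s. (\<lambda>(x, s). g x s) (y, s))"
            by (rule continuous_on_compose2[OF cont]) (use y r in \<open>auto intro!: continuous_intros\<close>)
          then show "continuous_on {0..1} (g y)" by simp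
          show "cmod (g y s - g y t) \<le> e/2" if "s \<in> {0..1}" "t \<in> {0..1}" "\<bar>s - t\<bar> \<le> 1 / real (Suc n)" for s t
            using d(2)[of "(y, t)" "(y, s)"] that y nd by (auto simp: dist_Pair_Pair dist_norm less_imp_le)
        qed simp
        then show ?thesis using e by (simp add: dist_norm norm_minus_commute)
      qed
      then show "\<forall>\<^sub>F n in sequentially. \<forall>y\<in>ball x r. dist (\<Sum>k<Suc n. g y (real k / real (Suc n)) / of_nat (Suc n)) (integral {0..1} (g y)) < e"
        unfolding eventually_sequentially by blast
    qed
  qed (use r in auto)
qed

text \<open>The interior of the zero set is also relatively closed: a limit point lies in a ball
  about some interior zero \<open>c\<close>, and every point of that ball is reached from
  \<open>c\<close> along a complex line, on which the one-variable identity theorem holds.\<close>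

lemma cdiff_identity_theorem:
  assumes f: "cdiff S f" and "open S" "connected S" and T: "open T" "T \<noteq> {}" "T \<subseteq> S"
    and z: "\<And>x. x \<in> T \<Longrightarrow> f x = 0" and "x \<in> S"
  shows "f x = 0"
proof -
  define Z where "Z = interior {x \<in> S. f x = 0}"
  have "T \<subseteq> Z" using T z by (auto simp: Z_def interior_def)
  have "S \<inter> closure Z \<subseteq> Z"
  proof
    fix y assume y: "y \<in> S \<inter> closure Z"
    then have "y \<in> S" "y \<in> closure Z" by auto
    obtain r where r: "0 < r" "ball y r \<subseteq> S" using openE[OF \<open>open S\<close> \<open>y \<in> S\<close>] .
    obtain c where "c \<in> Z" "dist c y < r/2"
      using \<open>y \<in> closure Z\<close> half_gt_zero[OF r(1)] unfolding closure_approachable by blast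
    then have c: "c \<in> Z" "c \<in> ball y (r/2)" by (auto simp: dist_commute)
    have sub: "ball c (r/2) \<subseteq> S" using ball_half_subset[OF c(2)] r by blast
    obtain d where d: "0 < d" "ball c d \<subseteq> {x \<in> S. f x = 0}"
      using c(1) unfolding Z_def mem_interior by blast
    have "f w = 0" if w: "w \<in> ball c (r/2)" for w
    proof (cases "w = c")
      case True then show ?thesis using d(2) centre_in_ball[of c d] d(1) by blast
    next
      case False
      define \<xi> where "\<xi> = w - c"
      have nz: "0 < norm \<xi>" using False by (simp add: \<xi>_def)
      have w1: "norm \<xi> < r/2" using w by (simp add: \<xi>_def dist_norm norm_minus_commute)
      have hol: "(\<lambda>z. f (c + z \<cdot> \<xi>)) holomorphic_on ball 0 (r/2 / norm \<xi>)"
        by (rule cdiff_line_holomorphic[OF f], rule subsetD[OF sub], rule line_in_ball)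
          (use nz in \<open>auto simp: field_simps\<close>)
      define U where "U = ball (0::complex) (min (r/2 / norm \<xi>) (d / norm \<xi>))"
      have U0: "f (c + z \<cdot> \<xi>) = 0" if "z \<in> U" for z
      proof -
        have "c + z \<cdot> \<xi> \<in> ball c d"
          by (rule line_in_ball) (use that nz in \<open>auto simp: U_def field_simps\<close>)
        then show ?thesis using d by blast
      qed
      have "(\<lambda>z. f (c + z \<cdot> \<xi>)) 1 = 0"
      proof (rule analytic_continuation_open[where s=U and s'="ball 0 (r/2 / norm \<xi>)" and g="\<lambda>_. 0" and f="\<lambda>z. f (c + z \<cdot> \<xi>)" and z=1])
        have "0 \<in> U" using nz d(1) r(1) by (simp add: U_def)
        then show "U \<noteq> {}" by blast
        show "(1::complex) \<in> ball 0 (r/2 / norm \<xi>)" using w1 nz by (simp add: field_simps)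
      qed (use hol U0 in \<open>auto simp: U_def\<close>)
      then show ?thesis by (simp add: \<xi>_def)
    qed
    then have "ball c (r/2) \<subseteq> {x \<in> S. f x = 0}" using sub by auto
    then have "ball c (r/2) \<subseteq> Z" unfolding Z_def by (simp add: interior_maximal)
    then show "y \<in> Z" using c(2) by (auto simp: dist_commute)
  qed
  then have "S \<inter> closure Z = S \<inter> Z" using closure_subset by blast
  moreover have "Z \<subseteq> S" unfolding Z_def using interior_subset by blast
  ultimately have "closedin (top_of_set S) Z" 
    using closedin_closed_Int[of "closure Z" S] by (simp add: Int_absorb1)
  moreover have "openin (top_of_set S) Z"
    using \<open>Z \<subseteq> S\<close> \<open>open S\<close> by (simp add: Z_def openin_open_eq)
  ultimately have "Z = {} \<or> Z = S"
    using \<open>connected S\<close> unfolding connected_clopen by blast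
  then have "Z = S" using \<open>T \<subseteq> Z\<close> T(2) by blast
  then show ?thesis using \<open>x \<in> S\<close> interior_subset unfolding Z_def by blast
qed

end

text \<open>A discrete Gronwall argument: by the mean value inequality, each bound on
  \<open>h\<close> implies half that bound, because \<open>C * \<rho> \<le> 1/2\<close>.\<close>

lemma zero_if_derivative_small:
  fixes h :: "'a::real_normed_vector \<Rightarrow> 'b::real_normed_vector"
  assumes S: "convex S" "x \<in> S" "S \<subseteq> cball x \<rho>"
    and h: "\<And>y. y \<in> S \<Longrightarrow> (h has_derivative h' y) (at y within S)"
    and C: "\<And>y \<xi>. y \<in> S \<Longrightarrow> norm (h' y \<xi>) \<le> C * norm (h y) * norm \<xi>" "0 \<le> C" "C * \<rho> \<le> 1/2"
    and B: "\<And>y. y \<in> S \<Longrightarrow> norm (h y) \<le> B" and 0: "h x = 0" and y: "y \<in> S"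
  shows "h y = 0"
proof -
  have "norm (h y) \<le> B / 2 ^ n" if "y \<in> S" for n y
    using that
  proof (induction n arbitrary: y)
    case (Suc n)
    have "0 \<le> B" using B[OF S(2)] norm_ge_zero order_trans by blast
    have "norm (h y - h x) \<le> (C * (B / 2 ^ n)) * norm (y - x)"
    proof (rule differentiable_bound[OF S(1) h])
      show "onorm (h' z) \<le> C * (B / 2 ^ n)" if z: "z \<in> S" for z
      proof (rule onorm_bound)
        show "norm (h' z \<xi>) \<le> C * (B / 2 ^ n) * norm \<xi>" for \<xi>
          by (rule order_trans[OF C(1)[OF z]])
            (intro mult_right_mono mult_left_mono Suc.IH z C(2) norm_ge_zero)
        show "0 \<le> C * (B / 2 ^ n)" using C(2) \<open>0 \<le> B\<close> by simp
      qed
    qed (use Suc S in auto)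
    also have "\<dots> \<le> (C * (B / 2 ^ n)) * \<rho>"
      using Suc.prems S(3) C(2) \<open>0 \<le> B\<close>
      by (intro mult_left_mono) (auto simp: dist_norm norm_minus_commute)
    also have "\<dots> = (C * \<rho>) * (B / 2 ^ n)" by simp
    also have "\<dots> \<le> 1/2 * (B / 2 ^ n)"
      using C(3) \<open>0 \<le> B\<close> by (intro mult_right_mono) auto
    finally show ?case using 0 by simp
  qed (use B in auto)
  from this[OF y] have *: "norm (h y) \<le> B * (1/2) ^ n" for n by (simp add: power_divide)
  have "(\<lambda>n. B * (1/2) ^ n) \<longlonglongrightarrow> B * 0"
    by (intro tendsto_intros LIMSEQ_power_zero) simp
  then have "norm (h y) \<le> 0"
    using Lim_bounded2[of "\<lambda>n. B * (1/2) ^ n" "B * 0" 0 "norm (h y)"] * by simp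
  then show ?thesis by simp
qed

text \<open>The zero set is closed by continuity and open by the preceding lemma on balls so small
  that \<open>C * \<rho> \<le> 1/2\<close>.\<close>

lemma zero_if_derivative_bounded_by_value:
  fixes h :: "'a::real_normed_vector \<Rightarrow> 'b::real_normed_vector"
  assumes "open S" "connected S" "p \<in> S" "h p = 0"
    and h: "\<And>y. y \<in> S \<Longrightarrow> (h has_derivative h' y) (at y)"
    and C: "\<And>x. x \<in> S \<Longrightarrow> \<exists>C r. 0 < r \<and> (\<forall>y\<in>ball x r. \<forall>\<xi>. norm (h' y \<xi>) \<le> C * norm (h y) * norm \<xi>)"
    and "x \<in> S"
  shows "h x = 0"
proof -
  define Z where "Z = {x \<in> S. h x = 0}"
  have cont: "continuous_on S h"
    using h by (auto intro!: continuous_at_imp_continuous_on has_derivative_continuous)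
  have "closedin (top_of_set S) Z"
    unfolding Z_def using continuous_closedin_preimage_constant[OF cont] .
  moreover have "open Z"
  proof (rule openI)
    fix x assume "x \<in> Z"
    then have x: "x \<in> S" "h x = 0" by (auto simp: Z_def)
    obtain C' r where r: "0 < r" and C': "\<And>y \<xi>. y \<in> ball x r \<Longrightarrow> norm (h' y \<xi>) \<le> C' * norm (h y) * norm \<xi>"
      using C[OF x(1)] by blast
    define C where "C = max C' 0"
    have C: "norm (h' y \<xi>) \<le> C * norm (h y) * norm \<xi>" if "y \<in> ball x r" for y \<xi>
      by (rule order_trans[OF C'[OF that]]) (auto simp: C_def intro!: mult_right_mono)
    obtain r2 where r2: "0 < r2" "ball x r2 \<subseteq> S" using x \<open>open S\<close> openE by blast
    obtain r3 where r3: "0 < r3" "\<And>y. dist y x < r3 \<Longrightarrow> dist (h y) (h x) < 1"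
      using has_derivative_continuous[OF h[OF x(1)], unfolded continuous_at_eps_delta, rule_format, of 1] by auto
    define \<rho> where "\<rho> = min (min r r2) (min r3 (1 / (2 * (C + 1))))"
    have \<rho>: "0 < \<rho>" "\<rho> \<le> r" "\<rho> \<le> r2" "\<rho> \<le> r3" "\<rho> \<le> 1 / (2 * (C + 1))"
      using r r2 r3 by (auto simp: \<rho>_def C_def add_nonneg_pos)
    have "h y = 0" if y: "y \<in> ball x \<rho>" for y
    proof (rule zero_if_derivative_small[where S="ball x \<rho>" and x=x and C=C and B=1 and h'=h' and \<rho>=\<rho>, OF _ _ _ _ _ _ _ _ _ y])
      show "C * \<rho> \<le> 1/2"
      proof -
        have "C * \<rho> \<le> C * (1 / (2 * (C + 1)))" using \<rho>(5) by (intro mult_left_mono) (auto simp: C_def)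
        also have "\<dots> \<le> 1/2" by (simp add: C_def divide_simps)
        finally show ?thesis .
      qed
      show "norm (h' y \<xi>) \<le> C * norm (h y) * norm \<xi>" if "y \<in> ball x \<rho>" for y \<xi>
        by (rule C) (use that \<rho> in auto)
      show "norm (h y) \<le> 1" if "y \<in> ball x \<rho>" for y
        using r3(2)[of y] that \<rho> x by (auto simp: dist_commute)
      show "(h has_derivative h' y) (at y within ball x \<rho>)" if "y \<in> ball x \<rho>" for y
        by (rule has_derivative_at_withinI, rule h) (use that \<rho> r2 in auto)
      show "0 \<le> C" by (simp add: C_def)
    qed (use \<rho>(1) x(2) ball_subset_cball in simp_all)
    then have "ball x \<rho> \<subseteq> Z" using \<rho> r2 by (auto simp: Z_def)
    then show "\<exists>\<epsilon>>0. ball x \<epsilon> \<subseteq> Z" using \<rho>(1) by blast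
  qed
  then have "openin (top_of_set S) Z" using \<open>open S\<close> by (auto simp: Z_def openin_open_eq)
  ultimately have "Z = {} \<or> Z = S" using \<open>connected S\<close> unfolding connected_clopen by blast
  then show ?thesis using assms(3,4,7) unfolding Z_def by blast
qed

section \<open>Complex coordinate spaces and their products\<close>

lemma norm_vector_scalar_mult: "norm (z *s x) = cmod z * norm x" for x :: "complex ^ 'n"
  by (simp add: norm_vec_def norm_mult L2_set_right_distrib)

global_interpretation cvec: complex_structure "(*s) :: complex \<Rightarrow> complex ^ 'n \<Rightarrow> complex ^ 'n"
  by standard (auto simp: vec_eq_iff algebra_simps norm_vector_scalar_mult scaleR_conv_of_real[where 'a=complex])

definition pair_scale :: "complex \<Rightarrow> (complex ^ 'm) \<times> (complex ^ 'n) \<Rightarrow> (complex ^ 'm) \<times> (complex ^ 'n)" where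
  "pair_scale z x = (z *s fst x, z *s snd x)"

global_interpretation cpair: complex_structure pair_scale
proof
  show "norm (pair_scale z x) = cmod z * norm x" for z and x :: "(complex ^ 'm) \<times> (complex ^ 'n)"
    by (simp add: pair_scale_def norm_Pair norm_vector_scalar_mult power_mult_distrib real_sqrt_mult
        norm_prod_def flip: distrib_left)
qed (auto simp: pair_scale_def vec_eq_iff algebra_simps scaleR_conv_of_real[where 'a=complex] prod_eq_iff)

lemma holo_on_iff_cdiff: "holo_on S f \<longleftrightarrow> cvec.cdiff S f"
  unfolding holo_on_def cvec.cdiff_def ..

lemma jointly_holo_on_iff_cdiff: "jointly_holo_on T S h \<longleftrightarrow> cpair.cdiff (T \<times> S) (\<lambda>(s, q). h s q)"
  unfolding jointly_holo_on_def cpair.cdiff_def pair_scale_def by auto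

lemma cdiff_compose:
  assumes "complex_structure sa" "complex_structure sb" "complex_structure.cdiff sb T f"
    and g: "\<And>p. p \<in> S \<Longrightarrow> g p \<in> T"
    and g': "\<And>p. p \<in> S \<Longrightarrow> (g has_derivative g' p) (at p)" "\<And>p z \<xi>. p \<in> S \<Longrightarrow> g' p (sa z \<xi>) = sb z (g' p \<xi>)"
  shows "complex_structure.cdiff sa S (\<lambda>p. f (g p))"
proof -
  interpret a: complex_structure sa by fact
  interpret b: complex_structure sb by fact
  show ?thesis
  proof (rule a.cdiffI)
    show "((\<lambda>p. f (g p)) has_derivative (\<lambda>\<xi>. FD f (g p) (g' p \<xi>))) (at p)" if "p \<in> S" for p
      by (rule has_derivative_compose[OF g'(1)[OF that] b.cdiffD(1)[OF assms(3) g[OF that]]])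
  qed (simp add: g' b.cdiffD(2)[OF assms(3) g])
qed

lemma has_derivative_vec_componentwise:
  fixes f :: "'a::real_normed_vector \<Rightarrow> 'b::euclidean_space ^ 'm"
  assumes "\<And>j. ((\<lambda>p. f p $ j) has_derivative (\<lambda>\<xi>. L \<xi> $ j)) (at p within S)"
  shows "(f has_derivative L) (at p within S)"
proof (subst has_derivative_componentwise_within, rule ballI)
  fix i :: "'b ^ 'm" assume "i \<in> Basis"
  then obtain j b where i: "i = axis j b" by (auto simp: Basis_vec_def)
  show "((\<lambda>x. f x \<bullet> i) has_derivative (\<lambda>x. L x \<bullet> i)) (at p within S)"
    unfolding i inner_axis by (rule has_derivative_inner_left[OF assms])
qed

lemma has_derivative_vec_nth:
  "(f has_derivative L) F \<Longrightarrow> ((\<lambda>p. f p $ j) has_derivative (\<lambda>\<xi>. L \<xi> $ j)) F"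
  by (rule bounded_linear.has_derivative[OF bounded_linear_vec_nth])

lemma cpair_cdiff_fst_nth: "cpair.cdiff S (\<lambda>x. fst x $ i)"
  by (rule cpair.cdiffI[where L="\<lambda>_ \<xi>. fst \<xi> $ i"])
    (auto simp: pair_scale_def intro!: bounded_linear_imp_has_derivative
      bounded_linear_compose[OF bounded_linear_vec_nth bounded_linear_fst])

lemma cpair_cdiff_snd_nth: "cpair.cdiff S (\<lambda>x. snd x $ i)"
  by (rule cpair.cdiffI[where L="\<lambda>_ \<xi>. snd \<xi> $ i"])
    (auto simp: pair_scale_def intro!: bounded_linear_imp_has_derivative
      bounded_linear_compose[OF bounded_linear_vec_nth bounded_linear_snd])

lemma norm_le_sum_components: "norm x \<le> (\<Sum>j\<in>UNIV. cmod (x $ j))" for x :: "complex ^ 'm"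
  unfolding norm_vec_def by (rule L2_set_le_sum) simp

lemma norm_le_card_mult:
  fixes x :: "complex ^ 'm"
  assumes "\<And>j. cmod (x $ j) \<le> B"
  shows "norm x \<le> real CARD('m) * B"
  using norm_le_sum_components[of x] sum_bounded_above[of "UNIV :: 'm set" "\<lambda>j. cmod (x $ j)" B] assms
  by simp

lemma component_expansion:
  fixes A :: "complex ^ 'n \<Rightarrow> complex ^ 'm"
  assumes "\<And>\<xi> \<zeta>. A (\<xi> + \<zeta>) = A \<xi> + A \<zeta>" "\<And>c \<xi>. A (c *s \<xi>) = c *s A \<xi>"
  shows "A \<xi> $ j = (\<Sum>k\<in>UNIV. \<xi> $ k * A (axis k 1) $ j)"
proof -
  have A0: "A 0 = 0" using assms(2)[of 0 0] by simp
  have "A (\<Sum>k\<in>I. \<xi> $ k *s axis k 1) = (\<Sum>k\<in>I. \<xi> $ k *s A (axis k 1))" if "finite I" for I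
    using that by induction (auto simp: A0 assms)
  moreover have "(\<Sum>k\<in>UNIV. \<xi> $ k *s axis k 1) = \<xi>"
    by (simp add: basis_expansion)
  ultimately have "A \<xi> = (\<Sum>k\<in>UNIV. \<xi> $ k *s A (axis k 1))" by (metis finite_class.finite)
  then show ?thesis by simp
qed

section \<open>Total differential systems and the holomorphic Frobenius theorem\<close>

lemma geometric_steps_convergent:
  fixes x :: "nat \<Rightarrow> 'a::banach"
  assumes "\<And>n. norm (x (Suc n) - x n) \<le> c / 2 ^ n"
  obtains l where "x \<longlonglongrightarrow> l" "\<And>n. norm (l - x n) \<le> 2 * c / 2 ^ n"
proof -
  have le: "norm (x (n + k) - x n) \<le> 2 * c / 2 ^ n - 2 * c / 2 ^ (n + k)" for n k
  proof (induction k)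
    case (Suc k)
    have "norm (x (n + Suc k) - x n) \<le> norm (x (Suc (n + k)) - x (n + k)) + norm (x (n + k) - x n)"
      using norm_triangle_ineq[of "x (Suc (n + k)) - x (n + k)" "x (n + k) - x n"] by simp
    also have "\<dots> \<le> c / 2 ^ (n + k) + (2 * c / 2 ^ n - 2 * c / 2 ^ (n + k))"
      using assms[of "n + k"] Suc by linarith
    finally show ?case by (simp add: field_simps)
  qed simp
  have "0 \<le> c" using assms[of 0] norm_ge_zero[of "x 1 - x 0"] by (simp del: norm_ge_zero)
  have le': "norm (x m - x n) \<le> 2 * c / 2 ^ n" if "m \<ge> n" for m n
  proof -
    have m: "n + (m - n) = m" using that by simp
    have "0 \<le> 2 * c / 2 ^ m" using \<open>0 \<le> c\<close> by simp
    with le[of n "m - n", unfolded m] show ?thesis by linarith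
  qed
  have "(\<lambda>n. 2 * c * (1/2) ^ n) \<longlonglongrightarrow> 2 * c * 0" 
    by (intro tendsto_intros LIMSEQ_power_zero) simp
  then have lim: "(\<lambda>n. 2 * c / 2 ^ n) \<longlonglongrightarrow> 0" by (simp add: power_divide)
  have "Cauchy x"
  proof (rule CauchyI')
    fix e :: real assume "e > 0"
    then obtain N where N: "\<And>n. n \<ge> N \<Longrightarrow> 2 * c / 2 ^ n < e"
      using order_tendstoD(2)[OF lim, of e] unfolding eventually_sequentially by blast
    have "dist (x m) (x n) < e" if "m \<ge> N" "n > m" for m n
      using N[OF that(1)] le'[OF less_imp_le[OF that(2)]] by (simp add: dist_norm norm_minus_commute)
    then show "\<exists>M. \<forall>m\<ge>M. \<forall>n>m. dist (x m) (x n) < e" by blast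
  qed
  then obtain l where l: "x \<longlonglongrightarrow> l" using Cauchy_convergent convergent_def by blast
  have "norm (l - x n) \<le> 2 * c / 2 ^ n" for n
  proof (rule Lim_norm_ubound)
    show "(\<lambda>m. x m - x n) \<longlonglongrightarrow> l - x n" by (intro tendsto_intros l)
    show "\<forall>\<^sub>F m in sequentially. norm (x m - x n) \<le> 2 * c / 2 ^ n"
      using le' unfolding eventually_sequentially by blast
  qed simp
  with l show ?thesis using that by blast
qed

text \<open>The radii are nested: initial values range over radius \<open>R\<close>, the Picard
  integral adds at most \<open>R\<close>, and about a point within \<open>2 * R\<close> there is
  still a ball of radius \<open>2 * R\<close> inside \<open>4 * R\<close> for Cauchy estimates in
  \<open>z\<close>. The assumption \<open>small\<close> makes the Picard operator contract by 1/2;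
  \<open>CARD('m)\<close> pays for passing from components to the norm. The assumption
  \<open>integrable\<close> is the Frobenius condition: the second derivatives that the system
  prescribes are symmetric.\<close>

locale pfaffian =
  fixes P :: "complex ^ 'n \<Rightarrow> complex ^ 'm \<Rightarrow> complex ^ 'n \<Rightarrow> complex ^ 'm"
    and p :: "complex ^ 'n" and z0 :: "complex ^ 'm" and r R M :: real
  assumes r: "0 < r" and R: "0 < R"
    and hol: "cpair.cdiff (ball p r \<times> ball z0 (4 * R)) (\<lambda>(q, z). P q z \<xi> $ j)"
    and P_add: "q \<in> ball p r \<Longrightarrow> z \<in> ball z0 (4 * R) \<Longrightarrow> P q z (\<xi> + \<zeta>) = P q z \<xi> + P q z \<zeta>"
    and P_scale: "q \<in> ball p r \<Longrightarrow> z \<in> ball z0 (4 * R) \<Longrightarrow> P q z (c *s \<xi>) = c *s P q z \<xi>"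
    and bound: "q \<in> ball p r \<Longrightarrow> z \<in> ball z0 (4 * R) \<Longrightarrow> norm (P q z \<xi>) \<le> M * norm \<xi>"
    and small: "real CARD('m) * M * r \<le> R / 2" and M: "0 \<le> M"
    and integrable: "q \<in> ball p r \<Longrightarrow> z \<in> ball z0 (4 * R) \<Longrightarrow>
      FD (\<lambda>(q, z). P q z \<zeta> $ j) (q, z) (\<xi>, P q z \<xi>) = FD (\<lambda>(q, z). P q z \<xi> $ j) (q, z) (\<zeta>, P q z \<zeta>)"
begin

abbreviation "B1 \<equiv> ball z0 R"
abbreviation "B2 \<equiv> ball p r"
definition "ray q s = p + s *\<^sub>R (q - p)"
definition lip :: real where "lip = real CARD('m) * M / R"

lemma Lr: "lip * r \<le> 1/2"
  using small R by (simp add: lip_def field_simps)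

lemma Mr: "M * r \<le> R"
proof -
  have "1 * (M * r) \<le> real CARD('m) * (M * r)"
    using M r by (intro mult_right_mono) (auto simp: Suc_leI)
  then show ?thesis using small R by (simp add: mult.assoc)
qed

lemma ray_in: "q \<in> B2 \<Longrightarrow> s \<in> {0..1} \<Longrightarrow> ray q s \<in> B2"
proof -
  assume "q \<in> B2" "s \<in> {0..1}"
  then have "s * norm (q - p) \<le> 1 * norm (q - p)" "norm (q - p) < r"
    using mult_right_mono[of s 1 "norm (q - p)"] by (auto simp: dist_norm norm_minus_commute)
  then show ?thesis using \<open>s \<in> {0..1}\<close> by (simp add: ray_def dist_norm)
qed

lemma cball_in: "z \<in> cball z0 (2 * R) \<Longrightarrow> z \<in> ball z0 (4 * R)"
  using R by auto

text \<open>Holomorphy of \<open>P\<close> is assumed for a fixed direction, whereas the Picard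
  integrand has the moving direction \<open>q - p\<close>. Linearity reduces it to finitely many
  fixed directions.\<close>

lemma P_expand: "q \<in> B2 \<Longrightarrow> z \<in> ball z0 (4 * R) \<Longrightarrow> P q z \<xi> $ j = (\<Sum>k\<in>UNIV. \<xi> $ k * P q z (axis k 1) $ j)"
  by (rule component_expansion) (auto simp: P_add P_scale)

lemma P_zero: "q \<in> B2 \<Longrightarrow> z \<in> ball z0 (4 * R) \<Longrightarrow> P q z 0 = 0"
  using P_scale[of q z 0 0] by simp

lemma P_has_derivative:
  "q \<in> B2 \<Longrightarrow> z \<in> ball z0 (4 * R) \<Longrightarrow>
    ((\<lambda>(q, z). P q z \<xi> $ j) has_derivative FD (\<lambda>(q, z). P q z \<xi> $ j) (q, z)) (at (q, z))"
  by (rule cpair.cdiffD(1)[OF hol]) auto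

lemma P_partial:
  assumes "q \<in> B2" "z \<in> ball z0 (4 * R)"
  shows "((\<lambda>z. P q z \<xi> $ j) has_derivative (\<lambda>\<delta>. FD (\<lambda>(q, z). P q z \<xi> $ j) (q, z) (0, \<delta>))) (at z)"
proof -
  have "((\<lambda>z. (q, z)) has_derivative (\<lambda>\<delta>. (0, \<delta>))) (at z)"
    by (auto intro!: derivative_eq_intros)
  from has_derivative_compose[OF this P_has_derivative[OF assms]] show ?thesis by simp
qed

text \<open>Cauchy estimate in \<open>z\<close> on a ball of radius \<open>2 * R\<close>: the bound
  \<open>M\<close> on \<open>P\<close> becomes a bound \<open>2 * M / (2 * R)\<close> on its
  derivative, hence the constant \<open>lip\<close>.\<close>

lemma P_partial_bound:
  assumes q: "q \<in> B2" and z: "z \<in> cball z0 (2 * R)"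
  shows "cmod (FD (\<lambda>(q, z). P q z \<xi> $ j) (q, z) (0, \<delta>)) \<le> M / R * norm \<xi> * norm \<delta>"
proof -
  have sub: "ball z (2 * R) \<subseteq> ball z0 (4 * R)"
  proof
    fix y assume "y \<in> ball z (2 * R)"
    then show "y \<in> ball z0 (4 * R)" using z dist_triangle[of z0 y z] by auto
  qed
  have "cmod (FD (\<lambda>z. P q z \<xi> $ j) z \<delta>) \<le> 2 * (M * norm \<xi>) / (2 * R) * norm \<delta>"
  proof (rule cvec.Cauchy_estimate)
    show "cvec.cdiff (ball z (2 * R)) (\<lambda>z. P q z \<xi> $ j)"
    proof (rule cvec.cdiffI[OF P_partial[OF q]])
      show "y \<in> ball z0 (4 * R)" if "y \<in> ball z (2 * R)" for y using that sub by blast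
      fix y c \<zeta> assume y: "y \<in> ball z (2 * R)"
      have "FD (\<lambda>(q, z). P q z \<xi> $ j) (q, y) (pair_scale c (0, \<zeta>)) = c * FD (\<lambda>(q, z). P q z \<xi> $ j) (q, y) (0, \<zeta>)"
        by (rule cpair.cdiffD(2)[OF hol]) (use q y sub in auto)
      then show "FD (\<lambda>(q, z). P q z \<xi> $ j) (q, y) (0, c *s \<zeta>) = c * FD (\<lambda>(q, z). P q z \<xi> $ j) (q, y) (0, \<zeta>)"
        by (simp add: pair_scale_def)
    qed
    show "cmod (P q y \<xi> $ j) \<le> M * norm \<xi>" if "y \<in> ball z (2 * R)" for y
      using order_trans[OF Finite_Cartesian_Product.norm_nth_le bound[OF q, of y \<xi>]] that sub by blast
    show "0 < 2 * R" using R by simp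
  qed
  then show ?thesis
    using FD_eqI[OF P_partial[OF q cball_in[OF z], of \<xi> j]] by simp
qed

lemma P_Lipschitz:
  assumes q: "q \<in> B2" and z: "z \<in> cball z0 (2 * R)" "z' \<in> cball z0 (2 * R)"
  shows "norm (P q z \<xi> - P q z' \<xi>) \<le> lip * norm \<xi> * norm (z - z')"
proof -
  have "cmod (P q z \<xi> $ j - P q z' \<xi> $ j) \<le> M / R * norm \<xi> * norm (z - z')" for j
  proof (rule differentiable_bound[where f="\<lambda>z. P q z \<xi> $ j" and S="cball z0 (2 * R)"])
    show "((\<lambda>z. P q z \<xi> $ j) has_derivative (\<lambda>\<delta>. FD (\<lambda>(q, z). P q z \<xi> $ j) (q, y) (0, \<delta>))) (at y within cball z0 (2 * R))"
      if "y \<in> cball z0 (2 * R)" for y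
      by (rule has_derivative_at_withinI, rule P_partial[OF q cball_in[OF that]])
    show "onorm (\<lambda>\<delta>. FD (\<lambda>(q, z). P q z \<xi> $ j) (q, y) (0, \<delta>)) \<le> M / R * norm \<xi>"
      if "y \<in> cball z0 (2 * R)" for y
      by (rule onorm_bound) (use P_partial_bound[OF q that] M R in auto)
  qed (use z in auto)
  then have "norm (P q z \<xi> - P q z' \<xi>) \<le> real CARD('m) * (M / R * norm \<xi> * norm (z - z'))"
    by (intro norm_le_card_mult) simp
  then show ?thesis by (simp add: lip_def mult_ac)
qed

text \<open>Along the ray from \<open>p\<close> to \<open>q\<close> the total differential system is
  an ordinary differential equation, and this is its integral equation. The limit therefore
  satisfies the system a priori only in the radial direction.\<close>

primrec Zs :: "nat \<Rightarrow> complex ^ 'm \<Rightarrow> complex ^ 'n \<Rightarrow> complex ^ 'm" where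
  "Zs 0 t q = t"
| "Zs (Suc n) t q = t + integral {0..1} (\<lambda>s. P (ray q s) (Zs n t (ray q s)) (q - p))"

abbreviation "regular Z \<equiv> (\<forall>j. cpair.cdiff (B1 \<times> B2) (\<lambda>(t, q). Z t q $ j)) \<and> (\<forall>t\<in>B1. \<forall>q\<in>B2. Z t q \<in> cball z0 (2 * R))"

lemma regular_continuous:
  assumes "regular Z"
  shows "continuous_on (B1 \<times> B2) (\<lambda>(t, q). Z t q)"
proof -
  have "continuous_on (B1 \<times> B2) (\<lambda>x. \<chi> j. (case x of (t, q) \<Rightarrow> Z t q $ j))"
    by (intro continuous_intros cpair.cdiff_continuous_on) (use assms in auto)
  moreover have "(\<lambda>x. \<chi> j. (case x of (t, q) \<Rightarrow> Z t q $ j)) = (\<lambda>(t, q). Z t q)"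
    by (auto simp: vec_eq_iff)
  ultimately show ?thesis by (simp only:)
qed

lemma continuous_on_ray: "continuous_on A (\<lambda>x. ray (f x) (g x))" if "continuous_on A f" "continuous_on A g"
  unfolding ray_def by (intro continuous_intros that)

lemma integrand_continuous:
  assumes Z: "regular Z"
  shows "continuous_on ((B1 \<times> B2) \<times> {0..1}) (\<lambda>((t, q), s). P (ray q s) (Z t (ray q s)) (q - p) $ j)"
proof -
  have Zc: "continuous_on ((B1 \<times> B2) \<times> {0..1}) (\<lambda>x. Z (fst (fst x)) (ray (snd (fst x)) (snd x)))"
  proof -
    have "continuous_on ((B1 \<times> B2) \<times> {0..1}) (\<lambda>x. (\<lambda>(t, q). Z t q) (fst (fst x), ray (snd (fst x)) (snd x)))"
      by (rule continuous_on_compose2[OF regular_continuous[OF Z]])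
        (use ray_in in \<open>auto intro!: continuous_intros continuous_on_ray\<close>)
    then show ?thesis by simp
  qed
  have "continuous_on ((B1 \<times> B2) \<times> {0..1}) (\<lambda>x. (\<lambda>(q, z). P q z (axis k 1) $ j) (ray (snd (fst x)) (snd x), Z (fst (fst x)) (ray (snd (fst x)) (snd x))))" for k
    by (rule continuous_on_compose2[OF cpair.cdiff_continuous_on[OF hol]])
      (use ray_in Z cball_in in \<open>auto intro!: continuous_intros continuous_on_ray Zc\<close>)
  then have "continuous_on ((B1 \<times> B2) \<times> {0..1}) (\<lambda>x. \<Sum>k\<in>UNIV. (snd (fst x) - p) $ k *
      P (ray (snd (fst x)) (snd x)) (Z (fst (fst x)) (ray (snd (fst x)) (snd x))) (axis k 1) $ j)"
    by (intro continuous_on_sum continuous_on_mult) (simp_all add: continuous_intros)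
  then show ?thesis
  proof (rule continuous_on_eq)
    fix x assume x: "x \<in> (B1 \<times> B2) \<times> {0..1::real}"
    then have "ray (snd (fst x)) (snd x) \<in> B2" "Z (fst (fst x)) (ray (snd (fst x)) (snd x)) \<in> ball z0 (4 * R)"
      using ray_in[of "snd (fst x)" "snd x"] cball_in Z by auto
    from P_expand[OF this, of "snd (fst x) - p" j]
    show "(\<Sum>k\<in>UNIV. (snd (fst x) - p) $ k *
        P (ray (snd (fst x)) (snd x)) (Z (fst (fst x)) (ray (snd (fst x)) (snd x))) (axis k 1) $ j)
      = (\<lambda>((t, q), s). P (ray q s) (Z t (ray q s)) (q - p) $ j) x"
      by (simp add: case_prod_beta')
  qed
qed

lemma integrand_cdiff:
  assumes Z: "regular Z" and s: "s \<in> {0..1}"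
  shows "cpair.cdiff (B1 \<times> B2) (\<lambda>(t, q). P (ray q s) (Z t (ray q s)) (q - p) $ j)"
proof -
  have Zr: "cpair.cdiff (B1 \<times> B2) (\<lambda>x. Z (fst x) (ray (snd x) s) $ j)" for j
  proof -
    have "cpair.cdiff (B1 \<times> B2) (\<lambda>x. (\<lambda>(t, q). Z t q $ j) (fst x, ray (snd x) s))"
    proof (rule cdiff_compose[OF cpair.complex_structure_axioms cpair.complex_structure_axioms, where T="B1 \<times> B2"])
      show "((\<lambda>x. (fst x, ray (snd x) s)) has_derivative (\<lambda>\<xi>. (fst \<xi>, s *\<^sub>R snd \<xi>))) (at x)" for x
        unfolding ray_def by (auto intro!: derivative_eq_intros)
    qed (use Z s ray_in in \<open>auto simp: pair_scale_def vec_eq_iff\<close>)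
    then show ?thesis by simp
  qed
  have P: "cpair.cdiff (B1 \<times> B2) (\<lambda>x. P (ray (snd x) s) (Z (fst x) (ray (snd x) s)) \<xi> $ j)" for \<xi>
  proof -
    have "cpair.cdiff (B1 \<times> B2) (\<lambda>x. (\<lambda>(q, z). P q z \<xi> $ j) (ray (snd x) s, Z (fst x) (ray (snd x) s)))"
    proof (rule cdiff_compose[OF cpair.complex_structure_axioms cpair.complex_structure_axioms, OF hol])
      fix x :: "(complex ^ 'm) \<times> (complex ^ 'n)" assume x: "x \<in> B1 \<times> B2"
      define g' where "g' = (\<lambda>\<xi>. (s *\<^sub>R snd \<xi>, \<chi> j. FD (\<lambda>x. Z (fst x) (ray (snd x) s) $ j) x \<xi>))"
      have "((\<lambda>x. Z (fst x) (ray (snd x) s)) has_derivative (\<lambda>\<xi>. \<chi> j. FD (\<lambda>x. Z (fst x) (ray (snd x) s) $ j) x \<xi>)) (at x)"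
        by (rule has_derivative_vec_componentwise) (simp add: cpair.cdiffD(1)[OF Zr x])
      then show "((\<lambda>x. (ray (snd x) s, Z (fst x) (ray (snd x) s))) has_derivative
          (\<lambda>\<xi>. (s *\<^sub>R snd \<xi>, \<chi> j. FD (\<lambda>x. Z (fst x) (ray (snd x) s) $ j) x \<xi>))) (at x)"
        unfolding ray_def by (auto intro!: derivative_eq_intros)
      show "(s *\<^sub>R snd (pair_scale c \<zeta>), \<chi> j. FD (\<lambda>x. Z (fst x) (ray (snd x) s) $ j) x (pair_scale c \<zeta>))
        = pair_scale c (s *\<^sub>R snd \<zeta>, \<chi> j. FD (\<lambda>x. Z (fst x) (ray (snd x) s) $ j) x \<zeta>)" for c \<zeta>
        by (simp add: cpair.cdiffD(2)[OF Zr x]) (simp add: pair_scale_def vec_eq_iff)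
    qed (use Z s ray_in cball_in in auto)
    then show ?thesis by simp
  qed
  have "cpair.cdiff (B1 \<times> B2) (\<lambda>x. \<Sum>k\<in>UNIV. (snd x $ k - p $ k) * P (ray (snd x) s) (Z (fst x) (ray (snd x) s)) (axis k 1) $ j)"
    by (intro cpair.cdiff_sum cpair.cdiff_mult cpair.cdiff_diff cpair.cdiff_const cpair_cdiff_snd_nth P)
  then show ?thesis
  proof (rule cpair.cdiff_cong)
    fix x assume x: "x \<in> B1 \<times> B2"
    then have "ray (snd x) s \<in> B2" "Z (fst x) (ray (snd x) s) \<in> ball z0 (4 * R)"
      using ray_in[OF _ s] cball_in Z by auto
    from P_expand[OF this, of "snd x - p" j]
    show "(\<Sum>k\<in>UNIV. (snd x $ k - p $ k) * P (ray (snd x) s) (Z (fst x) (ray (snd x) s)) (axis k 1) $ j)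
        = (\<lambda>(t, q). P (ray q s) (Z t (ray q s)) (q - p) $ j) x"
      by (simp add: case_prod_beta')
  qed (simp add: open_Times)
qed

lemma integrand_ray_continuous:
  assumes Z: "regular Z" and t: "t \<in> B1" and q: "q \<in> B2"
  shows "continuous_on {0..1} (\<lambda>s. P (ray q s) (Z t (ray q s)) (q - p))"
proof -
  have "continuous_on {0..1} (\<lambda>s. (\<lambda>((t, q), s). P (ray q s) (Z t (ray q s)) (q - p) $ j) ((t, q), s))" for j
    by (rule continuous_on_compose2[OF integrand_continuous[OF Z]]) (use t q in \<open>auto intro!: continuous_intros\<close>)
  then have "continuous_on {0..1} (\<lambda>s. \<chi> j. P (ray q s) (Z t (ray q s)) (q - p) $ j)"
    by (intro continuous_on_vec_lambda) simp
  then show ?thesis by simp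
qed

lemma dist_p: "q \<in> B2 \<Longrightarrow> norm (q - p) \<le> r"
  by (auto simp: dist_norm norm_minus_commute)

lemma regular_Zs: "regular (Zs n)"
proof (induction n)
  case 0
  have "cpair.cdiff (B1 \<times> B2) (\<lambda>(t, q). t $ j)" for j
    using cpair_cdiff_fst_nth[of "B1 \<times> B2" j] by (simp add: case_prod_beta')
  then show ?case using R by auto
next
  case (Suc n)
  have "cpair.cdiff (B1 \<times> B2) (\<lambda>(t, q). Zs (Suc n) t q $ j)" for j
  proof (rule cpair.cdiff_cong)
    show "cpair.cdiff (B1 \<times> B2) (\<lambda>x. fst x $ j + integral {0..1} (\<lambda>s. (\<lambda>(t, q). P (ray q s) (Zs n t (ray q s)) (q - p) $ j) x))"
      by (intro cpair.cdiff_add cpair_cdiff_fst_nth cpair.cdiff_integral)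
        (use integrand_continuous[OF Suc, of j] integrand_cdiff[OF Suc, of _ j] in
          \<open>auto simp: open_Times case_prod_beta'\<close>)
    fix x assume "x \<in> B1 \<times> B2"
    then obtain t q where x: "x = (t, q)" and t: "t \<in> B1" and q: "q \<in> B2" by auto
    have "integral {0..1} ((\<lambda>v. v $ j) \<circ> (\<lambda>s. P (ray q s) (Zs n t (ray q s)) (q - p)))
      = integral {0..1} (\<lambda>s. P (ray q s) (Zs n t (ray q s)) (q - p)) $ j"
      by (intro integral_linear integrable_continuous_real integrand_ray_continuous[OF Suc t q] bounded_linear_vec_nth)
    then show "fst x $ j + integral {0..1} (\<lambda>s. (\<lambda>(t, q). P (ray q s) (Zs n t (ray q s)) (q - p) $ j) x)
        = (\<lambda>(t, q). Zs (Suc n) t q $ j) x"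
      by (simp add: x o_def)
  qed (simp add: open_Times)
  moreover have "Zs (Suc n) t q \<in> cball z0 (2 * R)" if t: "t \<in> B1" and q: "q \<in> B2" for t q
  proof -
    have "norm (integral {0..1} (\<lambda>s. P (ray q s) (Zs n t (ray q s)) (q - p))) \<le> (M * r) * (1 - 0)"
    proof (rule integral_bound[OF _ integrand_ray_continuous[OF Suc t q]])
      show "norm (P (ray q s) (Zs n t (ray q s)) (q - p)) \<le> M * r" if s: "s \<in> {0..1}" for s
        using bound[OF ray_in[OF q s] cball_in, of "Zs n t (ray q s)" "q - p"] Suc t ray_in[OF q s]
          mult_left_mono[OF dist_p[OF q] M] order_trans by blast
    qed simp
    then have "dist z0 (Zs (Suc n) t q) \<le> dist z0 t + R"
      using Mr dist_triangle[of z0 "Zs (Suc n) t q" t] by (simp add: dist_norm)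
    then show ?thesis using t by simp
  qed
  ultimately show ?case by blast
qed

text \<open>The contraction estimate: along a ray the direction has norm at most \<open>r\<close>,
  and \<open>lip * r \<le> 1/2\<close>.\<close>

lemma integral_difference_bound:
  assumes "regular Z" "regular Z'" and t: "t \<in> B1" and q: "q \<in> B2"
    and d: "\<And>q. q \<in> B2 \<Longrightarrow> norm (Z t q - Z' t q) \<le> d"
  shows "norm (integral {0..1} (\<lambda>s. P (ray q s) (Z t (ray q s)) (q - p))
    - integral {0..1} (\<lambda>s. P (ray q s) (Z' t (ray q s)) (q - p))) \<le> d / 2"
proof -
  have "0 \<le> d" using d[OF q] norm_ge_zero order_trans by blast
  have "norm (integral {0..1} (\<lambda>s. P (ray q s) (Z t (ray q s)) (q - p) - P (ray q s) (Z' t (ray q s)) (q - p))) \<le> (lip * r * d) * (1 - 0)"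
  proof (rule integral_bound)
    show "norm (P (ray q s) (Z t (ray q s)) (q - p) - P (ray q s) (Z' t (ray q s)) (q - p)) \<le> lip * r * d" if s: "s \<in> {0..1}" for s
    proof (rule order_trans[OF P_Lipschitz[OF ray_in[OF q s]]])
      show "lip * norm (q - p) * norm (Z t (ray q s) - Z' t (ray q s)) \<le> lip * r * d"
        by (intro mult_mono mult_left_mono d ray_in[OF q s] dist_p q) (use M R r in \<open>auto simp: lip_def\<close>)
    qed (use assms t ray_in[OF q s] in auto)
  qed (use integrand_ray_continuous assms in \<open>auto intro!: continuous_intros\<close>)
  also have "\<dots> \<le> 1/2 * d" using mult_right_mono[OF Lr \<open>0 \<le> d\<close>] by simp
  finally show ?thesis
    by (subst (asm) Henstock_Kurzweil_Integration.integral_diff)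
      (use integrand_ray_continuous assms in \<open>auto intro!: integrable_continuous_real\<close>)
qed

lemma Zs_step: "t \<in> B1 \<Longrightarrow> q \<in> B2 \<Longrightarrow> norm (Zs (Suc n) t q - Zs n t q) \<le> (4 * R) / 2 ^ n"
proof (induction n arbitrary: q)
  case 0
  have "Zs (Suc 0) t q \<in> cball z0 (2 * R)" "Zs 0 t q \<in> cball z0 (2 * R)"
    using regular_Zs 0 by blast+
  then have "dist (Zs (Suc 0) t q) (Zs 0 t q) \<le> 2 * R + 2 * R"
    by (intro order_trans[OF dist_triangle3[of _ _ z0]]) auto
  then show ?case by (simp add: dist_norm)
next
  case (Suc n)
  have "norm (Zs (Suc (Suc n)) t q - Zs (Suc n) t q) \<le> (4 * R / 2 ^ n) / 2"
    using integral_difference_bound[OF regular_Zs regular_Zs Suc.prems Suc.IH[OF Suc.prems(1)]] by simp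
  then show ?case by simp
qed

definition Z :: "complex ^ 'm \<Rightarrow> complex ^ 'n \<Rightarrow> complex ^ 'm" where
  "Z t q = lim (\<lambda>n. Zs n t q)"

lemma Zs_limit:
  assumes "t \<in> B1" "q \<in> B2"
  shows "(\<lambda>n. Zs n t q) \<longlonglongrightarrow> Z t q" "norm (Z t q - Zs n t q) \<le> 8 * R / 2 ^ n"
proof -
  obtain l where l: "(\<lambda>n. Zs n t q) \<longlonglongrightarrow> l" "\<And>n. norm (l - Zs n t q) \<le> 2 * (4 * R) / 2 ^ n"
    using geometric_steps_convergent[OF Zs_step[OF assms]] by blast
  then have "Z t q = l" unfolding Z_def by (simp add: limI)
  with l show "(\<lambda>n. Zs n t q) \<longlonglongrightarrow> Z t q" "norm (Z t q - Zs n t q) \<le> 8 * R / 2 ^ n" by auto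
qed

lemma error_tendsto: "(\<lambda>n. c / 2 ^ n) \<longlonglongrightarrow> (0::real)"
proof -
  have "(\<lambda>n. c * (1/2) ^ n) \<longlonglongrightarrow> c * 0" 
    by (intro tendsto_intros LIMSEQ_power_zero) simp
  then show ?thesis by (simp add: power_divide)
qed

lemma regular_Z: "regular Z"
proof (intro conjI allI ballI)
  show "Z t q \<in> cball z0 (2 * R)" if "t \<in> B1" "q \<in> B2" for t q
    by (rule closed_sequentially[OF closed_cball _ Zs_limit(1)[OF that]])
      (use regular_Zs that in auto)
  fix j
  have ul: "uniform_limit (B1 \<times> B2) (\<lambda>n (t, q). Zs n t q $ j) (\<lambda>(t, q). Z t q $ j) sequentially"
  proof (rule uniform_limitI)
    fix e :: real assume "e > 0"
    have "\<forall>\<^sub>F n in sequentially. 8 * R / 2 ^ n < e"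
      using order_tendstoD(2)[OF error_tendsto \<open>e > 0\<close>] .
    then show "\<forall>\<^sub>F n in sequentially. \<forall>x\<in>B1 \<times> B2. dist (case x of (t, q) \<Rightarrow> Zs n t q $ j) (case x of (t, q) \<Rightarrow> Z t q $ j) < e"
    proof eventually_elim
      case (elim n)
      have "dist (Zs n t q $ j) (Z t q $ j) < e" if "t \<in> B1" "q \<in> B2" for t q
        using Zs_limit(2)[OF that, of n] Finite_Cartesian_Product.norm_nth_le[of "Z t q - Zs n t q" j] elim
        by (simp add: dist_norm norm_minus_commute)
      then show ?case by auto
    qed
  qed
  show "cpair.cdiff (B1 \<times> B2) (\<lambda>(t, q). Z t q $ j)"
  proof (rule cpair.cdiff_uniform_limit(1))
    fix x :: "(complex ^ 'm) \<times> (complex ^ 'n)" assume "x \<in> B1 \<times> B2"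
    then obtain e where e: "0 < e" "ball x e \<subseteq> B1 \<times> B2"
      using openE[of "B1 \<times> B2" x] by (auto simp: open_Times)
    show "\<exists>r>0. (\<forall>n. cpair.cdiff (ball x r) (\<lambda>(t, q). Zs n t q $ j)) \<and>
        uniform_limit (ball x r) (\<lambda>n (t, q). Zs n t q $ j) (\<lambda>(t, q). Z t q $ j) sequentially"
      using e uniform_limit_on_subset[OF ul e(2)] cpair.cdiff_subset[OF _ e(2)] regular_Zs by blast
  qed
qed

lemma Z_fixed_point:
  assumes "t \<in> B1" "q \<in> B2"
  shows "Z t q = t + integral {0..1} (\<lambda>s. P (ray q s) (Z t (ray q s)) (q - p))"
proof -
  let ?I = "\<lambda>Z. t + integral {0..1} (\<lambda>s. P (ray q s) (Z t (ray q s)) (q - p))"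
  have le: "norm (Zs (Suc n) t q - ?I Z) \<le> 8 * R / 2 ^ n * (1 / 2)" for n
    using integral_difference_bound[OF regular_Z regular_Zs assms, of n "8 * R / 2 ^ n"] Zs_limit(2)[OF assms(1)]
    by (simp add: norm_minus_commute)
  have "(\<lambda>n. Zs (Suc n) t q - ?I Z) \<longlonglongrightarrow> 0"
    by (rule Lim_null_comparison[OF always_eventually tendsto_mult_left_zero[OF error_tendsto[of "8 * R"], of "1 / 2"]])
      (use le in blast)
  then have "(\<lambda>n. Zs (Suc n) t q) \<longlonglongrightarrow> ?I Z"
    by (rule LIM_zero_cancel)
  then show ?thesis
    using LIMSEQ_unique LIMSEQ_Suc[OF Zs_limit(1)[OF assms]] by blast
qed

lemma Z_initial: "t \<in> B1 \<Longrightarrow> Z t p = t"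
proof -
  assume t: "t \<in> B1"
  have "integral {0..1} (\<lambda>s. P (ray p s) (Z t (ray p s)) (p - p)) = integral {0..1} (\<lambda>s::real. 0 :: complex ^ 'm)"
    by (rule Henstock_Kurzweil_Integration.integral_cong)
      (use regular_Z cball_in t r in \<open>auto simp: ray_def intro!: P_zero\<close>)
  then show ?thesis using Z_fixed_point[OF t, of p] r by simp
qed

end

lemma scaleR_eq_scalar_mult: "c *\<^sub>R v = complex_of_real c *s v" for v :: "complex ^ 'm"
  by (simp add: vec_eq_iff scaleR_conv_of_real[where 'a=complex])

context pfaffian
begin

context
  fixes t assumes t: "t \<in> B1"
begin

lemma Z_in: "q \<in> B2 \<Longrightarrow> Z t q \<in> cball z0 (2 * R)"
  using regular_Z t by blast

lemma Z_in': "q \<in> B2 \<Longrightarrow> Z t q \<in> ball z0 (4 * R)"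
  using Z_in cball_in by blast

text \<open>The fixed point equation at \<open>ray q \<sigma>\<close> integrates over a shorter ray.
  Rescaling turns it into an integral over the initial segment of the ray to \<open>q\<close>, which
  can be differentiated in \<open>\<sigma>\<close>.\<close>

lemma Z_ray_derivative:
  assumes q: "q \<in> B2" and \<sigma>: "\<sigma> \<in> {0..1}"
  shows "((\<lambda>s. Z t (ray q s)) has_vector_derivative P (ray q \<sigma>) (Z t (ray q \<sigma>)) (q - p)) (at \<sigma> within {0..1})"
proof -
  define G where "G = (\<lambda>s. P (ray q s) (Z t (ray q s)) (q - p))"
  define H where "H = (\<lambda>u. integral {0..u} G)"
  have G: "continuous_on {0..1} G"
    unfolding G_def by (rule integrand_ray_continuous[OF regular_Z t q])
  have H: "(H has_vector_derivative G s) (at s within {0..1})" if "s \<in> {0..1}" for s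
    unfolding H_def by (rule integral_has_vector_derivative[OF G that])
  have eq: "Z t (ray q \<sigma>) = t + H \<sigma>" if \<sigma>: "\<sigma> \<in> {0..1}" for \<sigma>
  proof -
    have rr: "ray (ray q \<sigma>) s = ray q (s * \<sigma>)" for s
      by (simp add: ray_def)
    have in01: "s * \<sigma> \<in> {0..1}" if "s \<in> {0..1}" for s
      using that \<sigma> mult_mono[of s 1 \<sigma> 1] by auto
    have int: "P (ray (ray q \<sigma>) s) (Z t (ray (ray q \<sigma>) s)) (ray q \<sigma> - p) = \<sigma> *\<^sub>R G (s * \<sigma>)"
      if "s \<in> {0..1}" for s
      using P_scale[OF ray_in[OF q in01[OF that]] Z_in'[OF ray_in[OF q in01[OF that]]], of "of_real \<sigma>" "q - p"]
      by (simp add: rr G_def) (simp add: ray_def scaleR_eq_scalar_mult)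
    \<comment> \<open>The substitution is made by the chain rule for the primitive \<open>H\<close>,
      which includes the case \<open>\<sigma> = 0\<close>.\<close>
    have "((\<lambda>s. \<sigma> *\<^sub>R G (s * \<sigma>)) has_integral (H \<circ> (\<lambda>s. s * \<sigma>)) 1 - (H \<circ> (\<lambda>s. s * \<sigma>)) 0) {0..1}"
    proof (rule fundamental_theorem_of_calculus)
      fix s :: real assume s: "s \<in> {0..1}"
      have "((\<lambda>s. s * \<sigma>) has_vector_derivative \<sigma>) (at s within {0..1})"
        by (auto intro!: derivative_eq_intros)
      moreover have "(H has_vector_derivative G (s * \<sigma>)) (at (s * \<sigma>) within (\<lambda>s. s * \<sigma>) ` {0..1})"
        by (rule has_vector_derivative_within_subset[OF H[OF in01[OF s]]]) (use in01 in auto)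
      ultimately show "(H \<circ> (\<lambda>s. s * \<sigma>) has_vector_derivative \<sigma> *\<^sub>R G (s * \<sigma>)) (at s within {0..1})"
        by (rule vector_diff_chain_within)
    qed simp
    from integral_unique[OF this]
    have "integral {0..1} (\<lambda>s. \<sigma> *\<^sub>R G (s * \<sigma>)) = H \<sigma>"
      using integral_refl[of 0 G] unfolding H_def o_def by (simp only: mult_1 mult_zero_left cbox_interval diff_zero)
    moreover have "integral {0..1} (\<lambda>s. P (ray (ray q \<sigma>) s) (Z t (ray (ray q \<sigma>) s)) (ray q \<sigma> - p))
        = integral {0..1} (\<lambda>s. \<sigma> *\<^sub>R G (s * \<sigma>))"
      by (rule Henstock_Kurzweil_Integration.integral_cong) (use int in auto)
    ultimately show ?thesis
      using Z_fixed_point[OF t ray_in[OF q \<sigma>]] by simp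
  qed
  have "((\<lambda>s. t + H s) has_vector_derivative 0 + G \<sigma>) (at \<sigma> within {0..1})"
    by (intro derivative_intros H \<sigma>)
  then have "((\<lambda>s. Z t (ray q s)) has_vector_derivative 0 + G \<sigma>) (at \<sigma> within {0..1})"
    by (rule has_vector_derivative_transform[rotated 2]) (use eq \<sigma> in auto)
  then show ?thesis by (simp add: G_def)
qed

lemma Z_cdiff: "cvec.cdiff B2 (\<lambda>q. Z t q $ j)"
proof -
  have "cvec.cdiff B2 (\<lambda>q. (\<lambda>(t, q). Z t q $ j) (t, q))"
  proof (rule cdiff_compose[OF cvec.complex_structure_axioms cpair.complex_structure_axioms])
    show "cpair.cdiff (B1 \<times> B2) (\<lambda>(t, q). Z t q $ j)" using regular_Z by blast
    show "((\<lambda>q. (t, q)) has_derivative (\<lambda>\<xi>. (0, \<xi>))) (at q)" for q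
      by (auto intro!: derivative_eq_intros)
  qed (use t in \<open>auto simp: pair_scale_def\<close>)
  then show ?thesis by simp
qed

definition DZ :: "complex ^ 'n \<Rightarrow> complex ^ 'n \<Rightarrow> complex ^ 'm" where
  "DZ q \<xi> = (\<chi> j. FD (\<lambda>q. Z t q $ j) q \<xi>)"

lemma Z_has_derivative: "q \<in> B2 \<Longrightarrow> (Z t has_derivative DZ q) (at q)"
  unfolding DZ_def by (rule has_derivative_vec_componentwise) (simp add: cvec.cdiffD(1)[OF Z_cdiff])

lemma DZ_scale: "q \<in> B2 \<Longrightarrow> DZ q (c *s \<xi>) = c *s DZ q \<xi>"
  by (simp add: DZ_def vec_eq_iff cvec.cdiffD(2)[OF Z_cdiff])

lemma DZ_add: "q \<in> B2 \<Longrightarrow> DZ q (\<xi> + \<zeta>) = DZ q \<xi> + DZ q \<zeta>"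
  by (simp add: linear_add[OF has_derivative_linear[OF Z_has_derivative]])

lemma P_along_Z_has_derivative:
  assumes "q \<in> B2"
  shows "((\<lambda>q. P q (Z t q) \<xi> $ j) has_derivative (\<lambda>\<eta>. FD (\<lambda>(q, z). P q z \<xi> $ j) (q, Z t q) (\<eta>, DZ q \<eta>))) (at q)"
proof -
  have "((\<lambda>q. (q, Z t q)) has_derivative (\<lambda>\<eta>. (\<eta>, DZ q \<eta>))) (at q)"
    by (intro has_derivative_Pair has_derivative_ident Z_has_derivative assms)
  from has_derivative_compose[OF this P_has_derivative[OF assms Z_in'[OF assms]]] show ?thesis by simp
qed

text \<open>The defect of the differential equation. It vanishes on radial vectors by construction,
  and the Frobenius condition propagates this to all directions.\<close>

definition W :: "complex ^ 'n \<Rightarrow> complex ^ 'n \<Rightarrow> complex ^ 'm" where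
  "W q \<xi> = DZ q \<xi> - P q (Z t q) \<xi>"

lemma W_cdiff: "cvec.cdiff B2 (\<lambda>q. W q \<xi> $ j)"
proof -
  have "cvec.cdiff B2 (\<lambda>q. P q (Z t q) \<xi> $ j)"
  proof (rule cvec.cdiffI[OF P_along_Z_has_derivative])
    fix q c \<eta> assume q: "q \<in> B2"
    have "FD (\<lambda>(q, z). P q z \<xi> $ j) (q, Z t q) (pair_scale c (\<eta>, DZ q \<eta>)) = c * FD (\<lambda>(q, z). P q z \<xi> $ j) (q, Z t q) (\<eta>, DZ q \<eta>)"
      by (rule cpair.cdiffD(2)[OF hol]) (use q Z_in' in auto)
    then show "FD (\<lambda>(q, z). P q z \<xi> $ j) (q, Z t q) (c *s \<eta>, DZ q (c *s \<eta>)) = c * FD (\<lambda>(q, z). P q z \<xi> $ j) (q, Z t q) (\<eta>, DZ q \<eta>)"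
      by (simp add: pair_scale_def DZ_scale[OF q])
  qed
  then have "cvec.cdiff B2 (\<lambda>q. FD (\<lambda>q. Z t q $ j) q \<xi> - P q (Z t q) \<xi> $ j)"
    by (intro cvec.cdiff_diff cvec.cdiff_FD Z_cdiff) auto
  then show ?thesis by (simp add: W_def DZ_def)
qed

lemma W_linear:
  assumes "q \<in> B2"
  shows "W q (\<xi> + \<zeta>) = W q \<xi> + W q \<zeta>" "W q (c *s \<xi>) = c *s W q \<xi>"
  using P_add[OF assms Z_in'[OF assms]] P_scale[OF assms Z_in'[OF assms]]
  by (simp_all add: W_def DZ_add[OF assms] DZ_scale[OF assms] vec_eq_iff algebra_simps)

lemma W_ray: assumes q: "q \<in> B2" shows "W q (q - p) = 0"
proof -
  have ray1: "ray q 1 = q" by (simp add: ray_def)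
  have "(ray q has_vector_derivative (q - p)) (at 1 within {0..1})"
    unfolding ray_def[abs_def] by (auto intro!: derivative_eq_intros)
  then have "(ray q has_derivative (\<lambda>h. h *\<^sub>R (q - p))) (at 1 within {0..1})"
    by (simp add: has_vector_derivative_def)
  from has_derivative_compose[OF this, of "Z t" "DZ q"] Z_has_derivative[OF q] ray1
  have "((\<lambda>s. Z t (ray q s)) has_derivative (\<lambda>h. DZ q (h *\<^sub>R (q - p)))) (at 1 within {0..1})"
    by simp
  then have 1: "((\<lambda>s. Z t (ray q s)) has_vector_derivative DZ q (q - p)) (at 1 within {0..1})"
    by (simp add: has_vector_derivative_def linear_cmul[OF has_derivative_linear[OF Z_has_derivative[OF q]]])
  have 2: "((\<lambda>s. Z t (ray q s)) has_vector_derivative P q (Z t q) (q - p)) (at 1 within {0..1})"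
    using Z_ray_derivative[OF q, of 1] ray1 by simp
  have "DZ q (q - p) = P q (Z t q) (q - p)"
    using vector_derivative_unique_within_closed_interval[of 0 1 1, OF _ _ 1[folded cbox_interval] 2[folded cbox_interval]] by simp
  then show ?thesis by (simp add: W_def)
qed

text \<open>In the antisymmetrized derivative of \<open>W\<close> the second derivatives of
  \<open>Z\<close> cancel by symmetry and the derivatives of \<open>P\<close> along the system
  cancel by \<open>integrable\<close>. What remains is linear in \<open>W\<close>.\<close>

lemma W_curl:
  assumes q: "q \<in> B2"
  shows "FD (\<lambda>q. W q \<xi> $ j) q \<eta> - FD (\<lambda>q. W q \<eta> $ j) q \<xi> =
    FD (\<lambda>(q, z). P q z \<eta> $ j) (q, Z t q) (0, W q \<xi>) - FD (\<lambda>(q, z). P q z \<xi> $ j) (q, Z t q) (0, W q \<eta>)"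
proof -
  have FDW: "FD (\<lambda>q. W q \<xi> $ j) q \<eta> = FD (\<lambda>q. FD (\<lambda>q. Z t q $ j) q \<xi>) q \<eta>
      - FD (\<lambda>(q, z). P q z \<xi> $ j) (q, Z t q) (\<eta>, DZ q \<eta>)" for \<xi> \<eta>
  proof -
    have "((\<lambda>q. FD (\<lambda>q. Z t q $ j) q \<xi> - P q (Z t q) \<xi> $ j) has_derivative
      (\<lambda>\<eta>. FD (\<lambda>q. FD (\<lambda>q. Z t q $ j) q \<xi>) q \<eta> - FD (\<lambda>(q, z). P q z \<xi> $ j) (q, Z t q) (\<eta>, DZ q \<eta>))) (at q)"
      by (intro has_derivative_diff P_along_Z_has_derivative q cvec.cdiffD(1)[OF cvec.cdiff_FD[OF Z_cdiff]]) auto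
    from FD_eqI[OF this] show ?thesis by (simp add: W_def DZ_def)
  qed
  have split: "FD (\<lambda>(q, z). P q z \<xi> $ j) (q, Z t q) (\<eta>, DZ q \<eta>) = 
      FD (\<lambda>(q, z). P q z \<xi> $ j) (q, Z t q) (\<eta>, P q (Z t q) \<eta>) + FD (\<lambda>(q, z). P q z \<xi> $ j) (q, Z t q) (0, W q \<eta>)" for \<xi> \<eta>
    using linear_add[OF has_derivative_linear[OF P_has_derivative[OF q Z_in'[OF q], of \<xi> j]],
        of "(\<eta>, P q (Z t q) \<eta>)" "(0, W q \<eta>)"]
    by (simp add: W_def)
  show ?thesis
    unfolding FDW split
    using cvec.FD_symmetric[OF Z_cdiff open_ball q, of j \<xi> \<eta>] integrable[OF q Z_in'[OF q], of \<xi> j \<eta>]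
    by simp
qed

text \<open>Differentiate the identity \<open>W q' (q' - p) = 0\<close> at \<open>q\<close>; the
  moving argument contributes \<open>W q \<xi>\<close>.\<close>

lemma W_radial:
  assumes q: "q \<in> B2"
  shows "FD (\<lambda>q'. W q' (q - p) $ j) q \<xi> = - W q \<xi> $ j"
proof -
  have split: "W q' (q' - p) = W q' (q - p) + W q' (q' - q)" if "q' \<in> B2" for q'
    using W_linear(1)[OF that, of "q - p" "q' - q"] by simp
  have 1: "((\<lambda>q'. W q' (q' - q) $ j) has_derivative (\<lambda>\<xi>. W q \<xi> $ j)) (at q)"
  proof -
    have "((\<lambda>q'. \<Sum>k\<in>UNIV. (q' - q) $ k * W q' (axis k 1) $ j) has_derivative
      (\<lambda>\<xi>. \<Sum>k\<in>UNIV. (q - q) $ k * FD (\<lambda>q'. W q' (axis k 1) $ j) q \<xi> + \<xi> $ k * W q (axis k 1) $ j)) (at q)"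
      by (intro has_derivative_sum has_derivative_mult cvec.cdiffD(1)[OF W_cdiff q] has_derivative_vec_nth)
        (auto intro!: derivative_eq_intros)
    moreover have expand: "(\<Sum>k\<in>UNIV. \<xi> $ k * W q' (axis k 1) $ j) = W q' \<xi> $ j" if "q' \<in> B2" for q' \<xi>
      using component_expansion[of "W q'" \<xi> j] W_linear[OF that] by simp
    ultimately have "((\<lambda>q'. \<Sum>k\<in>UNIV. (q' - q) $ k * W q' (axis k 1) $ j) has_derivative (\<lambda>\<xi>. W q \<xi> $ j)) (at q)"
      using q by simp
    then show ?thesis
      by (rule has_derivative_transform_within_open[OF _ open_ball q])
        (rule expand)
  qed
  have "((\<lambda>q'. W q' (q - p) $ j + W q' (q' - q) $ j) has_derivative (\<lambda>\<xi>. FD (\<lambda>q'. W q' (q - p) $ j) q \<xi> + W q \<xi> $ j)) (at q)"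
    by (intro has_derivative_add cvec.cdiffD(1)[OF W_cdiff q] 1)
  moreover have "((\<lambda>q'. W q' (q - p) $ j + W q' (q' - q) $ j) has_derivative (\<lambda>_. 0)) (at q)"
  proof (rule has_derivative_transform_within_open[OF has_derivative_const open_ball q])
    show "0 = W q' (q - p) $ j + W q' (q' - q) $ j" if "q' \<in> B2" for q'
      using split[OF that] W_ray[OF that] by (metis vector_add_component zero_index)
  qed
  ultimately have "(\<lambda>\<xi>. FD (\<lambda>q'. W q' (q - p) $ j) q \<xi> + W q \<xi> $ j) = (\<lambda>_. 0)"
    by (rule has_derivative_unique)
  from fun_cong[OF this, of \<xi>] show ?thesis by (simp add: eq_neg_iff_add_eq_0)
qed

text \<open>By \<open>W_curl\<close> and \<open>W_radial\<close>, the function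
  \<open>\<sigma> *\<^sub>R W (ray q \<sigma>) \<xi>\<close> satisfies a homogeneous linear
  differential equation in \<open>\<sigma>\<close> and starts at 0, so it vanishes by the Gronwall
  argument.\<close>

lemma W_zero:
  assumes q: "q \<in> B2"
  shows "W q \<xi> = 0"
proof -
  define k where "k = (\<lambda>\<sigma>. \<sigma> *\<^sub>R W (ray q \<sigma>) \<xi>)"
  define k' where "k' = (\<lambda>\<sigma>. \<chi> j. FD (\<lambda>(q', z). P q' z (\<sigma> *\<^sub>R (q - p)) $ j) (ray q \<sigma>, Z t (ray q \<sigma>)) (0, W (ray q \<sigma>) \<xi>))"
  have ray': "(ray q has_derivative (\<lambda>h. h *\<^sub>R (q - p))) (at \<sigma>)" for \<sigma>
    unfolding ray_def[abs_def] by (auto intro!: derivative_eq_intros)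
  have der: "(k has_derivative (\<lambda>h. h *\<^sub>R k' \<sigma>)) (at \<sigma> within {0..1})" if \<sigma>: "\<sigma> \<in> {0..1}" for \<sigma>
  proof (rule has_derivative_vec_componentwise)
    fix j
    let ?q = "ray q \<sigma>"
    have q': "?q \<in> B2" by (rule ray_in[OF q \<sigma>])
    have v: "\<sigma> *\<^sub>R (q - p) = ?q - p" by (simp add: ray_def)
    have "((\<lambda>\<sigma>. W (ray q \<sigma>) \<xi> $ j) has_derivative (\<lambda>h. FD (\<lambda>q. W q \<xi> $ j) ?q (h *\<^sub>R (q - p)))) (at \<sigma>)"
      by (rule has_derivative_compose[OF ray' cvec.cdiffD(1)[OF W_cdiff q']])
    then have "((\<lambda>\<sigma>. \<sigma> *\<^sub>R W (ray q \<sigma>) \<xi> $ j) has_derivative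
        (\<lambda>h. \<sigma> *\<^sub>R FD (\<lambda>q. W q \<xi> $ j) ?q (h *\<^sub>R (q - p)) + h *\<^sub>R W ?q \<xi> $ j)) (at \<sigma> within {0..1})"
      by (rule has_derivative_scaleR[OF has_derivative_ident has_derivative_at_withinI])
    moreover have "\<sigma> *\<^sub>R FD (\<lambda>q. W q \<xi> $ j) ?q (h *\<^sub>R (q - p)) + h *\<^sub>R W ?q \<xi> $ j = h *\<^sub>R k' \<sigma> $ j" for h
    proof -
      have lin: "linear (FD (\<lambda>q. W q \<xi> $ j) ?q)"
        using has_derivative_linear[OF cvec.cdiffD(1)[OF W_cdiff q']] .
      have P0: "FD (\<lambda>(q, z). P q z \<xi> $ j) (?q, Z t ?q) (0, 0) = 0"
        using linear_0[OF has_derivative_linear[OF P_has_derivative[OF q' Z_in'[OF q'], of \<xi> j]]]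
        by (simp add: zero_prod_def)
      \<comment> \<open>Of the two terms in \<open>W_curl\<close>, the one containing
        \<open>W\<close> on the radial vector is zero, and \<open>W_radial\<close> cancels the value
        \<open>W ?q \<xi>\<close> that the factor \<open>\<sigma>\<close> produces.\<close>
      have "FD (\<lambda>q. W q \<xi> $ j) ?q (?q - p) + W ?q \<xi> $ j = k' \<sigma> $ j"
        using W_curl[OF q', of \<xi> j "?q - p"] W_radial[OF q', of j \<xi>] W_ray[OF q'] P0
        by (simp add: k'_def v)
      then have "h *\<^sub>R (FD (\<lambda>q. W q \<xi> $ j) ?q (\<sigma> *\<^sub>R (q - p)) + W ?q \<xi> $ j) = h *\<^sub>R (k' \<sigma> $ j)"
        by (simp add: v)
      then show ?thesis
        by (simp add: linear_cmul[OF lin] scaleR_add_right) (simp add: mult.commute)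
    qed
    ultimately show "((\<lambda>\<sigma>. k \<sigma> $ j) has_derivative (\<lambda>h. (h *\<^sub>R k' \<sigma>) $ j)) (at \<sigma> within {0..1})"
      by (simp add: k_def)
  qed
  have k'_bound: "norm (k' \<sigma>) \<le> lip * norm (q - p) * norm (k \<sigma>)" if \<sigma>: "\<sigma> \<in> {0..1}" for \<sigma>
  proof -
    have "norm (k' \<sigma>) \<le> real CARD('m) * (M / R * norm (\<sigma> *\<^sub>R (q - p)) * norm (W (ray q \<sigma>) \<xi>))"
      unfolding k'_def
      by (rule norm_le_card_mult, subst vec_lambda_beta) (rule P_partial_bound[OF ray_in[OF q \<sigma>] Z_in[OF ray_in[OF q \<sigma>]]])
    then show ?thesis by (simp add: k_def lip_def mult_ac)
  qed
  have cont: "continuous_on {0..1} k"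
    using der has_derivative_continuous continuous_on_eq_continuous_within by blast
  obtain B where B: "\<And>\<sigma>. \<sigma> \<in> {0..1} \<Longrightarrow> norm (k \<sigma>) \<le> B"
    using compact_imp_bounded[OF compact_continuous_image[OF cont compact_Icc]]
    unfolding bounded_iff by blast
  have lp: "0 \<le> lip" unfolding lip_def using M R by simp
  have "k 1 = 0"
  proof (rule zero_if_derivative_small[where S="{0..1::real}" and x=0 and \<rho>=1 and C="lip * norm (q - p)" and h'="\<lambda>\<sigma> h. h *\<^sub>R k' \<sigma>"])
    show "lip * norm (q - p) * 1 \<le> 1/2"
      using mult_left_mono[OF dist_p[OF q] lp] Lr by simp
    show "norm (h *\<^sub>R k' \<sigma>) \<le> lip * norm (q - p) * norm (k \<sigma>) * norm h" if "\<sigma> \<in> {0..1}" for \<sigma> h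
      using mult_left_mono[OF k'_bound[OF that], of "\<bar>h\<bar>"] by (simp add: mult_ac)
    show "k 0 = 0" by (simp add: k_def)
  qed (use der B lp in \<open>auto simp: dist_norm\<close>)
  then show ?thesis by (simp add: k_def ray_def)
qed

lemma Z_solves: "q \<in> B2 \<Longrightarrow> (Z t has_derivative P q (Z t q)) (at q)"
proof -
  assume q: "q \<in> B2"
  have "DZ q = P q (Z t q)"
    using W_zero[OF q] by (simp add: W_def fun_eq_iff)
  then show ?thesis using Z_has_derivative[OF q] by simp
qed

end

theorem Frobenius:
  obtains Y :: "complex ^ 'm \<Rightarrow> complex ^ 'n \<Rightarrow> complex ^ 'm" where "\<And>j. cpair.cdiff (ball z0 R \<times> ball p r) (\<lambda>(t, q). Y t q $ j)"
    "\<And>t. t \<in> ball z0 R \<Longrightarrow> Y t p = t"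
    "\<And>t q. t \<in> ball z0 R \<Longrightarrow> q \<in> ball p r \<Longrightarrow> Y t q \<in> cball z0 (2 * R)"
    "\<And>t q. t \<in> ball z0 R \<Longrightarrow> q \<in> ball p r \<Longrightarrow> (Y t has_derivative P q (Y t q)) (at q)"
  using regular_Z Z_initial Z_solves that by blast

end

section \<open>Symplectic frames and the Maurer--Cartan equation\<close>

lemma three_eq_zero: "(3 :: 3) = 0"
  by simp

lemma UNIV_012: "(UNIV :: 3 set) = {0, 1, 2}"
  using UNIV_3 by (auto simp: three_eq_zero)

lemma sum_012: "(\<Sum>i\<in>UNIV. f (i :: 3)) = f 0 + f 1 + (f 2 :: 'a::comm_monoid_add)"
proof -
  have "(0 :: 3) \<noteq> 1" "(0 :: 3) \<noteq> 2" "(1 :: 3) \<noteq> 2" by simp_all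
  then show ?thesis unfolding UNIV_012 by (simp add: add.assoc)
qed

lemma exhaust_012: "(i :: 3) = 0 \<or> i = 1 \<or> i = 2"
  using UNIV_012 by blast

lemma sum_UNIV_Plus: "(\<Sum>I\<in>UNIV. f I) = (\<Sum>i\<in>UNIV. f (Inl i)) + (\<Sum>i\<in>UNIV. f (Inr i))"
  for f :: "'i::finite + 'j::finite \<Rightarrow> 'a::comm_monoid_add"
  by (simp add: UNIV_Plus_UNIV[symmetric] sum.Plus o_def del: UNIV_Plus_UNIV)

lemma holo_on_rules:
  "holo_on N (\<lambda>_. c)"
  "holo_on N f \<Longrightarrow> holo_on N g \<Longrightarrow> holo_on N (\<lambda>x. f x + g x)"
  "holo_on N f \<Longrightarrow> holo_on N (\<lambda>x. - f x)"
  "holo_on N f \<Longrightarrow> holo_on N g \<Longrightarrow> holo_on N (\<lambda>x. f x - g x)"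
  "holo_on N f \<Longrightarrow> holo_on N g \<Longrightarrow> holo_on N (\<lambda>x. f x * g x)"
  "holo_on N f \<Longrightarrow> holo_on N (\<lambda>x. f x ^ n)"
  "(\<And>i. i \<in> I \<Longrightarrow> holo_on N (h i)) \<Longrightarrow> holo_on N (\<lambda>x. \<Sum>i\<in>I. h i x)"
  unfolding holo_on_iff_cdiff
  by (rule cvec.cdiff_const cvec.cdiff_add cvec.cdiff_uminus cvec.cdiff_diff cvec.cdiff_mult
      cvec.cdiff_power cvec.cdiff_sum; assumption)+

lemma holo_on_divide:
  "holo_on N f \<Longrightarrow> holo_on N g \<Longrightarrow> (\<And>p. p \<in> N \<Longrightarrow> g p \<noteq> 0) \<Longrightarrow> holo_on N (\<lambda>x. f x / g x)"
  unfolding holo_on_iff_cdiff by (rule cvec.cdiff_divide)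

lemma holo_on_has_derivative: "holo_on N f \<Longrightarrow> p \<in> N \<Longrightarrow> (f has_derivative D f p) (at p)"
  and holo_on_D_scale: "holo_on N f \<Longrightarrow> p \<in> N \<Longrightarrow> D f p (z *s \<xi>) = z * D f p \<xi>"
  unfolding holo_on_iff_cdiff by (rule cvec.cdiffD; assumption)+

lemma holo_on_D_add: "holo_on N f \<Longrightarrow> p \<in> N \<Longrightarrow> D f p (\<xi> + \<zeta>) = D f p \<xi> + D f p \<zeta>"
  using linear_add[OF has_derivative_linear[OF holo_on_has_derivative]] .

lemma holo_on_D: "holo_on N f \<Longrightarrow> open N \<Longrightarrow> holo_on N (\<lambda>p. D f p \<xi>)"
  unfolding holo_on_iff_cdiff by (rule cvec.cdiff_FD)

lemma D_symmetric: "holo_on N f \<Longrightarrow> open N \<Longrightarrow> p \<in> N \<Longrightarrow> D (\<lambda>q. D f q \<xi>) p \<zeta> = D (\<lambda>q. D f q \<zeta>) p \<xi>"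
  unfolding holo_on_iff_cdiff by (rule cvec.FD_symmetric)

lemma holo_on_cong: "holo_on N f \<Longrightarrow> open N \<Longrightarrow> (\<And>p. p \<in> N \<Longrightarrow> f p = g p) \<Longrightarrow> holo_on N g"
  unfolding holo_on_iff_cdiff by (rule cvec.cdiff_cong)

lemma holo_on_subset: "holo_on N f \<Longrightarrow> M \<subseteq> N \<Longrightarrow> holo_on M f"
  unfolding holo_on_def by blast

lemma D_cong:
  assumes "open N" "p \<in> N" "\<And>q. q \<in> N \<Longrightarrow> f q = g q"
  shows "D f p = D g p"
proof -
  have "(f has_derivative L) (at p) \<longleftrightarrow> (g has_derivative L) (at p)" for L
    using has_derivative_transform_within_open[OF _ assms(1,2), of f L UNIV g]
      has_derivative_transform_within_open[OF _ assms(1,2), of g L UNIV f] assms(3) by auto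
  then show ?thesis unfolding frechet_derivative_def by simp
qed

lemma D_rules:
  assumes "holo_on N f" "holo_on N g" "p \<in> N"
  shows "D (\<lambda>x. f x + g x) p \<xi> = D f p \<xi> + D g p \<xi>"
    "D (\<lambda>x. f x - g x) p \<xi> = D f p \<xi> - D g p \<xi>"
    "D (\<lambda>x. f x * g x) p \<xi> = f p * D g p \<xi> + D f p \<xi> * g p"
  using FD_eqI[OF has_derivative_add[OF assms(1,2)[THEN holo_on_has_derivative, OF assms(3)]]]
    FD_eqI[OF has_derivative_diff[OF assms(1,2)[THEN holo_on_has_derivative, OF assms(3)]]]
    FD_eqI[OF has_derivative_mult[OF assms(1,2)[THEN holo_on_has_derivative, OF assms(3)]]]
  by simp_all

section \<open>The symplectic group\<close>

lemma sympl_axis: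
  "sympl (axis (Inl i) 1) w = w $ Inr i" "sympl (axis (Inr i) 1) w = - w $ Inl i"
  "sympl v (axis (Inl i) 1) = - v $ Inr i" "sympl v (axis (Inr i) 1) = v $ Inl i"
  by (auto simp: sympl_def axis_def if_distrib[of "\<lambda>x. x * _"] if_distrib[of "\<lambda>x. _ * x"] sum_subtractf sum_negf
      cong: if_cong)

lemma sympl_swap: "sympl v w = - sympl w v"
  by (simp add: sympl_def sum_negf[symmetric] mult.commute)

text \<open>The block form of \<open>J^-1 A^t J\<close> for the matrix \<open>J\<close> of the
  symplectic form, hence the inverse of a symplectic \<open>A\<close>. Its entries are entries of
  \<open>A\<close> up to sign, which makes the Maurer-Cartan form visibly holomorphic.\<close>

definition symplectic_adjoint :: "mat6 \<Rightarrow> mat6" where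
  "symplectic_adjoint A = (\<chi> I J. case I of
     Inl i \<Rightarrow> (case J of Inl j \<Rightarrow> A $ Inr j $ Inr i | Inr j \<Rightarrow> - A $ Inl j $ Inr i)
   | Inr i \<Rightarrow> (case J of Inl j \<Rightarrow> - A $ Inr j $ Inl i | Inr j \<Rightarrow> A $ Inl j $ Inl i))"

lemma matrix_mult_axis: "A *v axis I 1 = column I A" for A :: "complex ^ 'n ^ 'm"
  by (simp add: vec_eq_iff matrix_vector_mult_def column_def axis_def if_distrib[of "\<lambda>x. _ * x"] cong: if_cong)

lemma column_mult: "column I (A ** B) = A *v column I B" for A :: "complex ^ 'n ^ 'm"
  by (simp add: vec_eq_iff column_def matrix_matrix_mult_def matrix_vector_mult_def)

lemma Sp3_sympl_column:
  "A \<in> Sp3 \<Longrightarrow> sympl (column I A) (column J A) = sympl (axis I 1) (axis J 1)"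
  unfolding Sp3_def matrix_mult_axis[symmetric] by blast

lemma Sp3_adjoint_left:
  assumes "A \<in> Sp3"
  shows "symplectic_adjoint A ** A = mat 1"
proof -
  have "(symplectic_adjoint A ** A) $ I $ J = mat 1 $ I $ J" for I J
  proof (cases I)
    case (Inl i)
    have "(symplectic_adjoint A ** A) $ I $ J = - sympl (column (Inr i) A) (column J A)"
      by (simp add: Inl matrix_matrix_mult_def symplectic_adjoint_def sum_UNIV_Plus sympl_def column_def
          sum_subtractf sum_negf)
    then show ?thesis
      by (simp add: Sp3_sympl_column[OF assms] sympl_axis) (simp add: Inl mat_def axis_def eq_commute)
  next
    case (Inr i)
    have "(symplectic_adjoint A ** A) $ I $ J = sympl (column (Inl i) A) (column J A)"
      by (simp add: Inr matrix_matrix_mult_def symplectic_adjoint_def sum_UNIV_Plus sympl_def column_def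
          sum_subtractf sum_negf)
    then show ?thesis
      by (simp add: Sp3_sympl_column[OF assms] sympl_axis) (simp add: Inr mat_def axis_def eq_commute)
  qed
  then show ?thesis by (simp add: vec_eq_iff)
qed

lemma Sp3_adjoint_right: "A \<in> Sp3 \<Longrightarrow> A ** symplectic_adjoint A = mat 1"
  using Sp3_adjoint_left matrix_left_right_inverse by blast

lemma Sp3_matrix_inv: "A \<in> Sp3 \<Longrightarrow> matrix_inv A = symplectic_adjoint A"
proof -
  assume A: "A \<in> Sp3"
  have "A ** matrix_inv A = mat 1"
    unfolding matrix_inv_def
    by (rule someI2[of _ "symplectic_adjoint A"]) (simp_all add: Sp3_adjoint_left[OF A] Sp3_adjoint_right[OF A])
  then have "(symplectic_adjoint A ** A) ** matrix_inv A = symplectic_adjoint A"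
    by (simp add: matrix_mul_assoc[symmetric])
  then show ?thesis by (simp add: Sp3_adjoint_left[OF A])
qed

lemma Sp3_mult: "A \<in> Sp3 \<Longrightarrow> B \<in> Sp3 \<Longrightarrow> A ** B \<in> Sp3"
  by (simp add: Sp3_def matrix_vector_mul_assoc[symmetric])

lemma Sp3_adjoint:
  assumes "A \<in> Sp3"
  shows "symplectic_adjoint A \<in> Sp3"
  unfolding Sp3_def
proof (intro CollectI allI)
  fix v w
  have "sympl (symplectic_adjoint A *v v) (symplectic_adjoint A *v w)
    = sympl (A *v (symplectic_adjoint A *v v)) (A *v (symplectic_adjoint A *v w))"
    using assms by (simp add: Sp3_def)
  then show "sympl (symplectic_adjoint A *v v) (symplectic_adjoint A *v w) = sympl v w"
    by (simp add: matrix_vector_mul_assoc Sp3_adjoint_right[OF assms])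
qed

lemma Sp3_by_columns:
  assumes "\<And>I J. sympl (column I A) (column J A) = sympl (axis I 1) (axis J 1)"
  shows "A \<in> Sp3"
proof -
  have lin: "sympl (v + v') w = sympl v w + sympl v' w" "sympl (c *s v) w = c * sympl v w"
    "sympl w (v + v') = sympl w v + sympl w v'" "sympl w (c *s v) = c * sympl w v" for v v' w c
    by (simp_all add: sympl_def sum.distrib[symmetric] sum_distrib_left algebra_simps)
  have zero: "sympl 0 v = 0" "sympl v 0 = 0" for v
    by (simp_all add: sympl_def)
  have sumL: "sympl (\<Sum>I\<in>S. f I) w = (\<Sum>I\<in>S. sympl (f I) w)" if "finite S" for S :: "(3 + 3) set" and f w
    using that by induction (auto simp: lin zero)
  have sumR: "sympl w (\<Sum>I\<in>S. f I) = (\<Sum>I\<in>S. sympl w (f I))" if "finite S" for S :: "(3 + 3) set" and f w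
    using that by induction (auto simp: lin zero)
  have Av: "A *v v = (\<Sum>I\<in>UNIV. v $ I *s column I A)" for v
    by (rule matrix_mult_sum)
  have "sympl (A *v v) (A *v w) = sympl v w" for v w
  proof -
    have "sympl (A *v v) (A *v w) = (\<Sum>I\<in>UNIV. \<Sum>J\<in>UNIV. w $ I * (v $ J * sympl (axis J 1) (axis I 1)))"
      unfolding Av by (simp add: sumL sumR lin assms sum_distrib_left)
    also have "\<dots> = sympl (\<Sum>I\<in>UNIV. v $ I *s axis I 1) (\<Sum>I\<in>UNIV. w $ I *s axis I 1)"
      by (simp add: sumL sumR lin sum_distrib_left)
    finally show ?thesis by (simp add: basis_expansion)
  qed
  then show ?thesis by (simp add: Sp3_def)
qed

lemma sympl_has_derivative:
  assumes "(f has_derivative f') (at p within S)" "(g has_derivative g') (at p within S)"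
  shows "((\<lambda>q. sympl (f q) (g q)) has_derivative (\<lambda>\<xi>. sympl (f' \<xi>) (g p) + sympl (f p) (g' \<xi>))) (at p within S)"
proof -
  have "((\<lambda>q. f q $ I * g q $ J) has_derivative (\<lambda>\<xi>. f p $ I * g' \<xi> $ J + f' \<xi> $ I * g p $ J)) (at p within S)" for I J
    by (rule has_derivative_mult[OF assms[THEN has_derivative_vec_nth]])
  then have "((\<lambda>q. sympl (f q) (g q)) has_derivative (\<lambda>\<xi>. \<Sum>i\<in>UNIV.
      (f p $ Inl i * g' \<xi> $ Inr i + f' \<xi> $ Inl i * g p $ Inr i) - (f p $ Inr i * g' \<xi> $ Inl i + f' \<xi> $ Inr i * g p $ Inl i))) (at p within S)"
    unfolding sympl_def by (intro has_derivative_sum has_derivative_diff) auto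
  then show ?thesis
    by (rule has_derivative_eq_rhs) (simp add: fun_eq_iff sympl_def sum.distrib sum_subtractf)
qed

lemma has_derivative_column:
  fixes F :: "'a::real_normed_vector \<Rightarrow> complex ^ 'n ^ 'm"
  assumes "(F has_derivative F') (at p within S)"
  shows "((\<lambda>q. column I (F q)) has_derivative (\<lambda>\<xi>. column I (F' \<xi>))) (at p within S)"
  unfolding column_def
  by (rule has_derivative_vec_componentwise)
    (simp add: bounded_linear.has_derivative[OF bounded_linear_vec_nth]
      bounded_linear.has_derivative[OF bounded_linear_vec_nth bounded_linear.has_derivative[OF bounded_linear_vec_nth assms]])

section \<open>Symplectic frame fields\<close>

locale sframe =
  fixes N :: "pt set" and F :: "pt \<Rightarrow> mat6"
  assumes open_N: "open N" and frame: "symplectic_frame N F"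
begin

lemma F_holo: "holo_on N (\<lambda>p. F p $ I $ J)"
  using frame by (simp add: symplectic_frame_def)

lemma F_Sp3: "p \<in> N \<Longrightarrow> F p \<in> Sp3"
  using frame by (simp add: symplectic_frame_def)

lemma F_has_derivative: "p \<in> N \<Longrightarrow> (F has_derivative (\<lambda>\<xi>. \<chi> I J. D (\<lambda>q. F q $ I $ J) p \<xi>)) (at p)"
  by (intro has_derivative_vec_componentwise) (simp add: holo_on_has_derivative[OF F_holo])

lemma FD_has_derivative: "p \<in> N \<Longrightarrow> (F has_derivative D F p) (at p)"
  using FD_eqI[OF F_has_derivative] F_has_derivative by simp

lemma DF_entry: "p \<in> N \<Longrightarrow> D F p \<xi> $ I $ J = D (\<lambda>q. F q $ I $ J) p \<xi>"
  by (simp add: FD_eqI[OF F_has_derivative])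

lemma mc_eq: "p \<in> N \<Longrightarrow> mc F p \<xi> = symplectic_adjoint (F p) ** D F p \<xi>"
  by (simp add: mc_def Sp3_matrix_inv F_Sp3)

lemma DF_eq: "p \<in> N \<Longrightarrow> D F p \<xi> = F p ** mc F p \<xi>"
  by (simp add: mc_eq matrix_mul_assoc Sp3_adjoint_right F_Sp3)

lemma mc_add: "p \<in> N \<Longrightarrow> mc F p (\<xi> + \<zeta>) = mc F p \<xi> + mc F p \<zeta>"
  by (simp add: mc_eq vec_eq_iff matrix_matrix_mult_def DF_entry holo_on_D_add[OF F_holo] sum.distrib algebra_simps)

lemma mc_scale: "p \<in> N \<Longrightarrow> mc F p (z *s \<xi>) $ I $ J = z * mc F p \<xi> $ I $ J"
  by (simp add: mc_eq matrix_matrix_mult_def DF_entry holo_on_D_scale[OF F_holo] sum_distrib_left algebra_simps)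

lemma mc_holo: "holo_on N (\<lambda>p. mc F p \<xi> $ I $ J)"
proof (rule holo_on_cong[OF _ open_N])
  have "holo_on N (\<lambda>p. symplectic_adjoint (F p) $ I $ K)" for K
    unfolding symplectic_adjoint_def by (cases I; cases K) (auto intro!: holo_on_rules F_holo)
  then show "holo_on N (\<lambda>p. \<Sum>K\<in>UNIV. symplectic_adjoint (F p) $ I $ K * D (\<lambda>q. F q $ K $ J) p \<xi>)"
    by (intro holo_on_rules holo_on_D F_holo open_N)
qed (simp add: mc_eq matrix_matrix_mult_def DF_entry)

text \<open>Second derivatives of \<open>F\<close> are symmetric; express them through
  \<open>D F = F ** mc F\<close> and cancel the invertible factor \<open>F p\<close>.\<close>

lemma Maurer_Cartan:
  assumes p: "p \<in> N"
  shows "D (\<lambda>q. mc F q \<zeta> $ I $ J) p \<xi> - D (\<lambda>q. mc F q \<xi> $ I $ J) p \<zeta>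
    = - ((mc F p \<xi> ** mc F p \<zeta>) $ I $ J - (mc F p \<zeta> ** mc F p \<xi>) $ I $ J)"
proof -
  define X where "X = (\<lambda>\<xi> \<zeta>. (\<chi> I J. D (\<lambda>q. mc F q \<zeta> $ I $ J) p \<xi>) :: mat6)"
  have *: "D (\<lambda>q. D (\<lambda>q. F q $ I $ J) q \<zeta>) p \<xi> = (F p ** (X \<xi> \<zeta> + mc F p \<xi> ** mc F p \<zeta>)) $ I $ J" for I J \<xi> \<zeta>
  proof -
    have "D (\<lambda>q. D (\<lambda>q. F q $ I $ J) q \<zeta>) p \<xi> = D (\<lambda>q. \<Sum>K\<in>UNIV. F q $ I $ K * mc F q \<zeta> $ K $ J) p \<xi>"
      by (rule fun_cong[OF D_cong[OF open_N p]])
        (simp add: DF_entry[symmetric] DF_eq matrix_matrix_mult_def)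
    also have "\<dots> = (\<Sum>K\<in>UNIV. F p $ I $ K * D (\<lambda>q. mc F q \<zeta> $ K $ J) p \<xi> + D (\<lambda>q. F q $ I $ K) p \<xi> * mc F p \<zeta> $ K $ J)"
      by (rule fun_cong[OF FD_eqI[OF has_derivative_sum]])
        (intro has_derivative_mult holo_on_has_derivative[OF F_holo p] holo_on_has_derivative[OF mc_holo p])
    also have "\<dots> = (F p ** X \<xi> \<zeta>) $ I $ J + ((F p ** mc F p \<xi>) ** mc F p \<zeta>) $ I $ J"
      by (subst (2) matrix_matrix_mult_def)
        (simp add: matrix_matrix_mult_def X_def sum.distrib DF_entry[OF p, symmetric] DF_eq[OF p])
    finally show ?thesis
      by (simp add: matrix_add_ldistrib matrix_mul_assoc)
  qed
  have "F p ** (X \<xi> \<zeta> + mc F p \<xi> ** mc F p \<zeta>) = F p ** (X \<zeta> \<xi> + mc F p \<zeta> ** mc F p \<xi>)"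
    unfolding vec_eq_iff *[symmetric] by (intro allI D_symmetric[OF F_holo open_N p])
  then have "symplectic_adjoint (F p) ** (F p ** (X \<xi> \<zeta> + mc F p \<xi> ** mc F p \<zeta>))
      = symplectic_adjoint (F p) ** (F p ** (X \<zeta> \<xi> + mc F p \<zeta> ** mc F p \<xi>))" by simp
  then have "X \<xi> \<zeta> + mc F p \<xi> ** mc F p \<zeta> = X \<zeta> \<xi> + mc F p \<zeta> ** mc F p \<xi>"
    by (simp add: matrix_mul_assoc Sp3_adjoint_left[OF F_Sp3[OF p]])
  then have "(X \<xi> \<zeta> + mc F p \<xi> ** mc F p \<zeta>) $ I $ J = (X \<zeta> \<xi> + mc F p \<zeta> ** mc F p \<xi>) $ I $ J" by simp
  then show ?thesis by (simp add: X_def algebra_simps)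
qed

text \<open>The symplectic products of the columns of \<open>F\<close> are constant; their
  derivative says that \<open>mc F\<close> takes values in the symplectic Lie algebra.\<close>

lemma mc_sympl:
  assumes p: "p \<in> N"
  shows "sympl (column I (mc F p \<xi>)) (axis J 1) + sympl (axis I 1) (column J (mc F p \<xi>)) = 0"
proof -
  have "((\<lambda>q. sympl (column I (F q)) (column J (F q))) has_derivative
    (\<lambda>\<xi>. sympl (column I (D F p \<xi>)) (column J (F p)) + sympl (column I (F p)) (column J (D F p \<xi>)))) (at p)"
    by (rule sympl_has_derivative; rule has_derivative_column, rule FD_has_derivative[OF p])
  moreover have "((\<lambda>q. sympl (column I (F q)) (column J (F q))) has_derivative (\<lambda>_. 0)) (at p)"
    by (rule has_derivative_transform_within_open[OF has_derivative_const open_N p])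
      (simp add: Sp3_sympl_column[OF F_Sp3])
  ultimately have "(\<lambda>\<xi>. sympl (column I (D F p \<xi>)) (column J (F p)) + sympl (column I (F p)) (column J (D F p \<xi>))) = (\<lambda>_. 0)"
    by (rule has_derivative_unique)
  from fun_cong[OF this, of \<xi>]
  have "sympl (F p *v column I (mc F p \<xi>)) (F p *v axis J 1) + sympl (F p *v axis I 1) (F p *v column J (mc F p \<xi>)) = 0"
    by (simp add: DF_eq[OF p] column_mult matrix_mult_axis)
  then show ?thesis using F_Sp3[OF p] by (simp only: Sp3_def mem_Collect_eq)
qed

lemma theta_sym: "p \<in> N \<Longrightarrow> theta F i j p \<xi> = theta F j i p \<xi>"
  and eta_sym: "p \<in> N \<Longrightarrow> eta F i j p \<xi> = eta F j i p \<xi>"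
  and mc_lower: "p \<in> N \<Longrightarrow> mc F p \<xi> $ Inr i $ Inr j = - om F j i p \<xi>"
  using mc_sympl[of p "Inl i" \<xi> "Inl j"] mc_sympl[of p "Inr i" \<xi> "Inr j"] mc_sympl[of p "Inl i" \<xi> "Inr j"]
  by (auto simp: sympl_axis column_def theta_def eta_def om_def add_eq_0_iff)

end

section \<open>The coframe and covariant derivatives\<close>

lemma adapted1_sframe: "open N \<Longrightarrow> adapted1 N x F \<Longrightarrow> sframe N F"
  by (simp add: sframe_def adapted1_def)

context sframe
begin

lemma D_e_vec:
  assumes p: "p \<in> N"
  shows "D (e_vec F i) p \<xi> = F p *v column (Inl i) (mc F p \<xi>)"
proof -
  have "(e_vec F i has_derivative (\<lambda>\<xi>. column (Inl i) (D F p \<xi>))) (at p)"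
    unfolding e_vec_def[abs_def] by (rule has_derivative_column[OF FD_has_derivative[OF p]])
  from FD_eqI[OF this] show ?thesis by (simp add: DF_eq[OF p] column_mult)
qed

lemma adjoint_e_vec: "p \<in> N \<Longrightarrow> symplectic_adjoint (F p) *v e_vec F i p = axis (Inl i) 1"
  by (simp add: e_vec_def column_mult[symmetric] Sp3_adjoint_left[OF F_Sp3])
    (simp add: column_def mat_def axis_def vec_eq_iff)

lemma adjoint_D_e_vec: "p \<in> N \<Longrightarrow> symplectic_adjoint (F p) *v D (e_vec F i) p \<xi> = column (Inl i) (mc F p \<xi>)"
  by (simp add: D_e_vec matrix_vector_mul_assoc Sp3_adjoint_left[OF F_Sp3])

lemma frame_expansion: "F p *v v = (\<Sum>i\<in>UNIV. v $ Inl i *s e_vec F i p) + (\<Sum>i\<in>UNIV. v $ Inr i *s column (Inr i) (F p))"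
  unfolding matrix_mult_sum sum_UNIV_Plus e_vec_def ..

end

lemma subspace_functional:
  "vec.subspace {v. (\<Sum>I\<in>UNIV. k I * (A *v v) $ I) = 0}" for A :: mat6
  by (rule vec.subspaceI)
    (simp_all add: matrix_vector_right_distrib vector_scalar_commute sum.distrib
      mult.left_commute sum_distrib_left[symmetric] distrib_left)

text \<open>In coordinates with respect to the frame, the span of the e-vectors lies in the kernel
  of each f-coordinate, and the derivative of \<open>e_vec F 0\<close> belongs to that span.\<close>

lemma adapted1_theta:
  assumes "open N" "adapted1 N x F" and p: "p \<in> N"
  shows "theta F i 0 p \<xi> = 0"
proof -
  interpret sframe N F using adapted1_sframe assms by blast
  define S where "S = {v. (\<Sum>I\<in>UNIV. (if I = Inr i then 1 else 0) * (symplectic_adjoint (F p) *v v) $ I) = 0}"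
  have S: "v \<in> S \<longleftrightarrow> (symplectic_adjoint (F p) *v v) $ Inr i = 0" for v
    unfolding S_def by (simp add: if_distrib[of "\<lambda>x. x * _"] cong: if_cong)
  have "vec.span {e_vec F 0 p, e_vec F 1 p, e_vec F 2 p} \<subseteq> S"
    by (rule vec.span_minimal)
      (auto simp: S adjoint_e_vec[OF p] axis_def, simp add: S_def subspace_functional)
  moreover have "D (e_vec F 0) p \<xi> \<in> vec.span {e_vec F 0 p, e_vec F 1 p, e_vec F 2 p}"
    using assms(2) p by (auto simp: adapted1_def intro!: vec.span_base)
  ultimately show ?thesis
    by (auto simp: S adjoint_D_e_vec[OF p] column_def theta_def)
qed

text \<open>A linear relation between \<open>om1\<close> and \<open>om2\<close> is a functional that
  annihilates \<open>e_vec F 0\<close> and all its derivatives, hence the whole span, which contains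
  \<open>e_vec F 1\<close> and \<open>e_vec F 2\<close>; on these it takes the values
  \<open>k1\<close> and \<open>k2\<close>.\<close>

lemma adapted1_independent:
  assumes "open N" "adapted1 N x F" and p: "p \<in> N"
    and k: "\<And>\<xi>. k1 * om1 F p \<xi> + k2 * om2 F p \<xi> = 0"
  shows "k1 = 0 \<and> k2 = 0"
proof -
  interpret sframe N F using adapted1_sframe assms by blast
  define S where "S = {v. (\<Sum>I\<in>UNIV. (if I = Inl 1 then k1 else if I = Inl 2 then k2 else 0) * (symplectic_adjoint (F p) *v v) $ I) = 0}"
  have S: "v \<in> S \<longleftrightarrow> k1 * (symplectic_adjoint (F p) *v v) $ Inl 1 + k2 * (symplectic_adjoint (F p) *v v) $ Inl 2 = 0" for v
    unfolding S_def sum_UNIV_Plus by (simp add: sum_012)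
  have sp: "vec.span (insert (e_vec F 0 p) (range (D (e_vec F 0) p))) \<subseteq> S"
    by (rule vec.span_minimal)
      (use k in \<open>auto simp: S adjoint_e_vec[OF p] adjoint_D_e_vec[OF p] column_def om_def axis_def\<close>,
       simp add: S_def subspace_functional)
  have "e_vec F i p \<in> S" if "i = 1 \<or> i = 2" for i
  proof -
    have "e_vec F i p \<in> vec.span {e_vec F 0 p, e_vec F 1 p, e_vec F 2 p}"
      using that by (auto intro!: vec.span_base)
    then show ?thesis using sp assms(2) p by (auto simp: adapted1_def)
  qed
  from this[of 1] this[of 2] show ?thesis
    by (simp add: S adjoint_e_vec[OF p] axis_def)
qed

definition wedge12 :: "(pt \<Rightarrow> mat6) \<Rightarrow> pt \<Rightarrow> pt \<Rightarrow> pt \<Rightarrow> complex" where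
  "wedge12 F p \<xi> \<zeta> = om1 F p \<xi> * om2 F p \<zeta> - om1 F p \<zeta> * om2 F p \<xi>"

locale coframe = sframe +
  assumes independent: "p \<in> N \<Longrightarrow> (\<forall>\<xi>. k1 * om1 F p \<xi> + k2 * om2 F p \<xi> = 0) \<Longrightarrow> k1 = 0 \<and> k2 = 0"
begin

lemma om_holo: "holo_on N (\<lambda>p. om F i j p \<xi>)"
  unfolding om_def by (rule mc_holo)

lemma om_add: "p \<in> N \<Longrightarrow> om F i j p (\<xi> + \<zeta>) = om F i j p \<xi> + om F i j p \<zeta>"
  by (simp add: om_def mc_add)

lemma om_scale: "p \<in> N \<Longrightarrow> om F i j p (z *s \<xi>) = z * om F i j p \<xi>"
  by (simp add: om_def mc_scale)

abbreviation "ax k \<equiv> axis (k :: 2) (1 :: complex)"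

lemma pt_expand: "\<xi> = \<xi> $ 1 *s ax 1 + \<xi> $ 2 *s ax 2"
  by (simp add: vec_eq_iff forall_2 axis_def)

definition "det12 p = wedge12 F p (ax 1) (ax 2)"

lemma om_pt_expand: "p \<in> N \<Longrightarrow> om F i j p \<xi> = \<xi> $ 1 * om F i j p (ax 1) + \<xi> $ 2 * om F i j p (ax 2)"
  by (subst pt_expand[of \<xi>]) (simp only: om_add om_scale)

lemma det12_nonzero:
  assumes p: "p \<in> N"
  shows "det12 p \<noteq> 0"
proof
  assume 0: "det12 p = 0"
  have "om2 F p (ax 1) * om1 F p \<xi> + (- om1 F p (ax 1)) * om2 F p \<xi> = 0" for \<xi>
    using 0 unfolding om_pt_expand[OF p, of _ _ \<xi>] by (simp add: det12_def wedge12_def) algebra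
  then have 1: "om2 F p (ax 1) = 0" "om1 F p (ax 1) = 0"
    using independent[OF p, of "om2 F p (ax 1)" "- om1 F p (ax 1)"] by auto
  have "om2 F p (ax 2) * om1 F p \<xi> + (- om1 F p (ax 2)) * om2 F p \<xi> = 0" for \<xi>
    using 0 unfolding om_pt_expand[OF p, of _ _ \<xi>] by (simp add: det12_def wedge12_def) algebra
  then have 2: "om2 F p (ax 2) = 0" "om1 F p (ax 2) = 0"
    using independent[OF p, of "om2 F p (ax 2)" "- om1 F p (ax 2)"] by auto
  have "1 * om1 F p \<xi> + 0 * om2 F p \<xi> = 0" for \<xi>
    unfolding om_pt_expand[OF p, of _ _ \<xi>] by (simp add: 1 2)
  then show False using independent[OF p, of 1 0] by auto
qed

text \<open>The basis dual to \<open>om1\<close>, \<open>om2\<close>, by Cramer's rule. Evaluation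
  on \<open>E1\<close> and \<open>E2\<close> replaces comparison of coefficients of forms.\<close>

definition "E1 p = (om2 F p (ax 2) / det12 p) *s ax 1 - (om2 F p (ax 1) / det12 p) *s ax 2"
definition "E2 p = (om1 F p (ax 1) / det12 p) *s ax 2 - (om1 F p (ax 2) / det12 p) *s ax 1"

lemma E_components:
  "E1 p $ 1 = om2 F p (ax 2) / det12 p" "E1 p $ 2 = - om2 F p (ax 1) / det12 p"
  "E2 p $ 1 = - om1 F p (ax 2) / det12 p" "E2 p $ 2 = om1 F p (ax 1) / det12 p"
  by (simp_all add: E1_def E2_def axis_def)

lemma om_E:
  assumes p: "p \<in> N"
  shows "om1 F p (E1 p) = 1" "om2 F p (E1 p) = 0" "om1 F p (E2 p) = 0" "om2 F p (E2 p) = 1"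
  using det12_nonzero[OF p] unfolding om_pt_expand[OF p, of _ _ "E1 p"] om_pt_expand[OF p, of _ _ "E2 p"] E_components
  by (simp_all add: field_simps) (simp_all add: det12_def wedge12_def algebra_simps)

lemma E_holo: "holo_on N (\<lambda>p. E1 p $ k)" "holo_on N (\<lambda>p. E2 p $ k)"
proof -
  have d: "holo_on N det12" unfolding det12_def[abs_def] wedge12_def by (intro holo_on_rules om_holo)
  have "holo_on N (\<lambda>p. E1 p $ k)" if "k = 1 \<or> k = 2" for k
    using that E_components by (auto intro!: holo_on_rules holo_on_divide om_holo d det12_nonzero)
  then show "holo_on N (\<lambda>p. E1 p $ k)" by (metis exhaust_2)
  have "holo_on N (\<lambda>p. E2 p $ k)" if "k = 1 \<or> k = 2" for k
    using that E_components by (auto intro!: holo_on_rules holo_on_divide om_holo d det12_nonzero)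
  then show "holo_on N (\<lambda>p. E2 p $ k)" by (metis exhaust_2)
qed

lemma pt_E_expand:
  assumes p: "p \<in> N"
  shows "\<xi> = om1 F p \<xi> *s E1 p + om2 F p \<xi> *s E2 p"
  using det12_nonzero[OF p] unfolding vec_eq_iff forall_2 om_pt_expand[OF p, of _ _ \<xi>]
  by (simp add: E_components field_simps) (simp add: det12_def wedge12_def algebra_simps)

lemma form_expand:
  assumes "p \<in> N" "\<And>\<xi> \<zeta>. L (\<xi> + \<zeta>) = L \<xi> + L \<zeta>" "\<And>c \<xi>. L (c *s \<xi>) = c * L \<xi>"
  shows "L \<xi> = L (E1 p) * om1 F p \<xi> + L (E2 p) * om2 F p \<xi>"
  by (subst pt_E_expand[OF assms(1), of \<xi>]) (simp only: assms(2,3) mult.commute)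

lemma forms_eq_iff:
  assumes p: "p \<in> N"
  shows "(\<forall>\<xi>. x * om1 F p \<xi> + y * om2 F p \<xi> = x' * om1 F p \<xi> + y' * om2 F p \<xi>) \<longleftrightarrow> x = x' \<and> y = y'"
  using om_E[OF p] by (metis add.commute add_0 mult_1_right mult_zero_right)

lemma cov_unique:
  assumes p: "p \<in> N" and h: "\<And>\<xi>. D h p \<xi> = - r * h p * om00 F p \<xi> + x * om1 F p \<xi> + y * om2 F p \<xi>"
  shows "cov F r h 1 p = x" "cov F r h 2 p = y"
proof -
  define q :: pt where "q = (\<chi> k. if k = 1 then x else y)"
  have q: "q $ 1 = x" "q $ 2 = y" by (simp_all add: q_def)
  have "(THE q :: pt. \<forall>\<xi>. D h p \<xi> = - r * h p * om00 F p \<xi> + q $ 1 * om1 F p \<xi> + q $ 2 * om2 F p \<xi>) = q"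
  proof (rule the_equality)
    show "\<forall>\<xi>. D h p \<xi> = - r * h p * om00 F p \<xi> + q $ 1 * om1 F p \<xi> + q $ 2 * om2 F p \<xi>"
      using h q by simp
    fix q' :: pt assume "\<forall>\<xi>. D h p \<xi> = - r * h p * om00 F p \<xi> + q' $ 1 * om1 F p \<xi> + q' $ 2 * om2 F p \<xi>"
    then have "\<forall>\<xi>. q' $ 1 * om1 F p \<xi> + q' $ 2 * om2 F p \<xi> = x * om1 F p \<xi> + y * om2 F p \<xi>"
      using h by (simp add: add.assoc)
    then show "q' = q" unfolding forms_eq_iff[OF p] by (simp add: vec_eq_iff forall_2 q)
  qed
  then show "cov F r h 1 p = x" "cov F r h 2 p = y" by (simp_all add: cov_def q)
qed

lemma cov_E:
  assumes h: "holo_on N h" and p: "p \<in> N"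
  shows "cov F r h 1 p = D h p (E1 p) + r * h p * om00 F p (E1 p)"
    "cov F r h 2 p = D h p (E2 p) + r * h p * om00 F p (E2 p)"
proof -
  have "D h p \<xi> = - r * h p * om00 F p \<xi> + (D h p (E1 p) + r * h p * om00 F p (E1 p)) * om1 F p \<xi>
      + (D h p (E2 p) + r * h p * om00 F p (E2 p)) * om2 F p \<xi>" for \<xi>
    using form_expand[of p "D h p" \<xi>, OF p holo_on_D_add[OF h p] holo_on_D_scale[OF h p]]
      form_expand[of p "om00 F p" \<xi>, OF p om_add[OF p] om_scale[OF p]]
    by (simp add: algebra_simps)
  from cov_unique[OF p this] show "cov F r h 1 p = D h p (E1 p) + r * h p * om00 F p (E1 p)"
    "cov F r h 2 p = D h p (E2 p) + r * h p * om00 F p (E2 p)" by blast+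
qed

lemma D_cov:
  assumes h: "holo_on N h" and p: "p \<in> N"
  shows "D h p \<xi> = - r * h p * om00 F p \<xi> + cov F r h 1 p * om1 F p \<xi> + cov F r h 2 p * om2 F p \<xi>"
  using form_expand[of p "D h p" \<xi>, OF p holo_on_D_add[OF h p] holo_on_D_scale[OF h p]]
    form_expand[of p "om00 F p" \<xi>, OF p om_add[OF p] om_scale[OF p]]
  by (simp add: cov_E[OF assms] algebra_simps)

lemma D_E_holo:
  assumes h: "holo_on N h"
  shows "holo_on N (\<lambda>p. D h p (E1 p))" "holo_on N (\<lambda>p. D h p (E2 p))"
proof -
  have "D h p \<xi> = \<xi> $ 1 * D h p (ax 1) + \<xi> $ 2 * D h p (ax 2)" if "p \<in> N" for p \<xi>
    by (subst pt_expand[of \<xi>]) (simp only: holo_on_D_add[OF h that] holo_on_D_scale[OF h that])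
  note expand = this
  show "holo_on N (\<lambda>p. D h p (E1 p))"
    by (rule holo_on_cong[OF _ open_N expand[symmetric]]) (intro holo_on_rules E_holo holo_on_D h open_N)
  show "holo_on N (\<lambda>p. D h p (E2 p))"
    by (rule holo_on_cong[OF _ open_N expand[symmetric]]) (intro holo_on_rules E_holo holo_on_D h open_N)
qed

lemma om_E_holo: "holo_on N (\<lambda>p. om F i j p (E1 p))" "holo_on N (\<lambda>p. om F i j p (E2 p))"
  by (rule holo_on_cong[OF _ open_N om_pt_expand[symmetric]], intro holo_on_rules E_holo om_holo, assumption)+

lemma cov_holo:
  assumes h: "holo_on N h"
  shows "holo_on N (cov F r h k)"
proof -
  have "holo_on N (cov F r h 1)"
    by (rule holo_on_cong[OF _ open_N cov_E(1)[OF h, symmetric]]) (intro holo_on_rules D_E_holo om_E_holo h)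
  moreover have "holo_on N (cov F r h 2)"
    by (rule holo_on_cong[OF _ open_N cov_E(2)[OF h, symmetric]]) (intro holo_on_rules D_E_holo om_E_holo h)
  ultimately show ?thesis by (metis exhaust_2)
qed

lemma cov_jet_holo: "holo_on N h \<Longrightarrow> holo_on N (cov_jet F r h ks)"
  by (induction ks arbitrary: r h) (auto intro: cov_holo)

lemma cov_add:
  assumes "holo_on N f" "holo_on N g" "p \<in> N"
  shows "cov F r (\<lambda>q. f q + g q) k p = cov F r f k p + cov F r g k p"
proof -
  note cu = cov_unique[OF assms(3), of "\<lambda>q. f q + g q" r "cov F r f 1 p + cov F r g 1 p" "cov F r f 2 p + cov F r g 2 p"]
  have "D (\<lambda>q. f q + g q) p \<xi> = - r * (f p + g p) * om00 F p \<xi> + (cov F r f 1 p + cov F r g 1 p) * om1 F p \<xi>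
     + (cov F r f 2 p + cov F r g 2 p) * om2 F p \<xi>" for \<xi>
    unfolding D_rules[OF assms] D_cov[OF assms(1,3), of _ r] D_cov[OF assms(2,3), of _ r] by (simp add: algebra_simps)
  from cu[OF this] show ?thesis using forall_2[of "\<lambda>k. cov F r (\<lambda>q. f q + g q) k p = cov F r f k p + cov F r g k p"] by simp
qed

lemma cov_mult:
  assumes "holo_on N f" "holo_on N g" "p \<in> N" "t = r + s"
  shows "cov F t (\<lambda>q. f q * g q) k p = cov F r f k p * g p + f p * cov F s g k p"
proof -
  note cu = cov_unique[OF assms(3), of "\<lambda>q. f q * g q" t "cov F r f 1 p * g p + f p * cov F s g 1 p" "cov F r f 2 p * g p + f p * cov F s g 2 p"]
  have "D (\<lambda>q. f q * g q) p \<xi> = - t * (f p * g p) * om00 F p \<xi> + (cov F r f 1 p * g p + f p * cov F s g 1 p) * om1 F p \<xi>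
     + (cov F r f 2 p * g p + f p * cov F s g 2 p) * om2 F p \<xi>" for \<xi>
    unfolding D_rules[OF assms(1-3)] D_cov[OF assms(1,3), of _ r] D_cov[OF assms(2,3), of _ s] assms(4) by (simp add: algebra_simps)
  from cu[OF this] show ?thesis
    using forall_2[of "\<lambda>k. cov F t (\<lambda>q. f q * g q) k p = cov F r f k p * g p + f p * cov F s g k p"] by simp
qed

lemma cov_const: "p \<in> N \<Longrightarrow> cov F 0 (\<lambda>q. c) k p = 0"
  using cov_unique[of p "\<lambda>q. c" 0 0 0] forall_2[of "\<lambda>k. cov F 0 (\<lambda>q. c) k p = 0"] by simp

lemma cov_cmult: "holo_on N f \<Longrightarrow> p \<in> N \<Longrightarrow> cov F r (\<lambda>q. c * f q) k p = c * cov F r f k p"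
  using cov_mult[of "\<lambda>_. c" f p r 0 r k] by (simp add: cov_const holo_on_rules)

lemma cov_minus: "holo_on N f \<Longrightarrow> p \<in> N \<Longrightarrow> cov F r (\<lambda>q. - f q) k p = - cov F r f k p"
  using cov_cmult[of f p r "-1" k] by simp

lemma cov_diff:
  assumes "holo_on N f" "holo_on N g" "p \<in> N"
  shows "cov F r (\<lambda>q. f q - g q) k p = cov F r f k p - cov F r g k p"
  using cov_add[OF assms(1) holo_on_rules(3)[OF assms(2)] assms(3)] by (simp add: cov_minus assms)

lemma cov_cong:
  assumes "p \<in> N" "\<And>q. q \<in> N \<Longrightarrow> f q = g q"
  shows "cov F r f k p = cov F r g k p"
proof -
  have "D f p = D g p" by (rule D_cong[OF open_N assms])
  then show ?thesis by (simp add: cov_def assms)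
qed

lemma wedge12_E: "p \<in> N \<Longrightarrow> wedge12 F p (E1 p) (E2 p) = 1"
  by (simp add: wedge12_def om_E)

end

text \<open>The structure equations of the three forms that a deformation leaves unchanged;
  \<open>\<kappa>\<close> is 3/2 times the curvature of the asymptotic web.\<close>

locale structured_coframe = coframe +
  fixes \<kappa> :: fn
  assumes d_om1: "p \<in> N \<Longrightarrow> ext_d (om1 F) p \<xi> \<zeta> = 2/3 * (om00 F p \<xi> * om1 F p \<zeta> - om00 F p \<zeta> * om1 F p \<xi>)"
    and d_om2: "p \<in> N \<Longrightarrow> ext_d (om2 F) p \<xi> \<zeta> = 2/3 * (om00 F p \<xi> * om2 F p \<zeta> - om00 F p \<zeta> * om2 F p \<xi>)"
    and d_om00: "p \<in> N \<Longrightarrow> ext_d (om00 F) p \<xi> \<zeta> = \<kappa> p * wedge12 F p \<xi> \<zeta>"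
begin

text \<open>The weight \<open>s\<close> at which \<open>f\<close> and \<open>g\<close> are
  differentiated is arbitrary: the multiples of \<open>om00\<close> that it adds to their
  derivatives are compensated by the factor \<open>2/3 - s\<close>.\<close>

lemma ext_d_form:
  assumes f: "holo_on N f" and g: "holo_on N g" and h: "holo_on N h" and p: "p \<in> N"
    and \<alpha>: "\<And>q \<xi>. q \<in> N \<Longrightarrow> \<alpha> q \<xi> = f q * om1 F q \<xi> + g q * om2 F q \<xi> + h q * om00 F q \<xi>"
  shows "ext_d \<alpha> p \<xi> \<zeta> = (cov F s g 1 p - cov F s f 2 p + h p * \<kappa> p) * wedge12 F p \<xi> \<zeta>
    + (2/3 - s) * (om00 F p \<xi> * (f p * om1 F p \<zeta> + g p * om2 F p \<zeta>) - om00 F p \<zeta> * (f p * om1 F p \<xi> + g p * om2 F p \<xi>))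
    + (D h p \<xi> * om00 F p \<zeta> - D h p \<zeta> * om00 F p \<xi>)"
proof -
  have D\<alpha>: "D (\<lambda>q. \<alpha> q \<zeta>) p \<xi> = (f p * D (\<lambda>q. om1 F q \<zeta>) p \<xi> + D f p \<xi> * om1 F p \<zeta>)
    + (g p * D (\<lambda>q. om2 F q \<zeta>) p \<xi> + D g p \<xi> * om2 F p \<zeta>)
    + (h p * D (\<lambda>q. om00 F q \<zeta>) p \<xi> + D h p \<xi> * om00 F p \<zeta>)" for \<xi> \<zeta>
  proof -
    have "D (\<lambda>q. \<alpha> q \<zeta>) p = D (\<lambda>q. f q * om1 F q \<zeta> + g q * om2 F q \<zeta> + h q * om00 F q \<zeta>) p"
      by (rule D_cong[OF open_N p]) (rule \<alpha>)
    then show ?thesis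
      by (simp add: D_rules[OF _ _ p] holo_on_rules f g h om_holo)
  qed
  have "ext_d \<alpha> p \<xi> \<zeta> = f p * ext_d (om1 F) p \<xi> \<zeta> + g p * ext_d (om2 F) p \<xi> \<zeta> + h p * ext_d (om00 F) p \<xi> \<zeta>
      + (D f p \<xi> * om1 F p \<zeta> - D f p \<zeta> * om1 F p \<xi>) + (D g p \<xi> * om2 F p \<zeta> - D g p \<zeta> * om2 F p \<xi>)
      + (D h p \<xi> * om00 F p \<zeta> - D h p \<zeta> * om00 F p \<xi>)"
    unfolding ext_d_def D\<alpha> by (simp add: algebra_simps)
  then show ?thesis
    unfolding d_om1[OF p] d_om2[OF p] d_om00[OF p] D_cov[OF f p, of _ s] D_cov[OF g p, of _ s] wedge12_def
    by (simp add: algebra_simps)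
qed

lemma ext_d_D:
  assumes h: "holo_on N h" and p: "p \<in> N"
  shows "ext_d (D h) p \<xi> \<zeta> = 0"
  unfolding ext_d_def using D_symmetric[OF h open_N p, of \<zeta> \<xi>] by simp

text \<open>This is d(dh) = 0 for a function of weight \<open>r\<close>. The first derivatives have
  weight \<open>r + 2/3\<close>, and with this choice all terms in \<open>om00\<close> cancel
  against those from the exterior product of dh with \<open>om00\<close>. All compatibility
  conditions below are instances.\<close>

lemma cov_commute:
  assumes h: "holo_on N h" and p: "p \<in> N" and s: "s = r + 2/3"
  shows "cov F s (cov F r h 2) 1 p - cov F s (cov F r h 1) 2 p = r * \<kappa> p * h p"
proof -
  have e: "ext_d (D h) p (E1 p) (E2 p) = (cov F s (cov F r h 2) 1 p - cov F s (cov F r h 1) 2 p + - r * h p * \<kappa> p) * wedge12 F p (E1 p) (E2 p)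
    + (2/3 - s) * (om00 F p (E1 p) * (cov F r h 1 p * om1 F p (E2 p) + cov F r h 2 p * om2 F p (E2 p))
        - om00 F p (E2 p) * (cov F r h 1 p * om1 F p (E1 p) + cov F r h 2 p * om2 F p (E1 p)))
    + (D (\<lambda>q. - r * h q) p (E1 p) * om00 F p (E2 p) - D (\<lambda>q. - r * h q) p (E2 p) * om00 F p (E1 p))"
    by (rule ext_d_form) (simp_all add: cov_holo h holo_on_rules p D_cov[OF h, of _ _ r])
  have d: "D (\<lambda>q. - r * h q) p \<xi> = - r * D h p \<xi>" for \<xi>
    using D_rules(3)[OF holo_on_rules(1) h p, of "- r"] D_rules(3)[OF holo_on_rules(1) holo_on_rules(1) p, of 0 0] by (simp add: frechet_derivative_const)
  show ?thesis
    using e[unfolded d ext_d_D[OF h p] D_cov[OF h p, of _ r] wedge12_E[OF p] om_E[OF p] s]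
    by (simp add: s algebra_simps)
qed

end

section \<open>The structure equations of 5-adapted frames\<close>

text \<open>The 5-adapted normal form as a function of the values of the coefficients and of the
  three forms. With these as free arguments it also describes deformed coefficients over the same
  forms, and evaluation on dual vectors amounts to inserting 0 and 1.\<close>

definition phi_om :: "(4 \<Rightarrow> complex) \<Rightarrow> complex \<Rightarrow> complex \<Rightarrow> complex \<Rightarrow> 3 \<Rightarrow> 3 \<Rightarrow> complex" where
  "phi_om a w1 w2 w0 i j =
     (if i = 0 then
        (if j = 0 then w0
         else if j = 1 then (a 2 + a 4) * w1 + 3 / 5 * (a 3 - a 2) * w2
         else 3 / 5 * (a 2 - a 3) * w1 + (a 1 + a 3) * w2)
      else if j = 0 then (if i = 1 then w1 else w2)
      else if i = j then 1 / 3 * w0 else 0)"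

definition phi_eta :: "(4 \<Rightarrow> complex) \<Rightarrow> (3 \<Rightarrow> complex) \<Rightarrow> (2 \<Rightarrow> complex) \<Rightarrow> complex \<Rightarrow> complex \<Rightarrow> 3 \<Rightarrow> 3 \<Rightarrow> complex" where
  "phi_eta a b c w1 w2 i j =
     (if i = 1 \<and> j = 1 then a 1 * w2
      else if i = 1 \<and> j = 2 \<or> i = 2 \<and> j = 1 then a 2 * w1 + a 3 * w2
      else if i = 2 \<and> j = 2 then a 4 * w1
      else if i = 1 \<and> j = 0 \<or> i = 0 \<and> j = 1 then b 1 * w1 + b 2 * w2
      else if i = 2 \<and> j = 0 \<or> i = 0 \<and> j = 2 then b 3 * w1 - b 1 * w2
      else c 1 * w1 + c 2 * w2)"

definition phi_theta :: "complex \<Rightarrow> complex \<Rightarrow> 3 \<Rightarrow> 3 \<Rightarrow> complex" where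
  "phi_theta w1 w2 i j =
     (if i = 0 \<or> j = 0 then 0
      else if i = 1 \<and> j = 1 then w2
      else if i = 2 \<and> j = 2 then w1
      else w1 + w2)"

definition phi :: "(4 \<Rightarrow> complex) \<Rightarrow> (3 \<Rightarrow> complex) \<Rightarrow> (2 \<Rightarrow> complex) \<Rightarrow> complex \<Rightarrow> complex \<Rightarrow> complex \<Rightarrow> mat6" where
  "phi a b c w1 w2 w0 = (\<chi> I J. case I of
      Inl i \<Rightarrow> (case J of Inl j \<Rightarrow> phi_om a w1 w2 w0 i j | Inr j \<Rightarrow> phi_eta a b c w1 w2 i j)
    | Inr i \<Rightarrow> (case J of Inl j \<Rightarrow> phi_theta w1 w2 i j | Inr j \<Rightarrow> - phi_om a w1 w2 w0 j i))"

lemma phi_entries: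
  "phi a b c w1 w2 w0 $ Inl i $ Inl j = phi_om a w1 w2 w0 i j"
  "phi a b c w1 w2 w0 $ Inl i $ Inr j = phi_eta a b c w1 w2 i j"
  "phi a b c w1 w2 w0 $ Inr i $ Inl j = phi_theta w1 w2 i j"
  "phi a b c w1 w2 w0 $ Inr i $ Inr j = - phi_om a w1 w2 w0 j i"
  by (simp_all add: phi_def)

lemma distinct_012: "(0::3) \<noteq> 1" "(1::3) \<noteq> 0" "(0::3) \<noteq> 2" "(2::3) \<noteq> 0" "(1::3) \<noteq> 2" "(2::3) \<noteq> 1"
  by simp_all

lemma mat6_eqI:
  fixes A B :: mat6
  assumes "\<And>i j. A $ Inl i $ Inl j = B $ Inl i $ Inl j" "\<And>i j. A $ Inl i $ Inr j = B $ Inl i $ Inr j"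
    "\<And>i j. A $ Inr i $ Inl j = B $ Inr i $ Inl j" "\<And>i j. A $ Inr i $ Inr j = B $ Inr i $ Inr j"
  shows "A = B"
proof -
  have "A $ I $ J = B $ I $ J" for I J
    by (cases I; cases J) (simp_all add: assms)
  then show ?thesis by (simp add: vec_eq_iff)
qed

abbreviation Phi :: "(pt \<Rightarrow> mat6) \<Rightarrow> (4 \<Rightarrow> fn) \<Rightarrow> (3 \<Rightarrow> fn) \<Rightarrow> (2 \<Rightarrow> fn) \<Rightarrow> pt \<Rightarrow> pt \<Rightarrow> mat6" where
  "Phi F a b c p \<xi> \<equiv> phi (\<lambda>i. a i p) (\<lambda>i. b i p) (\<lambda>i. c i p) (om1 F p \<xi>) (om2 F p \<xi>) (om00 F p \<xi>)"

lemma adapted5_adapted1: "adapted5 N x F a b c \<Longrightarrow> adapted1 N x F"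
  by (simp add: adapted5_def adapted2_def)

lemma adapted5_coframe:
  assumes "open N" "adapted5 N x F a b c"
  shows "coframe N F"
proof -
  have 1: "adapted1 N x F" using adapted5_adapted1 assms by blast
  interpret sframe N F by (rule adapted1_sframe[OF assms(1) 1])
  show ?thesis
    by unfold_locales (use adapted1_independent[OF assms(1) 1] in blast)
qed

lemma adapted5_mc:
  assumes "open N" "adapted5 N x F a b c" and p: "p \<in> N"
  shows "mc F p \<xi> = Phi F a b c p \<xi>"
proof -
  have 1: "adapted1 N x F" using adapted5_adapted1 assms by blast
  interpret sframe N F by (rule adapted1_sframe[OF assms(1) 1])
  have t0: "theta F i 0 p \<xi> = 0" "theta F 0 i p \<xi> = 0" for i
    using adapted1_theta[OF assms(1) 1 p] theta_sym[OF p, of 0 i \<xi>] by simp_all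
  have A: "om F i j p \<xi> = (if i = j then 1 / 3 * om00 F p \<xi> else 0)" if "i \<in> {1, 2}" "j \<in> {1, 2}" for i j
    using assms(2) p that unfolding adapted5_def Let_def by blast
  have B: "om F 0 1 p \<xi> = (a 2 p + a 4 p) * om1 F p \<xi> + 3 / 5 * (a 3 p - a 2 p) * om2 F p \<xi>"
    "om F 0 2 p \<xi> = 3 / 5 * (a 2 p - a 3 p) * om1 F p \<xi> + (a 1 p + a 3 p) * om2 F p \<xi>"
    "eta F 1 1 p \<xi> = a 1 p * om2 F p \<xi>" "eta F 1 2 p \<xi> = a 2 p * om1 F p \<xi> + a 3 p * om2 F p \<xi>"
    "eta F 2 2 p \<xi> = a 4 p * om1 F p \<xi>" "eta F 1 0 p \<xi> = b 1 p * om1 F p \<xi> + b 2 p * om2 F p \<xi>"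
    "eta F 2 0 p \<xi> = b 3 p * om1 F p \<xi> - b 1 p * om2 F p \<xi>" "eta F 0 0 p \<xi> = c 1 p * om1 F p \<xi> + c 2 p * om2 F p \<xi>"
    using assms(2) p unfolding adapted5_def Let_def by blast+
  have C: "theta F 1 1 p \<xi> = om2 F p \<xi>" "theta F 1 2 p \<xi> = om1 F p \<xi> + om2 F p \<xi>" "theta F 2 2 p \<xi> = om1 F p \<xi>"
    using assms(2) p unfolding adapted5_def adapted2_def by blast+
  have om: "om F i j p \<xi> = phi_om (\<lambda>i. a i p) (om1 F p \<xi>) (om2 F p \<xi>) (om00 F p \<xi>) i j" for i j
    using exhaust_012[of i] exhaust_012[of j] A[of i j] B
    by (elim disjE) (simp_all add: phi_om_def)
  have et: "eta F i j p \<xi> = phi_eta (\<lambda>i. a i p) (\<lambda>i. b i p) (\<lambda>i. c i p) (om1 F p \<xi>) (om2 F p \<xi>) i j" for i j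
    using exhaust_012[of i] exhaust_012[of j] B eta_sym[OF p, of 0 1 \<xi>] eta_sym[OF p, of 0 2 \<xi>] eta_sym[OF p, of 2 1 \<xi>]
    by (elim disjE) (simp_all add: phi_eta_def)
  have th: "theta F i j p \<xi> = phi_theta (om1 F p \<xi>) (om2 F p \<xi>) i j" for i j
    using exhaust_012[of i] exhaust_012[of j] C t0 theta_sym[OF p, of 2 1 \<xi>]
    by (elim disjE) (simp_all add: phi_theta_def)
  show ?thesis
    by (rule mat6_eqI; simp only: phi_entries om[symmetric] et[symmetric] th[symmetric] mc_lower[OF p];
        simp only: om_def eta_def theta_def)
qed

context coframe
begin

text \<open>The definition of \<open>adapted5\<close> does not demand holomorphic coefficients. They
  are, being entries of the Maurer-Cartan form evaluated on the holomorphic dual vectors.\<close>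

lemma adapted5_coefficients:
  assumes "adapted5 N x F a b c"
  shows "holo_on N (a i)" "holo_on N (b j)" "holo_on N (c k)"
proof -
  note M = adapted5_mc[OF open_N assms, symmetric]
  have entry: "holo_on N (\<lambda>p. mc F p (E1 p) $ I $ J)" "holo_on N (\<lambda>p. mc F p (E2 p) $ I $ J)" for I J
  proof -
    have e: "mc F p \<xi> $ I $ J = \<xi> $ 1 * mc F p (ax 1) $ I $ J + \<xi> $ 2 * mc F p (ax 2) $ I $ J" if "p \<in> N" for p \<xi>
      by (subst pt_expand[of \<xi>]) (simp only: mc_add[OF that] mc_scale[OF that] vector_add_component)
    show "holo_on N (\<lambda>p. mc F p (E1 p) $ I $ J)"
      by (rule holo_on_cong[OF _ open_N e[symmetric]]) (intro holo_on_rules E_holo mc_holo)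
    show "holo_on N (\<lambda>p. mc F p (E2 p) $ I $ J)"
      by (rule holo_on_cong[OF _ open_N e[symmetric]]) (intro holo_on_rules E_holo mc_holo)
  qed
  have v: "mc F p (E1 p) $ Inl i $ Inr j = phi_eta (\<lambda>i. a i p) (\<lambda>i. b i p) (\<lambda>i. c i p) 1 0 i j"
    "mc F p (E2 p) $ Inl i $ Inr j = phi_eta (\<lambda>i. a i p) (\<lambda>i. b i p) (\<lambda>i. c i p) 0 1 i j" if "p \<in> N" for p i j
    by (simp_all add: M[OF that, symmetric] phi_entries om_E[OF that])
  have "holo_on N (a 1)" by (rule holo_on_cong[OF entry(2)[of "Inl 1" "Inr 1"] open_N]) (simp add: v phi_eta_def)
  moreover have "holo_on N (a 2)" by (rule holo_on_cong[OF entry(1)[of "Inl 1" "Inr 2"] open_N]) (simp add: v phi_eta_def)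
  moreover have "holo_on N (a 3)" by (rule holo_on_cong[OF entry(2)[of "Inl 1" "Inr 2"] open_N]) (simp add: v phi_eta_def)
  moreover have "holo_on N (a 4)" by (rule holo_on_cong[OF entry(1)[of "Inl 2" "Inr 2"] open_N]) (simp add: v phi_eta_def)
  ultimately show "holo_on N (a i)" using exhaust_4[of i] by auto
  have "holo_on N (b 1)" by (rule holo_on_cong[OF entry(1)[of "Inl 1" "Inr 0"] open_N]) (simp add: v phi_eta_def)
  moreover have "holo_on N (b 2)" by (rule holo_on_cong[OF entry(2)[of "Inl 1" "Inr 0"] open_N]) (simp add: v phi_eta_def)
  moreover have "holo_on N (b 3)" by (rule holo_on_cong[OF entry(1)[of "Inl 2" "Inr 0"] open_N]) (simp add: v phi_eta_def)
  ultimately show "holo_on N (b j)" using exhaust_3[of j] by auto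
  have "holo_on N (c 1)" by (rule holo_on_cong[OF entry(1)[of "Inl 0" "Inr 0"] open_N]) (simp add: v phi_eta_def)
  moreover have "holo_on N (c 2)" by (rule holo_on_cong[OF entry(2)[of "Inl 0" "Inr 0"] open_N]) (simp add: v phi_eta_def)
  ultimately show "holo_on N (c k)" using exhaust_2[of k] by auto
qed

end

lemma ext_d_entry:
  assumes "open N" "adapted5 N x F a b c" and p: "p \<in> N"
  shows "ext_d (\<lambda>q \<xi>. mc F q \<xi> $ I $ J) p \<xi> \<zeta> =
    - ((Phi F a b c p \<xi> ** Phi F a b c p \<zeta>) $ I $ J - (Phi F a b c p \<zeta> ** Phi F a b c p \<xi>) $ I $ J)"
proof -
  interpret sframe N F by (rule adapted1_sframe[OF assms(1) adapted5_adapted1[OF assms(2)]])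
  show ?thesis
    using Maurer_Cartan[OF p, of \<zeta> I J \<xi>] by (simp add: ext_d_def adapted5_mc[OF assms])
qed

lemma adapted5_structured_coframe:
  assumes "open N" "adapted5 N x F a b c"
  shows "structured_coframe N F (\<lambda>p. 6 / 5 * (a 3 p - a 2 p))"
proof -
  interpret coframe N F by (rule adapted5_coframe[OF assms])
  note E = ext_d_entry[OF assms]
  have o: "(\<lambda>q \<xi>. mc F q \<xi> $ Inl i $ Inl j) = om F i j" for i j
    by (simp add: fun_eq_iff om_def)
  note S = matrix_matrix_mult_def sum_UNIV_Plus sum_012 phi_entries phi_om_def phi_eta_def phi_theta_def
  show ?thesis
  proof
    fix p \<xi> \<zeta> assume p: "p \<in> N"
    show "ext_d (om1 F) p \<xi> \<zeta> = 2/3 * (om00 F p \<xi> * om1 F p \<zeta> - om00 F p \<zeta> * om1 F p \<xi>)"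
      using E[OF p, of "Inl 1" "Inl 0" \<xi> \<zeta>] unfolding o
      by (simp add: S algebra_simps)
    show "ext_d (om2 F) p \<xi> \<zeta> = 2/3 * (om00 F p \<xi> * om2 F p \<zeta> - om00 F p \<zeta> * om2 F p \<xi>)"
      using E[OF p, of "Inl 2" "Inl 0" \<xi> \<zeta>] unfolding o
      by (simp add: S algebra_simps)
    show "ext_d (om00 F) p \<xi> \<zeta> = 6 / 5 * (a 3 p - a 2 p) * wedge12 F p \<xi> \<zeta>"
      using E[OF p, of "Inl 0" "Inl 0" \<xi> \<zeta>] unfolding o
      by (simp add: S wedge12_def algebra_simps)
  qed
qed

text \<open>The content of the Maurer-Cartan equation for the coefficients, from the entries
  \<open>eta\<close> 1 1, 2 2, 1 2, then \<open>om\<close> 0 1, 0 2, then \<open>eta\<close> 1 0, 2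
  0, 0 0, partly solved. The other entries only repeat the structure equations of the
  coframe.\<close>

definition structure_relations :: "(pt \<Rightarrow> mat6) \<Rightarrow> (4 \<Rightarrow> fn) \<Rightarrow> (3 \<Rightarrow> fn) \<Rightarrow> (2 \<Rightarrow> fn) \<Rightarrow> pt \<Rightarrow> bool" where
  "structure_relations F a b c p \<longleftrightarrow>
     acov F a 1 1 p = - 2 * b 2 p \<and>
     acov F a 4 2 p = - 2 * b 3 p \<and>
     acov F a 3 1 p = acov F a 2 2 p + 2 * b 1 p \<and>
     acov F a 2 2 p = - 3 / 2 * acov F a 2 1 p + 8 * b 1 p + 15 / 2 * b 3 p \<and>
     acov F a 3 2 p = 5 * b 2 p - 20 / 3 * b 1 p - 2 / 3 * acov F a 2 2 p \<and>
     c 2 p = cov F 2 (b 1) 2 p - cov F 2 (b 2) 1 p - a 1 p * a 4 p + 2 / 5 * a 2 p * a 3 p + 3 / 5 * (a 3 p)\<^sup>2 \<and>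
     c 1 p = - a 1 p * a 4 p + 3 / 5 * (a 2 p)\<^sup>2 + 2 / 5 * a 2 p * a 3 p - cov F 2 (b 1) 1 p - cov F 2 (b 3) 2 p \<and>
     cov F (8 / 3) (c 2) 1 p = cov F (8 / 3) (c 1) 2 p
       + 2 * (a 1 p * b 3 p - a 2 p * b 2 p + a 3 p * b 3 p - a 4 p * b 2 p)"

context structured_coframe
begin

lemma ext_d_const_coefficient:
  assumes "holo_on N f" "holo_on N g" "p \<in> N"
    and "\<And>q \<xi>. q \<in> N \<Longrightarrow> \<alpha> q \<xi> = f q * om1 F q \<xi> + g q * om2 F q \<xi> + h * om00 F q \<xi>"
  shows "ext_d \<alpha> p \<xi> \<zeta> = (cov F s g 1 p - cov F s f 2 p + h * \<kappa> p) * wedge12 F p \<xi> \<zeta>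
    + (2/3 - s) * (om00 F p \<xi> * (f p * om1 F p \<zeta> + g p * om2 F p \<zeta>) - om00 F p \<zeta> * (f p * om1 F p \<xi> + g p * om2 F p \<xi>))"
  using ext_d_form[OF assms(1,2) holo_on_rules(1)[of N h] assms(3), of \<alpha> \<xi> \<zeta> s] assms(4)
  by (simp add: frechet_derivative_const)

lemma ext_d_uminus:
  assumes "\<And>\<xi>. holo_on N (\<lambda>q. \<alpha> q \<xi>)" "p \<in> N"
  shows "ext_d (\<lambda>q \<xi>. - \<alpha> q \<xi>) p \<xi> \<zeta> = - ext_d \<alpha> p \<xi> \<zeta>"
proof -
  have "D (\<lambda>q. - \<alpha> q \<zeta>) p \<xi> = - D (\<lambda>q. \<alpha> q \<zeta>) p \<xi>" for \<xi> \<zeta>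
    using FD_eqI[OF has_derivative_minus[OF holo_on_has_derivative[OF assms]]] by simp
  then show ?thesis by (simp add: ext_d_def)
qed

end

text \<open>The coefficients need not be those of the frame \<open>F\<close>: the locale is also
  used for deformed coefficients over the same coframe, which requires only that
  \<open>a 3 - a 2\<close> gives the same curvature at \<open>p\<close>.\<close>

locale coefficients_at = structured_coframe +
  fixes a :: "4 \<Rightarrow> fn" and b :: "3 \<Rightarrow> fn" and c :: "2 \<Rightarrow> fn" and p
  assumes a: "\<And>i. holo_on N (a i)" and b: "\<And>i. holo_on N (b i)" and c: "\<And>i. holo_on N (c i)"
    and \<kappa>: "\<kappa> p = 6 / 5 * (a 3 p - a 2 p)" and p: "p \<in> N"
begin

abbreviation "Om i j q \<xi> \<equiv> phi_om (\<lambda>i. a i q) (om1 F q \<xi>) (om2 F q \<xi>) (om00 F q \<xi>) i j"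
abbreviation "Et i j q \<xi> \<equiv> phi_eta (\<lambda>i. a i q) (\<lambda>i. b i q) (\<lambda>i. c i q) (om1 F q \<xi>) (om2 F q \<xi>) i j"
abbreviation "Th i j q \<xi> \<equiv> phi_theta (om1 F q \<xi>) (om2 F q \<xi>) i j"

lemmas cov_rules = cov_add[OF _ _ p] cov_diff[OF _ _ p] cov_minus[OF _ p] cov_cmult[OF _ p]
lemmas holo_abc = holo_on_rules a b c

lemma cov_zero: "cov F 0 (\<lambda>_. x) k p = 0"
  by (rule cov_const[OF p])

lemma ext_d_Om:
  "ext_d (Om 0 0) p \<xi> \<zeta> = \<kappa> p * wedge12 F p \<xi> \<zeta>"
  "ext_d (Om 0 1) p \<xi> \<zeta> = (3 / 5 * (acov F a 3 1 p - acov F a 2 1 p) - (acov F a 2 2 p + acov F a 4 2 p)) * wedge12 F p \<xi> \<zeta>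
    + (2/3 - 4/3) * (om00 F p \<xi> * Om 0 1 p \<zeta> - om00 F p \<zeta> * Om 0 1 p \<xi>)"
  "ext_d (Om 0 2) p \<xi> \<zeta> = (acov F a 1 1 p + acov F a 3 1 p - 3 / 5 * (acov F a 2 2 p - acov F a 3 2 p)) * wedge12 F p \<xi> \<zeta>
    + (2/3 - 4/3) * (om00 F p \<xi> * Om 0 2 p \<zeta> - om00 F p \<zeta> * Om 0 2 p \<xi>)"
  "ext_d (Om 1 0) p \<xi> \<zeta> = 2/3 * (om00 F p \<xi> * om1 F p \<zeta> - om00 F p \<zeta> * om1 F p \<xi>)"
  "ext_d (Om 2 0) p \<xi> \<zeta> = 2/3 * (om00 F p \<xi> * om2 F p \<zeta> - om00 F p \<zeta> * om2 F p \<xi>)"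
  "ext_d (Om 1 1) p \<xi> \<zeta> = 1/3 * \<kappa> p * wedge12 F p \<xi> \<zeta>"
  "ext_d (Om 2 2) p \<xi> \<zeta> = 1/3 * \<kappa> p * wedge12 F p \<xi> \<zeta>"
  "ext_d (Om 1 2) p \<xi> \<zeta> = 0"
  "ext_d (Om 2 1) p \<xi> \<zeta> = 0"
proof -
  note X = ext_d_const_coefficient[OF _ _ p, of _ _ _ _ \<xi> \<zeta>]
  have C: "cov F (4/3) (\<lambda>q. 3 / 5 * (a i q - a j q)) k p = 3 / 5 * (cov F (4/3) (a i) k p - cov F (4/3) (a j) k p)" for i j k
    by (simp only: cov_rules holo_abc)
  show "ext_d (Om 0 0) p \<xi> \<zeta> = \<kappa> p * wedge12 F p \<xi> \<zeta>"
    by (subst X[where f="\<lambda>_. 0" and g="\<lambda>_. 0" and h=1 and s=0]) (simp_all add: holo_abc cov_zero phi_om_def)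
  show "ext_d (Om 0 1) p \<xi> \<zeta> = (3 / 5 * (acov F a 3 1 p - acov F a 2 1 p) - (acov F a 2 2 p + acov F a 4 2 p)) * wedge12 F p \<xi> \<zeta>
      + (2/3 - 4/3) * (om00 F p \<xi> * Om 0 1 p \<zeta> - om00 F p \<zeta> * Om 0 1 p \<xi>)"
    using X[where f="\<lambda>q. a 2 q + a 4 q" and g="\<lambda>q. 3 / 5 * (a 3 q - a 2 q)" and h=0 and s="4/3"
        and \<alpha>="Om 0 1", unfolded C, OF holo_abc(2)[OF a a] holo_abc(5)[OF holo_abc(1) holo_abc(4)[OF a a]]]
    by (simp add: phi_om_def cov_rules a acov_def)
  show "ext_d (Om 0 2) p \<xi> \<zeta> = (acov F a 1 1 p + acov F a 3 1 p - 3 / 5 * (acov F a 2 2 p - acov F a 3 2 p)) * wedge12 F p \<xi> \<zeta>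
      + (2/3 - 4/3) * (om00 F p \<xi> * Om 0 2 p \<zeta> - om00 F p \<zeta> * Om 0 2 p \<xi>)"
    using X[where g="\<lambda>q. a 1 q + a 3 q" and f="\<lambda>q. 3 / 5 * (a 2 q - a 3 q)" and h=0 and s="4/3"
        and \<alpha>="Om 0 2", unfolded C, OF holo_abc(5)[OF holo_abc(1) holo_abc(4)[OF a a]] holo_abc(2)[OF a a]]
    by (simp add: phi_om_def cov_rules a acov_def)
  show "ext_d (Om 1 0) p \<xi> \<zeta> = 2/3 * (om00 F p \<xi> * om1 F p \<zeta> - om00 F p \<zeta> * om1 F p \<xi>)"
    using d_om1[OF p] by (simp add: phi_om_def)
  show "ext_d (Om 2 0) p \<xi> \<zeta> = 2/3 * (om00 F p \<xi> * om2 F p \<zeta> - om00 F p \<zeta> * om2 F p \<xi>)"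
    using d_om2[OF p] by (simp add: phi_om_def)
  show "ext_d (Om 1 1) p \<xi> \<zeta> = 1/3 * \<kappa> p * wedge12 F p \<xi> \<zeta>"
    by (subst X[where f="\<lambda>_. 0" and g="\<lambda>_. 0" and h="1/3" and s=0]) (simp_all add: holo_abc cov_zero phi_om_def)
  show "ext_d (Om 2 2) p \<xi> \<zeta> = 1/3 * \<kappa> p * wedge12 F p \<xi> \<zeta>"
    by (subst X[where f="\<lambda>_. 0" and g="\<lambda>_. 0" and h="1/3" and s=0]) (simp_all add: holo_abc cov_zero phi_om_def)
  show "ext_d (Om 1 2) p \<xi> \<zeta> = 0"
    by (subst X[where f="\<lambda>_. 0" and g="\<lambda>_. 0" and h="0" and s=0]) (simp_all add: holo_abc cov_zero phi_om_def)
  show "ext_d (Om 2 1) p \<xi> \<zeta> = 0"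
    by (subst X[where f="\<lambda>_. 0" and g="\<lambda>_. 0" and h="0" and s=0]) (simp_all add: holo_abc cov_zero phi_om_def)
qed

lemma ext_d_Et:
  "ext_d (Et 0 0) p \<xi> \<zeta> = (cov F (8/3) (c 2) 1 p - cov F (8/3) (c 1) 2 p) * wedge12 F p \<xi> \<zeta>
    + (2/3 - 8/3) * (om00 F p \<xi> * Et 0 0 p \<zeta> - om00 F p \<zeta> * Et 0 0 p \<xi>)"
  "ext_d (Et 1 0) p \<xi> \<zeta> = (cov F 2 (b 2) 1 p - cov F 2 (b 1) 2 p) * wedge12 F p \<xi> \<zeta>
    + (2/3 - 2) * (om00 F p \<xi> * Et 1 0 p \<zeta> - om00 F p \<zeta> * Et 1 0 p \<xi>)"
  "ext_d (Et 2 0) p \<xi> \<zeta> = (- cov F 2 (b 1) 1 p - cov F 2 (b 3) 2 p) * wedge12 F p \<xi> \<zeta>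
    + (2/3 - 2) * (om00 F p \<xi> * Et 2 0 p \<zeta> - om00 F p \<zeta> * Et 2 0 p \<xi>)"
  "ext_d (Et 1 1) p \<xi> \<zeta> = acov F a 1 1 p * wedge12 F p \<xi> \<zeta>
    + (2/3 - 4/3) * (om00 F p \<xi> * Et 1 1 p \<zeta> - om00 F p \<zeta> * Et 1 1 p \<xi>)"
  "ext_d (Et 1 2) p \<xi> \<zeta> = (acov F a 3 1 p - acov F a 2 2 p) * wedge12 F p \<xi> \<zeta>
    + (2/3 - 4/3) * (om00 F p \<xi> * Et 1 2 p \<zeta> - om00 F p \<zeta> * Et 1 2 p \<xi>)"
  "ext_d (Et 2 2) p \<xi> \<zeta> = - acov F a 4 2 p * wedge12 F p \<xi> \<zeta>
    + (2/3 - 4/3) * (om00 F p \<xi> * Et 2 2 p \<zeta> - om00 F p \<zeta> * Et 2 2 p \<xi>)"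
proof -
  note X = ext_d_const_coefficient[OF _ _ p, where h=0, of _ _ _ \<xi> \<zeta>]
  \<comment> \<open>Constants have vanishing covariant derivative at weight 0, whereas the zero
    function may be given any weight, here as \<open>0 * a 1\<close>.\<close>
  have z: "cov F (4/3) (\<lambda>_. 0) k p = 0" for k
    using cov_cmult[of "a 1" p "4/3" 0 k] a p by simp
  show "ext_d (Et 0 0) p \<xi> \<zeta> = (cov F (8/3) (c 2) 1 p - cov F (8/3) (c 1) 2 p) * wedge12 F p \<xi> \<zeta>
      + (2/3 - 8/3) * (om00 F p \<xi> * Et 0 0 p \<zeta> - om00 F p \<zeta> * Et 0 0 p \<xi>)"
    by (subst X[where f="c 1" and g="c 2" and s="8/3"]) (simp_all add: holo_abc cov_rules phi_eta_def acov_def)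
  show "ext_d (Et 1 0) p \<xi> \<zeta> = (cov F 2 (b 2) 1 p - cov F 2 (b 1) 2 p) * wedge12 F p \<xi> \<zeta>
      + (2/3 - 2) * (om00 F p \<xi> * Et 1 0 p \<zeta> - om00 F p \<zeta> * Et 1 0 p \<xi>)"
    by (subst X[where f="b 1" and g="b 2" and s=2]) (simp_all add: holo_abc cov_rules phi_eta_def acov_def)
  show "ext_d (Et 2 0) p \<xi> \<zeta> = (- cov F 2 (b 1) 1 p - cov F 2 (b 3) 2 p) * wedge12 F p \<xi> \<zeta>
      + (2/3 - 2) * (om00 F p \<xi> * Et 2 0 p \<zeta> - om00 F p \<zeta> * Et 2 0 p \<xi>)"
    by (subst X[where f="b 3" and g="\<lambda>q. - b 1 q" and s=2]) (simp_all add: holo_abc cov_rules phi_eta_def acov_def)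
  show "ext_d (Et 1 1) p \<xi> \<zeta> = acov F a 1 1 p * wedge12 F p \<xi> \<zeta>
      + (2/3 - 4/3) * (om00 F p \<xi> * Et 1 1 p \<zeta> - om00 F p \<zeta> * Et 1 1 p \<xi>)"
    by (subst X[where f="\<lambda>_. 0" and g="a 1" and s="4/3"]) (simp_all add: holo_abc cov_rules phi_eta_def acov_def z)
  show "ext_d (Et 1 2) p \<xi> \<zeta> = (acov F a 3 1 p - acov F a 2 2 p) * wedge12 F p \<xi> \<zeta>
      + (2/3 - 4/3) * (om00 F p \<xi> * Et 1 2 p \<zeta> - om00 F p \<zeta> * Et 1 2 p \<xi>)"
    by (subst X[where f="a 2" and g="a 3" and s="4/3"]) (simp_all add: holo_abc cov_rules phi_eta_def acov_def)
  show "ext_d (Et 2 2) p \<xi> \<zeta> = - acov F a 4 2 p * wedge12 F p \<xi> \<zeta>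
      + (2/3 - 4/3) * (om00 F p \<xi> * Et 2 2 p \<zeta> - om00 F p \<zeta> * Et 2 2 p \<xi>)"
    by (subst X[where f="a 4" and g="\<lambda>_. 0" and s="4/3"]) (simp_all add: holo_abc cov_rules phi_eta_def acov_def z)
qed

lemma ext_d_Th:
  "ext_d (Th 0 j) p \<xi> \<zeta> = 0" "ext_d (Th i 0) p \<xi> \<zeta> = 0"
  "ext_d (Th 1 1) p \<xi> \<zeta> = 2/3 * (om00 F p \<xi> * om2 F p \<zeta> - om00 F p \<zeta> * om2 F p \<xi>)"
  "ext_d (Th 2 2) p \<xi> \<zeta> = 2/3 * (om00 F p \<xi> * om1 F p \<zeta> - om00 F p \<zeta> * om1 F p \<xi>)"
  "ext_d (Th 1 2) p \<xi> \<zeta> = 2/3 * (om00 F p \<xi> * Th 1 2 p \<zeta> - om00 F p \<zeta> * Th 1 2 p \<xi>)"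
  "ext_d (Th 2 1) p \<xi> \<zeta> = 2/3 * (om00 F p \<xi> * Th 1 2 p \<zeta> - om00 F p \<zeta> * Th 1 2 p \<xi>)"
proof -
  note X = ext_d_const_coefficient[OF _ _ p, where h=0 and s=0, of _ _ _ \<xi> \<zeta>]
  show "ext_d (Th 0 j) p \<xi> \<zeta> = 0" "ext_d (Th i 0) p \<xi> \<zeta> = 0"
    by (simp_all add: phi_theta_def ext_d_def frechet_derivative_const)
  show "ext_d (Th 1 1) p \<xi> \<zeta> = 2/3 * (om00 F p \<xi> * om2 F p \<zeta> - om00 F p \<zeta> * om2 F p \<xi>)"
    using d_om2[OF p] by (simp add: phi_theta_def)
  show "ext_d (Th 2 2) p \<xi> \<zeta> = 2/3 * (om00 F p \<xi> * om1 F p \<zeta> - om00 F p \<zeta> * om1 F p \<xi>)"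
    using d_om1[OF p] by (simp add: phi_theta_def)
  show "ext_d (Th 1 2) p \<xi> \<zeta> = 2/3 * (om00 F p \<xi> * Th 1 2 p \<zeta> - om00 F p \<zeta> * Th 1 2 p \<xi>)"
    by (subst X[where f="\<lambda>_. 1" and g="\<lambda>_. 1"]) (simp_all add: holo_abc cov_zero phi_theta_def)
  show "ext_d (Th 2 1) p \<xi> \<zeta> = 2/3 * (om00 F p \<xi> * Th 1 2 p \<zeta> - om00 F p \<zeta> * Th 1 2 p \<xi>)"
    by (subst X[where f="\<lambda>_. 1" and g="\<lambda>_. 1"]) (simp_all add: holo_abc cov_zero phi_theta_def)
qed

definition "MC_at I J \<xi> \<zeta> \<longleftrightarrow> ext_d (\<lambda>q \<xi>. Phi F a b c q \<xi> $ I $ J) p \<xi> \<zeta> =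
    - ((Phi F a b c p \<xi> ** Phi F a b c p \<zeta>) $ I $ J - (Phi F a b c p \<zeta> ** Phi F a b c p \<xi>) $ I $ J)"

lemmas product_entries = matrix_matrix_mult_def sum_UNIV_Plus sum_012 vec_lambda_beta

lemma Maurer_Cartan_imp_relations:
  assumes "\<And>I J. MC_at I J (E1 p) (E2 p)"
  shows "structure_relations F a b c p"
proof -
  note M = assms[unfolded MC_at_def phi_entries product_entries]
  note S = phi_om_def phi_eta_def phi_theta_def om_E[OF p] wedge12_E[OF p] power2_eq_square
  have r1: "acov F a 1 1 p = - 2 * b 2 p"
    using M[of "Inl 1" "Inr 1", unfolded phi_entries ext_d_Et] by (simp add: S algebra_simps)
  have r2: "acov F a 4 2 p = - 2 * b 3 p"
    using M[of "Inl 2" "Inr 2", unfolded phi_entries ext_d_Et] by (simp add: S algebra_simps) algebra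
  have r3: "acov F a 3 1 p = acov F a 2 2 p + 2 * b 1 p"
    using M[of "Inl 1" "Inr 2", unfolded phi_entries ext_d_Et] by (simp add: S algebra_simps)
  have r4: "3 * (acov F a 3 1 p - acov F a 2 1 p) - 5 * (acov F a 2 2 p + acov F a 4 2 p) + 10 * b 1 p + 5 * b 3 p = 0"
    using M[of "Inl 0" "Inl 1", unfolded phi_entries ext_d_Om] by (simp add: S field_simps) algebra
  have r5: "5 * (acov F a 1 1 p + acov F a 3 1 p) - 3 * (acov F a 2 2 p - acov F a 3 2 p) + 10 * b 1 p - 5 * b 2 p = 0"
    using M[of "Inl 0" "Inl 2", unfolded phi_entries ext_d_Om] by (simp add: S field_simps) algebra
  have r6: "c 2 p = cov F 2 (b 1) 2 p - cov F 2 (b 2) 1 p - a 1 p * a 4 p + 2 / 5 * a 2 p * a 3 p + 3 / 5 * (a 3 p)\<^sup>2"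
    using M[of "Inl 1" "Inr 0", unfolded phi_entries ext_d_Et] by (simp add: S field_simps) algebra
  have r7: "c 1 p = - a 1 p * a 4 p + 3 / 5 * (a 2 p)\<^sup>2 + 2 / 5 * a 2 p * a 3 p - cov F 2 (b 1) 1 p - cov F 2 (b 3) 2 p"
    using M[of "Inl 2" "Inr 0", unfolded phi_entries ext_d_Et] by (simp add: S field_simps) algebra
  have r8: "cov F (8 / 3) (c 2) 1 p = cov F (8 / 3) (c 1) 2 p
       + 2 * (a 1 p * b 3 p - a 2 p * b 2 p + a 3 p * b 3 p - a 4 p * b 2 p)"
    using M[of "Inl 0" "Inr 0", unfolded phi_entries ext_d_Et] by (simp add: S field_simps) algebra
  have r4': "acov F a 2 2 p = - 3 / 2 * acov F a 2 1 p + 8 * b 1 p + 15 / 2 * b 3 p"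
    using r4 unfolding r3 r2 by (simp add: field_simps)
  have r5': "acov F a 3 2 p = 5 * b 2 p - 20 / 3 * b 1 p - 2 / 3 * acov F a 2 2 p"
    using r5 unfolding r1 r3 by (simp add: field_simps) algebra
  show ?thesis
    unfolding structure_relations_def using r1 r2 r3 r4' r5' r6 r7 r8 by blast
qed

lemma Om_holo: "holo_on N (\<lambda>q. Om i j q \<xi>)"
  using exhaust_012[of i] exhaust_012[of j]
  by (elim disjE; hypsubst; simp only: if_True if_False phi_om_def distinct_012 simp_thms; intro holo_abc om_holo)

lemma phi_eta_sym: "phi_eta a' b' c' w1 w2 i j = phi_eta a' b' c' w1 w2 j i"
  using exhaust_012[of i] exhaust_012[of j]
  by (elim disjE; hypsubst; simp only: if_True if_False phi_eta_def distinct_012 simp_thms)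

end

context coefficients_at
begin

text \<open>The converse direction, needed for existence: it makes the form with deformed
  coefficients integrable to a frame.\<close>

lemma relations_imp_Maurer_Cartan:
  assumes "structure_relations F a b c p"
  shows "MC_at I J \<xi> \<zeta>"
proof -
  note R = assms[unfolded structure_relations_def, THEN conjunct1]
    assms[unfolded structure_relations_def, THEN conjunct2, THEN conjunct1]
    assms[unfolded structure_relations_def, THEN conjunct2, THEN conjunct2, THEN conjunct1]
    assms[unfolded structure_relations_def, THEN conjunct2, THEN conjunct2, THEN conjunct2, THEN conjunct1]
    assms[unfolded structure_relations_def, THEN conjunct2, THEN conjunct2, THEN conjunct2, THEN conjunct2, THEN conjunct1]
    assms[unfolded structure_relations_def, THEN conjunct2, THEN conjunct2, THEN conjunct2, THEN conjunct2, THEN conjunct2, THEN conjunct1]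
    assms[unfolded structure_relations_def, THEN conjunct2, THEN conjunct2, THEN conjunct2, THEN conjunct2, THEN conjunct2, THEN conjunct2, THEN conjunct1]
    assms[unfolded structure_relations_def, THEN conjunct2, THEN conjunct2, THEN conjunct2, THEN conjunct2, THEN conjunct2, THEN conjunct2, THEN conjunct2]
  have neg: "ext_d (\<lambda>q \<xi>. - Om i j q \<xi>) p \<xi> \<zeta> = - ext_d (Om i j) p \<xi> \<zeta>" for i j
    by (rule ext_d_uminus[OF Om_holo p])
  have sym: "Et 0 1 = Et 1 0" "Et 0 2 = Et 2 0" "Et 2 1 = Et 1 2"
    by (intro ext phi_eta_sym)+
  have ll: "MC_at (Inl i) (Inl j) \<xi> \<zeta>" for i j
    unfolding MC_at_def phi_entries product_entries
    using exhaust_012[of i] exhaust_012[of j]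
    by (elim disjE; hypsubst; simp only: ext_d_Om; (simp only: phi_om_def phi_eta_def phi_theta_def wedge12_def distinct_012 simp_thms if_True if_False)?; (simp only: R \<kappa>)?; simp add: algebra_simps power2_eq_square)
  have rr: "MC_at (Inr i) (Inr j) \<xi> \<zeta>" for i j
    unfolding MC_at_def phi_entries product_entries neg
    using exhaust_012[of i] exhaust_012[of j]
    by (elim disjE; hypsubst; simp only: ext_d_Om; (simp only: phi_om_def phi_eta_def phi_theta_def wedge12_def distinct_012 simp_thms if_True if_False)?; (simp only: R \<kappa>)?; simp add: algebra_simps power2_eq_square)
  have rl: "MC_at (Inr i) (Inl j) \<xi> \<zeta>" for i j
    unfolding MC_at_def phi_entries product_entries
    using exhaust_012[of i] exhaust_012[of j]
    by (elim disjE; hypsubst; simp only: ext_d_Th; (simp only: phi_om_def phi_eta_def phi_theta_def wedge12_def distinct_012 simp_thms if_True if_False)?; (simp only: R \<kappa>)?; simp add: algebra_simps power2_eq_square)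
  have lr: "MC_at (Inl i) (Inr j) \<xi> \<zeta>" for i j
    unfolding MC_at_def phi_entries product_entries
    using exhaust_012[of i] exhaust_012[of j]
    by (elim disjE; hypsubst; (unfold sym)?; simp only: ext_d_Et; (simp only: phi_om_def phi_eta_def phi_theta_def wedge12_def distinct_012 simp_thms if_True if_False)?; (simp only: R \<kappa>)?; simp add: algebra_simps power2_eq_square)
  show ?thesis by (cases I; cases J) (simp_all add: ll lr rl rr)
qed

end

section \<open>Deformations and the closed system\<close>

locale leg_frame = structured_coframe N F "\<lambda>p. 6 / 5 * (a 3 p - a 2 p)"
  for N :: "pt set" and F :: "pt \<Rightarrow> mat6" and a :: "4 \<Rightarrow> fn" +
  fixes b :: "3 \<Rightarrow> fn" and c :: "2 \<Rightarrow> fn"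
  assumes a_holo: "\<And>i. holo_on N (a i)" and b_holo: "\<And>i. holo_on N (b i)" and c_holo: "\<And>i. holo_on N (c i)"
    and relations: "p \<in> N \<Longrightarrow> structure_relations F a b c p"

lemma adapted5_leg_frame:
  assumes "open N" "adapted5 N x F a b c"
  shows "leg_frame N F a b c"
proof -
  interpret structured_coframe N F "\<lambda>p. 6 / 5 * (a 3 p - a 2 p)"
    by (rule adapted5_structured_coframe[OF assms])
  show ?thesis
  proof
    fix p assume p: "p \<in> N"
    interpret coefficients_at N F "\<lambda>p. 6 / 5 * (a 3 p - a 2 p)" a b c p
      by unfold_locales (auto simp: adapted5_coefficients[OF assms(2)] p)
    show "structure_relations F a b c p"
    proof (rule Maurer_Cartan_imp_relations)
      fix I J
      have "D (\<lambda>q. Phi F a b c q \<xi> $ I $ J) p = D (\<lambda>q. mc F q \<xi> $ I $ J) p" for \<xi>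
        by (rule D_cong[OF open_N p]) (simp add: adapted5_mc[OF assms])
      then have "ext_d (\<lambda>q \<xi>. Phi F a b c q \<xi> $ I $ J) p \<xi> \<zeta> = ext_d (\<lambda>q \<xi>. mc F q \<xi> $ I $ J) p \<xi> \<zeta>" for \<xi> \<zeta>
        by (simp add: ext_d_def)
      then show "MC_at I J (E1 p) (E2 p)"
        unfolding MC_at_def using ext_d_entry[OF assms p] by simp
    qed
  qed (rule adapted5_coefficients[OF assms(2)])+
qed

text \<open>The line of shifts that preserve \<open>a 1 + 2 * a 2\<close> and
  \<open>2 * a 3 + a 4\<close>, the coefficients of \<open>Psi\<close>, together with
  \<open>a 3 - a 2\<close>, the web curvature. Three conditions on four coefficients leave the
  single parameter \<open>u\<close>.\<close>

definition deformed_a :: "(4 \<Rightarrow> fn) \<Rightarrow> fn \<Rightarrow> 4 \<Rightarrow> fn" where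
  "deformed_a a u i = (if i = 1 \<or> i = 4 then (\<lambda>p. a i p - 2 * u p) else (\<lambda>p. a i p + u p))"

definition deformed_b :: "(3 \<Rightarrow> fn) \<Rightarrow> fn \<Rightarrow> 3 \<Rightarrow> fn" where
  "deformed_b b v i = (if i = 3 then (\<lambda>p. b i p + v p) else (\<lambda>p. b i p - v p))"

text \<open>In the relations for \<open>c 2\<close> and \<open>c 1\<close> the shift of
  \<open>a\<close> changes \<open>3/5 * (a 3)^2\<close> and \<open>3/5 * (a 2)^2\<close>
  respectively. The difference of these changes is \<open>6/5 * (a 3 - a 2) * u\<close>, which is
  why one parameter \<open>w\<close> suffices for both coefficients.\<close>

definition deformed_c :: "(4 \<Rightarrow> fn) \<Rightarrow> (2 \<Rightarrow> fn) \<Rightarrow> fn \<Rightarrow> fn \<Rightarrow> 2 \<Rightarrow> fn" where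
  "deformed_c a c u w i = (if i = 1 then (\<lambda>p. c i p + w p) else (\<lambda>p. c i p + (w p + 6 / 5 * ((a 3 p - a 2 p) * u p))))"

lemma deformed_simps:
  "deformed_a a u 1 = (\<lambda>p. a 1 p - 2 * u p)" "deformed_a a u 2 = (\<lambda>p. a 2 p + u p)"
  "deformed_a a u 3 = (\<lambda>p. a 3 p + u p)" "deformed_a a u 4 = (\<lambda>p. a 4 p - 2 * u p)"
  "deformed_b b v 1 = (\<lambda>p. b 1 p - v p)" "deformed_b b v 2 = (\<lambda>p. b 2 p - v p)"
  "deformed_b b v 3 = (\<lambda>p. b 3 p + v p)"
  "deformed_c a c u w 1 = (\<lambda>p. c 1 p + w p)"
  "deformed_c a c u w 2 = (\<lambda>p. c 2 p + (w p + 6 / 5 * ((a 3 p - a 2 p) * u p)))"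
  by (simp_all add: deformed_a_def deformed_b_def deformed_c_def)

lemma Phi_deformed:
  "Phi F (deformed_a a u) (deformed_b b v) (deformed_c a c u w) p \<xi> = Phi F a b c p \<xi> + delta_mc F a u v w p \<xi>"
proof -
  have om: "phi_om (\<lambda>i. deformed_a a u i p) w1 w2 w0 i j = phi_om (\<lambda>i. a i p) w1 w2 w0 i j + delta_om F u i j p \<xi>"
    if "w1 = om1 F p \<xi>" "w2 = om2 F p \<xi>" for i j w1 w2 w0
    using exhaust_012[of i] exhaust_012[of j] that
    by (elim disjE; hypsubst; simp only: phi_om_def delta_om_def distinct_012 simp_thms if_True if_False deformed_simps;
        simp add: algebra_simps)
  have et: "phi_eta (\<lambda>i. deformed_a a u i p) (\<lambda>i. deformed_b b v i p) (\<lambda>i. deformed_c a c u w i p) w1 w2 i j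
      = phi_eta (\<lambda>i. a i p) (\<lambda>i. b i p) (\<lambda>i. c i p) w1 w2 i j + delta_eta F a u v w i j p \<xi>"
    if "w1 = om1 F p \<xi>" "w2 = om2 F p \<xi>" for i j w1 w2
    using exhaust_012[of i] exhaust_012[of j] that
    by (elim disjE; hypsubst; simp only: phi_eta_def delta_eta_def Let_def distinct_012 simp_thms if_True if_False deformed_simps;
        simp add: algebra_simps)
  show ?thesis
    by (rule mat6_eqI; simp only: phi_entries vector_add_component om[OF refl refl] et[OF refl refl])
      (simp_all add: delta_mc_def)
qed

text \<open>The right-hand sides of the structure equation. Squares are written as products so that
  the product rule for \<open>cov\<close> applies directly.\<close>

definition V1 :: "(4 \<Rightarrow> fn) \<Rightarrow> fn \<Rightarrow> fn \<Rightarrow> fn" where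
  "V1 a u w q = 3 / 2 * (u q * u q) + (3 / 5 * a 3 q - a 4 q - a 1 q - 8 / 5 * a 2 q) * u q + 1 / 2 * w q"

definition V2 :: "(4 \<Rightarrow> fn) \<Rightarrow> fn \<Rightarrow> fn \<Rightarrow> fn" where
  "V2 a u w q = (- 3 / 2) * (u q * u q) + (a 3 q + a 4 q + a 1 q) * u q + (- 1 / 2) * w q"

definition W1 :: "(pt \<Rightarrow> mat6) \<Rightarrow> (4 \<Rightarrow> fn) \<Rightarrow> (3 \<Rightarrow> fn) \<Rightarrow> fn \<Rightarrow> fn \<Rightarrow> fn" where
  "W1 F a b u v q = (- 2) * (u q * v q) + ((- 12 / 5) * a 3 q + 22 / 5 * a 2 q + a 4 q + a 1 q) * v q
    + (24 * b 1 q - 4 * b 2 q + 15 * b 3 q + acov F a 4 1 q + acov F a 1 2 q - 3 * acov F a 2 1 q) * u q"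

definition W2 :: "(pt \<Rightarrow> mat6) \<Rightarrow> (4 \<Rightarrow> fn) \<Rightarrow> (3 \<Rightarrow> fn) \<Rightarrow> fn \<Rightarrow> fn \<Rightarrow> fn" where
  "W2 F a b u v q = 2 * (u q * v q) + ((- 28 / 5) * a 3 q + 18 / 5 * a 2 q - a 4 q - a 1 q) * v q
    + (36 * b 1 q - 6 * b 2 q + 26 * b 3 q + acov F a 4 1 q + acov F a 1 2 q - 6 * acov F a 2 1 q) * u q"

definition solves_at :: "(pt \<Rightarrow> mat6) \<Rightarrow> (4 \<Rightarrow> fn) \<Rightarrow> (3 \<Rightarrow> fn) \<Rightarrow> fn \<Rightarrow> fn \<Rightarrow> fn \<Rightarrow> pt \<Rightarrow> bool" where
  "solves_at F a b u v w p \<longleftrightarrow>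
     cov F (4 / 3) u 1 p = - v p \<and> cov F (4 / 3) u 2 p = v p \<and>
     cov F 2 v 1 p = V1 a u w p \<and> cov F 2 v 2 p = V2 a u w p \<and>
     cov F (8 / 3) w 1 p = W1 F a b u v p \<and> cov F (8 / 3) w 2 p = W2 F a b u v p"

context leg_frame
begin

abbreviation "\<kappa> p \<equiv> 6 / 5 * (a 3 p - a 2 p)"

lemma acov_holo: "holo_on N (acov F a i k)"
  unfolding acov_def[abs_def] by (rule cov_holo[OF a_holo])

lemma acov_holo': "holo_on N (\<lambda>q. acov F a i k q)"
  by (rule acov_holo)

lemmas holo_intros = holo_on_rules a_holo b_holo c_holo acov_holo acov_holo'

text \<open>The relations solved as rewrite rules: of the eight derivatives of the \<open>a\<close>
  only \<open>a_12\<close>, \<open>a_21\<close> and \<open>a_41\<close> survive, so that later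
  identities become polynomial identities in independent quantities.\<close>

lemma rel:
  assumes "p \<in> N"
  shows "acov F a 1 1 p = - 2 * b 2 p" "acov F a 4 2 p = - 2 * b 3 p"
    "acov F a 2 2 p = - 3 / 2 * acov F a 2 1 p + 8 * b 1 p + 15 / 2 * b 3 p"
    "acov F a 3 1 p = - 3 / 2 * acov F a 2 1 p + 10 * b 1 p + 15 / 2 * b 3 p"
    "acov F a 3 2 p = acov F a 2 1 p + 5 * b 2 p - 12 * b 1 p - 5 * b 3 p"
    "c 2 p = cov F 2 (b 1) 2 p - cov F 2 (b 2) 1 p - a 1 p * a 4 p + 2 / 5 * a 2 p * a 3 p + 3 / 5 * (a 3 p)\<^sup>2"
    "c 1 p = - a 1 p * a 4 p + 3 / 5 * (a 2 p)\<^sup>2 + 2 / 5 * a 2 p * a 3 p - cov F 2 (b 1) 1 p - cov F 2 (b 3) 2 p"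
    "cov F (8 / 3) (c 2) 1 p = cov F (8 / 3) (c 1) 2 p + 2 * (a 1 p * b 3 p - a 2 p * b 2 p + a 3 p * b 3 p - a 4 p * b 2 p)"
proof -
  note R = relations[OF assms, unfolded structure_relations_def]
  have r4: "acov F a 2 2 p = - 3 / 2 * acov F a 2 1 p + 8 * b 1 p + 15 / 2 * b 3 p"
    using R by blast
  have r3: "acov F a 3 1 p = acov F a 2 2 p + 2 * b 1 p" using R by blast
  have r5: "acov F a 3 2 p = 5 * b 2 p - 20 / 3 * b 1 p - 2 / 3 * acov F a 2 2 p" using R by blast
  show "acov F a 3 1 p = - 3 / 2 * acov F a 2 1 p + 10 * b 1 p + 15 / 2 * b 3 p"
    unfolding r3 r4 by simp
  show "acov F a 3 2 p = acov F a 2 1 p + 5 * b 2 p - 12 * b 1 p - 5 * b 3 p"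
    unfolding r5 r4 by (simp add: algebra_simps)
qed (use relations[OF assms, unfolded structure_relations_def] in blast)+

lemma structure_equation_iff:
  "structure_equation N F a b u v w \<longleftrightarrow> holo_on N u \<and> holo_on N v \<and> holo_on N w \<and> (\<forall>p\<in>N. solves_at F a b u v w p)"
proof -
  have eq: "(\<forall>\<xi>. D h p \<xi> + r * h p * om00 F p \<xi> = x * om1 F p \<xi> + y * om2 F p \<xi>) \<longleftrightarrow> cov F r h 1 p = x \<and> cov F r h 2 p = y"
    if "holo_on N h" "p \<in> N" for h p r x y
  proof -
    have "D h p \<xi> + r * h p * om00 F p \<xi> = cov F r h 1 p * om1 F p \<xi> + cov F r h 2 p * om2 F p \<xi>" for \<xi>
      by (simp add: D_cov[OF that, of _ r])
    then show ?thesis using forms_eq_iff[OF that(2)] by simp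
  qed
  have "(\<forall>\<xi>. D u p \<xi> + 4 / 3 * u p * om00 F p \<xi> = v p * (- om1 F p \<xi> + om2 F p \<xi>) \<and>
           D v p \<xi> + 2 * v p * om00 F p \<xi> =
             (3 / 2 * (u p)\<^sup>2 + (3 / 5 * a 3 p - a 4 p - a 1 p - 8 / 5 * a 2 p) * u p + 1 / 2 * w p) * om1 F p \<xi> +
             (- 3 / 2 * (u p)\<^sup>2 + (a 3 p + a 4 p + a 1 p) * u p - 1 / 2 * w p) * om2 F p \<xi> \<and>
           D w p \<xi> + 8 / 3 * w p * om00 F p \<xi> =
            (- 2 * u p * v p + (- 12 / 5 * a 3 p + 22 / 5 * a 2 p + a 4 p + a 1 p) * v p +
                  (24 * b 1 p - 4 * b 2 p + 15 * b 3 p + acov F a 4 1 p + acov F a 1 2 p - 3 * acov F a 2 1 p) * u p) * om1 F p \<xi> + 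
            (2 * u p * v p + (- 28 / 5 * a 3 p + 18 / 5 * a 2 p - a 4 p - a 1 p) * v p +
                  (36 * b 1 p - 6 * b 2 p + 26 * b 3 p + acov F a 4 1 p + acov F a 1 2 p - 6 * acov F a 2 1 p) * u p) * om2 F p \<xi>)
      \<longleftrightarrow> solves_at F a b u v w p" if h: "holo_on N u" "holo_on N v" "holo_on N w" and p: "p \<in> N" for p
  proof -
    have "solves_at F a b u v w p \<longleftrightarrow> 
      (\<forall>\<xi>. D u p \<xi> + 4 / 3 * u p * om00 F p \<xi> = - v p * om1 F p \<xi> + v p * om2 F p \<xi>) \<and>
      (\<forall>\<xi>. D v p \<xi> + 2 * v p * om00 F p \<xi> = V1 a u w p * om1 F p \<xi> + V2 a u w p * om2 F p \<xi>) \<and>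
      (\<forall>\<xi>. D w p \<xi> + 8 / 3 * w p * om00 F p \<xi> = W1 F a b u v p * om1 F p \<xi> + W2 F a b u v p * om2 F p \<xi>)"
      unfolding solves_at_def eq[OF h(1) p] eq[OF h(2) p] eq[OF h(3) p] by blast
    also have "\<dots> \<longleftrightarrow> (\<forall>\<xi>. D u p \<xi> + 4 / 3 * u p * om00 F p \<xi> = - v p * om1 F p \<xi> + v p * om2 F p \<xi> \<and>
        D v p \<xi> + 2 * v p * om00 F p \<xi> = V1 a u w p * om1 F p \<xi> + V2 a u w p * om2 F p \<xi> \<and>
        D w p \<xi> + 8 / 3 * w p * om00 F p \<xi> = W1 F a b u v p * om1 F p \<xi> + W2 F a b u v p * om2 F p \<xi>)" by blast
    finally show ?thesis
      unfolding V1_def V2_def W1_def W2_def by (simp add: algebra_simps power2_eq_square)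
  qed
  then show ?thesis
    unfolding structure_equation_def Let_def by blast
qed

context
  fixes u v w :: fn
  assumes u: "holo_on N u" and v: "holo_on N v" and w: "holo_on N w"
begin

lemmas huvw = holo_intros u v w

lemma cov_uv_product:
  assumes p: "p \<in> N"
  shows "cov F (8/3) (\<lambda>q. u q * u q) k p = 2 * (u p * cov F (4/3) u k p)"
    "cov F (10/3) (\<lambda>q. u q * v q) k p = cov F (4/3) u k p * v p + u p * cov F 2 v k p"
    "holo_on N f \<Longrightarrow> cov F (8/3) (\<lambda>q. f q * u q) k p = cov F (4/3) f k p * u p + f p * cov F (4/3) u k p"
    "holo_on N f \<Longrightarrow> cov F (10/3) (\<lambda>q. f q * v q) k p = cov F (4/3) f k p * v p + f p * cov F 2 v k p"
    "holo_on N f \<Longrightarrow> cov F (10/3) (\<lambda>q. f q * u q) k p = cov F 2 f k p * u p + f p * cov F (4/3) u k p"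
  using cov_mult[OF u u p, of "8/3" "4/3" "4/3" k] cov_mult[OF u v p, of "10/3" "4/3" "2" k]
    cov_mult[OF _ u p, of f "8/3" "4/3" "4/3" k] cov_mult[OF _ v p, of f "10/3" "4/3" "2" k]
    cov_mult[OF _ u p, of f "10/3" "2" "4/3" k]
  by simp_all

lemma cov_V:
  assumes p: "p \<in> N"
  shows "cov F (8/3) (V1 a u w) k p = 3 * (u p * cov F (4/3) u k p)
      + ((3 / 5 * acov F a 3 k p - acov F a 4 k p - acov F a 1 k p - 8 / 5 * acov F a 2 k p) * u p
      + (3 / 5 * a 3 p - a 4 p - a 1 p - 8 / 5 * a 2 p) * cov F (4/3) u k p) + 1 / 2 * cov F (8/3) w k p"
    "cov F (8/3) (V2 a u w) k p = - 3 * (u p * cov F (4/3) u k p)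
      + ((acov F a 3 k p + acov F a 4 k p + acov F a 1 k p) * u p
      + (a 3 p + a 4 p + a 1 p) * cov F (4/3) u k p) - 1 / 2 * cov F (8/3) w k p"
proof -
  note C = cov_add[OF _ _ p] cov_diff[OF _ _ p] cov_cmult[OF _ p] cov_uv_product[OF p] acov_def
  show "cov F (8/3) (V1 a u w) k p = 3 * (u p * cov F (4/3) u k p)
      + ((3 / 5 * acov F a 3 k p - acov F a 4 k p - acov F a 1 k p - 8 / 5 * acov F a 2 k p) * u p
      + (3 / 5 * a 3 p - a 4 p - a 1 p - 8 / 5 * a 2 p) * cov F (4/3) u k p) + 1 / 2 * cov F (8/3) w k p"
    unfolding V1_def[abs_def] by (simp only: C huvw) simp
  show "cov F (8/3) (V2 a u w) k p = - 3 * (u p * cov F (4/3) u k p)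
      + ((acov F a 3 k p + acov F a 4 k p + acov F a 1 k p) * u p
      + (a 3 p + a 4 p + a 1 p) * cov F (4/3) u k p) - 1 / 2 * cov F (8/3) w k p"
    unfolding V2_def[abs_def] by (simp only: C huvw) simp
qed

lemma cov_W:
  assumes p: "p \<in> N"
  shows "cov F (10/3) (W1 F a b u v) k p = - 2 * (cov F (4/3) u k p * v p + u p * cov F 2 v k p)
      + ((- 12 / 5 * acov F a 3 k p + 22 / 5 * acov F a 2 k p + acov F a 4 k p + acov F a 1 k p) * v p
      + (- 12 / 5 * a 3 p + 22 / 5 * a 2 p + a 4 p + a 1 p) * cov F 2 v k p)
      + ((24 * cov F 2 (b 1) k p - 4 * cov F 2 (b 2) k p + 15 * cov F 2 (b 3) k p + cov F 2 (acov F a 4 1) k p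
          + cov F 2 (acov F a 1 2) k p - 3 * cov F 2 (acov F a 2 1) k p) * u p
      + (24 * b 1 p - 4 * b 2 p + 15 * b 3 p + acov F a 4 1 p + acov F a 1 2 p - 3 * acov F a 2 1 p) * cov F (4/3) u k p)"
    "cov F (10/3) (W2 F a b u v) k p = 2 * (cov F (4/3) u k p * v p + u p * cov F 2 v k p)
      + ((- 28 / 5 * acov F a 3 k p + 18 / 5 * acov F a 2 k p - acov F a 4 k p - acov F a 1 k p) * v p
      + (- 28 / 5 * a 3 p + 18 / 5 * a 2 p - a 4 p - a 1 p) * cov F 2 v k p)
      + ((36 * cov F 2 (b 1) k p - 6 * cov F 2 (b 2) k p + 26 * cov F 2 (b 3) k p + cov F 2 (acov F a 4 1) k p
          + cov F 2 (acov F a 1 2) k p - 6 * cov F 2 (acov F a 2 1) k p) * u p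
      + (36 * b 1 p - 6 * b 2 p + 26 * b 3 p + acov F a 4 1 p + acov F a 1 2 p - 6 * acov F a 2 1 p) * cov F (4/3) u k p)"
proof -
  note C = cov_add[OF _ _ p] cov_diff[OF _ _ p] cov_cmult[OF _ p] cov_uv_product[OF p]
  have A: "cov F (4/3) (a i) k p = acov F a i k p" for i by (simp add: acov_def)
  show "cov F (10/3) (W1 F a b u v) k p = - 2 * (cov F (4/3) u k p * v p + u p * cov F 2 v k p)
      + ((- 12 / 5 * acov F a 3 k p + 22 / 5 * acov F a 2 k p + acov F a 4 k p + acov F a 1 k p) * v p
      + (- 12 / 5 * a 3 p + 22 / 5 * a 2 p + a 4 p + a 1 p) * cov F 2 v k p)
      + ((24 * cov F 2 (b 1) k p - 4 * cov F 2 (b 2) k p + 15 * cov F 2 (b 3) k p + cov F 2 (acov F a 4 1) k p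
          + cov F 2 (acov F a 1 2) k p - 3 * cov F 2 (acov F a 2 1) k p) * u p
      + (24 * b 1 p - 4 * b 2 p + 15 * b 3 p + acov F a 4 1 p + acov F a 1 2 p - 3 * acov F a 2 1 p) * cov F (4/3) u k p)"
    unfolding W1_def[abs_def] by (simp only: C huvw A)
  show "cov F (10/3) (W2 F a b u v) k p = 2 * (cov F (4/3) u k p * v p + u p * cov F 2 v k p)
      + ((- 28 / 5 * acov F a 3 k p + 18 / 5 * acov F a 2 k p - acov F a 4 k p - acov F a 1 k p) * v p
      + (- 28 / 5 * a 3 p + 18 / 5 * a 2 p - a 4 p - a 1 p) * cov F 2 v k p)
      + ((36 * cov F 2 (b 1) k p - 6 * cov F 2 (b 2) k p + 26 * cov F 2 (b 3) k p + cov F 2 (acov F a 4 1) k p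
          + cov F 2 (acov F a 1 2) k p - 6 * cov F 2 (acov F a 2 1) k p) * u p
      + (36 * b 1 p - 6 * b 2 p + 26 * b 3 p + acov F a 4 1 p + acov F a 1 2 p - 6 * acov F a 2 1 p) * cov F (4/3) u k p)"
    unfolding W2_def[abs_def] by (simp only: C huvw A)
qed

end

end

context leg_frame
begin

context
  fixes u v w :: fn
  assumes u: "holo_on N u" and v: "holo_on N v" and w: "holo_on N w"
begin

text \<open>Subtract the relations of the original surface. Those for \<open>a\<close> give both
  derivatives of \<open>u\<close>; those for \<open>c\<close> and the last one contain derivatives
  of \<open>v\<close> and \<open>w\<close> only through the differences of the first and second
  one.\<close>

lemma deformed_relations_iff:
  assumes p: "p \<in> N"
  shows "structure_relations F (deformed_a a u) (deformed_b b v) (deformed_c a c u w) p \<longleftrightarrow>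
    cov F (4/3) u 1 p = - v p \<and> cov F (4/3) u 2 p = v p \<and>
    cov F 2 v 1 p - cov F 2 v 2 p = V1 a u w p - V2 a u w p \<and>
    cov F (8/3) w 1 p - cov F (8/3) w 2 p = W1 F a b u v p - W2 F a b u v p"
proof -
  let ?u1 = "cov F (4/3) u 1 p" and ?u2 = "cov F (4/3) u 2 p" and ?v1 = "cov F 2 v 1 p" and ?v2 = "cov F 2 v 2 p"
    and ?w1 = "cov F (8/3) w 1 p" and ?w2 = "cov F (8/3) w 2 p"
  note C = cov_add[OF _ _ p] cov_diff[OF _ _ p] cov_cmult[OF _ p] cov_uv_product[OF u v w p]
  have acov': "acov F (deformed_a a u) 1 k p = acov F a 1 k p - 2 * cov F (4/3) u k p"
    "acov F (deformed_a a u) 2 k p = acov F a 2 k p + cov F (4/3) u k p"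
    "acov F (deformed_a a u) 3 k p = acov F a 3 k p + cov F (4/3) u k p"
    "acov F (deformed_a a u) 4 k p = acov F a 4 k p - 2 * cov F (4/3) u k p" for k
    by (simp_all only: acov_def deformed_simps C holo_intros u v w)
  have bcov': "cov F 2 (deformed_b b v 1) k p = cov F 2 (b 1) k p - cov F 2 v k p"
    "cov F 2 (deformed_b b v 2) k p = cov F 2 (b 2) k p - cov F 2 v k p"
    "cov F 2 (deformed_b b v 3) k p = cov F 2 (b 3) k p + cov F 2 v k p" for k
    by (simp_all only: deformed_simps C holo_intros u v w)
  have ccov': "cov F (8/3) (deformed_c a c u w 1) k p = cov F (8/3) (c 1) k p + cov F (8/3) w k p"
    "cov F (8/3) (deformed_c a c u w 2) k p = cov F (8/3) (c 2) k p + (cov F (8/3) w k p +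
       6 / 5 * ((acov F a 3 k p - acov F a 2 k p) * u p + (a 3 p - a 2 p) * cov F (4/3) u k p))" for k
    by (simp_all only: deformed_simps C holo_intros u v w acov_def)
  note S = structure_relations_def acov' bcov' ccov'
  show ?thesis (is "?L \<longleftrightarrow> ?R")
  proof
    assume L: ?L
    note L1 = L[unfolded structure_relations_def, THEN conjunct1]
      and L2 = L[unfolded structure_relations_def, THEN conjunct2, THEN conjunct1]
      and L7 = L[unfolded structure_relations_def, THEN conjunct2, THEN conjunct2, THEN conjunct2, THEN conjunct2, THEN conjunct2, THEN conjunct2, THEN conjunct1]
      and L8 = L[unfolded structure_relations_def, THEN conjunct2, THEN conjunct2, THEN conjunct2, THEN conjunct2, THEN conjunct2, THEN conjunct2, THEN conjunct2]
    have u1: "?u1 = - v p"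
      using L1 unfolding acov' unfolding deformed_simps rel[OF p] by algebra
    have u2: "?u2 = v p"
      using L2 unfolding acov' unfolding deformed_simps rel[OF p] by algebra
    have v: "?v1 - ?v2 = V1 a u w p - V2 a u w p"
      using L7 unfolding bcov' unfolding deformed_simps rel[OF p] V1_def V2_def by (simp add: field_simps power2_eq_square) algebra
    have w: "?w1 - ?w2 = W1 F a b u v p - W2 F a b u v p"
      using L8 unfolding ccov' unfolding deformed_simps rel[OF p] u1 u2 W1_def W2_def by (simp add: field_simps) algebra
    show ?R using u1 u2 v w by blast
  next
    assume R: ?R
    then have u1: "?u1 = - v p" and u2: "?u2 = v p" by blast+
    have v: "?v1 = ?v2 + (V1 a u w p - V2 a u w p)" and w: "?w1 = ?w2 + (W1 F a b u v p - W2 F a b u v p)"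
      using R by algebra+
    show ?L
      unfolding S unfolding u1 u2 v w deformed_simps rel[OF p] V1_def V2_def W1_def W2_def
      by (intro conjI; simp add: power2_eq_square field_simps)
  qed
qed

text \<open>The compatibility condition for \<open>v\<close> becomes an identity once the structure
  equation and the relations are substituted, so d(dv) = 0 imposes nothing new on solutions.\<close>

lemma ddv_at:
  assumes p: "p \<in> N" and s: "solves_at F a b u v w p"
  shows "cov F (8/3) (V2 a u w) 1 p - cov F (8/3) (V1 a u w) 2 p = 2 * \<kappa> p * v p"
proof -
  note s' = s[unfolded solves_at_def, THEN conjunct1]
    s[unfolded solves_at_def, THEN conjunct2, THEN conjunct1]
    s[unfolded solves_at_def, THEN conjunct2, THEN conjunct2, THEN conjunct1]
    s[unfolded solves_at_def, THEN conjunct2, THEN conjunct2, THEN conjunct2, THEN conjunct1]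
    s[unfolded solves_at_def, THEN conjunct2, THEN conjunct2, THEN conjunct2, THEN conjunct2, THEN conjunct1]
    s[unfolded solves_at_def, THEN conjunct2, THEN conjunct2, THEN conjunct2, THEN conjunct2, THEN conjunct2]
  show ?thesis
    unfolding cov_V[OF u v w p] rel[OF p] s' V1_def V2_def W1_def W2_def by (simp add: field_simps)
qed

end

end

section \<open>The integrability condition\<close>

primrec jsum :: "jexpr list \<Rightarrow> jexpr" where
  "jsum [] = Num 0"
| "jsum (e # es) = Plus e (jsum es)"

text \<open>Read off from \<open>d(dw\<^sub>1) = 0\<close>, divided by 3.\<close>

definition integrability_expr :: jexpr where
  "integrability_expr = jsum
    [Times (Num (32/15)) (Times (JA 1 []) (JA 2 [])), Times (Num (-32/15)) (Times (JA 1 []) (JA 3 [])),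
     Times (Num (-1/3)) (JA 1 [2, 1]), Times (Num (1/3)) (JA 1 [2, 2]),
     Times (Num (48/25)) (Times (JA 2 []) (JA 2 [])), Times (Num (-56/25)) (Times (JA 2 []) (JA 3 [])),
     Times (Num (32/15)) (Times (JA 2 []) (JA 4 [])), Times (Num (-44/15)) (Times (JA 2 []) U0),
     Times (Num 2) (JA 2 [1, 1]), Times (Num (-1)) (JA 2 [1, 2]),
     Times (Num (8/25)) (Times (JA 3 []) (JA 3 [])), Times (Num (-32/15)) (Times (JA 3 []) (JA 4 [])),
     Times (Num (44/15)) (Times (JA 3 []) U0),
     Times (Num (-1/3)) (JA 4 [1, 1]), Times (Num (1/3)) (JA 4 [1, 2]),
     Times (Num (-12)) (JB 1 [1]), Times (Num 8) (JB 1 [2]), Times (Num 2) (JB 2 [1]), Times (Num (-4/3)) (JB 2 [2]),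
     Times (Num (-26/3)) (JB 3 [1]), Times (Num 5) (JB 3 [2])]"

lemma jval_integrability_expr:
  "jval F a b c u integrability_expr p =
     32/15 * (a 1 p * a 2 p) - 32/15 * (a 1 p * a 3 p) - 1/3 * cov F 2 (acov F a 1 2) 1 p + 1/3 * cov F 2 (acov F a 1 2) 2 p
     + 48/25 * (a 2 p * a 2 p) - 56/25 * (a 2 p * a 3 p) + 32/15 * (a 2 p * a 4 p) - 44/15 * (a 2 p * u p)
     + 2 * cov F 2 (acov F a 2 1) 1 p - cov F 2 (acov F a 2 1) 2 p
     + 8/25 * (a 3 p * a 3 p) - 32/15 * (a 3 p * a 4 p) + 44/15 * (a 3 p * u p)
     - 1/3 * cov F 2 (acov F a 4 1) 1 p + 1/3 * cov F 2 (acov F a 4 1) 2 p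
     - 12 * cov F 2 (b 1) 1 p + 8 * cov F 2 (b 1) 2 p + 2 * cov F 2 (b 2) 1 p - 4/3 * cov F 2 (b 2) 2 p
     - 26/3 * cov F 2 (b 3) 1 p + 5 * cov F 2 (b 3) 2 p"
proof -
  have w: "(4/3 :: complex) + 2/3 = 2" by simp
  have A: "cov F (4/3) (a i) k = acov F a i k" for i k by (simp add: acov_def fun_eq_iff)
  show ?thesis
    unfolding integrability_expr_def
    by (simp only: jsum.simps jval.simps cov_jet.simps w A) (simp add: of_rat_divide of_rat_minus)
qed

definition web_coefficient :: "(pt \<Rightarrow> mat6) \<Rightarrow> (4 \<Rightarrow> fn) \<Rightarrow> (3 \<Rightarrow> fn) \<Rightarrow> fn" where
  "web_coefficient F a b p = - 60 * b 1 p + 8 * b 2 p - 42 * b 3 p - acov F a 4 1 p - acov F a 1 2 p + 10 * acov F a 2 1 p"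

context leg_frame
begin

context
  fixes u v w :: fn and p
  assumes u: "holo_on N u" and v: "holo_on N v" and w: "holo_on N w"
    and p: "p \<in> N" and s: "solves_at F a b u v w p"
begin

lemmas solves_at_conjuncts = s[unfolded solves_at_def, THEN conjunct1]
    s[unfolded solves_at_def, THEN conjunct2, THEN conjunct1]
    s[unfolded solves_at_def, THEN conjunct2, THEN conjunct2, THEN conjunct1]
    s[unfolded solves_at_def, THEN conjunct2, THEN conjunct2, THEN conjunct2, THEN conjunct1]
    s[unfolded solves_at_def, THEN conjunct2, THEN conjunct2, THEN conjunct2, THEN conjunct2, THEN conjunct1]
    s[unfolded solves_at_def, THEN conjunct2, THEN conjunct2, THEN conjunct2, THEN conjunct2, THEN conjunct2]

lemma ddu_at: "cov F 2 v 1 p - cov F 2 (\<lambda>q. - v q) 2 p = 4 / 3 * \<kappa> p * u p"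
  unfolding cov_minus[OF v p] solves_at_conjuncts V1_def V2_def by (simp add: field_simps)

text \<open>The failure of d(dw) = 0 is three times the integrability expression. Only the first
  order equations at \<open>p\<close> enter, so the same computation yields the necessary condition
  along a solution and the closedness test for arbitrary values of the unknowns.\<close>

lemma ddw_at:
  "cov F (10/3) (W2 F a b u v) 1 p - cov F (10/3) (W1 F a b u v) 2 p - 8 / 3 * \<kappa> p * w p =
    3 * (web_coefficient F a b p * v p + 12 / 5 * (a 2 p - a 3 p) * w p - u p * jval F a b c u integrability_expr p)"
  unfolding cov_W[OF u v w p] solves_at_conjuncts jval_integrability_expr
  unfolding rel[OF p] V1_def V2_def web_coefficient_def by (simp add: field_simps)

end

lemma structure_equation_integrability:
  assumes "structure_equation N F a b u v w" and p: "p \<in> N"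
  shows "web_coefficient F a b p * v p + 12 / 5 * (a 2 p - a 3 p) * w p = u p * jval F a b c u integrability_expr p"
proof -
  have h: "holo_on N u" "holo_on N v" "holo_on N w" and s: "\<And>q. q \<in> N \<Longrightarrow> solves_at F a b u v w q"
    using assms(1) unfolding structure_equation_iff by blast+
  have "cov F (10/3) (cov F (8/3) w 2) 1 p - cov F (10/3) (cov F (8/3) w 1) 2 p = 8/3 * \<kappa> p * w p"
    by (rule cov_commute[OF h(3) p]) simp
  moreover have "cov F (10/3) (cov F (8/3) w 2) 1 p = cov F (10/3) (W2 F a b u v) 1 p"
    "cov F (10/3) (cov F (8/3) w 1) 2 p = cov F (10/3) (W1 F a b u v) 2 p"
    by (rule cov_cong[OF p], use s in \<open>simp add: solves_at_def\<close>)+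
  ultimately have "cov F (10/3) (W2 F a b u v) 1 p - cov F (10/3) (W1 F a b u v) 2 p = 8/3 * \<kappa> p * w p" by simp
  note ddw_at[OF h p s[OF p], unfolded this diff_self]
  moreover have "0 = 3 * x \<Longrightarrow> x = 0" for x :: complex by simp
  ultimately have "web_coefficient F a b p * v p + 12 / 5 * (a 2 p - a 3 p) * w p - u p * jval F a b c u integrability_expr p = 0" by blast
  then show ?thesis by (simp only: right_minus_eq)
qed

text \<open>The remaining combinations \<open>v\<^sub>1 + v\<^sub>2\<close> and \<open>w\<^sub>1 + w\<^sub>2\<close> of derivatives come from \<open>d(du) = 0\<close> and \<open>d(dv) = 0\<close>.\<close>

lemma deformed_relations_imp_structure_equation:
  assumes u: "holo_on N u" and v: "holo_on N v" and w: "holo_on N w"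
    and R: "\<And>p. p \<in> N \<Longrightarrow> structure_relations F (deformed_a a u) (deformed_b b v) (deformed_c a c u w) p"
  shows "structure_equation N F a b u v w"
proof -
  have u1: "cov F (4/3) u 1 q = - v q" and u2: "cov F (4/3) u 2 q = v q"
    and vd: "cov F 2 v 1 q - cov F 2 v 2 q = V1 a u w q - V2 a u w q"
    and wd: "cov F (8/3) w 1 q - cov F (8/3) w 2 q = W1 F a b u v q - W2 F a b u v q" if "q \<in> N" for q
    using R[OF that] unfolding deformed_relations_iff[OF u v w that] by blast+
  have vs: "cov F 2 v 1 p = V1 a u w p" "cov F 2 v 2 p = V2 a u w p" if p: "p \<in> N" for p
  proof -
    have "cov F 2 (cov F (4/3) u 2) 1 p - cov F 2 (cov F (4/3) u 1) 2 p = 4/3 * \<kappa> p * u p"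
      by (rule cov_commute[OF u p]) simp
    moreover have "cov F 2 (cov F (4/3) u 2) 1 p = cov F 2 v 1 p"
      "cov F 2 (cov F (4/3) u 1) 2 p = cov F 2 (\<lambda>q. - v q) 2 p"
      by (rule cov_cong[OF p], simp add: u1 u2)+
    ultimately have "cov F 2 v 1 p + cov F 2 v 2 p = V1 a u w p + V2 a u w p"
      unfolding cov_minus[OF v p] V1_def V2_def by (simp add: field_simps) algebra
    with vd[OF p] show "cov F 2 v 1 p = V1 a u w p" "cov F 2 v 2 p = V2 a u w p" by algebra+
  qed
  have ws: "cov F (8/3) w 1 p = W1 F a b u v p" "cov F (8/3) w 2 p = W2 F a b u v p" if p: "p \<in> N" for p
  proof -
    have "cov F (8/3) (cov F 2 v 2) 1 p - cov F (8/3) (cov F 2 v 1) 2 p = 2 * \<kappa> p * v p"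
      by (rule cov_commute[OF v p]) simp
    moreover have "cov F (8/3) (cov F 2 v 2) 1 p = cov F (8/3) (V2 a u w) 1 p"
      "cov F (8/3) (cov F 2 v 1) 2 p = cov F (8/3) (V1 a u w) 2 p"
      by (rule cov_cong[OF p], simp add: vs)+
    ultimately have "cov F (8/3) w 1 p + cov F (8/3) w 2 p = W1 F a b u v p + W2 F a b u v p"
      unfolding cov_V[OF u v w p] u1[OF p] u2[OF p] rel[OF p] W1_def W2_def by (simp add: field_simps) algebra
    with wd[OF p] show "cov F (8/3) w 1 p = W1 F a b u v p" "cov F (8/3) w 2 p = W2 F a b u v p" by algebra+
  qed
  show ?thesis
    unfolding structure_equation_iff solves_at_def using u v w u1 u2 vs ws by blast
qed

end

section \<open>Normal form of a deformation\<close>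

lemma cov_same_forms:
  assumes "\<And>\<xi>. om1 F' p \<xi> = om1 F p \<xi>" "\<And>\<xi>. om2 F' p \<xi> = om2 F p \<xi>" "\<And>\<xi>. om00 F' p \<xi> = om00 F p \<xi>"
  shows "cov F' r h k p = cov F r h k p"
  by (simp add: cov_def assms)

context leg_frame
begin

lemma Phi_inject:
  assumes p: "p \<in> N" and eq: "\<And>\<xi>. Phi F a' b' c' p \<xi> = Phi F a'' b'' c'' p \<xi>"
  shows "a' i p = a'' i p" "b' j p = b'' j p" "c' k p = c'' k p"
proof -
  have E: "phi_eta (\<lambda>i. a' i p) (\<lambda>i. b' i p) (\<lambda>i. c' i p) 1 0 i j = phi_eta (\<lambda>i. a'' i p) (\<lambda>i. b'' i p) (\<lambda>i. c'' i p) 1 0 i j"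
    "phi_eta (\<lambda>i. a' i p) (\<lambda>i. b' i p) (\<lambda>i. c' i p) 0 1 i j = phi_eta (\<lambda>i. a'' i p) (\<lambda>i. b'' i p) (\<lambda>i. c'' i p) 0 1 i j" for i j
    using arg_cong[OF eq[of "E1 p"], of "\<lambda>A. A $ Inl i $ Inr j"] arg_cong[OF eq[of "E2 p"], of "\<lambda>A. A $ Inl i $ Inr j"]
    by (simp_all add: phi_entries om_E[OF p])
  note S = phi_eta_def distinct_012 simp_thms if_True if_False mult_1_right mult_zero_right add_0_left add_0_right diff_0 diff_0_right
  have "a' 1 p = a'' 1 p" "a' 2 p = a'' 2 p" "a' 3 p = a'' 3 p" "a' 4 p = a'' 4 p"
    using E(2)[of 1 1] E(1)[of 1 2] E(2)[of 1 2] E(1)[of 2 2] by (simp_all only: S)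
  then show "a' i p = a'' i p" using exhaust_4[of i] by auto
  have "b' 1 p = b'' 1 p" "b' 2 p = b'' 2 p" "b' 3 p = b'' 3 p"
    using E(1)[of 1 0] E(2)[of 1 0] E(1)[of 2 0] by (simp_all only: S)
  then show "b' j p = b'' j p" using exhaust_3[of j] by auto
  have "c' 1 p = c'' 1 p" "c' 2 p = c'' 2 p"
    using E(1)[of 0 0] E(2)[of 0 0] by (simp_all only: S)
  then show "c' k p = c'' k p" using exhaust_2[of k] by auto
qed

context
  fixes x' F' a' b' c'
  assumes F': "adapted5 N x' F' a' b' c'"
    and forms: "\<And>p \<xi>. p \<in> N \<Longrightarrow> om1 F' p \<xi> = om1 F p \<xi>" "\<And>p \<xi>. p \<in> N \<Longrightarrow> om2 F' p \<xi> = om2 F p \<xi>"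
      "\<And>p \<xi>. p \<in> N \<Longrightarrow> om00 F' p \<xi> = om00 F p \<xi>"
begin

interpretation F': leg_frame N F' a' b' c'
  by (rule adapted5_leg_frame[OF open_N F'])

lemma Phi_other_frame: "p \<in> N \<Longrightarrow> mc F' p \<xi> = Phi F a' b' c' p \<xi>"
  by (simp add: adapted5_mc[OF open_N F'] forms)

lemma other_frame_relations: "p \<in> N \<Longrightarrow> structure_relations F a' b' c' p"
  using F'.relations[of p] unfolding structure_relations_def acov_def
  by (simp only: cov_same_forms[of F' p F] forms)

text \<open>Both differences are read off from the exterior derivative of \<open>om00\<close>, which
  the two frames share.\<close>

lemma other_frame_curvature: "p \<in> N \<Longrightarrow> a' 3 p - a' 2 p = a 3 p - a 2 p"
proof -
  assume p: "p \<in> N"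
  have "D (\<lambda>q. om00 F' q \<xi>) p = D (\<lambda>q. om00 F q \<xi>) p" for \<xi>
    by (rule D_cong[OF open_N p]) (rule forms)
  then have "ext_d (om00 F') p (E1 p) (E2 p) = ext_d (om00 F) p (E1 p) (E2 p)" by (simp add: ext_d_def)
  then show ?thesis
    unfolding F'.d_om00[OF p] d_om00[OF p] by (simp add: wedge12_def forms[OF p] om_E[OF p]) algebra
qed

text \<open>The common \<open>Psi\<close> and the common web curvature leave one parameter for
  \<open>a\<close>. The relations between derivatives of \<open>a\<close> and \<open>b\<close>,
  applied to both frames, then tie the shift of \<open>b\<close> to one function \<open>v\<close>,
  and those for \<open>c\<close> tie the shift of \<open>c\<close> to \<open>w\<close>.\<close>

lemma other_frame_deformed:
  assumes Psi: "\<And>p \<xi>. p \<in> N \<Longrightarrow> Psi F' a' p \<xi> = Psi F a p \<xi>"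
  obtains u v w where "holo_on N u" "holo_on N v" "holo_on N w"
    "\<And>p i. p \<in> N \<Longrightarrow> a' i p = deformed_a a u i p" "\<And>p i. p \<in> N \<Longrightarrow> b' i p = deformed_b b v i p"
    "\<And>p i. p \<in> N \<Longrightarrow> c' i p = deformed_c a c u w i p"
proof -
  define u where "u = (\<lambda>p. a' 2 p - a 2 p)"
  define v where "v = (\<lambda>p. b' 3 p - b 3 p)"
  define w where "w = (\<lambda>p. c' 1 p - c 1 p)"
  have h: "holo_on N u" "holo_on N v" "holo_on N w"
    unfolding u_def v_def w_def by (intro holo_on_rules a_holo b_holo c_holo F'.a_holo F'.b_holo F'.c_holo)+
  have a': "a' i p = deformed_a a u i p" if p: "p \<in> N" for i p
  proof -
    \<comment> \<open>The cubic \<open>Psi\<close> has two coefficients and vanishes on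
      \<open>E1\<close> and \<open>E2\<close>; its values on these two vectors determine both
      coefficients.\<close>
    have "Psi F' a' p (E1 p + E2 p) = Psi F a p (E1 p + E2 p)" "Psi F' a' p (E1 p + 2 *s E2 p) = Psi F a p (E1 p + 2 *s E2 p)"
      by (simp_all add: Psi p)
    then have "(a' 1 p + 2 * a' 2 p) + (2 * a' 3 p + a' 4 p) = (a 1 p + 2 * a 2 p) + (2 * a 3 p + a 4 p)"
      "(a' 1 p + 2 * a' 2 p) * 2 + (2 * a' 3 p + a' 4 p) * 4 = (a 1 p + 2 * a 2 p) * 2 + (2 * a 3 p + a 4 p) * 4"
      by (simp_all only: Psi_def forms[OF p] om_add[OF p] om_scale[OF p] om_E[OF p]) (simp_all add: algebra_simps)
    then have P: "a' 1 p + 2 * a' 2 p = a 1 p + 2 * a 2 p" "2 * a' 3 p + a' 4 p = 2 * a 3 p + a 4 p" by algebra+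
    have a2: "a' 2 p = a 2 p + u p" by (simp add: u_def)
    then have a3: "a' 3 p = a 3 p + u p" using other_frame_curvature[OF p] by algebra
    have "a' 1 p = a 1 p - 2 * u p" using P(1) a2 by algebra
    moreover have "a' 4 p = a 4 p - 2 * u p" using P(2) a3 by algebra
    ultimately show ?thesis using a2 a3 exhaust_4[of i] by (elim disjE) (simp_all only: deformed_simps)
  qed
  note C = cov_add[OF _ _] cov_diff[OF _ _] cov_cmult[OF _]
  have acov': "acov F a' 1 k p = acov F a 1 k p - 2 * cov F (4/3) u k p"
    "acov F a' 2 k p = acov F a 2 k p + cov F (4/3) u k p"
    "acov F a' 3 k p = acov F a 3 k p + cov F (4/3) u k p"
    "acov F a' 4 k p = acov F a 4 k p - 2 * cov F (4/3) u k p" if p: "p \<in> N" for k p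
    using cov_cong[OF p, of "a' _" "deformed_a a u _" "4/3" k, OF a'] p
    by (simp_all only: acov_def deformed_simps C holo_intros h)
  have b': "b' i p = deformed_b b v i p" if p: "p \<in> N" for i p
  proof -
    have R: "acov F a' 1 1 p = - 2 * b' 2 p" "acov F a' 4 2 p = - 2 * b' 3 p" "acov F a' 3 1 p = acov F a' 2 2 p + 2 * b' 1 p"
      "acov F a' 2 2 p = - 3 / 2 * acov F a' 2 1 p + 8 * b' 1 p + 15 / 2 * b' 3 p"
      using other_frame_relations[OF p] unfolding structure_relations_def by blast+
    have v: "b' 3 p = b 3 p + v p" by (simp add: v_def)
    have u2: "cov F (4/3) u 2 p = v p"
      using R(2) unfolding acov'[OF p] rel[OF p] v by algebra
    have b2: "b' 2 p = b 2 p + cov F (4/3) u 1 p"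
      using R(1) unfolding acov'[OF p] rel[OF p] by algebra
    have b1: "2 * b' 1 p = 2 * b 1 p + cov F (4/3) u 1 p - v p"
      using R(3) unfolding acov'[OF p] rel[OF p] u2 by (simp add: field_simps) algebra
    \<comment> \<open>With \<open>b1\<close>, this fourth relation determines the first derivative
      of \<open>u\<close>, and with it the shifts of \<open>b 1\<close> and
      \<open>b 2\<close>.\<close>
    have "2 * v p = - 3 * cov F (4/3) u 1 p + 16 * (b' 1 p - b 1 p) + 15 * v p"
      using R(4) unfolding acov'[OF p] rel[OF p] u2 v by (simp add: field_simps) algebra
    with b1 have u1: "cov F (4/3) u 1 p = - v p" by algebra
    have "b' 1 p = b 1 p - v p" "b' 2 p = b 2 p - v p" using b1 b2 u1 by algebra+
    then show ?thesis using v exhaust_3[of i] by (elim disjE) (simp_all only: deformed_simps)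
  qed
  have c': "c' i p = deformed_c a c u w i p" if p: "p \<in> N" for i p
  proof -
    have bcov': "cov F 2 (b' 1) k p = cov F 2 (b 1) k p - cov F 2 v k p"
      "cov F 2 (b' 2) k p = cov F 2 (b 2) k p - cov F 2 v k p"
      "cov F 2 (b' 3) k p = cov F 2 (b 3) k p + cov F 2 v k p" for k
      using cov_cong[OF p, of "b' _" "deformed_b b v _" 2 k, OF b'] p
      by (simp_all only: deformed_simps C holo_intros h)
    have R: "c' 2 p = cov F 2 (b' 1) 2 p - cov F 2 (b' 2) 1 p - a' 1 p * a' 4 p + 2 / 5 * a' 2 p * a' 3 p + 3 / 5 * (a' 3 p)\<^sup>2"
      "c' 1 p = - a' 1 p * a' 4 p + 3 / 5 * (a' 2 p)\<^sup>2 + 2 / 5 * a' 2 p * a' 3 p - cov F 2 (b' 1) 1 p - cov F 2 (b' 3) 2 p"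
      using other_frame_relations[OF p] unfolding structure_relations_def by blast+
    have w: "c' 1 p = c 1 p + w p" by (simp add: w_def)
    have "c' 2 p = c 2 p + (w p + 6 / 5 * ((a 3 p - a 2 p) * u p))"
      using R w unfolding bcov' a'[OF p] unfolding deformed_simps rel(6,7)[OF p] 
      by (simp add: field_simps power2_eq_square) algebra
    with w show ?thesis using exhaust_2[of i] by (elim disjE) (simp_all only: deformed_simps)
  qed
  show ?thesis by (rule that[OF h a' b' c'])
qed

end

end

section \<open>Uniqueness\<close>

text \<open>Local bounds on the coefficient forms bound the derivative of \<open>h\<close> by
  \<open>h\<close> itself. The lemma yields uniqueness of frames, uniqueness of solutions of the
  structure equation, and the symplectic relations of an integrated frame.\<close>

lemma linear_system_zero:
  fixes h :: "pt \<Rightarrow> complex ^ 'm"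
  assumes N: "open N" "connected N" "p \<in> N" and h0: "h p = 0"
    and h: "\<And>i. holo_on N (\<lambda>q. h q $ i)"
    and D: "\<And>q i \<xi>. q \<in> N \<Longrightarrow> D (\<lambda>q. h q $ i) q \<xi> = (\<Sum>j\<in>UNIV. A i j q \<xi> * h q $ j)"
    and A: "\<And>i j \<xi>. holo_on N (\<lambda>q. A i j q \<xi>)"
    and lin: "\<And>q i j \<xi> \<zeta>. q \<in> N \<Longrightarrow> A i j q (\<xi> + \<zeta>) = A i j q \<xi> + A i j q \<zeta>"
      "\<And>q i j \<xi> c. q \<in> N \<Longrightarrow> A i j q (c *s \<xi>) = c * A i j q \<xi>"
    and q: "q \<in> N"
  shows "h q = 0"
proof (rule zero_if_derivative_bounded_by_value[where h=h and S=N and p=p and x=q and h'="\<lambda>q \<xi>. \<chi> i. D (\<lambda>q. h q $ i) q \<xi>", OF N h0])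
  show "(h has_derivative (\<lambda>\<xi>. \<chi> i. D (\<lambda>q. h q $ i) q \<xi>)) (at q)" if "q \<in> N" for q
    by (rule has_derivative_vec_componentwise) (simp add: holo_on_has_derivative[OF h that])
  fix x assume x: "x \<in> N"
  have "\<exists>r>0. \<exists>B. \<forall>y\<in>ball x r. cmod (A i j y (axis k 1)) \<le> B" for i j and k :: 2
    by (rule cvec.cdiff_locally_bounded[OF A[of i j "axis k 1", unfolded holo_on_iff_cdiff] N(1) x]) blast
  then obtain r B where r: "\<And>i j k. 0 < r i j k" and B: "\<And>i j k y. y \<in> ball x (r i j k) \<Longrightarrow> cmod (A i j y (axis (k::2) 1)) \<le> B i j k"
    by metis
  obtain r0 where r0: "0 < r0" "ball x r0 \<subseteq> N" using openE[OF N(1) x] .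
  define R where "R = Min (insert r0 (range (\<lambda>(i, j, k). r i j k)))"
  define M where "M = Max (insert 0 (range (\<lambda>(i, j, k). B i j k)))"
  have R: "0 < R" "R \<le> r0" "R \<le> r i j k" for i j k
  proof -
    show "0 < R" using r r0 by (auto simp: R_def)
    show "R \<le> r0" by (simp add: R_def)
    have "r i j k \<in> insert r0 (range (\<lambda>(i, j, k). r i j k))" by (auto intro!: image_eqI[of _ _ "(i, j, k)"])
    then show "R \<le> r i j k" unfolding R_def by (intro Min_le) auto
  qed
  have M: "0 \<le> M" "B i j k \<le> M" for i j k
  proof -
    have "B i j k \<in> insert 0 (range (\<lambda>(i, j, k). B i j k))" by (auto intro!: image_eqI[of _ _ "(i, j, k)"])
    then show "B i j k \<le> M" unfolding M_def by (intro Max_ge) auto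
    show "0 \<le> M" by (simp add: M_def)
  qed
  have AB: "cmod (A i j y \<xi>) \<le> 2 * M * norm \<xi>" if y: "y \<in> ball x R" for i j y \<xi>
  proof -
    have yN: "y \<in> N" using y R(2) r0 by auto
    have "\<xi> = \<xi> $ 1 *s axis 1 1 + \<xi> $ 2 *s axis 2 1" by (simp add: vec_eq_iff forall_2 axis_def)
    then have "A i j y \<xi> = \<xi> $ 1 * A i j y (axis 1 1) + \<xi> $ 2 * A i j y (axis 2 1)"
      using lin[OF yN] by metis
    also have "cmod \<dots> \<le> norm \<xi> * M + norm \<xi> * M"
    proof -
      have "cmod (A i j y (axis k 1)) \<le> M" for k
        using B[of y i j k] M(2)[of i j k] y R(3)[of i j k] by auto
      then show ?thesis
        by (intro norm_triangle_mono; unfold norm_mult; intro mult_mono)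
          (simp_all add: Finite_Cartesian_Product.norm_nth_le)
    qed
    finally show ?thesis by (simp add: mult_ac)
  qed
  show "\<exists>C r. 0 < r \<and> (\<forall>y\<in>ball x r. \<forall>\<xi>. norm (\<chi> i. D (\<lambda>q. h q $ i) y \<xi>) \<le> C * norm (h y) * norm \<xi>)"
  proof (rule exI[of _ "real CARD('m) * (real CARD('m) * (2 * M))"], rule exI[of _ R], intro conjI ballI allI)
    fix y \<xi> assume y: "y \<in> ball x R"
    have yN: "y \<in> N" using y R(2) r0 by auto
    have "cmod (D (\<lambda>q. h q $ i) y \<xi>) \<le> real CARD('m) * (2 * M * norm \<xi> * norm (h y))" for i
    proof -
      have "cmod (D (\<lambda>q. h q $ i) y \<xi>) \<le> (\<Sum>j\<in>UNIV. cmod (A i j y \<xi> * h y $ j))"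
        unfolding D[OF yN] by (rule norm_sum)
      also have "\<dots> \<le> of_nat (card (UNIV :: 'm set)) * (2 * M * norm \<xi> * norm (h y))"
        by (rule sum_bounded_above) (use AB[OF y] M in \<open>auto simp: norm_mult Finite_Cartesian_Product.norm_nth_le intro!: mult_mono\<close>)
      finally show ?thesis by simp
    qed
    then have "norm (\<chi> i. D (\<lambda>q. h q $ i) y \<xi>) \<le> real CARD('m) * (real CARD('m) * (2 * M * norm \<xi> * norm (h y)))"
      by (intro norm_le_card_mult) simp
    then show "norm (\<chi> i. D (\<lambda>q. h q $ i) y \<xi>) \<le> real CARD('m) * (real CARD('m) * (2 * M)) * norm (h y) * norm \<xi>"
      by (simp add: mult_ac)
  qed (rule R)
qed (rule q)

text \<open>With \<open>g\<close> chosen to match the frames at one point, every row of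
  \<open>F' - g ** F\<close> solves a homogeneous linear system with zero initial value.\<close>

lemma frames_same_mc:
  assumes "sframe N F" "sframe N F'" and N: "connected N" "N \<noteq> {}"
    and mc: "\<And>p \<xi>. p \<in> N \<Longrightarrow> mc F' p \<xi> = mc F p \<xi>"
  obtains g where "g \<in> Sp3" "\<And>p. p \<in> N \<Longrightarrow> F' p = g ** F p"
proof -
  interpret F: sframe N F by fact
  interpret F': sframe N F' by fact
  obtain p0 where p0: "p0 \<in> N" using N by blast
  define g where "g = F' p0 ** symplectic_adjoint (F p0)"
  have g: "g \<in> Sp3" unfolding g_def by (intro Sp3_mult Sp3_adjoint F'.F_Sp3 F.F_Sp3 p0)
  have "F' q $ I - (g ** F q) $ I = 0" if q: "q \<in> N" for q I
  proof (rule linear_system_zero[where N=N and p=p0 and h="\<lambda>q. F' q $ I - (g ** F q) $ I" and A="\<lambda>J K q \<xi>. mc F q \<xi> $ K $ J"])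
    show "F' p0 $ I - (g ** F p0) $ I = 0"
      by (simp add: g_def matrix_mul_assoc[symmetric] Sp3_adjoint_left[OF F.F_Sp3[OF p0]])
    have gF: "holo_on N (\<lambda>q. (g ** F q) $ I $ J)" for J
      unfolding matrix_matrix_mult_def vec_lambda_beta by (intro holo_on_rules F.F_holo)
    show "holo_on N (\<lambda>q. (F' q $ I - (g ** F q) $ I) $ J)" for J
      using holo_on_rules(4)[OF F'.F_holo gF] by simp
    fix q J \<xi> assume q: "q \<in> N"
    have "D (\<lambda>q. (g ** F q) $ I $ J) q \<xi> = (\<Sum>L\<in>UNIV. g $ I $ L * D (\<lambda>q. F q $ L $ J) q \<xi>)"
      unfolding matrix_matrix_mult_def vec_lambda_beta
      by (rule fun_cong[OF FD_eqI[OF has_derivative_sum]])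
        (auto intro!: has_derivative_mult_right holo_on_has_derivative[OF F.F_holo q])
    also have "\<dots> = (g ** (F q ** mc F q \<xi>)) $ I $ J"
      unfolding F.DF_eq[OF q, symmetric] by (simp add: matrix_matrix_mult_def F.DF_entry[OF q])
    finally have "D (\<lambda>q. (F' q $ I - (g ** F q) $ I) $ J) q \<xi> = (F' q ** mc F q \<xi>) $ I $ J - ((g ** F q) ** mc F q \<xi>) $ I $ J"
      using D_rules(2)[OF F'.F_holo gF q] by (simp add: F'.DF_entry[OF q, symmetric] F'.DF_eq[OF q] mc[OF q] matrix_mul_assoc)
    also have "\<dots> = (\<Sum>K\<in>UNIV. mc F q \<xi> $ K $ J * (F' q $ I - (g ** F q) $ I) $ K)"
      by (subst (1 2) matrix_matrix_mult_def) (simp add: sum_subtractf[symmetric] algebra_simps)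
    finally show "D (\<lambda>q. (F' q $ I - (g ** F q) $ I) $ J) q \<xi> = (\<Sum>K\<in>UNIV. mc F q \<xi> $ K $ J * (F' q $ I - (g ** F q) $ I) $ K)" .
  qed (use F.open_N N p0 q F.mc_holo in \<open>auto simp: F.mc_add F.mc_scale\<close>)
  then have "F' p = g ** F p" if "p \<in> N" for p
    using that by (simp add: vec_eq_iff)
  with g show ?thesis using that by blast
qed

lemma pline_image: "(*v) g ` pline v = pline (g *v v)" for g :: mat6
  unfolding pline_def vec.span_singleton by (auto simp: vector_scalar_commute image_iff)

lemma adapted1_pline: "adapted1 N x F \<Longrightarrow> p \<in> N \<Longrightarrow> x p = pline (e_vec F 0 p)"
  by (simp add: adapted1_def)

lemma same_mc_congruent:
  assumes "open N" "connected N" "N \<noteq> {}" "adapted1 N x F" "adapted1 N x' F'"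
    and "\<And>p \<xi>. p \<in> N \<Longrightarrow> mc F' p \<xi> = mc F p \<xi>"
  shows "congruent_on N x x'"
proof -
  obtain g where g: "g \<in> Sp3" "\<And>p. p \<in> N \<Longrightarrow> F' p = g ** F p"
    using frames_same_mc[OF adapted1_sframe[OF assms(1,4)] adapted1_sframe[OF assms(1,5)] assms(2,3,6)] by blast
  have "x' p = (*v) g ` x p" if "p \<in> N" for p
    unfolding adapted1_pline[OF assms(4) that] adapted1_pline[OF assms(5) that] pline_image e_vec_def g(2)[OF that]
    by (simp add: column_mult)
  then show ?thesis unfolding congruent_on_def by (intro bexI[OF _ g(1)] ballI)
qed

lemma Sp3_cancel: "g \<in> Sp3 \<Longrightarrow> (*v) (symplectic_adjoint g) ` (*v) g ` S = S"
  by (auto simp: image_image matrix_vector_mul_assoc Sp3_adjoint_left)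

lemma congruent_trans:
  assumes "congruent_on N x y" "congruent_on N x z"
  shows "congruent_on N y z"
proof -
  from assms(1)[unfolded congruent_on_def] obtain g where g: "g \<in> Sp3" "\<forall>p\<in>N. y p = (*v) g ` x p" ..
  from assms(2)[unfolded congruent_on_def] obtain h where h: "h \<in> Sp3" "\<forall>p\<in>N. z p = (*v) h ` x p" ..
  have "z p = (*v) (h ** symplectic_adjoint g) ` y p" if p: "p \<in> N" for p
  proof -
    have "(*v) (h ** symplectic_adjoint g) ` y p = (*v) h ` (*v) (symplectic_adjoint g) ` (*v) g ` x p"
      by (simp only: g(2)[rule_format, OF p] image_image matrix_vector_mul_assoc[symmetric])
    then show ?thesis by (simp only: Sp3_cancel[OF g(1)] h(2)[rule_format, OF p])
  qed
  then show ?thesis unfolding congruent_on_def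
    by (intro bexI[of _ "h ** symplectic_adjoint g"] ballI Sp3_mult[OF h(1) Sp3_adjoint[OF g(1)]])
qed

context leg_frame
begin

text \<open>The difference of two solutions satisfies a linear system whose coefficients involve the
  solutions themselves: quadratic terms factor as \<open>u^2 - u'^2 = (u + u') * (u - u')\<close>
  and \<open>u * v - u' * v' = v * (u - u') + u' * (v - v')\<close>.\<close>

lemma solutions_unique:
  assumes s: "structure_equation N F a b u v w" and s': "structure_equation N F a b u' v' w'"
    and N: "connected N" "p \<in> N" and eq: "u p = u' p" "v p = v' p" "w p = w' p" and q: "q \<in> N"
  shows "u q = u' q" "v q = v' q" "w q = w' q"
proof -
  have h: "holo_on N u" "holo_on N v" "holo_on N w" "holo_on N u'" "holo_on N v'" "holo_on N w'"
    using s s' unfolding structure_equation_def by blast+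
  define h where "h = (\<lambda>q. (\<chi> i :: 3. if i = 0 then u q - u' q else if i = 1 then v q - v' q else w q - w' q))"
  define A where "A = (\<lambda>(i::3) (j::3) q \<xi>.
    if i = 0 then (if j = 0 then - 4/3 * om00 F q \<xi> else if j = 1 then om2 F q \<xi> - om1 F q \<xi> else 0)
    else if i = 1 then (if j = 0 then (3 / 2 * (u q + u' q) + (3 / 5 * a 3 q - a 4 q - a 1 q - 8 / 5 * a 2 q)) * om1 F q \<xi>
          + (- 3 / 2 * (u q + u' q) + (a 3 q + a 4 q + a 1 q)) * om2 F q \<xi>
        else if j = 1 then - 2 * om00 F q \<xi> else 1 / 2 * om1 F q \<xi> - 1 / 2 * om2 F q \<xi>)
    else (if j = 0 then (- 2 * v q + (24 * b 1 q - 4 * b 2 q + 15 * b 3 q + acov F a 4 1 q + acov F a 1 2 q - 3 * acov F a 2 1 q)) * om1 F q \<xi>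
           + (2 * v q + (36 * b 1 q - 6 * b 2 q + 26 * b 3 q + acov F a 4 1 q + acov F a 1 2 q - 6 * acov F a 2 1 q)) * om2 F q \<xi>
       else if j = 1 then (- 2 * u' q + (- 12 / 5 * a 3 q + 22 / 5 * a 2 q + a 4 q + a 1 q)) * om1 F q \<xi>
           + (2 * u' q + (- 28 / 5 * a 3 q + 18 / 5 * a 2 q - a 4 q - a 1 q)) * om2 F q \<xi>
       else - 8/3 * om00 F q \<xi>))"
  note dis = distinct_012 simp_thms if_True if_False
  have h0: "(\<lambda>q. h q $ 0) = (\<lambda>q. u q - u' q)" and h1: "(\<lambda>q. h q $ 1) = (\<lambda>q. v q - v' q)" and h2: "(\<lambda>q. h q $ 2) = (\<lambda>q. w q - w' q)"
    unfolding h_def by (simp_all only: vec_lambda_beta dis)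
  note hc = h0[THEN fun_cong] h1[THEN fun_cong] h2[THEN fun_cong]
  have "h q = 0"
  proof (rule linear_system_zero[where N=N and p=p and A=A, OF open_N N])
    show "h p = 0" by (simp add: h_def eq vec_eq_iff)
    show "holo_on N (\<lambda>q. h q $ i)" for i
      using exhaust_012[of i] by (elim disjE; hypsubst; simp only: h0 h1 h2; intro holo_on_rules h)
    show "holo_on N (\<lambda>q. A i j q \<xi>)" for i j \<xi>
      using exhaust_012[of i] exhaust_012[of j]
      by (elim disjE; hypsubst; simp only: A_def dis; intro holo_intros h om_holo)
    show "A i j q (\<xi> + \<zeta>) = A i j q \<xi> + A i j q \<zeta>" if "q \<in> N" for i j q \<xi> \<zeta>
      using exhaust_012[of i] exhaust_012[of j]
      by (elim disjE; hypsubst; simp only: A_def dis om_add[OF that];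
          ((simp only: distrib_left add_ac; fail) | simp add: algebra_simps)?)
    show "A i j q (c *s \<xi>) = c * A i j q \<xi>" if "q \<in> N" for i j q c \<xi>
      using exhaust_012[of i] exhaust_012[of j]
      by (elim disjE; hypsubst; simp only: A_def dis om_scale[OF that];
          ((simp only: distrib_left mult.left_commute; fail) | simp add: algebra_simps)?)
    fix q i \<xi> assume q: "q \<in> N"
    have sq: "solves_at F a b u v w q" "solves_at F a b u' v' w' q" using s s' q unfolding structure_equation_iff by blast+
    have Du: "D u q \<xi> = - (4/3) * u q * om00 F q \<xi> + (- v q) * om1 F q \<xi> + v q * om2 F q \<xi>"
      "D u' q \<xi> = - (4/3) * u' q * om00 F q \<xi> + (- v' q) * om1 F q \<xi> + v' q * om2 F q \<xi>"
      using D_cov[OF h(1) q, of \<xi> "4/3"] D_cov[OF h(4) q, of \<xi> "4/3"] sq unfolding solves_at_def by simp_all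
    have Dv: "D v q \<xi> = - 2 * v q * om00 F q \<xi> + V1 a u w q * om1 F q \<xi> + V2 a u w q * om2 F q \<xi>"
      "D v' q \<xi> = - 2 * v' q * om00 F q \<xi> + V1 a u' w' q * om1 F q \<xi> + V2 a u' w' q * om2 F q \<xi>"
      using D_cov[OF h(2) q, of \<xi> "2"] D_cov[OF h(5) q, of \<xi> "2"] sq unfolding solves_at_def by simp_all
    have Dw: "D w q \<xi> = - (8/3) * w q * om00 F q \<xi> + W1 F a b u v q * om1 F q \<xi> + W2 F a b u v q * om2 F q \<xi>"
      "D w' q \<xi> = - (8/3) * w' q * om00 F q \<xi> + W1 F a b u' v' q * om1 F q \<xi> + W2 F a b u' v' q * om2 F q \<xi>"
      using D_cov[OF h(3) q, of \<xi> "8/3"] D_cov[OF h(6) q, of \<xi> "8/3"] sq unfolding solves_at_def by simp_all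
    have "D (\<lambda>q. h q $ 0) q \<xi> = A 0 0 q \<xi> * h q $ 0 + A 0 1 q \<xi> * h q $ 1 + A 0 2 q \<xi> * h q $ 2"
      unfolding h0 D_rules(2)[OF h(1) h(4) q] Du hc by (simp only: A_def dis) (simp add: field_simps)
    moreover have "D (\<lambda>q. h q $ 1) q \<xi> = A 1 0 q \<xi> * h q $ 0 + A 1 1 q \<xi> * h q $ 1 + A 1 2 q \<xi> * h q $ 2"
      unfolding h1 D_rules(2)[OF h(2) h(5) q] Dv hc V1_def V2_def by (simp only: A_def dis) (simp add: field_simps)
    moreover have "D (\<lambda>q. h q $ 2) q \<xi> = A 2 0 q \<xi> * h q $ 0 + A 2 1 q \<xi> * h q $ 1 + A 2 2 q \<xi> * h q $ 2"
      unfolding h2 D_rules(2)[OF h(3) h(6) q] Dw hc W1_def W2_def by (simp only: A_def dis) (simp add: field_simps)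
    ultimately show "D (\<lambda>q. h q $ i) q \<xi> = (\<Sum>j\<in>UNIV. A i j q \<xi> * h q $ j)"
      unfolding sum_012 using exhaust_012[of i] by (elim disjE) (simp_all only:)
  qed (rule q)
  then show "u q = u' q" "v q = v' q" "w q = w' q"
    using hc[of q] by simp_all
qed

end

section \<open>Bounds on the number of parameters\<close>

lemma adapted5_subset:
  assumes "adapted5 U x F a b c" "N \<subseteq> U"
  shows "adapted5 N x F a b c"
proof -
  have ball: "\<forall>p\<in>N. Q p" if "\<forall>p\<in>U. Q p" for Q using that assms(2) by blast
  have sf: "symplectic_frame N F" if "symplectic_frame U F"
    using that assms(2) holo_on_subset unfolding symplectic_frame_def by blast
  note A = assms(1)[unfolded adapted5_def adapted2_def adapted1_def]
  show ?thesis
    unfolding adapted5_def adapted2_def adapted1_def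
    by (intro conjI; (rule sf | rule ball); insert A; elim conjE; assumption)
qed

lemma psi_parameters_cong:
  assumes P: "psi_parameters N x F a x' u v w" and N: "open N"
    and eq: "\<And>p. p \<in> N \<Longrightarrow> u p = u' p" "\<And>p. p \<in> N \<Longrightarrow> v p = v' p" "\<And>p. p \<in> N \<Longrightarrow> w p = w' p"
  shows "psi_parameters N x F a x' u' v' w'"
proof -
  have d: "delta_mc F a u v w p \<xi> = delta_mc F a u' v' w' p \<xi>" if "p \<in> N" for p \<xi>
    using eq[OF that] by (simp add: delta_mc_def delta_om_def delta_eta_def vec_eq_iff split: sum.split)
  from P obtain F' a' b' c' where F': "adapted5 N x' F' a' b' c'"
    "\<forall>p\<in>N. \<forall>\<xi>. mc F' p \<xi> = mc F p \<xi> + delta_mc F a u v w p \<xi>"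
    unfolding psi_parameters_def by blast
  have "\<forall>p\<in>N. \<forall>\<xi>. mc F' p \<xi> = mc F p \<xi> + delta_mc F a u' v' w' p \<xi>" using F'(2) d by simp
  moreover have "holo_on N u'" "holo_on N v'" "holo_on N w'"
    using P holo_on_cong[OF _ N] eq unfolding psi_parameters_def by blast+
  ultimately show ?thesis using P F'(1) unfolding psi_parameters_def by blast
qed

lemma psi_parameters_congruent:
  assumes N: "open N" "connected N" "N \<noteq> {}"
    and P: "psi_parameters N x F a x' u v w" "psi_parameters N x F a x'' u v w"
  shows "congruent_on N x' x''"
proof -
  obtain F' a' b' c' where F': "adapted5 N x' F' a' b' c'" "\<forall>p\<in>N. \<forall>\<xi>. mc F' p \<xi> = mc F p \<xi> + delta_mc F a u v w p \<xi>"
    using P(1) unfolding psi_parameters_def by blast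
  obtain F'' a'' b'' c'' where F'': "adapted5 N x'' F'' a'' b'' c''" "\<forall>p\<in>N. \<forall>\<xi>. mc F'' p \<xi> = mc F p \<xi> + delta_mc F a u v w p \<xi>"
    using P(2) unfolding psi_parameters_def by blast
  show ?thesis
    by (rule same_mc_congruent[OF N adapted5_adapted1[OF F'(1)] adapted5_adapted1[OF F''(1)]])
      (use F'(2) F''(2) in simp)
qed

lemma continuous_on_jointly_holo:
  assumes "jointly_holo_on T S h" "q \<in> S"
  shows "continuous_on T (\<lambda>t. h t q)"
proof (rule continuous_at_imp_continuous_on, rule ballI)
  fix t assume "t \<in> T"
  then obtain L where L: "((\<lambda>(s, q). h s q) has_derivative L) (at (t, q))"
    using assms unfolding jointly_holo_on_def by blast
  have "((\<lambda>t. (t, q)) has_derivative (\<lambda>\<tau>. (\<tau>, 0))) (at t)" by (auto intro!: derivative_eq_intros)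
  from has_derivative_compose[OF this L] show "isCont (\<lambda>t. h t q) t"
    using has_derivative_continuous by fastforce
qed

lemma delta_mc_first_column:
  "delta_mc F a u v w p \<xi> $ Inl i $ Inl 0 = 0"
  using distinct_012 by (simp add: delta_mc_def delta_om_def)

context leg_frame
begin

lemma structure_relations_cong:
  assumes p: "p \<in> N" and eq: "\<And>q i. q \<in> N \<Longrightarrow> a' i q = a'' i q" "\<And>q i. q \<in> N \<Longrightarrow> b' i q = b'' i q"
    "\<And>q i. q \<in> N \<Longrightarrow> c' i q = c'' i q"
  shows "structure_relations F a' b' c' p \<longleftrightarrow> structure_relations F a'' b'' c'' p"
proof -
  have "cov F r (a' i) k p = cov F r (a'' i) k p" for r i k by (rule cov_cong[OF p eq(1)])
  moreover have "cov F r (b' i) k p = cov F r (b'' i) k p" for r i k by (rule cov_cong[OF p eq(2)])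
  moreover have "cov F r (c' i) k p = cov F r (c'' i) k p" for r i k by (rule cov_cong[OF p eq(3)])
  ultimately show ?thesis
    unfolding structure_relations_def acov_def by (simp only: eq[OF p])
qed

context
  fixes x assumes F: "adapted5 N x F a b c"
begin

lemma psi_deformation_parameters:
  assumes "psi_deformation N x F a x'"
  obtains u v w where "psi_parameters N x F a x' u v w"
proof -
  obtain F' a' b' c' where F': "adapted5 N x' F' a' b' c'"
    and forms: "\<And>p \<xi>. p \<in> N \<Longrightarrow> om1 F' p \<xi> = om1 F p \<xi>" "\<And>p \<xi>. p \<in> N \<Longrightarrow> om2 F' p \<xi> = om2 F p \<xi>"
      "\<And>p \<xi>. p \<in> N \<Longrightarrow> om00 F' p \<xi> = om00 F p \<xi>" and Psi: "\<And>p \<xi>. p \<in> N \<Longrightarrow> Psi F' a' p \<xi> = Psi F a p \<xi>"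
    using assms unfolding psi_deformation_def by blast
  obtain u v w where h: "holo_on N u" "holo_on N v" "holo_on N w"
    and d: "\<And>p i. p \<in> N \<Longrightarrow> a' i p = deformed_a a u i p" "\<And>p i. p \<in> N \<Longrightarrow> b' i p = deformed_b b v i p"
      "\<And>p i. p \<in> N \<Longrightarrow> c' i p = deformed_c a c u w i p"
    by (rule other_frame_deformed[OF F' forms Psi]) (assumption | rule that)+
  have "mc F' p \<xi> = mc F p \<xi> + delta_mc F a u v w p \<xi>" if p: "p \<in> N" for p \<xi>
  proof -
    have "mc F' p \<xi> = Phi F a' b' c' p \<xi>"
      by (rule Phi_other_frame[OF F' _ _ _ p]) (rule forms, assumption)+
    then show ?thesis by (simp only: d[OF p] Phi_deformed adapted5_mc[OF open_N F p])
  qed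
  then have "psi_parameters N x F a x' u v w"
    using assms h F' unfolding psi_parameters_def by blast
  then show ?thesis by (rule that)
qed

lemma psi_parameters_structure_equation:
  assumes "psi_parameters N x F a x' u v w"
  shows "structure_equation N F a b u v w"
proof -
  obtain F' a' b' c' where F': "adapted5 N x' F' a' b' c'"
    and mc: "\<And>p \<xi>. p \<in> N \<Longrightarrow> mc F' p \<xi> = mc F p \<xi> + delta_mc F a u v w p \<xi>"
    and h: "holo_on N u" "holo_on N v" "holo_on N w"
    using assms unfolding psi_parameters_def by blast
  have forms: "om F' i 0 p \<xi> = om F i 0 p \<xi>" if "p \<in> N" for i p \<xi>
    by (simp add: om_def mc[OF that] delta_mc_first_column)
  have Peq: "Phi F a' b' c' p \<xi> = Phi F (deformed_a a u) (deformed_b b v) (deformed_c a c u w) p \<xi>" if p: "p \<in> N" for p \<xi>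
  proof -
    have "Phi F a' b' c' p \<xi> = mc F' p \<xi>"
      by (rule Phi_other_frame[OF F' _ _ _ p, symmetric]) (rule forms, assumption)+
    then show ?thesis by (simp only: mc[OF p] Phi_deformed adapted5_mc[OF open_N F p])
  qed
  have eq: "a' i p = deformed_a a u i p" "b' j p = deformed_b b v j p" "c' k p = deformed_c a c u w k p" if "p \<in> N" for p i j k
    by (rule Phi_inject[where a'=a' and b'=b' and c'=c' and a''="deformed_a a u" and b''="deformed_b b v"
        and c''="deformed_c a c u w", OF that Peq[OF that]])+
  show ?thesis
  proof (rule deformed_relations_imp_structure_equation[OF h])
    fix p assume p: "p \<in> N"
    have "structure_relations F a' b' c' p" by (rule other_frame_relations[OF F' _ _ _ p]) (rule forms, assumption)+
    then show "structure_relations F (deformed_a a u) (deformed_b b v) (deformed_c a c u w) p"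
      using structure_relations_cong[OF p, of a' "deformed_a a u" b' "deformed_b b v" c' "deformed_c a c u w"] eq by blast
  qed
qed

lemma psi_parameters_determined:
  assumes N: "connected N" "q \<in> N"
    and P: "psi_parameters N x F a x' u v w" "psi_parameters N x F a x'' u' v' w'"
    and eq: "u q = u' q" "v q = v' q" "w q = w' q"
  shows "congruent_on N x' x''"
proof -
  note U = solutions_unique[OF P[THEN psi_parameters_structure_equation] N eq]
  have "psi_parameters N x F a x' u' v' w'"
    by (rule psi_parameters_cong[OF P(1) open_N]) (use U in blast)+
  then show ?thesis
    using psi_parameters_congruent[OF open_N N(1) _ _ P(2)] N(2) by blast
qed

end

text \<open>Differentiating \<open>a 2 = a 3\<close> equates the relations for the derivatives of
  \<open>a 2\<close> and \<open>a 3\<close>, which gives two further linear equations.\<close>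

lemma flat_relations:
  assumes flat: "\<And>q. q \<in> N \<Longrightarrow> a 2 q = a 3 q" and p: "p \<in> N"
  shows "b 3 p = b 2 p - 2 * b 1 p" "acov F a 2 1 p = 3 * b 2 p - 2 * b 1 p" "acov F a 2 2 p = 3 * b 2 p - 4 * b 1 p"
proof -
  have e: "acov F a 2 k p = acov F a 3 k p" for k
    unfolding acov_def by (rule cov_cong[OF p flat])
  have 1: "acov F a 2 1 p = - 3 / 2 * acov F a 2 1 p + 10 * b 1 p + 15 / 2 * b 3 p"
    and 2: "- 3 / 2 * acov F a 2 1 p + 8 * b 1 p + 15 / 2 * b 3 p = acov F a 2 1 p + 5 * b 2 p - 12 * b 1 p - 5 * b 3 p"
    by (rule trans[OF e rel(4)[OF p]], rule trans[OF rel(3)[OF p, symmetric] trans[OF e rel(5)[OF p]]])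
  show 3: "b 3 p = b 2 p - 2 * b 1 p" using 1 2 by (simp add: field_simps) algebra
  show 4: "acov F a 2 1 p = 3 * b 2 p - 2 * b 1 p" using 1 3 by (simp add: field_simps) algebra
  show "acov F a 2 2 p = 3 * b 2 p - 4 * b 1 p" unfolding rel(3)[OF p] 4 3 by (simp add: field_simps)
qed

text \<open>The origin of the relation in case (c): on a flat web it is, up to sign, the coefficient
  of \<open>v\<close> in the integrability condition.\<close>

lemma flat_web_coefficient:
  assumes "\<And>q. q \<in> N \<Longrightarrow> a 2 q = a 3 q" "p \<in> N"
  shows "web_coefficient F a b p = - (acov F a 4 1 p + acov F a 1 2 p + 4 * b 2 p - 4 * b 1 p)"
  using flat_relations(1,2)[OF assms] unfolding web_coefficient_def by algebra

text \<open>The origin of the relation in case (d): derivatives of the flatness relations and of the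
  vanishing coefficient eliminate the second derivatives of \<open>a\<close>, and the relations for
  \<open>c\<close> absorb the derivatives of \<open>b\<close> that remain.\<close>

lemma flat_integrability_expr:
  assumes flat: "\<And>q. q \<in> N \<Longrightarrow> a 2 q = a 3 q" and p: "p \<in> N"
    and c0: "\<And>q. q \<in> N \<Longrightarrow> acov F a 4 1 q + acov F a 1 2 q + 4 * b 2 q - 4 * b 1 q = 0"
  shows "jval F a b c u integrability_expr p = 8 / 3 * (c 1 p - c 2 p)"
proof -
  note C = cov_add[OF _ _ p] cov_diff[OF _ _ p] cov_cmult[OF _ p]
  have A2: "cov F 2 (acov F a 2 1) k p = 3 * cov F 2 (b 2) k p - 2 * cov F 2 (b 1) k p" for k
    using cov_cong[OF p flat_relations(2)[OF flat], where r=2 and k=k] by (simp only: C holo_intros)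
  have A2': "cov F 2 (acov F a 2 2) k p = 3 * cov F 2 (b 2) k p - 4 * cov F 2 (b 1) k p" for k
    using cov_cong[OF p flat_relations(3)[OF flat], where r=2 and k=k] by (simp only: C holo_intros)
  have B3: "cov F 2 (b 3) k p = cov F 2 (b 2) k p - 2 * cov F 2 (b 1) k p" for k
    using cov_cong[OF p flat_relations(1)[OF flat], where r=2 and k=k] by (simp only: C holo_intros)
  have "acov F a 1 2 q = 4 * b 1 q - 4 * b 2 q - acov F a 4 1 q" if "q \<in> N" for q
    using c0[OF that] by algebra
  then have A1: "cov F 2 (acov F a 1 2) k p = 4 * cov F 2 (b 1) k p - 4 * cov F 2 (b 2) k p - cov F 2 (acov F a 4 1) k p" for k
    using cov_cong[OF p, of "acov F a 1 2" "\<lambda>q. 4 * b 1 q - 4 * b 2 q - acov F a 4 1 q" 2 k] by (simp only: C holo_intros)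
  \<comment> \<open>On a flat web covariant derivatives commute, which supplies one more relation
    between derivatives of \<open>b 1\<close> and \<open>b 2\<close>.\<close>
  have comm: "cov F 2 (acov F a 2 2) 1 p - cov F 2 (acov F a 2 1) 2 p = 0"
    using cov_commute[OF a_holo p, of 2 "4/3" 2] flat[OF p] by (simp add: acov_def[abs_def])
  have "4 * cov F 2 (b 1) 1 p = 3 * cov F 2 (b 2) 1 p - 3 * cov F 2 (b 2) 2 p + 2 * cov F 2 (b 1) 2 p"
    using comm unfolding A2 A2' by algebra
  then have b11: "cov F 2 (b 1) 1 p = 3 / 4 * cov F 2 (b 2) 1 p - 3 / 4 * cov F 2 (b 2) 2 p + 1 / 2 * cov F 2 (b 1) 2 p"
    by (simp add: field_simps)
  show ?thesis
    unfolding jval_integrability_expr A2 A1 B3 rel(6,7)[OF p] b11 flat[OF p]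
    by (simp add: field_simps power2_eq_square)
qed

lemma web_coefficient_holo: "holo_on N (web_coefficient F a b)"
  unfolding web_coefficient_def[abs_def] by (intro holo_intros)

lemma jval_holo: "holo_on N (jval F a b c (\<lambda>_. 0) e)"
  by (induction e) (simp_all add: holo_on_rules cov_jet_holo a_holo b_holo c_holo)

text \<open>On a flat web the integrability condition reads \<open>k * v = u * e\<close> with
  \<open>k\<close> the coefficient of \<open>v\<close>. It determines \<open>v\<close> by
  \<open>u\<close>; its derivative in the first direction contains \<open>k * w / 2\<close> through
  \<open>V1\<close>, and so determines \<open>w\<close>.\<close>

lemma flat_solution_w:
  assumes flat: "\<And>q. q \<in> N \<Longrightarrow> a 2 q = a 3 q" and q: "q \<in> N" and nz: "web_coefficient F a b q \<noteq> 0"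
    and s: "structure_equation N F a b u v w" "structure_equation N F a b u' v' w'" and eq: "u q = u' q"
  shows "v q = v' q" "w q = w' q"
proof -
  let ?e = "jval F a b c (\<lambda>_. 0) integrability_expr" and ?k = "web_coefficient F a b"
  \<comment> \<open>In \<open>integrability_expr\<close> the variable \<open>U0\<close> occurs only
    in \<open>44/15 * (a 3 - a 2) * U0\<close>, which vanishes on a flat web. Evaluating it at 0
    gives the same function for both solutions.\<close>
  have I: "?k r * v r = u r * ?e r" if "structure_equation N F a b u v w" "r \<in> N" for u v w r
    using structure_equation_integrability[OF that] flat[OF that(2)] by (simp add: jval_integrability_expr)
  show veq: "v q = v' q"
  proof -
    have "?k q * v q = ?k q * v' q" using I[OF s(1) q] I[OF s(2) q] by (simp only: eq)
    then show ?thesis using nz by simp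
  qed
  have "?k q * V1 a u w q = - v q * ?e q + u q * cov F (8/3) ?e 1 q - cov F 2 ?k 1 q * v q"
    if s: "structure_equation N F a b u v w" for u v w
  proof -
    have h: "holo_on N u" "holo_on N v" "holo_on N w" and sq: "solves_at F a b u v w q"
      using s q unfolding structure_equation_iff by blast+
    have "cov F 4 (\<lambda>r. ?k r * v r) 1 q = cov F 4 (\<lambda>r. u r * ?e r) 1 q"
      by (rule cov_cong[OF q I[OF s]])
    moreover have "cov F 4 (\<lambda>r. ?k r * v r) 1 q = cov F 2 ?k 1 q * v q + ?k q * cov F 2 v 1 q"
      by (rule cov_mult[OF web_coefficient_holo h(2) q]) simp
    moreover have "cov F 4 (\<lambda>r. u r * ?e r) 1 q = cov F (4/3) u 1 q * ?e q + u q * cov F (8/3) ?e 1 q"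
      by (rule cov_mult[OF h(1) jval_holo q]) simp
    ultimately show ?thesis using sq unfolding solves_at_def by (simp add: algebra_simps)
  qed
  from this[OF s(1)] this[OF s(2)] have "?k q * V1 a u w q = ?k q * V1 a u' w' q"
    by (simp only: eq veq)
  then show "w q = w' q" using nz by (simp add: V1_def eq)
qed

end

text \<open>If the values \<open>G\<close> at the point \<open>g N\<close> determine a deformation
  up to congruence, then a family of pairwise non-congruent ones maps continuously and injectively
  into the space of these values, and invariance of domain compares the real dimensions. The point
  may depend on \<open>N\<close>, which only the given family provides.\<close>

lemma no_psi_family:
  assumes fam: "admits_psi_family TYPE('k::finite) U x F a p"
    and inj: "\<And>N X' X'' u v w u' v' w'. subdomain N U \<Longrightarrow> p \<in> N \<Longrightarrow> psi_parameters N x F a X' u v w \<Longrightarrow>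
      psi_parameters N x F a X'' u' v' w' \<Longrightarrow> G u v w (g N) = G u' v' w' (g N) \<Longrightarrow> congruent_on N X' X''"
    and g: "\<And>N. subdomain N U \<Longrightarrow> p \<in> N \<Longrightarrow> g N \<in> N"
    and G: "\<And>(T :: (complex ^ 'k) set) N u v w. jointly_holo_on T N u \<Longrightarrow> jointly_holo_on T N v \<Longrightarrow> jointly_holo_on T N w \<Longrightarrow>
      g N \<in> N \<Longrightarrow> continuous_on T (\<lambda>t. G (u t) (v t) (w t) (g N) :: 'b::euclidean_space)"
  shows "2 * CARD('k) \<le> DIM('b)"
proof -
  obtain N and T :: "(complex ^ 'k) set" and X u v w where f: "subdomain N U" "p \<in> N" "open T" "T \<noteq> {}"
    "jointly_holo_on T N u" "jointly_holo_on T N v" "jointly_holo_on T N w"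
    "\<And>t. t \<in> T \<Longrightarrow> psi_parameters N x F a (X t) (u t) (v t) (w t)"
    "\<And>s t. s \<in> T \<Longrightarrow> t \<in> T \<Longrightarrow> s \<noteq> t \<Longrightarrow> \<not> congruent_on N (X s) (X t)"
    using fam unfolding admits_psi_family_def by blast
  have "inj_on (\<lambda>t. G (u t) (v t) (w t) (g N)) T"
    using inj[OF f(1,2) f(8) f(8)] f(9) unfolding inj_on_def by blast
  then have "DIM(complex ^ 'k) \<le> DIM('b)"
    using invariance_of_dimension[OF G[OF f(5-7) g[OF f(1,2)]] f(3) _ f(4)] by blast
  then show ?thesis by simp
qed

section \<open>Rigidity of 5-adapted frames\<close>

text \<open>Two 5-adapted frames of one surface with the same \<open>om1\<close>,
  \<open>om2\<close>, \<open>om00\<close>. The change of frame \<open>h\<close> turns out to be a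
  multiple \<open>lam\<close> of the identity with \<open>lam * lam = 1\<close>, so the
  Maurer-Cartan forms agree.\<close>

locale two_frames =
  fixes N x G H a b c a' b' c'
  assumes open_N: "open N" and G: "adapted5 N x G a b c" and H: "adapted5 N x H a' b' c'"
    and forms: "\<And>p \<xi>. p \<in> N \<Longrightarrow> om1 H p \<xi> = om1 G p \<xi>" "\<And>p \<xi>. p \<in> N \<Longrightarrow> om2 H p \<xi> = om2 G p \<xi>"
      "\<And>p \<xi>. p \<in> N \<Longrightarrow> om00 H p \<xi> = om00 G p \<xi>"
begin

sublocale G: coframe N G by (rule adapted5_coframe[OF open_N G])
sublocale H: coframe N H by (rule adapted5_coframe[OF open_N H])

definition h :: "pt \<Rightarrow> mat6" where "h p = symplectic_adjoint (G p) ** H p"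

lemma h_eq: "p \<in> N \<Longrightarrow> H p = G p ** h p"
  by (simp add: h_def matrix_mul_assoc Sp3_adjoint_right[OF G.F_Sp3])

lemma h_Sp3: "p \<in> N \<Longrightarrow> h p \<in> Sp3"
  by (simp add: h_def Sp3_mult Sp3_adjoint G.F_Sp3 H.F_Sp3)

lemma h_holo: "holo_on N (\<lambda>p. h p $ I $ J)"
proof -
  have "holo_on N (\<lambda>p. symplectic_adjoint (G p) $ I $ K)" for K
    unfolding symplectic_adjoint_def by (cases I; cases K) (auto intro!: holo_on_rules G.F_holo)
  then show ?thesis
    unfolding h_def matrix_matrix_mult_def vec_lambda_beta by (intro holo_on_rules H.F_holo)
qed

lemma h_derivative:
  assumes p: "p \<in> N"
  shows "D (\<lambda>q. h q $ I $ J) p \<xi> = (h p ** mc H p \<xi>) $ I $ J - (mc G p \<xi> ** h p) $ I $ J"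
proof -
  define X :: mat6 where "X = (\<chi> I J. D (\<lambda>q. h q $ I $ J) p \<xi>)"
  have "(H p ** mc H p \<xi>) $ I $ J = (G p ** (mc G p \<xi> ** h p + X)) $ I $ J" for I J
  proof -
    have "(H p ** mc H p \<xi>) $ I $ J = D (\<lambda>q. H q $ I $ J) p \<xi>"
      by (simp add: H.DF_eq[OF p, symmetric] H.DF_entry[OF p])
    also have "\<dots> = D (\<lambda>q. \<Sum>K\<in>UNIV. G q $ I $ K * h q $ K $ J) p \<xi>"
      by (rule fun_cong[OF D_cong[OF open_N p]]) (simp add: h_eq matrix_matrix_mult_def)
    also have "\<dots> = (\<Sum>K\<in>UNIV. G p $ I $ K * D (\<lambda>q. h q $ K $ J) p \<xi> + D (\<lambda>q. G q $ I $ K) p \<xi> * h p $ K $ J)"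
      by (rule fun_cong[OF FD_eqI[OF has_derivative_sum]])
        (intro has_derivative_mult holo_on_has_derivative[OF G.F_holo p] holo_on_has_derivative[OF h_holo p])
    also have "\<dots> = (G p ** X) $ I $ J + ((G p ** mc G p \<xi>) ** h p) $ I $ J"
      by (subst (2) matrix_matrix_mult_def)
        (simp add: matrix_matrix_mult_def X_def sum.distrib G.DF_entry[OF p, symmetric] G.DF_eq[OF p])
    finally show ?thesis by (simp add: matrix_add_ldistrib matrix_mul_assoc)
  qed
  then have "H p ** mc H p \<xi> = G p ** (mc G p \<xi> ** h p + X)" by (simp add: vec_eq_iff)
  then have "symplectic_adjoint (G p) ** ((G p ** h p) ** mc H p \<xi>) = symplectic_adjoint (G p) ** (G p ** (mc G p \<xi> ** h p + X))"
    by (simp add: h_eq[OF p])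
  then have "h p ** mc H p \<xi> = mc G p \<xi> ** h p + X"
    by (simp add: matrix_mul_assoc Sp3_adjoint_left[OF G.F_Sp3[OF p]])
  then show ?thesis by (simp add: X_def)
qed

lemma D_constant: "(\<And>q. q \<in> N \<Longrightarrow> h q $ I $ J = k) \<Longrightarrow> p \<in> N \<Longrightarrow> D (\<lambda>q. h q $ I $ J) p \<xi> = 0"
  using D_cong[OF open_N, of p "\<lambda>q. h q $ I $ J" "\<lambda>q. k"] by (simp add: frechet_derivative_const)

lemmas product_rules = matrix_matrix_mult_def vec_lambda_beta sum_UNIV_Plus sum_012 phi_entries

lemmas entry_rules = phi_entries phi_om_def phi_eta_def phi_theta_def distinct_012 simp_thms if_True if_False

lemma mc_GH:
  assumes p: "p \<in> N"
  shows "mc G p \<xi> = phi (\<lambda>i. a i p) (\<lambda>i. b i p) (\<lambda>i. c i p) (om1 G p \<xi>) (om2 G p \<xi>) (om00 G p \<xi>)"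
    "mc H p \<xi> = phi (\<lambda>i. a' i p) (\<lambda>i. b' i p) (\<lambda>i. c' i p) (om1 G p \<xi>) (om2 G p \<xi>) (om00 G p \<xi>)"
  using adapted5_mc[OF open_N G p] adapted5_mc[OF open_N H p] by (simp_all add: forms[OF p])

lemma mc_E:
  assumes p: "p \<in> N"
  shows "mc G p (G.E1 p) = phi (\<lambda>i. a i p) (\<lambda>i. b i p) (\<lambda>i. c i p) 1 0 (om00 G p (G.E1 p))"
    "mc H p (G.E1 p) = phi (\<lambda>i. a' i p) (\<lambda>i. b' i p) (\<lambda>i. c' i p) 1 0 (om00 G p (G.E1 p))"
    "mc G p (G.E2 p) = phi (\<lambda>i. a i p) (\<lambda>i. b i p) (\<lambda>i. c i p) 0 1 (om00 G p (G.E2 p))"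
    "mc H p (G.E2 p) = phi (\<lambda>i. a' i p) (\<lambda>i. b' i p) (\<lambda>i. c' i p) 0 1 (om00 G p (G.E2 p))"
  using mc_GH[OF p] by (simp_all add: G.om_E[OF p])

lemma h_column0:
  assumes p: "p \<in> N" and I: "I \<noteq> Inl 0"
  shows "h p $ I $ Inl 0 = 0"
proof -
  have "pline (e_vec G 0 p) = pline (e_vec H 0 p)"
    using adapted1_pline[OF adapted5_adapted1[OF G] p] adapted1_pline[OF adapted5_adapted1[OF H] p] by simp
  then have "e_vec H 0 p \<in> pline (e_vec G 0 p)"
    unfolding pline_def by (simp add: vec.span_base)
  then obtain k where "e_vec H 0 p = k *s e_vec G 0 p"
    unfolding pline_def vec.span_singleton by blast
  then have "symplectic_adjoint (G p) *v e_vec H 0 p = k *s axis (Inl 0) 1"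
    by (simp add: vector_scalar_commute G.adjoint_e_vec[OF p])
  moreover have "symplectic_adjoint (G p) *v e_vec H 0 p = column (Inl 0) (h p)"
    by (simp add: e_vec_def h_def column_mult)
  ultimately have "column (Inl 0) (h p) $ I = (k *s axis (Inl 0) 1) $ I" by simp
  then show ?thesis using I by (simp add: column_def axis_def)
qed

text \<open>Entries of \<open>h\<close> known to be constant have zero derivative, so
  \<open>h_derivative\<close> becomes a linear equation for other entries. Started from the first
  column, which is known since both frames have the same \<open>e_vec 0\<close> up to a factor, this
  determines \<open>h\<close> step by step.\<close>

lemma h_first_columns:
  assumes p: "p \<in> N"
  shows "h p $ Inr i $ Inl j = 0" "h p $ Inl 1 $ Inl 1 = h p $ Inl 0 $ Inl 0" "h p $ Inl 2 $ Inl 2 = h p $ Inl 0 $ Inl 0"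
    "h p $ Inl 1 $ Inl 2 = 0" "h p $ Inl 2 $ Inl 1 = 0"
    "D (\<lambda>q. h q $ Inl 0 $ Inl 0) p (G.E1 p) = h p $ Inl 0 $ Inl 1" "D (\<lambda>q. h q $ Inl 0 $ Inl 0) p (G.E2 p) = h p $ Inl 0 $ Inl 2"
proof -
  have z: "D (\<lambda>q. h q $ I $ Inl 0) p \<xi> = 0" if "I \<noteq> Inl 0" for I \<xi>
    by (rule D_constant[OF h_column0[OF _ that] p])
  note c0 = h_column0[OF p]
  have ne: "Inl 1 \<noteq> (Inl 0 :: 3 + 3)" "Inl 2 \<noteq> (Inl 0 :: 3 + 3)" "Inr i \<noteq> (Inl 0 :: 3 + 3)" for i by simp_all
  note E1 = h_derivative[OF p, of _ _ "G.E1 p", unfolded mc_E[OF p] product_rules]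
  note E2 = h_derivative[OF p, of _ _ "G.E2 p", unfolded mc_E[OF p] product_rules]
  have r: "h p $ Inr i $ Inl 1 = 0" "h p $ Inr i $ Inl 2 = 0" "h p $ Inr i $ Inl 0 = 0" for i
    using E1[of "Inr i" "Inl 0"] E2[of "Inr i" "Inl 0"] exhaust_012[of i]
    by (auto simp: z c0 entry_rules)
  then show "h p $ Inr i $ Inl j = 0" using exhaust_012[of j] by auto
  show "h p $ Inl 1 $ Inl 1 = h p $ Inl 0 $ Inl 0" "h p $ Inl 2 $ Inl 1 = 0"
    "D (\<lambda>q. h q $ Inl 0 $ Inl 0) p (G.E1 p) = h p $ Inl 0 $ Inl 1"
    using E1[of "Inl 1" "Inl 0"] E1[of "Inl 2" "Inl 0"] E1[of "Inl 0" "Inl 0"] by (simp_all add: z c0 r entry_rules)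
  show "h p $ Inl 2 $ Inl 2 = h p $ Inl 0 $ Inl 0" "h p $ Inl 1 $ Inl 2 = 0"
    "D (\<lambda>q. h q $ Inl 0 $ Inl 0) p (G.E2 p) = h p $ Inl 0 $ Inl 2"
    using E2[of "Inl 1" "Inl 0"] E2[of "Inl 2" "Inl 0"] E2[of "Inl 0" "Inl 0"] by (simp_all add: z c0 r entry_rules)
qed

lemma h_sympl: "p \<in> N \<Longrightarrow> sympl (column I (h p)) (column J (h p)) = sympl (axis I 1) (axis J 1)"
  by (rule Sp3_sympl_column[OF h_Sp3])

lemma h_pairing:
  assumes p: "p \<in> N"
  shows "(\<Sum>k\<in>UNIV. h p $ Inl k $ Inl i * h p $ Inr k $ Inr j) = (if i = j then 1 else 0)"
  using h_sympl[OF p, of "Inl i" "Inr j"]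
  by (cases "i = j") (simp_all add: sympl_axis, simp_all add: sympl_def column_def h_first_columns(1)[OF p] axis_def)

lemma h_diagonal:
  assumes p: "p \<in> N"
  shows "h p $ Inl 0 $ Inl 0 * h p $ Inl 0 $ Inl 0 = 1"
    "h p $ Inl 0 $ Inl 0 * h p $ Inr 0 $ Inr j = (if j = 0 then 1 else 0)"
proof -
  let ?l = "h p $ Inl 0 $ Inl 0"
  note c0 = h_column0[OF p] and fc = h_first_columns[OF p]
  note S = h_pairing[OF p]
  show r0: "?l * h p $ Inr 0 $ Inr j = (if j = 0 then 1 else 0)" for j
    using S[of 0 j] unfolding sum_012 by (simp add: c0 eq_commute[of 0 j])
  have l0: "?l \<noteq> 0" using r0[of 0] by auto
  have z: "h p $ Inr 0 $ Inr 1 = 0" "h p $ Inr 0 $ Inr 2 = 0" using r0[of 1] r0[of 2] l0 by auto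
  have s11: "?l * h p $ Inr 1 $ Inr 1 = 1" using S[of 1 1] unfolding sum_012 by (simp add: c0 fc z)
  have s12: "h p $ Inr 1 $ Inr 2 = 0" using S[of 1 2] l0 unfolding sum_012 by (simp add: c0 fc z)
  have d: "D (\<lambda>q. h q $ Inr 1 $ Inl 1) p \<xi> = 0" for \<xi> by (rule D_constant[OF h_first_columns(1) p])
  \<comment> \<open>The \<open>theta\<close> block is the same in both frames, so the lower right
    entry equals the upper left one; the symplectic pairing makes it the inverse instead. Hence the
    square is 1.\<close>
  have "h p $ Inr 1 $ Inr 1 = ?l"
    using h_derivative[OF p, of "Inr 1" "Inl 1" "G.E2 p", unfolded mc_E[OF p] product_rules]
    by (simp add: d fc c0 s12 entry_rules)
  then show "?l * ?l = 1" using s11 by simp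
qed

text \<open>Since its square is 1, the diagonal entry has zero derivative, and by
  \<open>h_first_columns\<close> this derivative consists of the two remaining entries.\<close>

lemma h_upper_left:
  assumes p: "p \<in> N"
  shows "h p $ Inl 0 $ Inl 1 = 0" "h p $ Inl 0 $ Inl 2 = 0"
    and "D (\<lambda>q. h q $ Inl 0 $ Inl 0) p \<xi> = 0"
proof -
  let ?l = "\<lambda>q. h q $ Inl 0 $ Inl 0"
  have "D (\<lambda>q. ?l q * ?l q) p \<xi> = D (\<lambda>q. 1) p \<xi>" for \<xi>
    by (rule fun_cong[OF D_cong[OF open_N p h_diagonal(1)]])
  then have "2 * (?l p * D ?l p \<xi>) = 0" for \<xi>
    using D_rules(3)[OF h_holo h_holo p, of "Inl 0" "Inl 0" "Inl 0" "Inl 0" \<xi>] by (simp add: frechet_derivative_const)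
  moreover have "?l p \<noteq> 0" using h_diagonal(1)[OF p] by auto
  ultimately show *: "D ?l p \<xi> = 0" for \<xi> by simp
  show "h p $ Inl 0 $ Inl 1 = 0" "h p $ Inl 0 $ Inl 2 = 0"
    using h_first_columns(6,7)[OF p] * by simp_all
qed

definition lam :: "pt \<Rightarrow> complex" where "lam p = h p $ Inl 0 $ Inl 0"

lemma lam_sq: "p \<in> N \<Longrightarrow> lam p * lam p = 1"
  unfolding lam_def by (rule h_diagonal(1))

lemma D_lam: "p \<in> N \<Longrightarrow> D lam p \<xi> = 0"
  unfolding lam_def[abs_def] by (rule h_upper_left(3))

lemma h_left:
  assumes p: "p \<in> N"
  shows "h p $ Inl i $ Inl j = (if i = j then lam p else 0)"
  using exhaust_012[of i] exhaust_012[of j] h_upper_left[OF p] h_first_columns[OF p] h_column0[OF p]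
  by (elim disjE; hypsubst; simp add: lam_def)

lemma l_nonzero: "p \<in> N \<Longrightarrow> lam p \<noteq> 0"
  using lam_sq by fastforce

lemma h_lower_right:
  assumes p: "p \<in> N"
  shows "h p $ Inr i $ Inr j = (if i = j then lam p else 0)"
proof -
  have "lam p * h p $ Inr i $ Inr j = (if i = j then 1 else 0)"
    using h_pairing[OF p, of i j] exhaust_012[of i] unfolding sum_012
    by (elim disjE; hypsubst; simp only: h_left[OF p] distinct_012 simp_thms if_True if_False; simp)
  then have "lam p * h p $ Inr i $ Inr j = lam p * (if i = j then lam p else 0)"
    using lam_sq[OF p] by simp
  then show ?thesis by (rule mult_left_cancel[OF l_nonzero[OF p], THEN iffD1])
qed

lemma h_upper_right_symmetric:
  assumes p: "p \<in> N"
  shows "h p $ Inl i $ Inr j = h p $ Inl j $ Inr i"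
proof -
  have "(\<Sum>k\<in>UNIV. h p $ Inl k $ Inr i * h p $ Inr k $ Inr j - h p $ Inr k $ Inr i * h p $ Inl k $ Inr j) = 0"
    using h_sympl[OF p, of "Inr i" "Inr j"] by (simp add: sympl_axis) (simp add: sympl_def column_def axis_def)
  then have "lam p * h p $ Inl j $ Inr i = lam p * h p $ Inl i $ Inr j"
    using exhaust_012[of i] exhaust_012[of j] unfolding sum_012
    by (elim disjE; hypsubst; simp only: h_lower_right[OF p] distinct_012 simp_thms if_True if_False; simp)
  then show ?thesis using l_nonzero[OF p] by simp
qed

lemma D_left: "p \<in> N \<Longrightarrow> D (\<lambda>q. h q $ Inl i $ Inl j) p \<xi> = 0"
proof -
  assume p: "p \<in> N"
  have "D (\<lambda>q. h q $ Inl i $ Inl j) p = D (\<lambda>q. if i = j then lam q else 0) p"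
    by (rule D_cong[OF open_N p h_left])
  then show ?thesis
    using D_lam[OF p] by (cases "i = j") (simp_all add: frechet_derivative_const)
qed

lemma h_upper_right_lower:
  assumes p: "p \<in> N" and "i = 1 \<or> i = 2" "k = 1 \<or> k = 2"
  shows "h p $ Inl i $ Inr k = 0"
proof -
  note d = D_left[OF p]
  note R = h_left[OF p] h_lower_right[OF p] h_first_columns(1)[OF p]
  have e: "h p $ Inl i $ Inr 2 = 0" "h p $ Inl i $ Inr 1 + h p $ Inl i $ Inr 2 = 0"
    using h_derivative[OF p, of "Inl i" "Inl 1" "G.E1 p", unfolded mc_E[OF p] product_rules d]
      h_derivative[OF p, of "Inl i" "Inl 1" "G.E2 p", unfolded mc_E[OF p] product_rules d] assms(2)
    by (auto simp: R entry_rules)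
  then show ?thesis using assms(3) by auto
qed

lemma h_upper_right:
  assumes p: "p \<in> N"
  shows "h p $ Inl i $ Inr k = 0"
proof -
  note R = h_left[OF p] h_lower_right[OF p] h_first_columns(1)[OF p]
  note lower = h_upper_right_lower[OF p]
  have d: "D (\<lambda>q. h q $ Inl i $ Inr k) p \<xi> = 0" if "i = 1 \<or> i = 2" "k = 1 \<or> k = 2" for i k \<xi>
    by (rule D_constant[OF h_upper_right_lower[OF _ that] p])
  \<comment> \<open>In the normal form \<open>eta\<close> 1 1 has no \<open>om1\<close> part and
    \<open>eta\<close> 2 2 no \<open>om2\<close> part, so on these vectors the unknown coefficients
    drop out. With the symmetry of the upper right block, each entry equals its own
    negative.\<close>
  have b1: "h q $ Inl 1 $ Inr 0 = 0" and b2: "h q $ Inl 2 $ Inr 0 = 0" if q: "q \<in> N" for q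
  proof -
    note R = h_left[OF q] h_lower_right[OF q] h_first_columns(1)[OF q] h_upper_right_lower[OF q]
    have d: "D (\<lambda>q. h q $ Inl i $ Inr k) q \<xi> = 0" if "i = 1 \<or> i = 2" "k = 1 \<or> k = 2" for i k \<xi>
      by (rule D_constant[OF h_upper_right_lower[OF _ that] q])
    show "h q $ Inl 1 $ Inr 0 = 0"
      using h_derivative[OF q, of "Inl 1" "Inr 1" "G.E1 q", unfolded mc_E[OF q] product_rules] h_upper_right_symmetric[OF q, of 0 1]
      by (simp add: R d entry_rules)
    show "h q $ Inl 2 $ Inr 0 = 0"
      using h_derivative[OF q, of "Inl 2" "Inr 2" "G.E2 q", unfolded mc_E[OF q] product_rules] h_upper_right_symmetric[OF q, of 0 2]
      by (simp add: R d entry_rules)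
  qed
  have d0: "D (\<lambda>q. h q $ Inl 1 $ Inr 0) p \<xi> = 0" "D (\<lambda>q. h q $ Inl 2 $ Inr 0) p \<xi> = 0" for \<xi>
    by (rule D_constant[OF b1 p], assumption, rule D_constant[OF b2 p])
  \<comment> \<open>The coefficient \<open>b 1\<close> occurs in \<open>eta\<close> 1 0 with
    \<open>om1\<close> and in \<open>eta\<close> 2 0 with \<open>- om2\<close>. The two equations
    identify its change with the corner entry and with the negative of that entry.\<close>
  have "lam p * (b' 1 p - b 1 p) = h p $ Inl 0 $ Inr 0" "lam p * (b' 1 p - b 1 p) = - h p $ Inl 0 $ Inr 0"
    using h_derivative[OF p, of "Inl 1" "Inr 0" "G.E1 p", unfolded mc_E[OF p] product_rules d0]
      h_derivative[OF p, of "Inl 2" "Inr 0" "G.E2 p", unfolded mc_E[OF p] product_rules d0]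
    by (simp_all add: R lower b1[OF p] b2[OF p] entry_rules algebra_simps)
  then have "h p $ Inl 0 $ Inr 0 = 0" by simp
  then show ?thesis
    using exhaust_012[of i] exhaust_012[of k] lower b1[OF p] b2[OF p] h_upper_right_symmetric[OF p]
    by (elim disjE; hypsubst; simp)
qed

lemma same_mc:
  assumes p: "p \<in> N"
  shows "mc H p \<xi> = mc G p \<xi>"
proof -
  have he: "h q $ I $ J = (if I = J then lam q else 0)" if "q \<in> N" for q I J
    by (cases I; cases J) (simp_all add: h_left[OF that] h_lower_right[OF that] h_first_columns(1)[OF that] h_upper_right[OF that])
  have "D (\<lambda>q. h q $ I $ J) p = D (\<lambda>q. if I = J then lam q else 0) p" for I J
    by (rule D_cong[OF open_N p he])
  then have d: "D (\<lambda>q. h q $ I $ J) p \<xi> = 0" for I J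
    using D_lam[OF p] by (cases "I = J") (simp_all add: frechet_derivative_const)
  have "lam p * mc H p \<xi> $ I $ J = lam p * mc G p \<xi> $ I $ J" for I J
    using h_derivative[OF p, of I J \<xi>]
    by (simp add: d matrix_matrix_mult_def he[OF p] if_distrib[of "\<lambda>x. x * _"] if_distrib[of "\<lambda>x. _ * x"] mult.commute cong: if_cong)
  then show ?thesis using l_nonzero[OF p] by (simp add: vec_eq_iff)
qed

end

section \<open>Existence\<close>

lemma phi_sp: "sympl (column I (phi a b c w1 w2 w0)) (axis J 1) + sympl (axis I 1) (column J (phi a b c w1 w2 w0)) = 0"
proof -
  have th: "phi_theta w1 w2 i j = phi_theta w1 w2 j i" for i j
    by (simp add: phi_theta_def conj_commute disj_commute)
  have et: "phi_eta a b c w1 w2 i j = phi_eta a b c w1 w2 j i" for i j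
    using exhaust_012[of i] exhaust_012[of j]
    by (elim disjE; hypsubst; simp only: if_True if_False phi_eta_def distinct_012 simp_thms)
  show ?thesis
    using th et by (cases I; cases J) (simp_all add: sympl_axis column_def phi_entries)
qed

lemma sympl_columns_left:
  "sympl (column K (A ** B)) w = (\<Sum>M\<in>UNIV. B $ M $ K * sympl (column M A) w)" for A :: mat6
proof -
  have "(A ** B) $ I $ K = (\<Sum>M\<in>UNIV. B $ M $ K * column M A $ I)" for I
    by (simp add: matrix_matrix_mult_def column_def mult.commute)
  then show ?thesis
    by (simp add: sympl_def column_def[of K] sum_distrib_left sum_distrib_right right_diff_distrib sum_subtractf mult.assoc)
      (simp add: sum.swap[of _ "UNIV :: (3 + 3) set" "UNIV :: 3 set"])
qed

lemma sympl_columns_right: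
  "sympl w (column K (A ** B)) = (\<Sum>M\<in>UNIV. B $ M $ K * sympl w (column M A))" for A :: mat6
  using sympl_columns_left[of K A B w] by (subst (1 2) sympl_swap) (simp add: sum_negf)

lemma column_mat: "column M (mat 1) = axis M (1 :: complex)"
  by (simp add: column_def mat_def axis_def vec_eq_iff eq_commute)

lemma cpair_cdiff_fst:
  assumes "holo_on S f"
  shows "cpair.cdiff (S \<times> T) (\<lambda>x. f (fst x))"
  by (rule cdiff_compose[OF cpair.complex_structure_axioms cvec.complex_structure_axioms
        assms[unfolded holo_on_iff_cdiff], where g'="\<lambda>_. fst"])
    (auto intro!: derivative_eq_intros simp: pair_scale_def)

text \<open>A flat form with values in the symplectic Lie algebra, no longer attached to a surface.
  The bound \<open>C\<close> controls the size of the ball on which the frame equation is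
  solved.\<close>

locale mc_form =
  fixes N :: "pt set" and \<pi> :: "pt \<Rightarrow> pt \<Rightarrow> mat6" and p :: pt and r C :: real
  assumes N: "N = ball p r" and r: "0 < r"
    and \<pi>_holo: "\<And>\<xi> I J. holo_on N (\<lambda>q. \<pi> q \<xi> $ I $ J)"
    and \<pi>_add: "\<And>q \<xi> \<zeta>. q \<in> N \<Longrightarrow> \<pi> q (\<xi> + \<zeta>) = \<pi> q \<xi> + \<pi> q \<zeta>"
    and \<pi>_scale: "\<And>q k \<xi> I J. q \<in> N \<Longrightarrow> \<pi> q (k *s \<xi>) $ I $ J = k * \<pi> q \<xi> $ I $ J"
    and \<pi>_bound: "\<And>q \<xi> I J. q \<in> N \<Longrightarrow> cmod (\<pi> q \<xi> $ I $ J) \<le> C * norm \<xi>"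
    and C: "0 \<le> C"
    and \<pi>_sp: "\<And>q \<xi> I J. q \<in> N \<Longrightarrow> sympl (column I (\<pi> q \<xi>)) (axis J 1) + sympl (axis I 1) (column J (\<pi> q \<xi>)) = 0"
    and \<pi>_MC: "\<And>q \<xi> \<zeta> I J. q \<in> N \<Longrightarrow> D (\<lambda>q. \<pi> q \<zeta> $ I $ J) q \<xi> - D (\<lambda>q. \<pi> q \<xi> $ I $ J) q \<zeta>
        = - ((\<pi> q \<xi> ** \<pi> q \<zeta>) $ I $ J - (\<pi> q \<zeta> ** \<pi> q \<xi>) $ I $ J)"
begin

text \<open>In \<open>dG = G \<pi>\<close> the rows of \<open>G\<close> decouple; this is the system
  for one row \<open>z\<close>.\<close>

definition P :: "pt \<Rightarrow> V \<Rightarrow> pt \<Rightarrow> V" where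
  "P q z \<xi> = (\<chi> J. \<Sum>K\<in>UNIV. z $ K * \<pi> q \<xi> $ K $ J)"

lemma P_has_derivative:
  assumes q: "q \<in> N"
  shows "((\<lambda>(q, z). P q z \<xi> $ J) has_derivative
    (\<lambda>(\<eta>, \<delta>). (\<Sum>K\<in>UNIV. z $ K * D (\<lambda>q. \<pi> q \<xi> $ K $ J) q \<eta> + \<delta> $ K * \<pi> q \<xi> $ K $ J))) (at (q, z))"
proof -
  have 1: "((\<lambda>x. snd x $ K) has_derivative (\<lambda>x. snd x $ K)) (at (q, z))" for K :: "3 + 3"
    by (rule bounded_linear_imp_has_derivative[OF bounded_linear_compose[OF bounded_linear_vec_nth bounded_linear_snd]])
  have 2: "((\<lambda>x. \<pi> (fst x) \<xi> $ K $ J) has_derivative (\<lambda>x. D (\<lambda>q. \<pi> q \<xi> $ K $ J) q (fst x))) (at (q, z))" for K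
    using has_derivative_compose[OF bounded_linear_imp_has_derivative[OF bounded_linear_fst], of "\<lambda>q. \<pi> q \<xi> $ K $ J" _ "(q, z)"]
      holo_on_has_derivative[OF \<pi>_holo q] by simp
  have "((\<lambda>x. \<Sum>K\<in>UNIV. snd x $ K * \<pi> (fst x) \<xi> $ K $ J) has_derivative
      (\<lambda>x. \<Sum>K\<in>UNIV. snd (q, z) $ K * D (\<lambda>q. \<pi> q \<xi> $ K $ J) q (fst x) + snd x $ K * \<pi> (fst (q, z)) \<xi> $ K $ J)) (at (q, z))"
    by (intro has_derivative_sum has_derivative_mult 1 2)
  then show ?thesis by (simp add: P_def case_prod_beta')
qed

text \<open>The Frobenius condition for rows is the Maurer-Cartan equation. With
  \<open>R = 1\<close> the values satisfy \<open>norm z \<le> norm z0 + 4\<close>; the factor 36 is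
  6 for the matrix product times 6 for the norm of a vector with six components, and 12 is twice the
  dimension 6 in the smallness condition.\<close>

lemma pfaffian_rows:
  assumes r': "0 < r'" "r' \<le> r" and small: "12 * (36 * (C * (norm z0 + 4))) * r' \<le> 1"
  shows "pfaffian P p z0 r' 1 (36 * (C * (norm z0 + 4)))"
proof
  have sub: "ball p r' \<subseteq> N" using r' N by auto
  show "cpair.cdiff (ball p r' \<times> ball z0 (4 * 1)) (\<lambda>(q, z). P q z \<xi> $ j)" for \<xi> j
  proof -
    have "cpair.cdiff (N \<times> ball z0 (4 * 1)) (\<lambda>x. \<Sum>K\<in>UNIV. snd x $ K * \<pi> (fst x) \<xi> $ K $ j)"
      by (intro cpair.cdiff_sum cpair.cdiff_mult cpair_cdiff_snd_nth cpair_cdiff_fst \<pi>_holo)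
    then have "cpair.cdiff (ball p r' \<times> ball z0 (4 * 1)) (\<lambda>x. \<Sum>K\<in>UNIV. snd x $ K * \<pi> (fst x) \<xi> $ K $ j)"
      by (rule cpair.cdiff_subset) (use sub in auto)
    then show ?thesis by (simp add: P_def case_prod_beta')
  qed
  fix q z assume q: "q \<in> ball p r'" and z: "z \<in> ball z0 (4 * 1)"
  then have qN: "q \<in> N" using sub by blast
  show "P q z (\<xi> + \<zeta>) = P q z \<xi> + P q z \<zeta>" for \<xi> \<zeta>
    by (simp add: P_def vec_eq_iff \<pi>_add[OF qN] distrib_left sum.distrib)
  show "P q z (k *s \<xi>) = k *s P q z \<xi>" for k \<xi>
    by (simp add: P_def vec_eq_iff \<pi>_scale[OF qN] sum_distrib_left mult.left_commute)
  show "norm (P q z \<xi>) \<le> 36 * (C * (norm z0 + 4)) * norm \<xi>" for \<xi>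
  proof -
    have nz: "norm z \<le> norm z0 + 4"
      using z norm_triangle_ineq2[of z z0] by (simp add: dist_norm norm_minus_commute)
    have "cmod (P q z \<xi> $ J) \<le> 6 * ((norm z0 + 4) * (C * norm \<xi>))" for J
    proof -
      have "cmod (P q z \<xi> $ J) \<le> (\<Sum>K\<in>UNIV. cmod (z $ K * \<pi> q \<xi> $ K $ J))"
        unfolding P_def vec_lambda_beta by (rule norm_sum)
      also have "\<dots> \<le> of_nat (card (UNIV :: (3 + 3) set)) * ((norm z0 + 4) * (C * norm \<xi>))"
      proof (rule sum_bounded_above)
        show "cmod (z $ K * \<pi> q \<xi> $ K $ J) \<le> (norm z0 + 4) * (C * norm \<xi>)" for K
          unfolding norm_mult
          by (rule mult_mono) (use Finite_Cartesian_Product.norm_nth_le[of z K] nz C \<pi>_bound[OF qN] in auto)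
      qed
      finally show ?thesis by simp
    qed
    from norm_le_card_mult[OF this] show ?thesis by (simp add: mult_ac)
  qed
  show "FD (\<lambda>(q, z). P q z \<zeta> $ j) (q, z) (\<xi>, P q z \<xi>) = FD (\<lambda>(q, z). P q z \<xi> $ j) (q, z) (\<zeta>, P q z \<zeta>)" for \<zeta> j \<xi>
  proof -
    have e: "FD (\<lambda>(q, z). P q z \<zeta> $ j) (q, z) (\<xi>, P q z \<xi>) =
        (\<Sum>K\<in>UNIV. z $ K * (D (\<lambda>q. \<pi> q \<zeta> $ K $ j) q \<xi> + (\<pi> q \<xi> ** \<pi> q \<zeta>) $ K $ j))" for \<xi> \<zeta>
    proof -
      have "(\<Sum>K\<in>UNIV. P q z \<xi> $ K * \<pi> q \<zeta> $ K $ j) = (\<Sum>K\<in>UNIV. \<Sum>L\<in>UNIV. z $ L * (\<pi> q \<xi> $ L $ K * \<pi> q \<zeta> $ K $ j))"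
        by (simp add: P_def sum_distrib_right mult.assoc)
      also have "\<dots> = (\<Sum>L\<in>UNIV. \<Sum>K\<in>UNIV. z $ L * (\<pi> q \<xi> $ L $ K * \<pi> q \<zeta> $ K $ j))" by (rule sum.swap)
      finally show ?thesis
        by (simp add: FD_eqI[OF P_has_derivative[OF qN]] sum.distrib distrib_left)
          (simp add: matrix_matrix_mult_def sum_distrib_left)
    qed
    show ?thesis
      unfolding e using \<pi>_MC[OF qN, of \<zeta> _ j \<xi>] by (intro sum.cong refl arg_cong2[of _ _ _ _ "(*)"]) (simp add: algebra_simps)
  qed
qed (use r' small C in \<open>auto simp: mult_ac\<close>)

text \<open>The rows are integrated separately, over one radius by the common bound
  \<open>k\<close>. Since \<open>\<pi>\<close> lies in the symplectic Lie algebra, the defects of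
  the symplectic products of the columns satisfy a homogeneous linear system, so they stay
  zero.\<close>

lemma exists_frame:
  assumes r': "0 < r'" "r' \<le> r" and small: "12 * (36 * (C * (k + 4))) * r' \<le> 1"
    and G0: "G0 \<in> Sp3" "\<And>I. norm (G0 $ I) \<le> k"
  obtains G where "sframe (ball p r') G" "G p = G0" "\<And>q \<xi>. q \<in> ball p r' \<Longrightarrow> mc G q \<xi> = \<pi> q \<xi>"
proof -
  define B where "B = ball p r'"
  have sub: "B \<subseteq> N" using r' N by (auto simp: B_def)
  have "\<exists>y. y p = G0 $ I \<and> (\<forall>q\<in>B. (y has_derivative P q (y q)) (at q))" for I
  proof -
    have "0 \<le> C * r'" using C r' by simp
    then have "12 * (36 * (C * (norm (G0 $ I) + 4))) * r' \<le> 12 * (36 * (C * (k + 4))) * r'"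
      using mult_right_mono[of "norm (G0 $ I) + 4" "k + 4" "C * r'"] G0(2)[of I] by (simp add: algebra_simps)
    then interpret pfaffian P p "G0 $ I" r' 1 "36 * (C * (norm (G0 $ I) + 4))"
      using small by (intro pfaffian_rows r') simp
    have t: "G0 $ I \<in> ball (G0 $ I) 1" by simp
    obtain Y where Y: "\<And>t. t \<in> ball (G0 $ I) 1 \<Longrightarrow> Y t p = t"
      "\<And>t q. t \<in> ball (G0 $ I) 1 \<Longrightarrow> q \<in> ball p r' \<Longrightarrow> (Y t has_derivative P q (Y t q)) (at q)"
      by (rule Frobenius) blast
    show ?thesis
      using Y(1)[OF t] Y(2)[OF t] by (auto simp: B_def intro!: exI[of _ "Y (G0 $ I)"])
  qed
  then obtain Y where Y: "\<And>I. Y I p = G0 $ I" "\<And>I q. q \<in> B \<Longrightarrow> (Y I has_derivative P q (Y I q)) (at q)"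
    by metis
  define G where "G = (\<lambda>q. (\<chi> I. Y I q) :: mat6)"
  have DG: "((\<lambda>q. G q $ I $ J) has_derivative (\<lambda>\<xi>. (G q ** \<pi> q \<xi>) $ I $ J)) (at q)" if q: "q \<in> B" for q I J
    using has_derivative_vec_nth[OF Y(2)[OF q, of I]] by (simp add: G_def P_def matrix_matrix_mult_def)
  have scale: "(G q ** \<pi> q (z *s \<xi>)) $ I $ J = z * (G q ** \<pi> q \<xi>) $ I $ J" if "q \<in> B" for q z \<xi> I J
    using that sub by (auto simp: matrix_matrix_mult_def \<pi>_scale sum_distrib_left mult.left_commute)
  have Gh: "holo_on B (\<lambda>q. G q $ I $ J)" for I J
    unfolding holo_on_def
  proof (intro ballI exI conjI allI)
    show "((\<lambda>q. G q $ I $ J) has_derivative (\<lambda>\<xi>. (G q ** \<pi> q \<xi>) $ I $ J)) (at q)" if "q \<in> B" for q by (rule DG[OF that])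
  qed (rule scale)
  have DG': "D (\<lambda>q. G q $ I $ J) q \<xi> = (G q ** \<pi> q \<xi>) $ I $ J" if "q \<in> B" for q I J \<xi>
    by (simp add: FD_eqI[OF DG[OF that]])
  have G0p: "G p = G0" by (simp add: G_def Y(1) vec_eq_iff)
  have GSp: "G q \<in> Sp3" if q: "q \<in> B" for q
  proof (rule Sp3_by_columns)
    fix I J
    define s where "s = (\<lambda>q. (\<chi> KL. sympl (column (fst KL) (G q)) (column (snd KL) (G q)) - sympl (axis (fst KL) 1) (axis (snd KL) 1)) :: complex ^ ((3 + 3) \<times> (3 + 3)))"
    define A where "A = (\<lambda>(KL :: (3 + 3) \<times> (3 + 3)) (MN :: (3 + 3) \<times> (3 + 3)) q \<xi>. (if snd MN = snd KL then \<pi> q \<xi> $ fst MN $ fst KL else 0)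
        + (if fst MN = fst KL then \<pi> q \<xi> $ snd MN $ snd KL else 0))"
    have sKL: "s q $ (K, L) = sympl (column K (G q)) (column L (G q)) - sympl (axis K 1) (axis L 1)" for q and K L :: "3 + 3"
      by (simp add: s_def)
    have "s q = 0"
    proof (rule linear_system_zero[where N=B and p=p and A=A])
      show "s p = 0" using Sp3_sympl_column[OF G0(1)] by (auto simp: vec_eq_iff s_def G0p)
      have sh: "holo_on B (\<lambda>q. s q $ (K, L))" for K L :: "3 + 3"
        unfolding sKL sympl_def column_def vec_lambda_beta by (intro holo_on_rules Gh)
      then show "holo_on B (\<lambda>q. s q $ KL)" for KL by (cases KL) simp
      show "holo_on B (\<lambda>q. A i j q \<xi>)" for i j \<xi>
        unfolding A_def by (cases "snd j = snd i"; cases "fst j = fst i")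
          (simp_all add: holo_on_rules holo_on_subset[OF \<pi>_holo sub])
      show "A i j q (\<xi> + \<zeta>) = A i j q \<xi> + A i j q \<zeta>" "A i j q (z *s \<xi>) = z * A i j q \<xi>" if "q \<in> B" for i j q \<xi> \<zeta> z
        using that sub by (auto simp: A_def \<pi>_add \<pi>_scale algebra_simps)
      fix q \<xi> and KL :: "(3 + 3) \<times> (3 + 3)" assume q: "q \<in> B"
      obtain K L where KL: "KL = (K, L)" by (cases KL)
      have col: "((\<lambda>q. column K (G q)) has_derivative (\<lambda>\<xi>. column K (G q ** \<pi> q \<xi>))) (at q)" for K :: "3 + 3"
        unfolding column_def by (rule has_derivative_vec_componentwise) (simp add: DG[OF q])
      have "((\<lambda>q. s q $ (K, L)) has_derivative (\<lambda>\<xi>. sympl (column K (G q ** \<pi> q \<xi>)) (column L (G q))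
          + sympl (column K (G q)) (column L (G q ** \<pi> q \<xi>)) - 0)) (at q)"
        unfolding sKL by (intro has_derivative_diff sympl_has_derivative col has_derivative_const)
      from FD_eqI[OF this] have "D (\<lambda>q. s q $ (K, L)) q \<xi> = sympl (column K (G q ** \<pi> q \<xi>)) (column L (G q))
          + sympl (column K (G q)) (column L (G q ** \<pi> q \<xi>))" by simp
      also have "\<dots> = (\<Sum>M\<in>UNIV. \<pi> q \<xi> $ M $ K * sympl (column M (G q)) (column L (G q)))
          + (\<Sum>M\<in>UNIV. \<pi> q \<xi> $ M $ L * sympl (column K (G q)) (column M (G q)))"
        by (simp add: sympl_columns_left sympl_columns_right)
      \<comment> \<open>Subtracting the constant standard products from the columns' products leaves
        an inhomogeneous term, which is zero by \<open>\<pi>_sp\<close>.\<close>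
      also have "\<dots> = (\<Sum>M\<in>UNIV. \<pi> q \<xi> $ M $ K * s q $ (M, L)) + (\<Sum>M\<in>UNIV. \<pi> q \<xi> $ M $ L * s q $ (K, M))"
      proof -
        have "(\<Sum>M\<in>UNIV. \<pi> q \<xi> $ M $ K * sympl (axis M 1) (axis L 1)) + (\<Sum>M\<in>UNIV. \<pi> q \<xi> $ M $ L * sympl (axis K 1) (axis M 1)) = 0"
          using \<pi>_sp[of q K \<xi> L] q sub sympl_columns_left[of K "mat 1" "\<pi> q \<xi>" "axis L 1"] sympl_columns_right[of "axis K 1" L "mat 1" "\<pi> q \<xi>"]
          by (auto simp: column_mat)
        then show ?thesis by (simp add: sKL right_diff_distrib sum_subtractf add_eq_0_iff)
      qed
      also have "\<dots> = (\<Sum>MN | snd MN = L. \<pi> q \<xi> $ fst MN $ K * s q $ MN) + (\<Sum>MN | fst MN = K. \<pi> q \<xi> $ snd MN $ L * s q $ MN)"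
      proof -
        have "{MN :: (3 + 3) \<times> (3 + 3). snd MN = L} = (\<lambda>M. (M, L)) ` UNIV" "{MN :: (3 + 3) \<times> (3 + 3). fst MN = K} = (\<lambda>M. (K, M)) ` UNIV" by auto
        then show ?thesis by (simp add: sum.reindex inj_on_def)
      qed
      also have "\<dots> = (\<Sum>MN\<in>UNIV. A (K, L) MN q \<xi> * s q $ MN)"
        by (simp add: A_def distrib_right sum.distrib if_distrib[of "\<lambda>x. x * _"] sum.If_cases cong: if_cong)
      finally show "D (\<lambda>q. s q $ KL) q \<xi> = (\<Sum>MN\<in>UNIV. A KL MN q \<xi> * s q $ MN)" by (simp add: KL)
    qed (use q r' in \<open>auto simp: B_def\<close>)
    then have "s q $ (I, J) = 0" by simp
    then show "sympl (column I (G q)) (column J (G q)) = sympl (axis I 1) (axis J 1)" by (simp add: sKL)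
  qed
  have sf: "sframe B G"
    unfolding sframe_def symplectic_frame_def using Gh GSp by (simp add: B_def)
  interpret G: sframe B G by (rule sf)
  have "mc G q \<xi> = \<pi> q \<xi>" if q: "q \<in> B" for q \<xi>
  proof -
    have "D G q \<xi> = G q ** \<pi> q \<xi>" by (simp add: vec_eq_iff G.DF_entry[OF q] DG'[OF q])
    then show ?thesis by (simp add: G.mc_eq[OF q] matrix_mul_assoc Sp3_adjoint_left[OF GSp[OF q]])
  qed
  then show ?thesis using that sf G0p unfolding B_def by blast
qed

end

section \<open>Surfaces recovered from their frames\<close>

lemma sframe_first_leg:
  assumes G: "sframe N G" and p: "p \<in> N" and mc: "mc G p \<xi> = Phi F a b c p \<xi>"
  shows "D (e_vec G 0) p \<xi> = om00 F p \<xi> *s e_vec G 0 p + om1 F p \<xi> *s e_vec G 1 p + om2 F p \<xi> *s e_vec G 2 p"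
proof -
  interpret G: sframe N G by fact
  show ?thesis
    unfolding G.D_e_vec[OF p] mc G.frame_expansion sum_012
    by (simp add: column_def phi_entries phi_om_def phi_theta_def)
qed

text \<open>The normal form of the Maurer-Cartan form implies that the frame is adapted: evaluating
  the derivative of the first leg on the dual vectors recovers \<open>e_vec G 1\<close> and
  \<open>e_vec G 2\<close> from the span of the first leg and its derivatives.\<close>

lemma adapted5_by_mc:
  assumes F: "coframe N F" and G: "sframe N G"
    and mc: "\<And>p \<xi>. p \<in> N \<Longrightarrow> mc G p \<xi> = Phi F a b c p \<xi>" and x: "\<And>p. p \<in> N \<Longrightarrow> x p = pline (e_vec G 0 p)"
  shows "adapted5 N x G a b c"
proof -
  interpret F: coframe N F by fact
  interpret G: sframe N G by fact
  have e: "om G i j p \<xi> = phi_om (\<lambda>i. a i p) (om1 F p \<xi>) (om2 F p \<xi>) (om00 F p \<xi>) i j"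
    "eta G i j p \<xi> = phi_eta (\<lambda>i. a i p) (\<lambda>i. b i p) (\<lambda>i. c i p) (om1 F p \<xi>) (om2 F p \<xi>) i j"
    "theta G i j p \<xi> = phi_theta (om1 F p \<xi>) (om2 F p \<xi>) i j" if "p \<in> N" for i j p \<xi>
    by (simp_all add: om_def[of G] eta_def[of G] theta_def[of G] mc[OF that] phi_entries)
  have sp: "vec.span {e_vec G 0 p, e_vec G 1 p, e_vec G 2 p} = vec.span (insert (e_vec G 0 p) (range (D (e_vec G 0) p)))"
    if p: "p \<in> N" for p
  proof -
    note d = sframe_first_leg[where F=F and a=a and b=b and c=c, OF G p mc[OF p]]
    have "e_vec G 1 p = D (e_vec G 0) p (F.E1 p) - om00 F p (F.E1 p) *s e_vec G 0 p"
      "e_vec G 2 p = D (e_vec G 0) p (F.E2 p) - om00 F p (F.E2 p) *s e_vec G 0 p"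
      by (simp_all add: d F.om_E[OF p])
    then have "e_vec G 1 p \<in> vec.span (insert (e_vec G 0 p) (range (D (e_vec G 0) p)))"
      "e_vec G 2 p \<in> vec.span (insert (e_vec G 0 p) (range (D (e_vec G 0) p)))"
      by (metis insertI1 insertI2 rangeI vec.span_base vec.span_diff vec.span_scale)+
    moreover have "D (e_vec G 0) p \<xi> \<in> vec.span {e_vec G 0 p, e_vec G 1 p, e_vec G 2 p}" for \<xi>
      unfolding d by (intro vec.span_add vec.span_scale vec.span_base) auto
    ultimately show ?thesis
      by (intro equalityI vec.span_minimal vec.subspace_span) (auto intro: vec.span_base)
  qed
  show ?thesis
    unfolding adapted5_def adapted2_def adapted1_def
    using G.frame x sp by (simp add: e phi_om_def phi_eta_def phi_theta_def Let_def)
qed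

lemma mult_left_frame:
  assumes F: "sframe N F" and g: "g \<in> Sp3"
  shows "sframe N (\<lambda>q. g ** F q)" "p \<in> N \<Longrightarrow> mc (\<lambda>q. g ** F q) p \<xi> = mc F p \<xi>"
proof -
  interpret F: sframe N F by fact
  show 1: "sframe N (\<lambda>q. g ** F q)"
    unfolding sframe_def symplectic_frame_def matrix_matrix_mult_def vec_lambda_beta
    using F.open_N Sp3_mult[OF g F.F_Sp3] by (auto simp: matrix_matrix_mult_def intro!: holo_on_rules F.F_holo)
  interpret G: sframe N "\<lambda>q. g ** F q" by (rule 1)
  assume p: "p \<in> N"
  have "D (\<lambda>q. g ** F q) p \<xi> $ I $ J = (g ** D F p \<xi>) $ I $ J" for I J
  proof -
    have "((\<lambda>q. \<Sum>K\<in>UNIV. g $ I $ K * F q $ K $ J) has_derivative (\<lambda>\<xi>. \<Sum>K\<in>UNIV. g $ I $ K * D (\<lambda>q. F q $ K $ J) p \<xi>)) (at p)"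
      by (intro has_derivative_sum has_derivative_mult_right holo_on_has_derivative[OF F.F_holo p])
    from FD_eqI[OF this] show ?thesis
      by (simp add: G.DF_entry[OF p]) (simp add: matrix_matrix_mult_def F.DF_entry[OF p])
  qed
  then have "D (\<lambda>q. g ** F q) p \<xi> = (g ** F p) ** mc F p \<xi>"
    by (simp add: vec_eq_iff F.DF_eq[OF p] matrix_mul_assoc)
  then show "mc (\<lambda>q. g ** F q) p \<xi> = mc F p \<xi>"
    using Sp3_adjoint_left[OF G.F_Sp3[OF p]] by (simp add: G.mc_eq[OF p] matrix_mul_assoc)
qed

lemma adapted5_image:
  assumes N: "open N" and F: "adapted5 N x F a b c" and g: "g \<in> Sp3" and x': "\<And>p. p \<in> N \<Longrightarrow> x' p = (*v) g ` x p"
  shows "adapted5 N x' (\<lambda>q. g ** F q) a b c"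
proof -
  interpret F: coframe N F by (rule adapted5_coframe[OF N F])
  show ?thesis
  proof (rule adapted5_by_mc[OF F.coframe_axioms mult_left_frame(1)[OF F.sframe_axioms g]])
    fix p assume p: "p \<in> N"
    show "mc (\<lambda>q. g ** F q) p \<xi> = Phi F a b c p \<xi>" for \<xi>
      by (simp add: mult_left_frame(2)[OF F.sframe_axioms g p] adapted5_mc[OF N F p])
    show "x' p = pline (e_vec (\<lambda>q. g ** F q) 0 p)"
      by (simp add: x'[OF p] adapted1_pline[OF adapted5_adapted1[OF F] p] pline_image e_vec_def column_mult)
  qed
qed

context leg_frame
begin

lemma delta_mc_inject:
  assumes p: "p \<in> N" and eq: "\<And>\<xi>. delta_mc F a u v w p \<xi> = delta_mc F a u' v' w' p \<xi>"
  shows "u p = u' p" "v p = v' p" "w p = w' p"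
proof -
  have "delta_om F u 0 1 p (E1 p) = delta_om F u' 0 1 p (E1 p)"
    using arg_cong[OF eq, of "\<lambda>A. A $ Inl 0 $ Inl 1" "E1 p"] by (simp add: delta_mc_def)
  then show "u p = u' p" by (simp add: delta_om_def om_E[OF p])
  have e: "delta_eta F a u v w i j p (E1 p) = delta_eta F a u' v' w' i j p (E1 p)" for i j
    using arg_cong[OF eq, of "\<lambda>A. A $ Inl i $ Inr j" "E1 p"] by (simp add: delta_mc_def)
  show "v p = v' p" using e[of 1 0] by (simp add: delta_eta_def om_E[OF p])
  show "w p = w' p" using e[of 0 0] by (simp add: delta_eta_def om_E[OF p])
qed

text \<open>The congruence carries the frame of \<open>x'\<close> to a 5-adapted frame of
  \<open>x''\<close> with the same three forms, so rigidity applies. This is what makes deformations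
  with different initial values non-congruent.\<close>

lemma congruent_psi_parameters:
  assumes P: "psi_parameters N x F a x' u v w" "psi_parameters N x F a x'' u' v' w'"
    and g: "congruent_on N x' x''" and p: "p \<in> N"
  shows "u p = u' p" "v p = v' p" "w p = w' p"
proof -
  obtain F' a' b' c' where F': "adapted5 N x' F' a' b' c'" "\<And>p \<xi>. p \<in> N \<Longrightarrow> mc F' p \<xi> = mc F p \<xi> + delta_mc F a u v w p \<xi>"
    using P(1) unfolding psi_parameters_def by blast
  obtain F'' a'' b'' c'' where F'': "adapted5 N x'' F'' a'' b'' c''" "\<And>p \<xi>. p \<in> N \<Longrightarrow> mc F'' p \<xi> = mc F p \<xi> + delta_mc F a u' v' w' p \<xi>"
    using P(2) unfolding psi_parameters_def by blast
  obtain g where g: "g \<in> Sp3" "\<And>p. p \<in> N \<Longrightarrow> x'' p = (*v) g ` x' p"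
    using g unfolding congruent_on_def by blast
  have F'_sframe: "sframe N F'" by (rule adapted1_sframe[OF open_N adapted5_adapted1[OF F'(1)]])
  note gF' = adapted5_image[OF open_N F'(1) g] and mc_g = mult_left_frame(2)[OF F'_sframe g(1)]
  interpret two_frames N x'' "\<lambda>q. g ** F' q" F'' a' b' c' a'' b'' c''
    by unfold_locales
      (use open_N gF' F''(1) in \<open>simp_all add: om_def[of "\<lambda>q. g ** F' q"] om_def[of F''] mc_g F'(2) F''(2) delta_mc_first_column\<close>)
  have "mc F'' p \<xi> = mc F' p \<xi>" for \<xi> using same_mc[OF p] mc_g[OF p] by simp
  then have "delta_mc F a u v w p \<xi> = delta_mc F a u' v' w' p \<xi>" for \<xi>
    using F'(2)[OF p, of \<xi>] F''(2)[OF p, of \<xi>] by simp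
  then show "u p = u' p" "v p = v' p" "w p = w' p" by (rule delta_mc_inject[OF p])+
qed

lemma psi_parameters_of_frame:
  assumes F: "adapted5 N x F a b c" and G: "sframe N G" and h: "holo_on N u" "holo_on N v" "holo_on N w"
    and mc: "\<And>p \<xi>. p \<in> N \<Longrightarrow> mc G p \<xi> = Phi F (deformed_a a u) (deformed_b b v) (deformed_c a c u w) p \<xi>"
  shows "psi_parameters N x F a (\<lambda>q. pline (e_vec G 0 q)) u v w"
proof -
  let ?x = "\<lambda>q. pline (e_vec G 0 q)" and ?a = "deformed_a a u" and ?b = "deformed_b b v" and ?c = "deformed_c a c u w"
  interpret G: sframe N G by fact
  have G5: "adapted5 N ?x G ?a ?b ?c"
    by (rule adapted5_by_mc[OF coframe_axioms G mc]) auto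
  have forms: "om1 G p \<xi> = om1 F p \<xi>" "om2 G p \<xi> = om2 F p \<xi>" "om00 G p \<xi> = om00 F p \<xi>" if "p \<in> N" for p \<xi>
    by (simp_all add: om_def[of G] mc[OF that] phi_entries phi_om_def)
  have leg: "legendrian_immersion N ?x"
    unfolding legendrian_immersion_def
  proof (intro ballI exI[of _ N] exI[of _ "e_vec G 0"] conjI allI impI)
    fix p q \<xi> assume "p \<in> N" and q: "q \<in> N"
    note d = sframe_first_leg[where F=F and a="?a" and b="?b" and c="?c", OF G q mc[OF q]]
    show "e_vec G 0 q \<noteq> 0"
      using G.adjoint_e_vec[OF q, of 0] by (metis axis_eq_0_iff matrix_vector_mult_0_right one_neq_zero)
    show "sympl (e_vec G 0 q) (D (e_vec G 0) q \<xi>) = 0"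
    proof -
      have "sympl (G q *v axis (Inl 0) 1) (G q *v column (Inl 0) (mc G q \<xi>)) = 0"
        using G.F_Sp3[OF q] by (simp add: Sp3_def sympl_axis column_def mc[OF q] phi_entries phi_theta_def)
      then show ?thesis by (simp add: G.D_e_vec[OF q] matrix_mult_axis e_vec_def)
    qed
    assume "D (e_vec G 0) q \<xi> \<in> pline (e_vec G 0 q)"
    then obtain k where "D (e_vec G 0) q \<xi> = k *s e_vec G 0 q"
      by (auto simp: pline_def vec.span_singleton)
    then have "column (Inl 0) (mc G q \<xi>) = k *s axis (Inl 0) 1"
      using G.adjoint_D_e_vec[OF q, of 0 \<xi>] G.adjoint_e_vec[OF q, of 0] by (simp add: vector_scalar_commute)
    then have "column (Inl 0) (mc G q \<xi>) $ Inl 1 = 0" "column (Inl 0) (mc G q \<xi>) $ Inl 2 = 0"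
      by (simp_all add: axis_def)
    then have "om1 F q \<xi> = 0" "om2 F q \<xi> = 0"
      by (simp_all add: column_def mc[OF q] phi_entries phi_om_def)
    then show "\<xi> = 0" using pt_E_expand[OF q, of \<xi>] by simp
  qed (use open_N G.F_holo in \<open>auto simp: e_vec_def column_def\<close>)
  have "second_order_deformation N x ?x"
    unfolding second_order_deformation_def
  \<comment> \<open>At each point \<open>g\<close> is the symplectic matrix that carries the frame
    \<open>F p\<close> to the frame \<open>G p\<close>.\<close>
  proof (intro conjI leg exI[of _ "\<lambda>p. G p ** symplectic_adjoint (F p)"] ballI)
    fix p assume p: "p \<in> N"
    show "G p ** symplectic_adjoint (F p) \<in> Sp3"
      by (intro Sp3_mult Sp3_adjoint F_Sp3 G.F_Sp3 p)
    have "(G p ** symplectic_adjoint (F p)) ** F p = G p"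
      by (simp add: matrix_mul_assoc[symmetric] Sp3_adjoint_left[OF F_Sp3[OF p]])
    moreover have "adapted2 N x F" "adapted2 N ?x G" using F G5 by (simp_all add: adapted5_def)
    ultimately show "\<exists>N' F' G'. open N' \<and> p \<in> N' \<and> N' \<subseteq> N \<and> adapted2 N' x F' \<and> adapted2 N' ?x G' \<and>
        G' p = (G p ** symplectic_adjoint (F p)) ** F' p \<and> (\<forall>\<xi>. om1 G' p \<xi> = om1 F' p \<xi> \<and> om2 G' p \<xi> = om2 F' p \<xi>)"
      using p open_N forms[OF p] by (intro exI[of _ N] exI[of _ F] exI[of _ G]) simp
  qed
  moreover have "Psi G ?a p \<xi> = Psi F a p \<xi>" if "p \<in> N" for p \<xi>
    by (simp add: Psi_def forms[OF that] deformed_simps)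
  ultimately have "psi_deformation N x F a ?x"
    unfolding psi_deformation_def using G5 forms by blast
  moreover have "mc G p \<xi> = mc F p \<xi> + delta_mc F a u v w p \<xi>" if "p \<in> N" for p \<xi>
    by (simp only: mc[OF that] Phi_deformed adapted5_mc[OF open_N F that])
  ultimately show ?thesis
    unfolding psi_parameters_def using h G5 by blast
qed

end

section \<open>The structure equation as a total differential system\<close>

definition weight :: "3 \<Rightarrow> complex" where
  "weight j = (if j = 0 then 4 / 3 else if j = 1 then 2 else 8 / 3)"

definition K1 :: "(pt \<Rightarrow> mat6) \<Rightarrow> (4 \<Rightarrow> fn) \<Rightarrow> (3 \<Rightarrow> fn) \<Rightarrow> 3 \<Rightarrow> pt \<Rightarrow> complex ^ 3 \<Rightarrow> complex" where
  "K1 F a b j q z = (if j = 0 then - z $ 1 else if j = 1 then V1 a (\<lambda>_. z $ 0) (\<lambda>_. z $ 2) q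
    else W1 F a b (\<lambda>_. z $ 0) (\<lambda>_. z $ 1) q)"

definition K2 :: "(pt \<Rightarrow> mat6) \<Rightarrow> (4 \<Rightarrow> fn) \<Rightarrow> (3 \<Rightarrow> fn) \<Rightarrow> 3 \<Rightarrow> pt \<Rightarrow> complex ^ 3 \<Rightarrow> complex" where
  "K2 F a b j q z = (if j = 0 then z $ 1 else if j = 1 then V2 a (\<lambda>_. z $ 0) (\<lambda>_. z $ 2) q
    else W2 F a b (\<lambda>_. z $ 0) (\<lambda>_. z $ 1) q)"

text \<open>The structure equation as a total differential system \<open>dz = total_system q z\<close> for
  \<open>z = (u\<^sub>0, v\<^sub>1, w\<^sub>1)\<close>, with indices \<open>0, 1, 2\<close>.\<close>

definition total_system :: "(pt \<Rightarrow> mat6) \<Rightarrow> (4 \<Rightarrow> fn) \<Rightarrow> (3 \<Rightarrow> fn) \<Rightarrow> pt \<Rightarrow> complex ^ 3 \<Rightarrow> pt \<Rightarrow> complex ^ 3" where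
  "total_system F a b q z \<xi> = (\<chi> j. K1 F a b j q z * om1 F q \<xi> + K2 F a b j q z * om2 F q \<xi> + (- weight j * z $ j) * om00 F q \<xi>)"

text \<open>The equation for \<open>h\<close> is assumed at the point \<open>p\<close> only. This
  allows testing closedness on functions that solve the system just to first order there.\<close>

lemma (in structured_coframe) ext_d_total:
  assumes f: "holo_on N f" and g: "holo_on N g" and h: "holo_on N h" and p: "p \<in> N"
    and Dh: "\<And>\<xi>. D h p \<xi> = f p * om1 F p \<xi> + g p * om2 F p \<xi> + (- r * h p) * om00 F p \<xi>"
    and \<alpha>: "\<And>q \<xi>. q \<in> N \<Longrightarrow> \<alpha> q \<xi> = f q * om1 F q \<xi> + g q * om2 F q \<xi> + (- r * h q) * om00 F q \<xi>"
  shows "ext_d \<alpha> p \<xi> \<zeta> = (cov F (r + 2/3) g 1 p - cov F (r + 2/3) f 2 p - r * \<kappa> p * h p) * wedge12 F p \<xi> \<zeta>"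
proof -
  have h': "holo_on N (\<lambda>q. - r * h q)" by (intro holo_on_rules h)
  have d: "D (\<lambda>q. - r * h q) p \<xi> = - r * D h p \<xi>" for \<xi>
    using D_rules(3)[OF holo_on_rules(1) h p, of "- r"] D_rules(3)[OF holo_on_rules(1) holo_on_rules(1) p, of 0 0]
    by (simp add: frechet_derivative_const)
  show ?thesis
    using ext_d_form[where \<alpha>=\<alpha> and s="r + 2/3" and \<xi>=\<xi> and \<zeta>=\<zeta>, OF f g h' p \<alpha>]
    unfolding d Dh by (simp add: algebra_simps)
qed

locale flat_surface =
  fixes N x F a b c
  assumes open_N: "open N" and F5: "adapted5 N x F a b c"
    and flat: "\<And>q. q \<in> N \<Longrightarrow> a 2 q = a 3 q"
    and coefficient: "\<And>q. q \<in> N \<Longrightarrow> acov F a 4 1 q + acov F a 1 2 q + 4 * b 2 q - 4 * b 1 q = 0"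
    and c12: "\<And>q. q \<in> N \<Longrightarrow> c 1 q = c 2 q"
begin

sublocale leg_frame N F a b c by (rule adapted5_leg_frame[OF open_N F5])

lemma flat_subset: "open B \<Longrightarrow> B \<subseteq> N \<Longrightarrow> flat_surface B x F a b c"
  using adapted5_subset[OF F5] flat coefficient c12 by (auto simp: flat_surface_def)

lemma K_holo:
  assumes "\<And>j. holo_on N (\<lambda>q. y q $ j)"
  shows "holo_on N (\<lambda>q. K1 F a b j q (y q))" "holo_on N (\<lambda>q. K2 F a b j q (y q))"
  using exhaust_012[of j]
  by (elim disjE; hypsubst; simp only: K1_def K2_def V1_def V2_def W1_def W2_def distinct_012 simp_thms if_True if_False;
      intro holo_intros assms)+

lemma K_cdiff:
  "cpair.cdiff (N \<times> T) (\<lambda>x. K1 F a b j (fst x) (snd x))" "cpair.cdiff (N \<times> T) (\<lambda>x. K2 F a b j (fst x) (snd x))"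
proof -
  note C = cpair.cdiff_add cpair.cdiff_diff cpair.cdiff_mult cpair.cdiff_uminus cpair.cdiff_const cpair_cdiff_snd_nth
    cpair_cdiff_fst[OF a_holo] cpair_cdiff_fst[OF b_holo] cpair_cdiff_fst[OF acov_holo]
  show "cpair.cdiff (N \<times> T) (\<lambda>x. K1 F a b j (fst x) (snd x))"
    using exhaust_012[of j]
    by (elim disjE; hypsubst; simp only: K1_def V1_def W1_def distinct_012 simp_thms if_True if_False; intro C)
  show "cpair.cdiff (N \<times> T) (\<lambda>x. K2 F a b j (fst x) (snd x))"
    using exhaust_012[of j]
    by (elim disjE; hypsubst; simp only: K2_def V2_def W2_def distinct_012 simp_thms if_True if_False; intro C)
qed

lemma total_system_cdiff: "cpair.cdiff (N \<times> T) (\<lambda>(q, z). total_system F a b q z \<xi> $ j)"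
  unfolding total_system_def vec_lambda_beta case_prod_beta'
  by (intro cpair.cdiff_add cpair.cdiff_mult K_cdiff cpair.cdiff_const cpair_cdiff_snd_nth cpair_cdiff_fst om_holo)

lemma total_system_linear:
  assumes "q \<in> N"
  shows "total_system F a b q z (\<xi> + \<zeta>) = total_system F a b q z \<xi> + total_system F a b q z \<zeta>"
    "total_system F a b q z (k *s \<xi>) = k *s total_system F a b q z \<xi>"
  by (simp_all add: total_system_def vec_eq_iff om_add[OF assms] om_scale[OF assms] algebra_simps)

context
  fixes y :: "pt \<Rightarrow> complex ^ 3" and q
  assumes y: "\<And>j. holo_on N (\<lambda>q. y q $ j)" and q: "q \<in> N"
    and Dy: "\<And>j \<xi>. D (\<lambda>q. y q $ j) q \<xi> = total_system F a b q (y q) \<xi> $ j"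
begin

lemma total_system_solves: "solves_at F a b (\<lambda>q. y q $ 0) (\<lambda>q. y q $ 1) (\<lambda>q. y q $ 2) q"
proof -
  have "cov F (weight j) (\<lambda>q. y q $ j) 1 q = K1 F a b j q (y q)" "cov F (weight j) (\<lambda>q. y q $ j) 2 q = K2 F a b j q (y q)" for j
    using cov_unique[OF q, of "\<lambda>q. y q $ j" "weight j" "K1 F a b j q (y q)" "K2 F a b j q (y q)"]
    by (simp_all add: Dy total_system_def)
  from this[of 0] this[of 1] this[of 2] show ?thesis
    by (simp add: solves_at_def weight_def K1_def K2_def V1_def V2_def W1_def W2_def)
qed

text \<open>The conditions for \<open>u\<close> and \<open>v\<close> are identities. The one for
  \<open>w\<close> holds because under the assumptions of case (e) both the coefficient of
  \<open>v\<close> and the \<open>u\<close>-term of the integrability condition vanish.\<close>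

lemma total_system_closed: "ext_d (\<lambda>q \<zeta>. total_system F a b q (y q) \<zeta> $ j) q \<xi> \<zeta> = 0"
proof -
  note s = total_system_solves
  have r: "weight j * \<kappa> q * y q $ j = cov F (weight j + 2/3) (\<lambda>q. K2 F a b j q (y q)) 1 q - cov F (weight j + 2/3) (\<lambda>q. K1 F a b j q (y q)) 2 q"
  proof -
    have w0: "web_coefficient F a b q = 0"
      using flat_web_coefficient[OF flat q] coefficient[OF q] by simp
    have w: "jval F a b c u integrability_expr q = 0" for u
      using flat_integrability_expr[OF flat q coefficient] c12[OF q] by simp
    have k: "K1 F a b 0 q (y q) = - y q $ 1" "K2 F a b 0 q (y q) = y q $ 1"
      "K1 F a b 1 q (y q) = V1 a (\<lambda>q. y q $ 0) (\<lambda>q. y q $ 2) q" "K2 F a b 1 q (y q) = V2 a (\<lambda>q. y q $ 0) (\<lambda>q. y q $ 2) q"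
      "K1 F a b 2 q (y q) = W1 F a b (\<lambda>q. y q $ 0) (\<lambda>q. y q $ 1) q" "K2 F a b 2 q (y q) = W2 F a b (\<lambda>q. y q $ 0) (\<lambda>q. y q $ 1) q" for q
      by (simp_all add: K1_def K2_def V1_def V2_def W1_def W2_def)
    from exhaust_012[of j] show ?thesis
    proof (elim disjE)
      assume "j = 0"
      then show ?thesis using ddu_at[OF y y y q s] by (simp add: k weight_def)
    next
      assume "j = 1"
      then show ?thesis using ddv_at[OF y y y q s] by (simp add: k weight_def)
    next
      assume "j = 2"
      then show ?thesis using ddw_at[OF y y y q s] by (simp add: k weight_def w0 w flat[OF q])
    qed
  qed
  have "ext_d (\<lambda>q \<zeta>. total_system F a b q (y q) \<zeta> $ j) q \<xi> \<zeta> =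
      (cov F (weight j + 2/3) (\<lambda>q. K2 F a b j q (y q)) 1 q - cov F (weight j + 2/3) (\<lambda>q. K1 F a b j q (y q)) 2 q
        - weight j * \<kappa> q * y q $ j) * wedge12 F q \<xi> \<zeta>"
    by (rule ext_d_total[OF K_holo(1)[OF y] K_holo(2)[OF y] y q]) (simp_all add: Dy total_system_def)
  then show ?thesis by (simp only: r) simp
qed

end

text \<open>Given a point and a value \<open>z\<close>, take the affine function \<open>y\<close>
  with \<open>y q = z\<close> whose derivative is prescribed by the system at that point. The
  Frobenius condition at the pair is then closedness at \<open>q\<close> of the form pulled back by
  \<open>y\<close>.\<close>

lemma total_system_symmetric:
  assumes q: "q \<in> N"
  shows "FD (\<lambda>(q, z). total_system F a b q z \<zeta> $ j) (q, z) (\<xi>, total_system F a b q z \<xi>)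
    = FD (\<lambda>(q, z). total_system F a b q z \<xi> $ j) (q, z) (\<zeta>, total_system F a b q z \<zeta>)"
proof -
  let ?P = "total_system F a b"
  define y where "y = (\<lambda>q'. z + ?P q z (q' - q))"
  have lin: "linear (?P q z)"
  proof
    show "?P q z (k *\<^sub>R \<xi>) = k *\<^sub>R ?P q z \<xi>" for k \<xi>
      using total_system_linear(2)[OF q, of z "complex_of_real k" \<xi>] by (simp add: scaleR_eq_scalar_mult)
  qed (rule total_system_linear(1)[OF q])
  have Dy: "(y has_derivative ?P q z) (at q')" for q'
    unfolding y_def
    by (rule has_derivative_eq_rhs[OF has_derivative_add[OF has_derivative_const
            bounded_linear.has_derivative[OF lin[unfolded linear_conv_bounded_linear] has_derivative_diff[OF has_derivative_ident has_derivative_const]]]]) simp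
  have yq: "y q = z" using linear_0[OF lin] by (simp add: y_def)
  have y: "holo_on N (\<lambda>q. y q $ j)" for j
    unfolding holo_on_def
    by (intro ballI exI conjI allI, rule has_derivative_vec_nth[OF Dy]) (simp add: total_system_linear(2)[OF q])
  have D: "D (\<lambda>q. ?P q (y q) \<zeta> $ j) q \<xi> = FD (\<lambda>(q, z). ?P q z \<zeta> $ j) (q, z) (\<xi>, ?P q z \<xi>)" for \<xi> \<zeta>
  proof -
    have "((\<lambda>(q, z). ?P q z \<zeta> $ j) has_derivative FD (\<lambda>(q, z). ?P q z \<zeta> $ j) (q, y q)) (at (q, y q))"
      by (rule cpair.cdiffD(1)[OF total_system_cdiff[of UNIV]]) (simp add: q)
    from FD_eqI[OF has_derivative_compose[OF has_derivative_Pair[OF has_derivative_ident Dy] this]]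
    show ?thesis by (simp add: yq)
  qed
  have "ext_d (\<lambda>q \<zeta>. ?P q (y q) \<zeta> $ j) q \<xi> \<zeta> = 0"
    by (rule total_system_closed[OF y q]) (simp add: yq FD_eqI[OF has_derivative_vec_nth[OF Dy]])
  then show ?thesis by (simp add: ext_d_def D)
qed

end

section \<open>Uniform bounds and the three parameter family\<close>

lemma uniform_form_bound:
  fixes h :: "pt \<Rightarrow> 'b::topological_space \<Rightarrow> pt \<Rightarrow> complex"
  assumes K: "compact (A \<times> B)" and cont: "\<And>\<xi>. continuous_on (A \<times> B) (\<lambda>x. h (fst x) (snd x) \<xi>)"
    and add: "\<And>q z \<xi> \<zeta>. q \<in> A \<Longrightarrow> h q z (\<xi> + \<zeta>) = h q z \<xi> + h q z \<zeta>"
    and scale: "\<And>q z k \<xi>. q \<in> A \<Longrightarrow> h q z (k *s \<xi>) = k * h q z \<xi>"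
  obtains C where "0 \<le> C" "\<And>q z \<xi>. q \<in> A \<Longrightarrow> z \<in> B \<Longrightarrow> cmod (h q z \<xi>) \<le> C * norm \<xi>"
proof -
  have "\<exists>C. \<forall>x\<in>A \<times> B. cmod (h (fst x) (snd x) \<xi>) \<le> C" for \<xi>
    using compact_imp_bounded[OF compact_continuous_image[OF cont K]] unfolding bounded_iff by auto
  then obtain C where C: "\<And>\<xi> q z. q \<in> A \<Longrightarrow> z \<in> B \<Longrightarrow> cmod (h q z \<xi>) \<le> C \<xi>"
    by (metis (no_types, lifting) SigmaI fst_conv snd_conv)
  define C' where "C' = \<bar>C (axis 1 1)\<bar> + \<bar>C (axis 2 1)\<bar>"
  have "cmod (h q z \<xi>) \<le> C' * norm \<xi>" if q: "q \<in> A" "z \<in> B" for q z \<xi>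
  proof -
    have "\<xi> = \<xi> $ 1 *s axis 1 1 + \<xi> $ 2 *s axis 2 1" by (simp add: vec_eq_iff forall_2 axis_def)
    then have "h q z \<xi> = \<xi> $ 1 * h q z (axis 1 1) + \<xi> $ 2 * h q z (axis 2 1)"
      using add[OF q(1)] scale[OF q(1)] by metis
    also have "cmod \<dots> \<le> norm \<xi> * \<bar>C (axis 1 1)\<bar> + norm \<xi> * \<bar>C (axis 2 1)\<bar>"
      using C[OF q, of "axis 1 1"] C[OF q, of "axis 2 1"] Finite_Cartesian_Product.norm_nth_le[of \<xi>]
      by (intro norm_triangle_mono) (auto simp: norm_mult intro!: mult_mono)
    finally show ?thesis by (simp add: C'_def algebra_simps)
  qed
  then show ?thesis using that[of C'] by (simp add: C'_def)
qed

context leg_frame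
begin

lemma delta_mc_linear:
  assumes "q \<in> N"
  shows "delta_mc F a u v w q (\<xi> + \<zeta>) = delta_mc F a u v w q \<xi> + delta_mc F a u v w q \<zeta>"
    "delta_mc F a u v w q (k *s \<xi>) $ I $ J = k * delta_mc F a u v w q \<xi> $ I $ J"
proof -
  have 1: "delta_om F u i j q (\<xi> + \<zeta>) = delta_om F u i j q \<xi> + delta_om F u i j q \<zeta>"
    "delta_om F u i j q (k *s \<xi>) = k * delta_om F u i j q \<xi>" for i j
    by (simp_all add: delta_om_def om_add[OF assms] om_scale[OF assms] algebra_simps)
  have 2: "delta_eta F a u v w i j q (\<xi> + \<zeta>) = delta_eta F a u v w i j q \<xi> + delta_eta F a u v w i j q \<zeta>"
    "delta_eta F a u v w i j q (k *s \<xi>) = k * delta_eta F a u v w i j q \<xi>" for i j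
    by (simp_all add: delta_eta_def Let_def om_add[OF assms] om_scale[OF assms] field_simps)
  show "delta_mc F a u v w q (\<xi> + \<zeta>) = delta_mc F a u v w q \<xi> + delta_mc F a u v w q \<zeta>"
    by (rule mat6_eqI) (simp_all add: delta_mc_def 1 2)
  show "delta_mc F a u v w q (k *s \<xi>) $ I $ J = k * delta_mc F a u v w q \<xi> $ I $ J"
    by (cases I; cases J) (simp_all add: delta_mc_def 1 2)
qed

lemma delta_mc_holo:
  assumes "holo_on N u" "holo_on N v" "holo_on N w"
  shows "holo_on N (\<lambda>q. delta_mc F a u v w q \<xi> $ I $ J)"
proof -
  note H = holo_on_rules assms om_holo a_holo
  have 1: "holo_on N (\<lambda>q. delta_om F u i j q \<xi>)" for i j
    using exhaust_012[of i] exhaust_012[of j]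
    by (elim disjE; hypsubst; simp only: delta_om_def distinct_012 simp_thms if_True if_False; intro H)
  have 2: "holo_on N (\<lambda>q. delta_eta F a u v w i j q \<xi>)" for i j
    using exhaust_012[of i] exhaust_012[of j]
    by (elim disjE; hypsubst; simp only: delta_eta_def Let_def distinct_012 simp_thms if_True if_False; intro H)
  show ?thesis by (cases I; cases J) (simp_all add: delta_mc_def 1 2 holo_on_rules)
qed

lemma delta_mc_cdiff:
  "cpair.cdiff (N \<times> T) (\<lambda>x. delta_mc F a (\<lambda>_. snd x $ 0) (\<lambda>_. snd x $ 1) (\<lambda>_. snd x $ 2) (fst x) \<xi> $ I $ J)"
  for T :: "(complex ^ 3) set"
proof -
  note H = cpair.cdiff_add cpair.cdiff_mult cpair.cdiff_uminus cpair.cdiff_const cpair_cdiff_snd_nth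
    cpair_cdiff_fst[OF a_holo] cpair_cdiff_fst[OF om_holo]
  have 1: "cpair.cdiff (N \<times> T) (\<lambda>x. delta_om F (\<lambda>_. snd x $ 0) i j (fst x) \<xi>)" for i j
    using exhaust_012[of i] exhaust_012[of j]
    by (elim disjE; hypsubst; simp only: delta_om_def distinct_012 simp_thms if_True if_False; intro H)
  have 2: "cpair.cdiff (N \<times> T) (\<lambda>x. delta_eta F a (\<lambda>_. snd x $ 0) (\<lambda>_. snd x $ 1) (\<lambda>_. snd x $ 2) i j (fst x) \<xi>)" for i j
    using exhaust_012[of i] exhaust_012[of j]
    by (elim disjE; hypsubst; simp only: delta_eta_def Let_def distinct_012 simp_thms if_True if_False; intro H)
  show ?thesis by (cases I; cases J) (simp_all add: delta_mc_def 1 2 cpair.cdiff_const cpair.cdiff_uminus)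
qed

lemma deformed_holo:
  assumes "holo_on N u" "holo_on N v" "holo_on N w"
  shows "holo_on N (deformed_a a u i)" "holo_on N (deformed_b b v j)" "holo_on N (deformed_c a c u w k)"
proof -
  show "holo_on N (deformed_a a u i)"
    by (cases "i = 1 \<or> i = 4"; simp only: deformed_a_def if_True if_False; intro holo_intros assms)
  show "holo_on N (deformed_b b v j)"
    by (cases "j = 3"; simp only: deformed_b_def simp_thms if_True if_False; intro holo_intros assms)
  show "holo_on N (deformed_c a c u w k)"
    by (cases "k = 1"; simp only: deformed_c_def simp_thms if_True if_False; intro holo_intros assms)
qed

end

context flat_surface
begin

lemma total_system_bound:
  assumes A: "compact A" "A \<subseteq> N" and B: "compact B"
  obtains M where "0 \<le> M" "\<And>q z \<xi>. q \<in> A \<Longrightarrow> z \<in> B \<Longrightarrow> norm (total_system F a b q z \<xi>) \<le> M * norm \<xi>"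
proof -
  have "\<exists>C\<ge>0. \<forall>q\<in>A. \<forall>z\<in>B. \<forall>\<xi>. cmod (total_system F a b q z \<xi> $ j) \<le> C * norm \<xi>" for j
  proof -
    have "continuous_on (A \<times> B) (\<lambda>x. total_system F a b (fst x) (snd x) \<xi> $ j)" for \<xi>
      by (rule continuous_on_subset[OF cpair.cdiff_continuous_on[OF total_system_cdiff[of UNIV, unfolded case_prod_beta']]])
        (use A in auto)
    then show ?thesis
      by (rule uniform_form_bound[where h="\<lambda>q z \<xi>. total_system F a b q z \<xi> $ j", OF compact_Times[OF A(1) B]])
        (use A in \<open>auto simp: total_system_linear subset_iff\<close>)
  qed
  then obtain C where C: "\<And>j. 0 \<le> C j" "\<And>j q z \<xi>. q \<in> A \<Longrightarrow> z \<in> B \<Longrightarrow> cmod (total_system F a b q z \<xi> $ j) \<le> C j * norm \<xi>"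
    by metis
  have "norm (total_system F a b q z \<xi>) \<le> (\<Sum>j\<in>UNIV. C j) * norm \<xi>" if "q \<in> A" "z \<in> B" for q z \<xi>
    unfolding sum_distrib_right
    by (rule order_trans[OF norm_le_sum_components sum_mono]) (rule C(2)[OF that])
  then show ?thesis using that[of "\<Sum>j\<in>UNIV. C j"] C(1) by (simp add: sum_nonneg)
qed

lemma deformed_mc_bound:
  fixes B :: "(complex ^ 3) set"
  assumes A: "compact A" "A \<subseteq> N" and B: "compact B"
  obtains C where "0 \<le> C" "\<And>q z \<xi> I J. q \<in> A \<Longrightarrow> z \<in> B \<Longrightarrow>
    cmod ((mc F q \<xi> + delta_mc F a (\<lambda>_. z $ 0) (\<lambda>_. z $ 1) (\<lambda>_. z $ 2) q \<xi>) $ I $ J) \<le> C * norm \<xi>"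
proof -
  let ?h = "\<lambda>q (z :: complex ^ 3) \<xi>. mc F q \<xi> + delta_mc F a (\<lambda>_. z $ 0) (\<lambda>_. z $ 1) (\<lambda>_. z $ 2) q \<xi>"
  have "\<exists>C\<ge>0. \<forall>q\<in>A. \<forall>z\<in>B. \<forall>\<xi>. cmod (?h q z \<xi> $ I $ J) \<le> C * norm \<xi>" for I J
  proof -
    have "cpair.cdiff (N \<times> UNIV) (\<lambda>x. ?h (fst x) (snd x) \<xi> $ I $ J)" for \<xi>
      unfolding vector_add_component by (intro cpair.cdiff_add cpair_cdiff_fst mc_holo delta_mc_cdiff)
    then have "continuous_on (A \<times> B) (\<lambda>x. ?h (fst x) (snd x) \<xi> $ I $ J)" for \<xi>
      by (rule continuous_on_subset[OF cpair.cdiff_continuous_on]) (use A in auto)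
    then show ?thesis
      by (rule uniform_form_bound[where h="\<lambda>q z \<xi>. ?h q z \<xi> $ I $ J", OF compact_Times[OF A(1) B]])
        (use A in \<open>auto simp: mc_add mc_scale delta_mc_linear distrib_left subset_iff\<close>)
  qed
  then obtain C where C: "\<And>I J. 0 \<le> C I J" "\<And>I J q z \<xi>. q \<in> A \<Longrightarrow> z \<in> B \<Longrightarrow> cmod (?h q z \<xi> $ I $ J) \<le> C I J * norm \<xi>"
    by metis
  have "cmod (?h q z \<xi> $ I $ J) \<le> (\<Sum>I\<in>UNIV. \<Sum>J\<in>UNIV. C I J) * norm \<xi>" if "q \<in> A" "z \<in> B" for q z \<xi> I J
  proof -
    have "C I J \<le> (\<Sum>J\<in>UNIV. C I J)" by (rule member_le_sum) (simp_all add: C)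
    also have "\<dots> \<le> (\<Sum>I\<in>UNIV. \<Sum>J\<in>UNIV. C I J)" by (rule member_le_sum) (simp_all add: C sum_nonneg)
    finally show ?thesis using C(2)[OF that, of \<xi> I J] mult_right_mono[OF _ norm_ge_zero[of \<xi>]] order_trans by blast
  qed
  then show ?thesis using that[of "\<Sum>I\<in>UNIV. \<Sum>J\<in>UNIV. C I J"] C(1) by (simp add: sum_nonneg)
qed

lemma deformed_mc_form:
  assumes N: "N = ball p r" "0 < r" and h: "holo_on N u" "holo_on N v" "holo_on N w"
    and s: "\<And>q. q \<in> N \<Longrightarrow> solves_at F a b u v w q"
    and C: "0 \<le> C" "\<And>q \<xi> I J. q \<in> N \<Longrightarrow> cmod ((mc F q \<xi> + delta_mc F a u v w q \<xi>) $ I $ J) \<le> C * norm \<xi>"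
  shows "mc_form N (Phi F (deformed_a a u) (deformed_b b v) (deformed_c a c u w)) p r C"
proof -
  have e: "Phi F (deformed_a a u) (deformed_b b v) (deformed_c a c u w) q \<xi> = mc F q \<xi> + delta_mc F a u v w q \<xi>"
    if "q \<in> N" for q \<xi>
    by (simp only: Phi_deformed adapted5_mc[OF open_N F5 that])
  show ?thesis
  proof
    show "holo_on N (\<lambda>q. Phi F (deformed_a a u) (deformed_b b v) (deformed_c a c u w) q \<xi> $ I $ J)" for \<xi> I J
      by (rule holo_on_cong[OF _ open_N, of "\<lambda>q. mc F q \<xi> $ I $ J + delta_mc F a u v w q \<xi> $ I $ J"])
        (simp_all add: e holo_on_rules mc_holo delta_mc_holo h)
    fix q assume q: "q \<in> N"
    show "sympl (column I (Phi F (deformed_a a u) (deformed_b b v) (deformed_c a c u w) q \<xi>)) (axis J 1)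
        + sympl (axis I 1) (column J (Phi F (deformed_a a u) (deformed_b b v) (deformed_c a c u w) q \<xi>)) = 0" for \<xi> I J
      by (rule phi_sp)
    have c: "coefficients_at N F (\<lambda>p. 6 / 5 * (a 3 p - a 2 p)) (deformed_a a u) (deformed_b b v) (deformed_c a c u w) q"
      by unfold_locales (simp_all add: deformed_holo[OF h] q deformed_simps)
    have "structure_relations F (deformed_a a u) (deformed_b b v) (deformed_c a c u w) q"
      unfolding deformed_relations_iff[OF h q] using s[OF q] unfolding solves_at_def by simp
    from coefficients_at.relations_imp_Maurer_Cartan[OF c this, unfolded coefficients_at.MC_at_def[OF c] ext_d_def]
    show "D (\<lambda>q. Phi F (deformed_a a u) (deformed_b b v) (deformed_c a c u w) q \<zeta> $ I $ J) q \<xi>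
        - D (\<lambda>q. Phi F (deformed_a a u) (deformed_b b v) (deformed_c a c u w) q \<xi> $ I $ J) q \<zeta> =
      - ((Phi F (deformed_a a u) (deformed_b b v) (deformed_c a c u w) q \<xi> **
          Phi F (deformed_a a u) (deformed_b b v) (deformed_c a c u w) q \<zeta>) $ I $ J
        - (Phi F (deformed_a a u) (deformed_b b v) (deformed_c a c u w) q \<zeta> **
          Phi F (deformed_a a u) (deformed_b b v) (deformed_c a c u w) q \<xi>) $ I $ J)" for \<xi> \<zeta> I J .
  qed (use N C in \<open>simp_all add: e mc_add mc_scale delta_mc_linear distrib_left\<close>)
qed

end

context flat_surface
begin

theorem admits_three_parameter_family:
  assumes p: "p \<in> N"
  shows "admits_psi_family TYPE(3) N x F a p"
proof -
  obtain r0 where r0: "0 < r0" "cball p r0 \<subseteq> N"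
    using open_N p by (auto simp: open_contains_cball)
  \<comment> \<open>Radius 4 is the \<open>4 * R\<close> required by the Frobenius theorem with
    \<open>R = 1\<close>; its solutions take values within radius 2, where the bound
    \<open>C\<close> is taken.\<close>
  obtain M where M: "0 \<le> M" "\<And>q z \<xi>. q \<in> cball p r0 \<Longrightarrow> z \<in> cball 0 4 \<Longrightarrow> norm (total_system F a b q z \<xi>) \<le> M * norm \<xi>"
    by (rule total_system_bound[OF compact_cball r0(2) compact_cball]) (rule that)
  obtain C where C: "0 \<le> C" "\<And>q z \<xi> I J. q \<in> cball p r0 \<Longrightarrow> z \<in> cball (0 :: complex ^ 3) 2 \<Longrightarrow>
      cmod ((mc F q \<xi> + delta_mc F a (\<lambda>_. z $ 0) (\<lambda>_. z $ 1) (\<lambda>_. z $ 2) q \<xi>) $ I $ J) \<le> C * norm \<xi>"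
    by (rule deformed_mc_bound[OF compact_cball r0(2) compact_cball]) (rule that)
  \<comment> \<open>The factor 6 is twice the number of unknowns, as demanded by the smallness
    condition; the \<open>+ 1\<close> covers \<open>M = 0\<close>.\<close>
  define r where "r = min r0 (1 / (6 * (M + 1)))"
  have r: "0 < r" "r \<le> r0" using r0(1) M(1) by (simp_all add: r_def)
  have "M * r \<le> M * (1 / (6 * (M + 1)))" unfolding r_def using M(1) by (intro mult_left_mono) auto
  also have "\<dots> \<le> 1 / 6" using M(1) by (simp add: field_simps)
  finally have small: "real CARD(3) * M * r \<le> 1 / 2" by simp
  have sub: "ball p r \<subseteq> cball p r0" "ball p r \<subseteq> N" using r r0(2) by (auto simp: subset_iff)
  interpret pf: pfaffian "total_system F a b" p "0 :: complex ^ 3" r 1 M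
  proof
    show "cpair.cdiff (ball p r \<times> ball 0 (4 * 1)) (\<lambda>(q, z). total_system F a b q z \<xi> $ j)" for \<xi> j
      by (rule cpair.cdiff_subset[OF total_system_cdiff[of UNIV]]) (use sub in auto)
    fix q and z :: "complex ^ 3" assume q: "q \<in> ball p r" and z: "z \<in> ball 0 (4 * 1)"
    then have q': "q \<in> N" "q \<in> cball p r0" using sub by blast+
    show "total_system F a b q z (\<xi> + \<zeta>) = total_system F a b q z \<xi> + total_system F a b q z \<zeta>" for \<xi> \<zeta>
      by (rule total_system_linear[OF q'(1)])
    show "total_system F a b q z (k *s \<xi>) = k *s total_system F a b q z \<xi>" for k \<xi>
      by (rule total_system_linear[OF q'(1)])
    show "norm (total_system F a b q z \<xi>) \<le> M * norm \<xi>" for \<xi>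
      by (rule M(2)[OF q'(2)]) (use z in auto)
    show "FD (\<lambda>(q, z). total_system F a b q z \<zeta> $ j) (q, z) (\<xi>, total_system F a b q z \<xi>) =
        FD (\<lambda>(q, z). total_system F a b q z \<xi> $ j) (q, z) (\<zeta>, total_system F a b q z \<zeta>)" for \<xi> \<zeta> j
      by (rule total_system_symmetric[OF q'(1)])
  qed (use r M small in auto)
  obtain Z where Z: "\<And>j. cpair.cdiff (ball 0 1 \<times> ball p r) (\<lambda>(t, q). Z t q $ j)"
    "\<And>t. t \<in> ball 0 1 \<Longrightarrow> Z t p = t"
    "\<And>t q. t \<in> ball 0 1 \<Longrightarrow> q \<in> ball p r \<Longrightarrow> Z t q \<in> cball 0 (2 * 1)"
    "\<And>t q. t \<in> ball 0 1 \<Longrightarrow> q \<in> ball p r \<Longrightarrow> (Z t has_derivative total_system F a b q (Z t q)) (at q)"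
    by (rule pf.Frobenius) blast
  interpret B: flat_surface "ball p r" x F a b c by (rule flat_subset[OF open_ball sub(2)])
  define k where "k = (\<Sum>I\<in>UNIV. norm (F p $ I))"
  have k: "0 \<le> k" "norm (F p $ I) \<le> k" for I
    unfolding k_def by (simp add: sum_nonneg) (rule member_le_sum[of I UNIV "\<lambda>I. norm (F p $ I)"], simp_all)
  define m where "m = 12 * (36 * (C * (k + 4)))"
  have m: "0 \<le> m" using C(1) k(1) by (simp add: m_def)
  \<comment> \<open>Neither \<open>C\<close> nor \<open>k\<close> depends on \<open>t\<close>, so
    one ball carries the frames for all initial values.\<close>
  define r' where "r' = min r (1 / (m + 1))"
  have r': "0 < r'" "r' \<le> r" using r m by (simp_all add: r'_def)
  have "m * r' \<le> m * (1 / (m + 1))" unfolding r'_def using m by (intro mult_left_mono) auto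
  also have "\<dots> \<le> 1" using m by (simp add: field_simps)
  finally have small': "12 * (36 * (C * (k + 4))) * r' \<le> 1" by (simp add: m_def)
  have sub': "ball p r' \<subseteq> ball p r" "ball p r' \<subseteq> N" using r' sub(2) by (auto simp: subset_iff)
  interpret B': flat_surface "ball p r'" x F a b c by (rule flat_subset[OF open_ball sub'(2)])
  have pB: "p \<in> ball p r'" "p \<in> ball p r" using r' r by simp_all
  have Z_holo: "holo_on (ball p r) (\<lambda>q. Z t q $ j)" if t: "t \<in> ball 0 1" for t j
    unfolding holo_on_def
  proof (intro ballI exI conjI allI)
    fix q assume q: "q \<in> ball p r"
    show "((\<lambda>q. Z t q $ j) has_derivative (\<lambda>\<xi>. total_system F a b q (Z t q) \<xi> $ j)) (at q)"
      by (rule has_derivative_vec_nth[OF Z(4)[OF t q]])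
    show "total_system F a b q (Z t q) (z *s \<xi>) $ j = z * total_system F a b q (Z t q) \<xi> $ j" for z \<xi>
      by (simp add: B.total_system_linear[OF q])
  qed
  have fam: "\<exists>x'. psi_parameters (ball p r') x F a x' (\<lambda>q. Z t q $ 0) (\<lambda>q. Z t q $ 1) (\<lambda>q. Z t q $ 2)" if t: "t \<in> ball 0 1" for t
  proof -
    let ?u = "\<lambda>q. Z t q $ 0" and ?v = "\<lambda>q. Z t q $ 1" and ?w = "\<lambda>q. Z t q $ 2"
    let ?\<pi> = "Phi F (deformed_a a ?u) (deformed_b b ?v) (deformed_c a c ?u ?w)"
    have s: "solves_at F a b ?u ?v ?w q" if q: "q \<in> ball p r" for q
      by (rule B.total_system_solves[OF Z_holo[OF t] q]) (simp add: FD_eqI[OF has_derivative_vec_nth[OF Z(4)[OF t q]]])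
    have d: "delta_mc F a ?u ?v ?w q \<xi> = delta_mc F a (\<lambda>_. Z t q $ 0) (\<lambda>_. Z t q $ 1) (\<lambda>_. Z t q $ 2) q \<xi>" for q \<xi>
      by (simp add: delta_mc_def delta_om_def delta_eta_def vec_eq_iff split: sum.split)
    have bd: "cmod ((mc F q \<xi> + delta_mc F a ?u ?v ?w q \<xi>) $ I $ J) \<le> C * norm \<xi>" if q: "q \<in> ball p r" for q \<xi> I J
    proof -
      have "Z t q \<in> cball 0 2" using Z(3)[OF t q] by simp
      from C(2)[OF subsetD[OF sub(1) q] this] show ?thesis unfolding d .
    qed
    interpret mc_form "ball p r" ?\<pi> p r C
      by (rule B.deformed_mc_form[OF refl r(1) Z_holo[OF t] Z_holo[OF t] Z_holo[OF t] s C(1) bd])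
    obtain G where G: "sframe (ball p r') G" "\<And>q \<xi>. q \<in> ball p r' \<Longrightarrow> mc G q \<xi> = ?\<pi> q \<xi>"
      by (rule exists_frame[OF r' small' F_Sp3[OF p] k(2)]) (rule that)
    show ?thesis
      by (rule exI, rule B'.psi_parameters_of_frame[OF B'.F5 G(1)])
        (rule holo_on_subset[OF Z_holo[OF t] sub'(1)] G(2), assumption?)+
  qed
  define X where "X t = (SOME x'. psi_parameters (ball p r') x F a x' (\<lambda>q. Z t q $ 0) (\<lambda>q. Z t q $ 1) (\<lambda>q. Z t q $ 2))" for t
  have X: "psi_parameters (ball p r') x F a (X t) (\<lambda>q. Z t q $ 0) (\<lambda>q. Z t q $ 1) (\<lambda>q. Z t q $ 2)"
    if "t \<in> ball 0 1" for t
    unfolding X_def by (rule someI_ex[OF fam[OF that]])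
  have jh: "jointly_holo_on (ball 0 1) (ball p r') (\<lambda>t q. Z t q $ j)" for j
    unfolding jointly_holo_on_iff_cdiff by (rule cpair.cdiff_subset[OF Z(1)]) (use sub' in auto)
  have "s = t" if st: "s \<in> ball 0 1" "t \<in> ball 0 1" "congruent_on (ball p r') (X s) (X t)" for s t
  proof -
    \<comment> \<open>Congruent deformations have equal parameters at \<open>p\<close>, and these
      are the initial values.\<close>
    have "s $ j = t $ j" for j
      using B'.congruent_psi_parameters[OF X[OF st(1)] X[OF st(2)] st(3) pB(1)] exhaust_012[of j]
      by (auto simp: Z(2)[OF st(1)] Z(2)[OF st(2)])
    then show ?thesis by (simp add: vec_eq_iff)
  qed
  then show ?thesis
    unfolding admits_psi_family_def subdomain_def
    by (intro exI[of _ "ball p r'"] exI[of _ "ball 0 1 :: (complex ^ 3) set"] exI[of _ X] exI[of _ "\<lambda>t q. Z t q $ 0"]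
        exI[of _ "\<lambda>t q. Z t q $ 1"] exI[of _ "\<lambda>t q. Z t q $ 2"])
      (use pB(1) sub'(2) jh X in auto)
qed

end

section \<open>Families of \<open>\<Psi>\<close>-deformations\<close>

lemma holo_identity_theorem:
  assumes "holo_on S f" "open S" "connected S" "subdomain N S" "\<And>q. q \<in> N \<Longrightarrow> f q = 0" "q \<in> S"
  shows "f q = 0"
  using assms cvec.cdiff_identity_theorem[of S f N q] by (auto simp: holo_on_iff_cdiff subdomain_def)

lemma (in leg_frame) web_flat_iff: "web_flat N F \<longleftrightarrow> (\<forall>p\<in>N. a 2 p = a 3 p)"
proof
  assume "web_flat N F"
  then obtain K where K: "web_curvature N F K" "\<And>p. p \<in> N \<Longrightarrow> K p = 0" unfolding web_flat_def by blast
  show "\<forall>p\<in>N. a 2 p = a 3 p"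
  proof
    fix p assume p: "p \<in> N"
    have "ext_d (om00 F) p (E1 p) (E2 p) = 0"
      using K p unfolding web_curvature_def by fastforce
    then show "a 2 p = a 3 p" by (simp add: d_om00[OF p] wedge12_E[OF p])
  qed
next
  assume "\<forall>p\<in>N. a 2 p = a 3 p"
  then have "web_curvature N F (\<lambda>_. 0)"
    by (simp add: web_curvature_def d_om00)
  then show "web_flat N F" unfolding web_flat_def by (intro exI[of _ "\<lambda>_. 0"]) simp
qed

lemma jval_cong: "u p = u' p \<Longrightarrow> jval F a b c u e p = jval F a b c u' e p"
  by (induction e) simp_all

locale surface =
  fixes U x F a b c
  assumes surface: "legendrian_surface U x F a b c"
begin

lemma U: "open U" "connected U" "U \<noteq> {}" and F5: "adapted5 U x F a b c"
  using surface by (simp_all add: legendrian_surface_def)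

sublocale leg_frame U F a b c by (rule adapted5_leg_frame[OF U(1) F5])

context
  fixes N assumes N: "subdomain N U"
begin

lemma sub: "open N" "connected N" "N \<noteq> {}" "N \<subseteq> U"
  using N by (simp_all add: subdomain_def)

lemma sub_F5: "adapted5 N x F a b c"
  by (rule adapted5_subset[OF F5 sub(4)])

lemma sub_leg_frame: "leg_frame N F a b c"
  by (rule adapted5_leg_frame[OF sub(1) sub_F5])

lemmas sub_psi_deformation_parameters = leg_frame.psi_deformation_parameters[OF sub_leg_frame sub_F5]
  and sub_structure_equation = leg_frame.psi_parameters_structure_equation[OF sub_leg_frame sub_F5]
  and sub_determined = leg_frame.psi_parameters_determined[OF sub_leg_frame sub_F5]
  and sub_integrability = leg_frame.structure_equation_integrability[OF sub_leg_frame]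

text \<open>By the identity theorem, a function that does not vanish identically on the surface does
  not do so on any smaller neighbourhood either. This supplies the comparison points for the
  bounds.\<close>

lemma sub_point:
  assumes "holo_on U f" "\<not> (\<forall>q\<in>U. f q = 0)"
  shows "\<exists>q\<in>N. f q \<noteq> 0"
  using holo_identity_theorem[OF assms(1) U(1,2) N] assms(2) by blast

end

theorem no_four_parameter_family:
  assumes fam: "admits_psi_family TYPE('k::finite) U x F a p"
  shows "CARD('k) \<le> 3"
proof -
  have "2 * CARD('k) \<le> DIM(complex \<times> complex \<times> complex)"
  proof (rule no_psi_family[OF fam, where g="\<lambda>_. p" and G="\<lambda>u v w q. (u q, v q, w q)"])
    fix N X' X'' and u v w u' v' w' :: fn
    assume N: "subdomain N U" and p: "p \<in> N" and P: "psi_parameters N x F a X' u v w" "psi_parameters N x F a X'' u' v' w'"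
      and eq: "(u p, v p, w p) = (u' p, v' p, w' p)"
    show "congruent_on N X' X''"
      by (rule sub_determined[OF N sub(2)[OF N] p P]) (use eq in simp_all)
  qed (auto intro!: continuous_on_Pair continuous_on_jointly_holo)
  then show ?thesis by simp
qed

text \<open>At a point of nonzero web curvature the integrability condition can be solved for
  \<open>w\<close>, which leaves the values of \<open>u\<close> and \<open>v\<close> there.\<close>

theorem no_three_parameter_family:
  assumes fam: "admits_psi_family TYPE('k::finite) U x F a p" and nonflat: "\<not> web_flat U F"
  shows "CARD('k) \<le> 2"
proof -
  define g where "g N = (SOME q. q \<in> N \<and> a 2 q - a 3 q \<noteq> 0)" for N
  have g: "g N \<in> N" "a 2 (g N) - a 3 (g N) \<noteq> 0" if N: "subdomain N U" for N
  proof -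
    have "holo_on U (\<lambda>q. a 2 q - a 3 q)" by (intro holo_intros)
    then have "\<exists>q. q \<in> N \<and> a 2 q - a 3 q \<noteq> 0"
      using sub_point[OF N] nonflat by (fastforce simp: web_flat_iff)
    then have "g N \<in> N \<and> a 2 (g N) - a 3 (g N) \<noteq> 0" unfolding g_def by (rule someI_ex)
    then show "g N \<in> N" "a 2 (g N) - a 3 (g N) \<noteq> 0" by blast+
  qed
  have "2 * CARD('k) \<le> DIM(complex \<times> complex)"
  proof (rule no_psi_family[OF fam, where g=g and G="\<lambda>u v w q. (u q, v q)"])
    fix N X' X'' and u v w u' v' w' :: fn
    assume N: "subdomain N U" and P: "psi_parameters N x F a X' u v w" "psi_parameters N x F a X'' u' v' w'"
      and "(u (g N), v (g N)) = (u' (g N), v' (g N))"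
    then have eq: "u (g N) = u' (g N)" "v (g N) = v' (g N)" by simp_all
    have "12 / 5 * (a 2 (g N) - a 3 (g N)) * w (g N) = 12 / 5 * (a 2 (g N) - a 3 (g N)) * w' (g N)"
      using sub_integrability[OF N sub_structure_equation[OF N P(1)] g(1)[OF N]]
        sub_integrability[OF N sub_structure_equation[OF N P(2)] g(1)[OF N]]
      unfolding jval_cong[of u "g N" u', OF eq(1)] eq by algebra
    then have "w (g N) = w' (g N)" using g(2)[OF N] by simp
    then show "congruent_on N X' X''"
      by (intro sub_determined[OF N sub(2)[OF N] g(1)[OF N] P] eq)
  qed (auto intro!: continuous_on_Pair continuous_on_jointly_holo g)
  then show ?thesis by simp
qed

text \<open>At a point where the coefficient of \<open>v\<close> is nonzero, the integrability
  condition and its derivative express \<open>v\<close> and \<open>w\<close> by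
  \<open>u\<close>.\<close>

theorem no_two_parameter_family:
  assumes fam: "admits_psi_family TYPE('k::finite) U x F a p" and flat: "web_flat U F"
    and nz: "\<not> (\<forall>p\<in>U. acov F a 4 1 p + acov F a 1 2 p + 4 * b 2 p - 4 * b 1 p = 0)"
  shows "CARD('k) \<le> 1"
proof -
  have a23: "a 2 q = a 3 q" if "q \<in> U" for q using flat that by (simp add: web_flat_iff)
  define g where "g N = (SOME q. q \<in> N \<and> web_coefficient F a b q \<noteq> 0)" for N
  have g: "g N \<in> N" "web_coefficient F a b (g N) \<noteq> 0" if N: "subdomain N U" for N
  proof -
    obtain q where q: "q \<in> U" "acov F a 4 1 q + acov F a 1 2 q + 4 * b 2 q - 4 * b 1 q \<noteq> 0"
      using nz by blast
    have e: "web_coefficient F a b q = - (acov F a 4 1 q + acov F a 1 2 q + 4 * b 2 q - 4 * b 1 q)"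
      by (rule flat_web_coefficient[OF a23 q(1)])
    have "web_coefficient F a b q \<noteq> 0"
      unfolding e neg_equal_0_iff_equal by (rule q(2))
    with q(1) have "\<not> (\<forall>q\<in>U. web_coefficient F a b q = 0)" by blast
    then have "\<exists>q. q \<in> N \<and> web_coefficient F a b q \<noteq> 0"
      using sub_point[OF N web_coefficient_holo] by blast
    then have "g N \<in> N \<and> web_coefficient F a b (g N) \<noteq> 0" unfolding g_def by (rule someI_ex)
    then show "g N \<in> N" "web_coefficient F a b (g N) \<noteq> 0" by blast+
  qed
  have "2 * CARD('k) \<le> DIM(complex)"
  proof (rule no_psi_family[OF fam, where g=g and G="\<lambda>u v w q. u q"])
    fix N X' X'' and u v w u' v' w' :: fn
    assume N: "subdomain N U" and P: "psi_parameters N x F a X' u v w" "psi_parameters N x F a X'' u' v' w'"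
      and eq: "u (g N) = u' (g N)"
    have "a 2 q = a 3 q" if "q \<in> N" for q using a23 that sub(4)[OF N] by blast
    note vw = leg_frame.flat_solution_w[OF sub_leg_frame[OF N] this g[OF N] sub_structure_equation[OF N P(1)]
        sub_structure_equation[OF N P(2)] eq]
    show "congruent_on N X' X''"
      by (rule sub_determined[OF N sub(2)[OF N] g(1)[OF N] P eq vw])
  qed (auto intro!: continuous_on_jointly_holo g)
  then show ?thesis by simp
qed

text \<open>The integrability condition reduces to \<open>u * (c 1 - c 2) = 0\<close>. So
  \<open>u\<close> vanishes on a nonempty open set, hence everywhere, and the structure equation for
  du and then for dv gives \<open>v = 0\<close> and \<open>w = 0\<close>.\<close>

theorem rigid:
  assumes flat: "web_flat U F"
    and coefficient: "\<And>p. p \<in> U \<Longrightarrow> acov F a 4 1 p + acov F a 1 2 p + 4 * b 2 p - 4 * b 1 p = 0"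
    and nz: "\<not> (\<forall>p\<in>U. c 1 p = c 2 p)" and N: "subdomain N U" and def: "psi_deformation N x F a x'"
  shows "congruent_on N x x'"
proof -
  interpret N: leg_frame N F a b c by (rule sub_leg_frame[OF N])
  obtain u v w where P: "psi_parameters N x F a x' u v w"
    by (rule sub_psi_deformation_parameters[OF N def])
  have a23: "a 2 q = a 3 q" if "q \<in> N" for q using flat sub(4)[OF N] that by (auto simp: web_flat_iff)
  have coef: "acov F a 4 1 q + acov F a 1 2 q + 4 * b 2 q - 4 * b 1 q = 0" if "q \<in> N" for q
    using coefficient sub(4)[OF N] that by blast
  note s = sub_structure_equation[OF N P]
  have h: "holo_on N u" "holo_on N v" "holo_on N w" and sol: "\<And>q. q \<in> N \<Longrightarrow> solves_at F a b u v w q"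
    using s unfolding N.structure_equation_iff by blast+
  have uc: "u q * (c 1 q - c 2 q) = 0" if q: "q \<in> N" for q
    using N.structure_equation_integrability[OF s q] N.flat_integrability_expr[OF a23 q coef]
      N.flat_web_coefficient[OF a23 q] coef[OF q] a23[OF q] by simp
  obtain q0 where q0: "q0 \<in> N" "c 1 q0 - c 2 q0 \<noteq> 0"
    using sub_point[OF N, of "\<lambda>q. c 1 q - c 2 q"] nz by (auto intro!: holo_intros)
  have u0: "u q = 0" if q: "q \<in> N" for q
  proof -
    have "holo_on N (\<lambda>q. c 1 q - c 2 q)" by (intro N.holo_intros)
    then have "continuous_on N (\<lambda>q. c 1 q - c 2 q)"
      using cvec.cdiff_continuous_on holo_on_iff_cdiff by blast
    then have "open {q \<in> N. c 1 q - c 2 q \<noteq> 0}"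
      using continuous_open_preimage[OF _ N.open_N, of "\<lambda>q. c 1 q - c 2 q" "- {0}"] by (simp add: Int_def vimage_def open_Compl)
    moreover have "u q = 0" if "q \<in> {q \<in> N. c 1 q - c 2 q \<noteq> 0}" for q using uc[of q] that by simp
    ultimately show ?thesis
      using cvec.cdiff_identity_theorem[OF h(1)[unfolded holo_on_iff_cdiff] N.open_N sub(2)[OF N], of "{q \<in> N. c 1 q - c 2 q \<noteq> 0}" q]
        q0 q by blast
  qed
  have cov0: "cov F r f k q = 0" if "q \<in> N" "\<And>q. q \<in> N \<Longrightarrow> f q = 0" for r f k q
    using N.cov_cong[OF that(1), of f "\<lambda>_. 0" r k] N.cov_cmult[of "\<lambda>_. 0" q r 0 k] that by (simp add: holo_on_rules)
  have v0: "v q = 0" if q: "q \<in> N" for q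
    using sol[OF q] cov0[OF q u0] unfolding solves_at_def by simp
  have w0: "w q = 0" if q: "q \<in> N" for q
    using sol[OF q] cov0[OF q v0] u0[OF q] unfolding solves_at_def V1_def by simp
  obtain F' a' b' c' where F': "adapted5 N x' F' a' b' c'" "\<And>p \<xi>. p \<in> N \<Longrightarrow> mc F' p \<xi> = mc F p \<xi> + delta_mc F a u v w p \<xi>"
    using P unfolding psi_parameters_def by blast
  have "delta_mc F a u v w q \<xi> = 0" if "q \<in> N" for q \<xi>
    by (simp add: delta_mc_def delta_om_def delta_eta_def u0 v0 w0 that vec_eq_iff split: sum.split)
  then show ?thesis
    by (intro same_mc_congruent[OF sub(1,2,3)[OF N] adapted5_adapted1[OF sub_F5[OF N]] adapted5_adapted1[OF F'(1)]])
      (simp add: F'(2))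
qed

theorem three_parameter_family_iff:
  assumes p: "p \<in> U"
  shows "admits_psi_family TYPE(3) U x F a p \<longleftrightarrow> web_flat U F \<and> (\<forall>q\<in>U. a 2 q = a 3 q \<and>
    b 1 q - b 2 q = 1 / 4 * (acov F a 4 1 q + acov F a 1 2 q) \<and> c 1 q = c 2 q)"
proof -
  have coef: "b 1 q - b 2 q = 1 / 4 * (acov F a 4 1 q + acov F a 1 2 q) \<longleftrightarrow>
      acov F a 4 1 q + acov F a 1 2 q + 4 * b 2 q - 4 * b 1 q = 0" for q
    by (simp add: field_simps) (safe; algebra)
  show ?thesis
    unfolding coef
  proof
    assume fam: "admits_psi_family TYPE(3) U x F a p"
    have flat: "web_flat U F" using no_three_parameter_family[OF fam] by auto
    have c1: "acov F a 4 1 q + acov F a 1 2 q + 4 * b 2 q - 4 * b 1 q = 0" if "q \<in> U" for q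
      using no_two_parameter_family[OF fam flat] that by auto
    obtain N and T :: "(complex ^ 3) set" and X u v w where f: "subdomain N U" "open T" "T \<noteq> {}"
      "\<And>t. t \<in> T \<Longrightarrow> psi_parameters N x F a (X t) (u t) (v t) (w t)"
      "\<And>s t. s \<in> T \<Longrightarrow> t \<in> T \<Longrightarrow> s \<noteq> t \<Longrightarrow> \<not> congruent_on N (X s) (X t)"
      using fam unfolding admits_psi_family_def by blast
    obtain t where t: "t \<in> T" using f(3) by blast
    \<comment> \<open>An open parameter set has two different points, whose deformations are not
      congruent; under rigidity both would be congruent to the original surface.\<close>
    have "T \<noteq> {t}" using f(2) not_open_singleton[of t] by (metis (no_types))
    then obtain s where s: "s \<in> T" "s \<noteq> t" using t by auto
    have "\<forall>p\<in>U. c 1 p = c 2 p"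
    proof (rule ccontr)
      assume "\<not> (\<forall>p\<in>U. c 1 p = c 2 p)"
      note rigid = rigid[OF flat c1 this f(1)]
      have "congruent_on N x (X r)" if "r \<in> T" for r
        by (rule rigid[OF _ conjunct1[OF f(4)[OF that, unfolded psi_parameters_def]]])
      then show False using congruent_trans[of N x "X s" "X t"] f(5)[OF s(1) t s(2)] s(1) t by blast
    qed
    then show "web_flat U F \<and> (\<forall>q\<in>U. a 2 q = a 3 q \<and>
        acov F a 4 1 q + acov F a 1 2 q + 4 * b 2 q - 4 * b 1 q = 0 \<and> c 1 q = c 2 q)"
      using flat c1 by (auto simp: web_flat_iff)
  next
    assume "web_flat U F \<and> (\<forall>q\<in>U. a 2 q = a 3 q \<and>
        acov F a 4 1 q + acov F a 1 2 q + 4 * b 2 q - 4 * b 1 q = 0 \<and> c 1 q = c 2 q)"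
    then interpret flat_surface U x F a b c
      by unfold_locales (use U(1) F5 in blast)+
    show "admits_psi_family TYPE(3) U x F a p" by (rule admits_three_parameter_family[OF p])
  qed
qed

end

text \<open>The expression \<open>E\<close> is chosen before the surface: a single universal
  expression in \<open>u\<close> and the jets of the structure coefficients serves for all of them,
  which gives the congruence modulo \<open>u\<close> its meaning.\<close>

theorem proposition4p9:
  "\<exists>E :: jexpr. \<forall>U x F a b c. legendrian_surface U x F a b c \<longrightarrow>
    (\<comment> \<open>normal form and structure equation\<close>
     (\<forall>N x'. subdomain N U \<and> psi_deformation N x F a x' \<longrightarrow>
        (\<exists>u v w. psi_parameters N x F a x' u v w)) \<and>
     (\<forall>N x' x'' u v w. subdomain N U \<and>
        psi_parameters N x F a x' u v w \<and> psi_parameters N x F a x'' u v w \<longrightarrow>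
        congruent_on N x' x'') \<and>
     (\<forall>N x' u v w. subdomain N U \<and> psi_parameters N x F a x' u v w \<longrightarrow>
        structure_equation N F a b u v w) \<and>
     \<comment> \<open>integrability condition\<close>
     (\<forall>N u v w. subdomain N U \<and> structure_equation N F a b u v w \<longrightarrow>
        (\<forall>p\<in>N. (- 60 * b 1 p + 8 * b 2 p - 42 * b 3 p
                   - acov F a 4 1 p - acov F a 1 2 p + 10 * acov F a 2 1 p) * v p
                + 12 / 5 * (a 2 p - a 3 p) * w p = u p * jval F a b c u E p)) \<and>
     \<comment> \<open>(a)\<close>
     (CARD('k::finite) > 3 \<longrightarrow> (\<forall>p\<in>U. \<not> admits_psi_family TYPE('k) U x F a p)) \<and>
     \<comment> \<open>(b)\<close>
     (\<not> web_flat U F \<longrightarrow>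
        CARD('k) > 2 \<longrightarrow> (\<forall>p\<in>U. \<not> admits_psi_family TYPE('k) U x F a p)) \<and>
     \<comment> \<open>(c)\<close>
     (web_flat U F \<and>
      \<not> (\<forall>p\<in>U. acov F a 4 1 p + acov F a 1 2 p + 4 * b 2 p - 4 * b 1 p = 0) \<longrightarrow>
        CARD('k) > 1 \<longrightarrow> (\<forall>p\<in>U. \<not> admits_psi_family TYPE('k) U x F a p)) \<and>
     \<comment> \<open>(d)\<close>
     (web_flat U F \<and>
      (\<forall>p\<in>U. acov F a 4 1 p + acov F a 1 2 p + 4 * b 2 p - 4 * b 1 p = 0) \<and>
      \<not> (\<forall>p\<in>U. c 1 p = c 2 p) \<longrightarrow>
        (\<forall>N x'. subdomain N U \<and> psi_deformation N x F a x' \<longrightarrow> congruent_on N x x')) \<and>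
     \<comment> \<open>(e)\<close>
     (\<forall>p\<in>U. admits_psi_family TYPE(3) U x F a p \<longleftrightarrow>
        web_flat U F \<and>
        (\<forall>q\<in>U. a 2 q = a 3 q \<and>
                b 1 q - b 2 q = 1 / 4 * (acov F a 4 1 q + acov F a 1 2 q) \<and>
                c 1 q = c 2 q)))"
proof (intro exI[of _ integrability_expr] allI impI, goal_cases)
  case (1 U x F a b c)
  then interpret surface U x F a b c by (rule surface.intro)
  have part1: "\<exists>u v w. psi_parameters N x F a x' u v w" if "subdomain N U \<and> psi_deformation N x F a x'" for N x'
    by (rule sub_psi_deformation_parameters[OF conjunct1[OF that] conjunct2[OF that]]) blast
  have part2: "congruent_on N x' x''"
    if "subdomain N U \<and> psi_parameters N x F a x' u v w \<and> psi_parameters N x F a x'' u v w" for N x' x'' u v w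
    using that psi_parameters_congruent[of N x F a x' u v w x''] by (simp add: subdomain_def)
  have part3: "structure_equation N F a b u v w" if "subdomain N U \<and> psi_parameters N x F a x' u v w" for N x' u v w
    using that sub_structure_equation by blast
  have part4: "\<forall>p\<in>N. (- 60 * b 1 p + 8 * b 2 p - 42 * b 3 p - acov F a 4 1 p - acov F a 1 2 p + 10 * acov F a 2 1 p) * v p
      + 12 / 5 * (a 2 p - a 3 p) * w p = u p * jval F a b c u integrability_expr p"
    if "subdomain N U \<and> structure_equation N F a b u v w" for N u v w
    using that sub_integrability unfolding web_coefficient_def by blast
  have part5: "CARD('k) \<le> 3" if "admits_psi_family TYPE('k) U x F a p" for p
    by (rule no_four_parameter_family[OF that])
  have part6: "CARD('k) \<le> 2" if "admits_psi_family TYPE('k) U x F a p" "\<not> web_flat U F" for p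
    by (rule no_three_parameter_family[OF that])
  have part7: "CARD('k) \<le> 1" if "admits_psi_family TYPE('k) U x F a p"
    "web_flat U F \<and> \<not> (\<forall>p\<in>U. acov F a 4 1 p + acov F a 1 2 p + 4 * b 2 p - 4 * b 1 p = 0)" for p
    using no_two_parameter_family[OF that(1)] that(2) by blast
  have part8: "congruent_on N x x'"
    if "web_flat U F \<and> (\<forall>p\<in>U. acov F a 4 1 p + acov F a 1 2 p + 4 * b 2 p - 4 * b 1 p = 0) \<and> \<not> (\<forall>p\<in>U. c 1 p = c 2 p)"
      "subdomain N U \<and> psi_deformation N x F a x'" for N x'
    by (rule rigid[OF conjunct1[OF that(1)] _ _ conjunct1[OF that(2)] conjunct2[OF that(2)]]) (use that(1) in blast)+
  show ?case
  proof (intro conjI, goal_cases)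
    case 1
    show ?case using part1 by blast
  next
    case 2
    show ?case using part2 by blast
  next
    case 3
    show ?case using part3 by blast
  next
    case 4
    show ?case using part4 by blast
  next
    case 5
    show ?case using part5[THEN leD] by blast
  next
    case 6
    show ?case using part6[THEN leD] by blast
  next
    case 7
    show ?case using part7[THEN leD] by blast
  next
    case 8
    show ?case using part8 by blast
  next
    case 9
    show ?case using three_parameter_family_iff by blast
  qed
qed

end
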